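(* Let $(d,h)$ be a minimal higher matrix factorization with respect to a regular sequence $f_1,\dots,f_c$ in a local ring $S$ with residue field $k$, let $R=S/(f_1,\dots,f_c)$, and let $M$ be the HMF module of $(d,h)$. Let $k[\chi_1,\dots,\chi_c]$ act on $\operatorname{Ext}_R(M,k)$ via the CI operators. There is an isomorphism $$\operatorname{Ext}_R(M,k)\cong\bigoplus_{p=1}^ck[\chi_p,\dots,\chi_c]\otimes_k\operatorname{Hom}_S(\mathbf B(p),k)$$ of vector spaces such that, for $i\ge p$, $\chi_i$ preserves the summand $k[\chi_p,\dots,\chi_c]\otimes\operatorname{Hom}_S(\mathbf B(p),k)$ and acts on it via the action on the first factor.
   Context: All rings are commutative and Noetherian, all modules finitely generated. A higher matrix factorization (HMF) $(d,h)$ with respect to $f_1,\dots,f_c\in S$ consists of: (1) finitely generated free $S$-modules $A_0,A_1$ with filtrations $0=A_s(0)\subseteq A_s(1)\subseteq\cdots\subseteq A_s(c)=A_s$ ($s=0,1$) such that each $A_s(p-1)$ is a free summand of $A_s(p)$; (2) $S$-linear maps $d:A_1\to A_0$ and $h:\bigoplus_{q=1}^cA_0(q)\to A_1$ preserving filtrations, where $\bigoplus_qA_0(q)$ is filtered by the submodules $\bigoplus_{q\le p}A_0(q)$; such that, writing $d_p:A_1(p)\to A_0(p)$ and $h_p:A_0(p)\to A_1(p)$ for the induced maps ($h_p$ is the restriction of $h$ to the $p$-th summand), $B_s(p)=A_s(p)/A_s(p-1)$ (free modules), and $\pi_p:A_1(p)\to B_1(p)$ for the projection, one has for all $1\le p\le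 c$: (a) $d_ph_p\equiv f_p\,\mathrm{Id}_{A_0(p)}$ modulo $(f_1,\dots,f_{p-1})A_0(p)$; (b) $\pi_ph_pd_p\equiv f_p\,\pi_p$ modulo $(f_1,\dots,f_{p-1})B_1(p)$. The HMF module of $(d,h)$ is $M=\operatorname{coker}(R\otimes_S d)$. $(d,h)$ is minimal if the images of $d$ and $h$ are contained in the maximal ideal times their targets. $\mathbf B(p)$ denotes the two-term complex $B_1(p)\to B_0(p)$ induced by $d$, and $\operatorname{Hom}_S(\mathbf B(p),k)$ is the graded vector space with $\operatorname{Hom}_S(B_s(p),k)$ in degree $s$. CI operators: if $(\mathbf F,\delta)$ is an $R$-free resolution of an $R$-module $N$, lift it to free $S$-modules and maps $(\tilde{\mathbf F},\tilde\delta)$ and write $\tilde\delta^2=\sum_jf_j\tilde t_j$; the maps $t_j=R\otimes\tilde t_j:F_{i+2}\to F_i$ are maps of complexes, well defined up to homotopy, and induce well-defined commuting maps $\chi_j$ of degree $2$ on $\operatorname{Ext}_R(N,k)=\bigoplus_i\operatorname{Ext}_R^i(N,k)$, making it a graded module over the polynomial ring $k[\chi_1,\dots,\chi_c]$ with $\deg\chi_j=2$. *)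

theory Defs
  imports Complex_Main "HOL-Library.Poly_Mapping" "HOL-Library.Function_Algebras"
begin

text \<open>
  Rings are types of class \<open>comm_ring_1\<close>.  A module over the ring \<open>'r\<close> is a pair of a scalar
  multiplication \<open>s :: 'r \<Rightarrow> 'm \<Rightarrow> 'm\<close> on an ambient group \<open>'m\<close> and a carrier \<open>X :: 'm set\<close>; a family
  of modules may share one ambient group, which loses nothing, as every family of modules embeds
  into its direct sum.

  Quotients depend on terms and so are not types.  A quotient \<open>X / N\<close> (of rings or of modules) is
  therefore given by any surjective homomorphism with kernel \<open>N\<close>, and all statements are about
  arbitrary such presentations.
\<close>

subsection \<open>Modules\<close>

definition submodule :: "('r::comm_ring_1 \<Rightarrow> 'm \<Rightarrow> 'm) \<Rightarrow> 'm::ab_group_add set \<Rightarrow> bool" where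
  "submodule s X \<longleftrightarrow> module s \<and> module.subspace s X"

text \<open>Additive maps that are semilinear along a ring homomorphism \<open>\<sigma>\<close>; its values outside
  the carrier \<open>X\<close> are irrelevant.\<close>

definition semilinear_on ::
  "('r \<Rightarrow> 'q) \<Rightarrow> ('r \<Rightarrow> 'm \<Rightarrow> 'm) \<Rightarrow> 'm set \<Rightarrow> ('q \<Rightarrow> 'n \<Rightarrow> 'n) \<Rightarrow> 'n set
    \<Rightarrow> ('m::plus \<Rightarrow> 'n::plus) \<Rightarrow> bool" where
  "semilinear_on \<sigma> s X s' Y g \<longleftrightarrow>
     g ` X \<subseteq> Y \<and>
     (\<forall>x\<in>X. \<forall>y\<in>X. g (x + y) = g x + g y) \<and>
     (\<forall>r. \<forall>x\<in>X. g (s r x) = s' (\<sigma> r) (g x))"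

abbreviation lin_on ::
  "('r \<Rightarrow> 'm \<Rightarrow> 'm) \<Rightarrow> 'm set \<Rightarrow> ('r \<Rightarrow> 'n \<Rightarrow> 'n) \<Rightarrow> 'n set \<Rightarrow> ('m::plus \<Rightarrow> 'n::plus) \<Rightarrow> bool" where
  "lin_on \<equiv> semilinear_on (\<lambda>r. r)"

text \<open>\<open>g\<close> exhibits \<open>Y\<close> as \<open>X / N\<close>, scalars being changed along \<open>\<sigma>\<close>.  For \<open>\<sigma> : S \<rightarrow> S / I\<close>
  and \<open>N = I X\<close> this says \<open>Y = S/I \<otimes> X\<close>.\<close>

definition quotient_by ::
  "('r \<Rightarrow> 'q) \<Rightarrow> ('r \<Rightarrow> 'm \<Rightarrow> 'm) \<Rightarrow> 'm set \<Rightarrow> ('q::comm_ring_1 \<Rightarrow> 'n \<Rightarrow> 'n) \<Rightarrow> 'n set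
    \<Rightarrow> 'm set \<Rightarrow> ('m::plus \<Rightarrow> 'n::ab_group_add) \<Rightarrow> bool" where
  "quotient_by \<sigma> s X s' Y N g \<longleftrightarrow>
     submodule s' Y \<and> semilinear_on \<sigma> s X s' Y g \<and> g ` X = Y \<and> {x \<in> X. g x = 0} = N"

definition fin_free :: "('r::comm_ring_1 \<Rightarrow> 'm \<Rightarrow> 'm) \<Rightarrow> 'm::ab_group_add set \<Rightarrow> bool" where
  "fin_free s X \<longleftrightarrow>
     module s \<and> (\<exists>B. finite B \<and> \<not> module.dependent s B \<and> module.span s B = X)"

definition direct_summand ::
    "('r::comm_ring_1 \<Rightarrow> 'm \<Rightarrow> 'm) \<Rightarrow> 'm::ab_group_add set \<Rightarrow> 'm set \<Rightarrow> bool" where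
  "direct_summand s X Y \<longleftrightarrow>
     submodule s X \<and>
     (\<exists>C. submodule s C \<and> X \<inter> C = {0} \<and> {x + y | x y. x \<in> X \<and> y \<in> C} = Y)"

definition ideal_times ::
    "('r::comm_ring_1 \<Rightarrow> 'm \<Rightarrow> 'm) \<Rightarrow> 'r set \<Rightarrow> 'm::ab_group_add set \<Rightarrow> 'm set" where
  "ideal_times s J X = module.span s {s r x | r x. r \<in> J \<and> x \<in> X}"

text \<open>The direct sum \<open>X 1 \<oplus> \<dots> \<oplus> X p\<close>.\<close>

definition fam_sum :: "(nat \<Rightarrow> 'm set) \<Rightarrow> nat \<Rightarrow> (nat \<Rightarrow> 'm::zero) set" where
  "fam_sum X p = {x. \<forall>q. if q \<in> {1..p} then x q \<in> X q else x q = 0}"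

definition inj_at :: "nat \<Rightarrow> 'm \<Rightarrow> nat \<Rightarrow> 'm::zero" where
  "inj_at p x = (\<lambda>q. if q = p then x else 0)"


subsection \<open>Rings\<close>

definition is_ideal :: "'a::comm_ring_1 set \<Rightarrow> bool" where
  "is_ideal J \<longleftrightarrow> submodule (*) J"

definition noetherian :: "'a::comm_ring_1 itself \<Rightarrow> bool" where
  "noetherian _ \<longleftrightarrow>
     (\<forall>J :: 'a set. is_ideal J \<longrightarrow> (\<exists>B. finite B \<and> module.span (*) B = J))"

definition maximal_ideal :: "'a::comm_ring_1 set \<Rightarrow> bool" where
  "maximal_ideal J \<longleftrightarrow>
     is_ideal J \<and> J \<noteq> UNIV \<and> (\<forall>K. is_ideal K \<and> J \<subseteq> K \<and> K \<noteq> UNIV \<longrightarrow> K = J)"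

text \<open>The ring \<open>'a\<close> is Noetherian local with maximal ideal \<open>\<mm>\<close>.\<close>

definition local_ring :: "'a::comm_ring_1 set \<Rightarrow> bool" where
  "local_ring \<mm> \<longleftrightarrow> noetherian TYPE('a) \<and> (\<forall>J. maximal_ideal J \<longleftrightarrow> J = \<mm>)"

text \<open>\<open>\<phi>\<close> exhibits the ring \<open>'b\<close> as \<open>'a / J\<close>.\<close>

definition quotient_ring :: "('a::comm_ring_1 \<Rightarrow> 'b::comm_ring_1) \<Rightarrow> 'a set \<Rightarrow> bool" where
  "quotient_ring \<phi> J \<longleftrightarrow>
     \<phi> 1 = 1 \<and> (\<forall>x y. \<phi> (x + y) = \<phi> x + \<phi> y) \<and> (\<forall>x y. \<phi> (x * y) = \<phi> x * \<phi> y) \<and>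
     surj \<phi> \<and> {x. \<phi> x = 0} = J"

text \<open>The ideal \<open>(f 1, \<dots>, f p)\<close>.\<close>

definition gen_ideal :: "(nat \<Rightarrow> 'a::comm_ring_1) \<Rightarrow> nat \<Rightarrow> 'a set" where
  "gen_ideal f p = module.span (*) (f ` {1..p})"

definition regular_sequence :: "nat \<Rightarrow> (nat \<Rightarrow> 'a::comm_ring_1) \<Rightarrow> bool" where
  "regular_sequence c f \<longleftrightarrow>
     gen_ideal f c \<noteq> UNIV \<and>
     (\<forall>p\<in>{1..c}. \<forall>x. f p * x \<in> gen_ideal f (p - 1) \<longrightarrow> x \<in> gen_ideal f (p - 1))"


subsection \<open>Higher matrix factorizations\<close>

text \<open>\<open>A i p\<close> and \<open>B i p\<close> (\<open>i = 0, 1\<close>) are the modules written \<open>A\<^sub>i(p)\<close> and \<open>B\<^sub>i(p) = A\<^sub>i(p) / A\<^sub>i(p-1)\<close>,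
  with projection \<open>\<pi> i p\<close>, and \<open>h (inj_at p x)\<close> is \<open>h\<^sub>p(x)\<close>.\<close>

definition higher_matrix_factorization ::
  "nat \<Rightarrow> (nat \<Rightarrow> 'a::comm_ring_1)
    \<Rightarrow> ('a \<Rightarrow> 'm \<Rightarrow> 'm) \<Rightarrow> (nat \<Rightarrow> nat \<Rightarrow> 'm::ab_group_add set)
    \<Rightarrow> ('a \<Rightarrow> 'b \<Rightarrow> 'b) \<Rightarrow> (nat \<Rightarrow> nat \<Rightarrow> 'b::ab_group_add set)
    \<Rightarrow> (nat \<Rightarrow> nat \<Rightarrow> 'm \<Rightarrow> 'b)
    \<Rightarrow> ('m \<Rightarrow> 'm) \<Rightarrow> ((nat \<Rightarrow> 'm) \<Rightarrow> 'm) \<Rightarrow> bool" where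
  "higher_matrix_factorization c f sA A sB B \<pi> d h \<longleftrightarrow>
     (\<forall>i\<in>{0,1}. A i 0 = {0} \<and> fin_free sA (A i c) \<and>
        (\<forall>p\<in>{1..c}. fin_free sA (A i (p - 1)) \<and> direct_summand sA (A i (p - 1)) (A i p) \<and>
           quotient_by (\<lambda>r. r) sA (A i p) sB (B i p) (A i (p - 1)) (\<pi> i p) \<and>
           fin_free sB (B i p))) \<and>
     lin_on sA (A 1 c) sA (A 0 c) d \<and>
     lin_on (\<lambda>r x q. sA r (x q)) (fam_sum (A 0) c) sA (A 1 c) h \<and>
     (\<forall>p\<in>{1..c}. d ` A 1 p \<subseteq> A 0 p \<and> h ` fam_sum (A 0) p \<subseteq> A 1 p) \<and>
     (\<forall>p\<in>{1..c}. \<forall>x\<in>A 0 p.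
        d (h (inj_at p x)) - sA (f p) x \<in> ideal_times sA (gen_ideal f (p - 1)) (A 0 p)) \<and>
     (\<forall>p\<in>{1..c}. \<forall>x\<in>A 1 p.
        \<pi> 1 p (h (inj_at p (d x))) - sB (f p) (\<pi> 1 p x)
          \<in> ideal_times sB (gen_ideal f (p - 1)) (B 1 p))"

definition hmf_minimal ::
  "nat \<Rightarrow> 'a::comm_ring_1 set \<Rightarrow> ('a \<Rightarrow> 'm \<Rightarrow> 'm) \<Rightarrow> (nat \<Rightarrow> nat \<Rightarrow> 'm::ab_group_add set)
    \<Rightarrow> ('m \<Rightarrow> 'm) \<Rightarrow> ((nat \<Rightarrow> 'm) \<Rightarrow> 'm) \<Rightarrow> bool" where
  "hmf_minimal c \<mm> sA A d h \<longleftrightarrow>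
     d ` A 1 c \<subseteq> ideal_times sA \<mm> (A 0 c) \<and>
     h ` fam_sum (A 0) c \<subseteq> ideal_times sA \<mm> (A 1 c)"

text \<open>\<open>\<mu>\<close> exhibits the module \<open>M\<close> over \<open>R = S/(f 1, \<dots>, f c)\<close> as the cokernel of
  \<open>R \<otimes> d : A\<^sub>1/I A\<^sub>1 \<rightarrow> A\<^sub>0/I A\<^sub>0\<close>: the image of \<open>R \<otimes> d\<close> is \<open>(I A\<^sub>0 + d A\<^sub>1)/I A\<^sub>0\<close>, where
  \<open>I = (f 1, \<dots>, f c)\<close>.\<close>

definition hmf_module ::
  "nat \<Rightarrow> (nat \<Rightarrow> 'a::comm_ring_1) \<Rightarrow> ('a \<Rightarrow> 'r::comm_ring_1)
    \<Rightarrow> ('a \<Rightarrow> 'm \<Rightarrow> 'm) \<Rightarrow> (nat \<Rightarrow> nat \<Rightarrow> 'm::ab_group_add set) \<Rightarrow> ('m \<Rightarrow> 'm)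
    \<Rightarrow> ('r \<Rightarrow> 'n \<Rightarrow> 'n) \<Rightarrow> 'n::ab_group_add set \<Rightarrow> ('m \<Rightarrow> 'n) \<Rightarrow> bool" where
  "hmf_module c f \<phi> sA A d sM M \<mu> \<longleftrightarrow>
     quotient_by \<phi> sA (A 0 c) sM M
       {x + y | x y. x \<in> ideal_times sA (gen_ideal f c) (A 0 c) \<and> y \<in> d ` A 1 c} \<mu>"


subsection \<open>Resolutions, Ext and the CI operators\<close>

text \<open>The differentials are \<open>\<delta> i : F (i+1) \<rightarrow> F i\<close>, the augmentation is \<open>\<epsilon> : F 0 \<rightarrow> M\<close>.\<close>

definition free_resolution ::
  "('r::comm_ring_1 \<Rightarrow> 'f \<Rightarrow> 'f) \<Rightarrow> (nat \<Rightarrow> 'f::ab_group_add set) \<Rightarrow> (nat \<Rightarrow> 'f \<Rightarrow> 'f)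
    \<Rightarrow> ('r \<Rightarrow> 'n \<Rightarrow> 'n) \<Rightarrow> 'n::ab_group_add set \<Rightarrow> ('f \<Rightarrow> 'n) \<Rightarrow> bool" where
  "free_resolution sF F \<delta> sM M \<epsilon> \<longleftrightarrow>
     (\<forall>i. fin_free sF (F i)) \<and>
     (\<forall>i. lin_on sF (F (Suc i)) sF (F i) (\<delta> i)) \<and>
     (\<forall>i. {x \<in> F (Suc i). \<delta> i x = 0} = \<delta> (Suc i) ` F (Suc (Suc i))) \<and>
     quotient_by (\<lambda>r. r) sF (F 0) sM M (\<delta> 0 ` F (Suc 0)) \<epsilon>"

text \<open>\<open>(G, D)\<close> is a lift of \<open>(F, \<delta>)\<close> to free modules over \<open>S\<close>, with \<open>\<theta> i : G i \<rightarrow> F i = R \<otimes> G i\<close>;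
  \<open>D\<^sup>2 = \<Sum>\<^sub>j f\<^sub>j T\<^sub>j\<close>, and \<open>t j i : F (i+2) \<rightarrow> F i\<close> is \<open>R \<otimes> T j i\<close>.\<close>

definition ci_system ::
  "nat \<Rightarrow> (nat \<Rightarrow> 'a::comm_ring_1) \<Rightarrow> ('a \<Rightarrow> 'r::comm_ring_1)
    \<Rightarrow> ('r \<Rightarrow> 'f \<Rightarrow> 'f) \<Rightarrow> (nat \<Rightarrow> 'f::ab_group_add set) \<Rightarrow> (nat \<Rightarrow> 'f \<Rightarrow> 'f)
    \<Rightarrow> ('a \<Rightarrow> 'g \<Rightarrow> 'g) \<Rightarrow> (nat \<Rightarrow> 'g::ab_group_add set) \<Rightarrow> (nat \<Rightarrow> 'g \<Rightarrow> 'f)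
    \<Rightarrow> (nat \<Rightarrow> 'g \<Rightarrow> 'g) \<Rightarrow> (nat \<Rightarrow> nat \<Rightarrow> 'g \<Rightarrow> 'g) \<Rightarrow> (nat \<Rightarrow> nat \<Rightarrow> 'f \<Rightarrow> 'f) \<Rightarrow> bool" where
  "ci_system c f \<phi> sF F \<delta> sG G \<theta> D T t \<longleftrightarrow>
     (\<forall>i. fin_free sG (G i) \<and>
        quotient_by \<phi> sG (G i) sF (F i) (ideal_times sG (gen_ideal f c) (G i)) (\<theta> i) \<and>
        lin_on sG (G (Suc i)) sG (G i) (D i) \<and>
        (\<forall>x\<in>G (Suc i). \<theta> i (D i x) = \<delta> i (\<theta> (Suc i) x)) \<and>
        (\<forall>x\<in>G (i + 2). D i (D (Suc i) x) = (\<Sum>j=1..c. sG (f j) (T j i x))) \<and>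
        (\<forall>j\<in>{1..c}. lin_on sG (G (i + 2)) sG (G i) (T j i) \<and>
           lin_on sF (F (i + 2)) sF (F i) (t j i) \<and>
           (\<forall>x\<in>G (i + 2). t j i (\<theta> (i + 2) x) = \<theta> i (T j i x))))"

definition restr :: "'m set \<Rightarrow> ('m \<Rightarrow> 'k) \<Rightarrow> 'm \<Rightarrow> 'k::zero" where
  "restr X u = (\<lambda>x. if x \<in> X then u x else 0)"

text \<open>\<open>Hom(X, k)\<close> for a module \<open>X\<close> over a ring with structure map \<open>\<rho>\<close> to \<open>k\<close>.  Functions
  are set to 0 outside the carrier, so that equality of homomorphisms is equality of functions.\<close>

definition hom_k :: "('r \<Rightarrow> 'k::field) \<Rightarrow> ('r \<Rightarrow> 'm \<Rightarrow> 'm) \<Rightarrow> 'm::plus set \<Rightarrow> ('m \<Rightarrow> 'k) set" where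
  "hom_k \<rho> s X = {u. semilinear_on \<rho> s X (*) UNIV u \<and> (\<forall>x. x \<notin> X \<longrightarrow> u x = 0)}"

definition cocycles ::
  "('r \<Rightarrow> 'k::field) \<Rightarrow> ('r \<Rightarrow> 'f \<Rightarrow> 'f) \<Rightarrow> (nat \<Rightarrow> 'f::plus set) \<Rightarrow> (nat \<Rightarrow> 'f \<Rightarrow> 'f)
    \<Rightarrow> nat \<Rightarrow> ('f \<Rightarrow> 'k) set" where
  "cocycles \<kappa> sF F \<delta> n = {u \<in> hom_k \<kappa> sF (F n). \<forall>x\<in>F (Suc n). u (\<delta> n x) = 0}"

definition coboundaries ::
  "('r \<Rightarrow> 'k::field) \<Rightarrow> ('r \<Rightarrow> 'f \<Rightarrow> 'f) \<Rightarrow> (nat \<Rightarrow> 'f::plus set) \<Rightarrow> (nat \<Rightarrow> 'f \<Rightarrow> 'f)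
    \<Rightarrow> nat \<Rightarrow> ('f \<Rightarrow> 'k) set" where
  "coboundaries \<kappa> sF F \<delta> n =
     (case n of 0 \<Rightarrow> {\<lambda>x. 0}
      | Suc m \<Rightarrow> (\<lambda>w. restr (F n) (\<lambda>x. w (\<delta> m x))) ` hom_k \<kappa> sF (F m))"

text \<open>\<open>cl n\<close> exhibits \<open>E n\<close> as \<open>Ext\<^sup>n(M, k)\<close>, the cohomology of \<open>Hom(F, k)\<close>.\<close>

definition is_Ext ::
  "('r \<Rightarrow> 'k::field) \<Rightarrow> ('r \<Rightarrow> 'f \<Rightarrow> 'f) \<Rightarrow> (nat \<Rightarrow> 'f::plus set) \<Rightarrow> (nat \<Rightarrow> 'f \<Rightarrow> 'f)
    \<Rightarrow> ('k \<Rightarrow> 'e \<Rightarrow> 'e) \<Rightarrow> (nat \<Rightarrow> 'e::ab_group_add set) \<Rightarrow> (nat \<Rightarrow> ('f \<Rightarrow> 'k) \<Rightarrow> 'e) \<Rightarrow> bool" where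
  "is_Ext \<kappa> sF F \<delta> sE E cl \<longleftrightarrow>
     (\<forall>n. quotient_by (\<lambda>a. a) (\<lambda>a u x. a * u x) (cocycles \<kappa> sF F \<delta> n) sE (E n)
            (coboundaries \<kappa> sF F \<delta> n) (cl n))"

text \<open>\<open>\<chi> j n : Ext\<^sup>n \<rightarrow> Ext\<^sup>n\<^sup>+\<^sup>2\<close> is the map induced by \<open>t j\<close>.\<close>

definition ci_operators ::
  "nat \<Rightarrow> ('r \<Rightarrow> 'k::field) \<Rightarrow> ('r \<Rightarrow> 'f \<Rightarrow> 'f) \<Rightarrow> (nat \<Rightarrow> 'f::plus set) \<Rightarrow> (nat \<Rightarrow> 'f \<Rightarrow> 'f)
    \<Rightarrow> (nat \<Rightarrow> nat \<Rightarrow> 'f \<Rightarrow> 'f) \<Rightarrow> (nat \<Rightarrow> ('f \<Rightarrow> 'k) \<Rightarrow> 'e) \<Rightarrow> (nat \<Rightarrow> nat \<Rightarrow> 'e \<Rightarrow> 'e) \<Rightarrow> bool" where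
  "ci_operators c \<kappa> sF F \<delta> t cl \<chi> \<longleftrightarrow>
     (\<forall>j\<in>{1..c}. \<forall>n. \<forall>u\<in>cocycles \<kappa> sF F \<delta> n.
        \<chi> j n (cl n u) = cl (n + 2) (restr (F (n + 2)) (\<lambda>x. u (t j n x))))"

definition Ext_total :: "(nat \<Rightarrow> 'e::zero set) \<Rightarrow> (nat \<Rightarrow> 'e) set" where
  "Ext_total E = {e. (\<forall>n. e n \<in> E n) \<and> finite {n. e n \<noteq> 0}}"

definition chi_total :: "(nat \<Rightarrow> nat \<Rightarrow> 'e \<Rightarrow> 'e) \<Rightarrow> nat \<Rightarrow> (nat \<Rightarrow> 'e::zero) \<Rightarrow> nat \<Rightarrow> 'e" where
  "chi_total \<chi> j e = (\<lambda>n. if n < 2 then 0 else \<chi> j (n - 2) (e (n - 2)))"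


subsection \<open>Polynomial rings and tensor products over \<open>k\<close>\<close>

type_synonym 'k pol = "(nat \<Rightarrow>\<^sub>0 nat) \<Rightarrow>\<^sub>0 'k"

text \<open>\<open>k[\<chi>\<^sub>p, \<dots>, \<chi>\<^sub>c]\<close> inside the polynomial ring in all variables \<open>\<chi>\<^sub>i\<close>.\<close>

definition pol_ring :: "nat \<Rightarrow> nat \<Rightarrow> 'k::field pol set" where
  "pol_ring p c = {q. \<forall>m \<in> Poly_Mapping.keys q. Poly_Mapping.keys m \<subseteq> {p..c}}"

definition pol_var :: "nat \<Rightarrow> 'k::field pol" where
  "pol_var i = Poly_Mapping.single (Poly_Mapping.single i 1) 1"

text \<open>Homogeneous of degree \<open>2j\<close> when each variable has degree 2.\<close>

definition pol_homogeneous :: "nat \<Rightarrow> 'k::field pol \<Rightarrow> bool" where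
  "pol_homogeneous j q \<longleftrightarrow>
     (\<forall>m \<in> Poly_Mapping.keys q. (\<Sum>i\<in>Poly_Mapping.keys m. Poly_Mapping.lookup m i) = j)"

definition pm_scale :: "'k::field \<Rightarrow> ('x \<Rightarrow>\<^sub>0 'k) \<Rightarrow> 'x \<Rightarrow>\<^sub>0 'k" where
  "pm_scale a = Poly_Mapping.map ((*) a)"

text \<open>The graded space \<open>Hom(\<B>(p), k)\<close>: component \<open>v i \<in> Hom(B\<^sub>i(p), k)\<close> in degree \<open>i = 0, 1\<close>.\<close>

definition hom_B ::
  "('a \<Rightarrow> 'k::field) \<Rightarrow> ('a \<Rightarrow> 'b \<Rightarrow> 'b) \<Rightarrow> (nat \<Rightarrow> nat \<Rightarrow> 'b::plus set) \<Rightarrow> nat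
    \<Rightarrow> (nat \<Rightarrow> 'b \<Rightarrow> 'k) set" where
  "hom_B \<rho> sB B p = {v. \<forall>i. if i \<in> {0,1} then v i \<in> hom_k \<rho> sB (B i p) else v i = 0}"

text \<open>The bilinear map \<open>\<tau> : U \<times> V \<rightarrow> T\<close> exhibits \<open>T\<close> as \<open>U \<otimes>\<^sub>k V\<close>: the quotient of the vector space
  with basis \<open>U \<times> V\<close> by the bilinearity relations.\<close>

definition is_tensor ::
  "('k::field \<Rightarrow> 'u \<Rightarrow> 'u) \<Rightarrow> 'u::ab_group_add set \<Rightarrow> ('k \<Rightarrow> 'v \<Rightarrow> 'v) \<Rightarrow> 'v::ab_group_add set
    \<Rightarrow> ('k \<Rightarrow> 't \<Rightarrow> 't) \<Rightarrow> 't::ab_group_add set \<Rightarrow> ('u \<Rightarrow> 'v \<Rightarrow> 't) \<Rightarrow> bool" where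
  "is_tensor sU U sV V sT T \<tau> \<longleftrightarrow>
     (let e = (\<lambda>u v. Poly_Mapping.single (u, v) (1::'k));
          rels = {e (u + u') v - e u v - e u' v | u u' v. u \<in> U \<and> u' \<in> U \<and> v \<in> V}
               \<union> {e u (v + v') - e u v - e u v' | u v v'. u \<in> U \<and> v \<in> V \<and> v' \<in> V}
               \<union> {e (sU a u) v - pm_scale a (e u v) | a u v. u \<in> U \<and> v \<in> V}
               \<union> {e u (sV a v) - pm_scale a (e u v) | a u v. u \<in> U \<and> v \<in> V}
      in \<exists>Q. quotient_by (\<lambda>a. a) pm_scale {w. Poly_Mapping.keys w \<subseteq> U \<times> V} sT T
               (module.span pm_scale rels) Q \<and>
             (\<forall>u\<in>U. \<forall>v\<in>V. Q (e u v) = \<tau> u v))"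

end

theory Submission
  imports Defs
begin

text \<open>Write \<open>I\<^sub>p = (f\<^sub>1, \<dots>, f\<^sub>p)\<close>, \<open>R(p) = S/I\<^sub>p\<close>, and let \<open>M(p)\<close> be the module presented over
  \<open>R(p)\<close> by \<open>d : A\<^sub>1(p) \<rightarrow> A\<^sub>0(p)\<close>.  The heart of the proof is the statement, by induction on \<open>p\<close>, that
  the elements \<open>\<chi>\<^sub>w v\<close> form a \<open>k\<close>-basis of \<open>Ext\<close> of \<open>M(p)\<close> over \<open>R(p)\<close>: here \<open>v\<close> runs through copies of
  bases of \<open>Hom(B\<^sub>0(q), k)\<close> and \<open>Hom(B\<^sub>1(q), k)\<close> in degrees 0 and 1, for \<open>q \<le> p\<close>, and \<open>w\<close> through the
  monomials in \<open>\<chi>\<^sub>q, \<dots>, \<chi>\<^sub>p\<close> (\<open>adapted_expansion\<close>).  The isomorphism of the theorem then multiplies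
  out \<open>a \<otimes> v\<close> to \<open>a(\<chi>) v\<close>, and it has the required properties because the CI operators commute.

  The step from \<open>p\<close> to \<open>p + 1\<close> has two halves.

  First (\<open>box\<close>), the condition on \<open>\<pi>\<^sub>p h\<^sub>p d\<^sub>p\<close> shows that \<open>x \<in> A\<^sub>1(p+1)\<close> with \<open>d x \<in> I\<^sub>p A\<^sub>0(p+1)\<close> lies in
  \<open>A\<^sub>1(p) + I\<^sub>p A\<^sub>1(p+1)\<close>.  Hence an \<open>R(p)\<close>-resolution of \<open>M(p)\<close> that starts with \<open>A\<^sub>1(p) \<rightarrow> A\<^sub>0(p)\<close> stays
  exact when these two modules are replaced by \<open>A\<^sub>1(p+1)\<close> and \<open>A\<^sub>0(p+1)\<close>, and by the condition on \<open>d\<^sub>p h\<^sub>p\<close> it then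
  resolves \<open>M(p+1)\<close>.  As \<open>d\<close> is minimal, the change adds precisely \<open>Hom(\<B>(p+1), k)\<close> to \<open>Ext\<close>.

  Second (\<open>cone\<close>, \<open>hypersurface_step\<close>), let \<open>(G, D)\<close> lift an \<open>R(p+1)\<close>-resolution of \<open>M(p+1)\<close>, and let
  \<open>f = f\<^sub>p\<^sub>+\<^sub>1\<close> and \<open>T = T\<^sub>p\<^sub>+\<^sub>1\<close>.  The modules \<open>G\<^sub>n \<oplus> G\<^sub>n\<^sub>-\<^sub>1\<close> with \<open>(x, y) \<mapsto> (D x + f y, - T x - D y)\<close>
  resolve \<open>M(p+1)\<close> over \<open>R(p)\<close>.  Applying \<open>Hom(-, k)\<close>, where \<open>f\<close> acts as zero, gives the mapping cone
  of \<open>\<chi>\<^sub>p\<^sub>+\<^sub>1\<close>.  So the map from \<open>Ext\<close> over \<open>R(p+1)\<close> to \<open>Ext\<close> over \<open>R(p)\<close> has kernel \<open>im \<chi>\<^sub>p\<^sub>+\<^sub>1\<close>, and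
  \<open>\<chi>\<^sub>p\<^sub>+\<^sub>1\<close> is injective if that map is onto.  By the first half the target is generated over
  \<open>\<chi>\<^sub>1, \<dots>, \<chi>\<^sub>p\<close> in degrees 0 and 1, so only these degrees matter.  There it is onto: as \<open>h\<close> is minimal,
  \<open>G\<^sub>2 \<rightarrow> A\<^sub>1(p+1)\<close> vanishes modulo the maximal ideal (\<open>syzygy_minimal\<close>), whereas \<open>T : G\<^sub>2 \<rightarrow> A\<^sub>0(p+1)\<close>
  is onto modulo the maximal ideal (\<open>T_top_onto\<close>).  A basis therefore arises by lifting the basis of
  the target and multiplying by the powers of \<open>\<chi>\<^sub>p\<^sub>+\<^sub>1\<close> (\<open>expands_step\<close>).

  Different resolutions of one module are interchangeable: comparison maps commute with the CI
  operators up to homotopy, because the \<open>f\<^sub>j\<close> are independent modulo \<open>I\<^sup>2\<close> (\<open>regular_coefficients\<close>).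
  Instead of the rings \<open>R(p)\<close> the proof uses free \<open>S\<close>-modules throughout, with maps that form a complex,
  and an exact one, modulo \<open>I\<^sub>p\<close>; so all these rings are treated in one ambient type.\<close>

section \<open>The ideals generated by initial segments of a regular sequence\<close>

interpretation ring_module: module "(*) :: 'a::comm_ring_1 \<Rightarrow> 'a \<Rightarrow> 'a"
  by unfold_locales (auto simp: algebra_simps)

\<comment> \<open>As a simplification rule this law reassociates all products of ring elements.\<close>
declare ring_module.scale_scale [simp del]

lemma sum_apply: "(\<Sum>i\<in>A. g i) x = (\<Sum>i\<in>A. g i x)"
  for g :: "'i \<Rightarrow> 'x \<Rightarrow> 'y::comm_monoid_add"
  by (induction A rule: infinite_finite_induct) auto

lemma gen_ideal_iff: "x \<in> gen_ideal f p \<longleftrightarrow> (\<exists>a. x = (\<Sum>j=1..p. f j * a j))"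
proof
  let ?S = "{x. \<exists>a. x = (\<Sum>j=1..p. f j * a j)}"
  have "ring_module.subspace ?S"
  proof (unfold ring_module.subspace_def, intro conjI ballI allI)
    show "0 \<in> ?S" by (auto intro!: exI[of _ "\<lambda>_. 0"])
    fix x y assume "x \<in> ?S" "y \<in> ?S"
    then obtain a b where "x = (\<Sum>j=1..p. f j * a j)" "y = (\<Sum>j=1..p. f j * b j)" by auto
    then have "x + y = (\<Sum>j=1..p. f j * (a j + b j))" by (simp add: distrib_left sum.distrib)
    then show "x + y \<in> ?S" by (auto intro!: exI[of _ "\<lambda>j. a j + b j"])
  next
    fix c x assume "x \<in> ?S"
    then obtain a where "x = (\<Sum>j=1..p. f j * a j)" by auto
    then have "c * x = (\<Sum>j=1..p. f j * (c * a j))" by (simp add: sum_distrib_left mult.left_commute)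
    then show "c * x \<in> ?S" by (auto intro!: exI[of _ "\<lambda>j. c * a j"])
  qed
  moreover have "f ` {1..p} \<subseteq> ?S"
  proof clarify
    fix j assume j: "j \<in> {1..p}"
    have "f j = (\<Sum>i=1..p. f i * (if i = j then 1 else 0))"
      using j by (simp add: if_distrib sum.delta cong: if_cong)
    then show "\<exists>a. f j = (\<Sum>i=1..p. f i * a i)" by (rule exI[of _ "\<lambda>i. if i = j then 1 else 0"])
  qed
  ultimately have "gen_ideal f p \<subseteq> ?S"
    unfolding gen_ideal_def by (intro ring_module.span_minimal)
  then show "x \<in> gen_ideal f p \<Longrightarrow> \<exists>a. x = (\<Sum>j=1..p. f j * a j)" by auto
next
  assume "\<exists>a. x = (\<Sum>j=1..p. f j * a j)"
  then obtain a where x: "x = (\<Sum>j=1..p. f j * a j)" by auto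
  have "a j * f j \<in> gen_ideal f p" if "j \<in> {1..p}" for j
    unfolding gen_ideal_def using that by (intro ring_module.span_scale ring_module.span_base) auto
  then show "x \<in> gen_ideal f p"
    unfolding x gen_ideal_def by (intro ring_module.span_sum) (auto simp: mult.commute)
qed

lemma gi_zero [simp]: "0 \<in> gen_ideal f p"
  and gi_add: "x \<in> gen_ideal f p \<Longrightarrow> y \<in> gen_ideal f p \<Longrightarrow> x + y \<in> gen_ideal f p"
  and gi_diff: "x \<in> gen_ideal f p \<Longrightarrow> y \<in> gen_ideal f p \<Longrightarrow> x - y \<in> gen_ideal f p"
  and gi_minus: "x \<in> gen_ideal f p \<Longrightarrow> - x \<in> gen_ideal f p"
  and gi_mult: "x \<in> gen_ideal f p \<Longrightarrow> r * x \<in> gen_ideal f p"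
  and gi_sum: "(\<And>i. i \<in> A \<Longrightarrow> g i \<in> gen_ideal f p) \<Longrightarrow> sum g A \<in> gen_ideal f p"
  unfolding gen_ideal_def
  by (auto intro: ring_module.span_zero ring_module.span_add ring_module.span_diff
      ring_module.span_neg ring_module.span_scale ring_module.span_sum)

lemma gi_mono: "p \<le> q \<Longrightarrow> x \<in> gen_ideal f p \<Longrightarrow> x \<in> gen_ideal f q"
  unfolding gen_ideal_def by (meson atLeastatMost_subset_iff image_mono le_refl
      ring_module.span_mono subsetD)

lemma gi_gen: "1 \<le> j \<Longrightarrow> j \<le> p \<Longrightarrow> f j * x \<in> gen_ideal f p"
  using gi_mult[of "f j" f p x] ring_module.span_base[of "f j" "f ` {1..p}"]
  unfolding gen_ideal_def by (simp add: mult.commute)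

text \<open>This is the freeness of \<open>I/I\<^sup>2\<close> on the classes of \<open>f\<^sub>1, \<dots>, f\<^sub>p\<close>, which makes the CI operators
  well defined and compatible with comparison maps.  Regularity puts the last coefficient into
  \<open>I\<^sub>p\<^sub>-\<^sub>1\<close>; substituting it gives a relation between \<open>f\<^sub>1, \<dots>, f\<^sub>p\<^sub>-\<^sub>1\<close>.\<close>

lemma regular_coefficients:
  assumes reg: "\<And>q x. q \<in> {1..p} \<Longrightarrow> f q * x \<in> gen_ideal f (q - 1) \<Longrightarrow> x \<in> gen_ideal f (q - 1)"
    and 0: "(\<Sum>j=1..p. f j * a j) = 0" and j: "j \<in> {1..p}"
  shows "a j \<in> gen_ideal f p"
  using assms
proof (induction p arbitrary: a j)
  case 0
  then show ?case by simp
next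
  case (Suc p)
  have "f (Suc p) * a (Suc p) = (\<Sum>j=1..p. f j * (- a j))"
    using Suc.prems(2) by (simp add: sum_negf eq_neg_iff_add_eq_0 add.commute)
  then have "f (Suc p) * a (Suc p) \<in> gen_ideal f p"
    by (auto simp only: gen_ideal_iff)
  with Suc.prems(1)[of "Suc p" "a (Suc p)"] have top: "a (Suc p) \<in> gen_ideal f p" by auto
  then obtain b where b: "a (Suc p) = (\<Sum>j=1..p. f j * b j)" by (auto simp: gen_ideal_iff)
  have "(\<Sum>j=1..p. f j * (a j + f (Suc p) * b j)) = 0"
    using Suc.prems(2) by (simp add: b distrib_left sum.distrib sum_distrib_left mult.left_commute)
  then have IH: "a j + f (Suc p) * b j \<in> gen_ideal f p" if "j \<in> {1..p}" for j
    by (intro Suc.IH) (use that Suc.prems(1) in auto)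
  show ?case
  proof (cases "j = Suc p")
    case True
    then show ?thesis using top gi_mono[of p "Suc p"] by auto
  next
    case False
    then have "a j + f (Suc p) * b j \<in> gen_ideal f (Suc p)"
      using IH[of j] Suc.prems(3) gi_mono[of p "Suc p"] by auto
    from gi_diff[OF this gi_gen[of "Suc p" "Suc p" f "b j"]] show ?thesis by simp
  qed
qed

section \<open>Free modules in coordinates\<close>

definition sc :: "'a::comm_ring_1 \<Rightarrow> ('i \<Rightarrow> 'a) \<Rightarrow> 'i \<Rightarrow> 'a" where
  "sc r x = (\<lambda>i. r * x i)"

lemma sc_apply [simp]: "sc r x i = r * x i" by (simp add: sc_def)

lemma module_sc: "module sc"
proof
  show "sc r (x + y) = sc r x + sc r y" for r :: 'a and x y :: "'i \<Rightarrow> 'a"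
    by (rule ext) (simp only: sc_apply plus_fun_apply distrib_left)
  show "sc (r + s) x = sc r x + sc s x" for r s :: 'a and x :: "'i \<Rightarrow> 'a"
    by (rule ext) (simp only: sc_apply plus_fun_apply distrib_right)
  show "sc r (sc s x) = sc (r * s) x" for r s :: 'a and x :: "'i \<Rightarrow> 'a"
    by (rule ext) (simp only: sc_apply mult.assoc)
  show "sc 1 x = x" for x :: "'i \<Rightarrow> 'a"
    by (rule ext) (simp only: sc_apply mult_1_left)
qed

interpretation vec: module "sc :: 'a::comm_ring_1 \<Rightarrow> ('i \<Rightarrow> 'a) \<Rightarrow> 'i \<Rightarrow> 'a"
  by (rule module_sc)

text \<open>The free module with basis \<open>J\<close>, and the projection of all vectors onto it.\<close>

definition fr :: "'i set \<Rightarrow> ('i \<Rightarrow> 'a::comm_ring_1) set" where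
  "fr J = {x. \<forall>i. i \<notin> J \<longrightarrow> x i = 0}"

definition tr :: "'i set \<Rightarrow> ('i \<Rightarrow> 'a::comm_ring_1) \<Rightarrow> 'i \<Rightarrow> 'a" where
  "tr J x = (\<lambda>i. if i \<in> J then x i else 0)"

definition unit_vec :: "'i \<Rightarrow> 'i \<Rightarrow> 'a::comm_ring_1" where
  "unit_vec i = (\<lambda>k. if k = i then 1 else 0)"

lemma tr_fr [simp]: "tr J x \<in> fr J" by (simp add: tr_def fr_def)
lemma tr_id: "x \<in> fr J \<Longrightarrow> tr J x = x" by (auto simp: tr_def fr_def)
lemma tr_tr: "tr J (tr K x) = tr (J \<inter> K) x" by (auto simp: tr_def)
lemma tr_add: "tr J (x + y) = tr J x + tr J y" by (auto simp: tr_def)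
lemma tr_sc: "tr J (sc r x) = sc r (tr J x)" by (auto simp: tr_def)
lemma fr_mono: "J \<subseteq> K \<Longrightarrow> x \<in> fr J \<Longrightarrow> x \<in> fr K" by (auto simp: fr_def)
lemma fr_zero [simp]: "0 \<in> fr J" by (simp add: fr_def)
lemma fr_add: "x \<in> fr J \<Longrightarrow> y \<in> fr J \<Longrightarrow> x + y \<in> fr J" by (simp add: fr_def)
lemma fr_diff: "x \<in> fr J \<Longrightarrow> y \<in> fr J \<Longrightarrow> x - y \<in> fr J" by (simp add: fr_def)
lemma fr_minus: "x \<in> fr J \<Longrightarrow> - x \<in> fr J" by (simp add: fr_def)
lemma fr_sc: "x \<in> fr J \<Longrightarrow> sc r x \<in> fr J" by (simp add: fr_def)
lemma fr_sum: "(\<And>i. i \<in> A \<Longrightarrow> g i \<in> fr J) \<Longrightarrow> sum g A \<in> fr J" by (auto simp: fr_def sum_apply)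
lemma unit_fr: "i \<in> J \<Longrightarrow> unit_vec i \<in> fr J" by (auto simp: unit_vec_def fr_def)

lemma fr_expand: "finite J \<Longrightarrow> tr J x = (\<Sum>i\<in>J. sc (x i) (unit_vec i))"
  by (auto simp: tr_def unit_vec_def sum_apply fun_eq_iff if_distrib sum.delta' cong: if_cong)

text \<open>For a free module \<open>X\<close> of vectors, \<open>iv f p \<inter> X\<close> is \<open>I\<^sub>p X\<close>; membership of a difference is congruence
  modulo \<open>I\<^sub>p\<close>.\<close>

definition iv :: "(nat \<Rightarrow> 'a::comm_ring_1) \<Rightarrow> nat \<Rightarrow> ('i \<Rightarrow> 'a) set" where
  "iv f p = {x. \<forall>i. x i \<in> gen_ideal f p}"

lemma iv_zero [simp]: "0 \<in> iv f p" by (simp add: iv_def)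
lemma iv_add: "x \<in> iv f p \<Longrightarrow> y \<in> iv f p \<Longrightarrow> x + y \<in> iv f p" by (auto simp: iv_def gi_add)
lemma iv_diff: "x \<in> iv f p \<Longrightarrow> y \<in> iv f p \<Longrightarrow> x - y \<in> iv f p" by (auto simp: iv_def gi_diff)
lemma iv_minus: "x \<in> iv f p \<Longrightarrow> - x \<in> iv f p" by (auto simp: iv_def gi_minus)
lemma iv_sc: "x \<in> iv f p \<Longrightarrow> sc r x \<in> iv f p" by (auto simp: iv_def gi_mult)
lemma iv_sum: "(\<And>i. i \<in> A \<Longrightarrow> g i \<in> iv f p) \<Longrightarrow> sum g A \<in> iv f p"
  by (auto simp: iv_def sum_apply intro: gi_sum)
lemma iv_mono: "p \<le> q \<Longrightarrow> x \<in> iv f p \<Longrightarrow> x \<in> iv f q" by (auto simp: iv_def gi_mono)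
lemma iv_gen: "1 \<le> j \<Longrightarrow> j \<le> p \<Longrightarrow> sc (f j) x \<in> iv f p" by (auto simp: iv_def gi_gen)
lemma iv_gens: "(\<Sum>j=1..p. sc (f j) (a j)) \<in> iv f p" by (intro iv_sum iv_gen) auto
lemma iv_decompose:
  assumes "x \<in> iv f p" "x \<in> fr K"
  obtains a where "\<And>j. a j \<in> fr K" "x = (\<Sum>j=1..p. sc (f j) (a j))"
proof -
  have "\<forall>i. \<exists>a. x i = (\<Sum>j=1..p. f j * a j)" using assms(1) by (simp add: iv_def gen_ideal_iff)
  then obtain a where a: "\<And>i. x i = (\<Sum>j=1..p. f j * a i j)" by metis
  show thesis
  proof (rule that[of "\<lambda>j. tr K (\<lambda>i. a i j)"])
    show "x = (\<Sum>j=1..p. sc (f j) (tr K (\<lambda>i. a i j)))"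
    proof
      fix i
      show "x i = (\<Sum>j=1..p. sc (f j) (tr K (\<lambda>i. a i j))) i"
        using assms(2) a[of i] by (cases "i \<in> K") (simp_all add: sum_apply tr_def fr_def)
    qed
  qed simp
qed

section \<open>Linear maps and functionals\<close>

text \<open>A homomorphism between the free modules on \<open>J\<close> and \<open>K\<close>, extended to all vectors by ignoring the
  coordinates outside \<open>J\<close>.  So composites and equations need no membership conditions.\<close>

definition Lin :: "'i set \<Rightarrow> 'j set \<Rightarrow> (('i \<Rightarrow> 'a::comm_ring_1) \<Rightarrow> 'j \<Rightarrow> 'a) \<Rightarrow> bool" where
  "Lin J K g \<longleftrightarrow> (\<forall>x y. g (x + y) = g x + g y) \<and> (\<forall>r x. g (sc r x) = sc r (g x)) \<and>
     (\<forall>x. g x \<in> fr K) \<and> (\<forall>x. g (tr J x) = g x)"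

lemma Lin_add: "Lin J K g \<Longrightarrow> g (x + y) = g x + g y"
  and Lin_sc: "Lin J K g \<Longrightarrow> g (sc r x) = sc r (g x)"
  and Lin_fr: "Lin J K g \<Longrightarrow> g x \<in> fr K"
  and Lin_tr: "Lin J K g \<Longrightarrow> g (tr J x) = g x"
  by (auto simp: Lin_def)

lemma Lin_zero: "Lin J K g \<Longrightarrow> g 0 = 0"
  using Lin_add[of J K g 0 0] by simp
lemma Lin_minus: "Lin J K g \<Longrightarrow> g (- x) = - g x"
  using Lin_add[of J K g x "- x"] Lin_zero[of J K g] by (simp add: eq_neg_iff_add_eq_0 add.commute)
lemma Lin_diff: "Lin J K g \<Longrightarrow> g (x - y) = g x - g y"
  using Lin_add[of J K g x "- y"] Lin_minus[of J K g y] by simp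
lemma Lin_sum: "Lin J K g \<Longrightarrow> g (sum a A) = (\<Sum>i\<in>A. g (a i))"
  by (induction A rule: infinite_finite_induct) (auto simp: Lin_add Lin_zero)

lemma LinI:
  assumes "\<And>x y. g (x + y) = g x + g y" "\<And>r x. g (sc r x) = sc r (g x)"
    "\<And>x. g x \<in> fr K" "\<And>x. g (tr J x) = g x"
  shows "Lin J K g"
  using assms by (auto simp: Lin_def)

lemma Lin_comp: "Lin J K g \<Longrightarrow> Lin K M h \<Longrightarrow> Lin J M (\<lambda>x. h (g x))"
  by (simp add: Lin_def)
lemma Lin_plus: "Lin J K g \<Longrightarrow> Lin J K h \<Longrightarrow> Lin J K (\<lambda>x. g x + h x)"
  by (simp add: Lin_def fr_add vec.scale_right_distrib add_ac)
lemma Lin_uminus: "Lin J K g \<Longrightarrow> Lin J K (\<lambda>x. - g x)"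
  by (simp add: Lin_def fr_minus vec.scale_minus_right)
lemma Lin_minus_fun: "Lin J K g \<Longrightarrow> Lin J K h \<Longrightarrow> Lin J K (\<lambda>x. g x - h x)"
  using Lin_plus[of J K g "\<lambda>x. - h x"] Lin_uminus[of J K h] by simp
lemma Lin_scale: "Lin J K g \<Longrightarrow> Lin J K (\<lambda>x. sc r (g x))"
  by (simp add: Lin_def fr_sc vec.scale_right_distrib mult.commute)
lemma Lin_null: "Lin J K (\<lambda>x. 0)" by (simp add: Lin_def)
lemma Lin_target: "Lin J K g \<Longrightarrow> K \<subseteq> K' \<Longrightarrow> Lin J K' g"
  by (auto simp: Lin_def intro: fr_mono)
lemma Lin_trunc: "Lin J J (tr J)"
  by (auto intro!: LinI simp: tr_add tr_sc tr_tr)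
lemma Lin_restrict: "Lin J K g \<Longrightarrow> J' \<subseteq> J \<Longrightarrow> Lin J' K (\<lambda>x. g (tr J' x))"
  by (auto simp: Lin_def tr_add tr_sc tr_tr)

lemma Lin_expand:
  assumes "Lin J K g" "finite J"
  shows "g x = (\<Sum>i\<in>J. sc (x i) (g (unit_vec i)))"
proof -
  have "g x = g (\<Sum>i\<in>J. sc (x i) (unit_vec i))"
    using Lin_tr[OF assms(1), of x] fr_expand[OF assms(2), of x] by simp
  also have "\<dots> = (\<Sum>i\<in>J. sc (x i) (g (unit_vec i)))"
    by (simp only: Lin_sum[OF assms(1)] Lin_sc[OF assms(1)])
  finally show ?thesis .
qed

lemma Lin_iv:
  assumes "Lin J K g" "finite J" "\<And>i. i \<in> J \<Longrightarrow> x i \<in> gen_ideal f p"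
  shows "g x \<in> iv f p"
proof -
  have "sc (x i) (g (unit_vec i)) \<in> iv f p" if "i \<in> J" for i
    using gi_mult[OF assms(3)[OF that]] by (auto simp: iv_def mult.commute[of "x i"])
  then show ?thesis unfolding Lin_expand[OF assms(1,2), of x] by (rule iv_sum)
qed

lemma Lin_iv': "Lin J K g \<Longrightarrow> finite J \<Longrightarrow> x \<in> iv f p \<Longrightarrow> g x \<in> iv f p"
  by (rule Lin_iv[of J K g]) (simp_all add: iv_def)

definition lin_ext :: "'i set \<Rightarrow> ('i \<Rightarrow> 'j \<Rightarrow> 'a::comm_ring_1) \<Rightarrow> ('i \<Rightarrow> 'a) \<Rightarrow> 'j \<Rightarrow> 'a" where
  "lin_ext J y x = (\<Sum>i\<in>J. sc (x i) (y i))"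

lemma Lin_lin_ext:
  assumes "\<And>i. i \<in> J \<Longrightarrow> y i \<in> fr K"
  shows "Lin J K (lin_ext J y)"
proof (rule LinI)
  show "lin_ext J y (tr J x) = lin_ext J y x" for x
    by (auto simp: lin_ext_def tr_def intro: sum.cong)
qed (auto simp: lin_ext_def vec.scale_left_distrib sum.distrib vec.scale_sum_right
      intro!: fr_sum fr_sc assms)

lemma lin_ext_unit: "finite J \<Longrightarrow> i \<in> J \<Longrightarrow> lin_ext J y (unit_vec i) = y i"
  by (auto simp: lin_ext_def unit_vec_def fun_eq_iff sum_apply if_distrib if_distribR sum.delta
      cong: if_cong)

text \<open>Free modules are projective: choose values on the basis.\<close>

lemma lift_through:
  assumes "finite J" "Lin J M g" "Lin K M D"
    and ex: "\<And>x. \<exists>y\<in>fr K. g x - D y \<in> iv f p"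
  obtains s where "Lin J K s" "\<And>x. g x - D (s x) \<in> iv f p"
proof -
  obtain y where y: "\<And>i. y i \<in> fr K" "\<And>i. g (unit_vec i) - D (y i) \<in> iv f p"
    using ex[of "unit_vec _"] by metis
  define s where "s = lin_ext J y"
  have s: "Lin J K s" unfolding s_def by (rule Lin_lin_ext) (rule y)
  have L: "Lin J M (\<lambda>x. g x - D (s x))"
    by (intro Lin_minus_fun assms Lin_comp[OF s])
  have "g x - D (s x) \<in> iv f p" for x
    unfolding Lin_expand[OF L assms(1), of x]
    by (intro iv_sum iv_sc) (simp add: s_def lin_ext_unit assms(1) y)
  with s show thesis by (rule that)
qed

text \<open>This is how the components \<open>T\<^sub>j\<close> of \<open>D\<^sup>2\<close> and the homotopies between CI operators are produced.\<close>

lemma Lin_decompose: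
  assumes "finite J" "Lin J M g" "\<And>x. g x \<in> iv f p"
  obtains s where "\<And>j. Lin J M (s j)" "\<And>x. g x = (\<Sum>j=1..p. sc (f j) (s j x))"
proof -
  have "\<exists>a. (\<forall>j. a j \<in> fr M) \<and> g (unit_vec i) = (\<Sum>j=1..p. sc (f j) (a j))" for i
    using iv_decompose[OF assms(3) Lin_fr[OF assms(2)]] by metis
  then obtain a where a: "\<And>i j. a i j \<in> fr M" "\<And>i. g (unit_vec i) = (\<Sum>j=1..p. sc (f j) (a i j))"
    by metis
  show thesis
  proof (rule that[of "\<lambda>j. lin_ext J (\<lambda>i. a i j)"])
    show "Lin J M (lin_ext J (\<lambda>i. a i j))" for j by (rule Lin_lin_ext) (rule a)
    show "g x = (\<Sum>j=1..p. sc (f j) (lin_ext J (\<lambda>i. a i j) x))" for x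
      unfolding Lin_expand[OF assms(2,1), of x] a lin_ext_def vec.scale_sum_right
      by (subst sum.swap) (simp add: sc_def mult.left_commute)
  qed
qed

text \<open>\<open>Hom(X, k)\<close> for the free module \<open>X\<close> on \<open>J\<close>.\<close>

definition Hm :: "('a::comm_ring_1 \<Rightarrow> 'k::field) \<Rightarrow> 'i set \<Rightarrow> (('i \<Rightarrow> 'a) \<Rightarrow> 'k) set" where
  "Hm \<rho> J = {u. (\<forall>x y. u (x + y) = u x + u y) \<and> (\<forall>r x. u (sc r x) = \<rho> r * u x) \<and>
      (\<forall>x. u (tr J x) = u x)}"

lemma HmI:
  assumes "\<And>x y. u (x + y) = u x + u y" "\<And>r x. u (sc r x) = \<rho> r * u x" "\<And>x. u (tr J x) = u x"
  shows "u \<in> Hm \<rho> J"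
  using assms by (auto simp: Hm_def)

lemma Hm_add: "u \<in> Hm \<rho> J \<Longrightarrow> u (x + y) = u x + u y"
  and Hm_sc: "u \<in> Hm \<rho> J \<Longrightarrow> u (sc r x) = \<rho> r * u x"
  and Hm_tr: "u \<in> Hm \<rho> J \<Longrightarrow> u (tr J x) = u x"
  by (auto simp: Hm_def)

lemma Hm_tr2: "u \<in> Hm \<rho> J \<Longrightarrow> J \<subseteq> J' \<Longrightarrow> u (tr J' x) = u x"
  using Hm_tr[of u \<rho> J "tr J' x"] Hm_tr[of u \<rho> J x] by (simp add: tr_tr inf_absorb1)
lemma Hm_zero: "u \<in> Hm \<rho> J \<Longrightarrow> u 0 = 0"
  using Hm_add[of u \<rho> J 0 0] by (simp only: add_0_left add_cancel_right_right)
lemma Hm_minus: "u \<in> Hm \<rho> J \<Longrightarrow> u (- x) = - u x"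
  using Hm_add[of u \<rho> J x "- x"] Hm_zero[of u \<rho> J] by (simp add: eq_neg_iff_add_eq_0 add.commute)
lemma Hm_diff: "u \<in> Hm \<rho> J \<Longrightarrow> u (x - y) = u x - u y"
  using Hm_add[of u \<rho> J x "- y"] Hm_minus[of u \<rho> J y] by simp
lemma Hm_sum: "u \<in> Hm \<rho> J \<Longrightarrow> u (sum a A) = (\<Sum>i\<in>A. u (a i))"
  by (induction A rule: infinite_finite_induct) (auto simp: Hm_add Hm_zero)

lemma Hm_comp: "u \<in> Hm \<rho> K \<Longrightarrow> Lin J K g \<Longrightarrow> (\<lambda>x. u (g x)) \<in> Hm \<rho> J"
  by (simp add: Hm_def Lin_def)
lemma Hm_mono: "u \<in> Hm \<rho> J \<Longrightarrow> J \<subseteq> J' \<Longrightarrow> u \<in> Hm \<rho> J'"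
  using Hm_tr2[of u \<rho> J J'] by (simp add: Hm_def)

lemma Hm_expand:
  assumes "u \<in> Hm \<rho> J" "finite J"
  shows "u x = (\<Sum>i\<in>J. \<rho> (x i) * u (unit_vec i))"
proof -
  have "u x = u (\<Sum>i\<in>J. sc (x i) (unit_vec i))"
    using Hm_tr[OF assms(1), of x] fr_expand[OF assms(2), of x] by simp
  also have "\<dots> = (\<Sum>i\<in>J. \<rho> (x i) * u (unit_vec i))"
    by (simp only: Hm_sum[OF assms(1)] Hm_sc[OF assms(1)])
  finally show ?thesis .
qed

lemma Hm_subspace: "vec.subspace (Hm \<rho> J)"
  unfolding vec.subspace_def by (simp add: Hm_def distrib_left mult.left_commute add_ac)

section \<open>Complexes modulo a regular sequence\<close>

text \<open>A lift to \<open>S\<close> of a complex over \<open>S/(f\<^sub>1, \<dots>, f\<^sub>p)\<close> with free modules on \<open>J n\<close>, together with the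
  components of \<open>D\<^sup>2\<close>.\<close>

definition ci_lift :: "(nat \<Rightarrow> 'a::comm_ring_1) \<Rightarrow> nat \<Rightarrow> (nat \<Rightarrow> 'i set)
    \<Rightarrow> (nat \<Rightarrow> ('i \<Rightarrow> 'a) \<Rightarrow> 'i \<Rightarrow> 'a) \<Rightarrow> (nat \<Rightarrow> nat \<Rightarrow> ('i \<Rightarrow> 'a) \<Rightarrow> 'i \<Rightarrow> 'a) \<Rightarrow> bool" where
  "ci_lift f p J D T \<longleftrightarrow> (\<forall>n. finite (J n)) \<and> (\<forall>n. Lin (J (Suc n)) (J n) (D n)) \<and>
     (\<forall>j n. Lin (J (Suc (Suc n))) (J n) (T j n)) \<and>
     (\<forall>n x. D n (D (Suc n) x) = (\<Sum>j=1..p. sc (f j) (T j n x)))"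

text \<open>Exactness over \<open>S/(f\<^sub>1, \<dots>, f\<^sub>p)\<close> in all positive degrees.\<close>

definition exact_mod :: "(nat \<Rightarrow> 'a::comm_ring_1) \<Rightarrow> nat \<Rightarrow> (nat \<Rightarrow> 'i set)
    \<Rightarrow> (nat \<Rightarrow> ('i \<Rightarrow> 'a) \<Rightarrow> 'i \<Rightarrow> 'a) \<Rightarrow> bool" where
  "exact_mod f p J D \<longleftrightarrow> (\<forall>n. \<forall>x\<in>fr (J (Suc n)). D n x \<in> iv f p \<longrightarrow>
      (\<exists>y\<in>fr (J (Suc (Suc n))). x - D (Suc n) y \<in> iv f p))"

text \<open>Cocycles and coboundaries of \<open>Hom(-, k)\<close>, and the cochain maps that induce the CI operators.\<close>

definition Zc :: "('a::comm_ring_1 \<Rightarrow> 'k::field) \<Rightarrow> (nat \<Rightarrow> 'i set)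
    \<Rightarrow> (nat \<Rightarrow> ('i \<Rightarrow> 'a) \<Rightarrow> 'i \<Rightarrow> 'a) \<Rightarrow> nat \<Rightarrow> (('i \<Rightarrow> 'a) \<Rightarrow> 'k) set" where
  "Zc \<rho> J D n = {u \<in> Hm \<rho> (J n). \<forall>x. u (D n x) = 0}"

definition Bc :: "('a::comm_ring_1 \<Rightarrow> 'k::field) \<Rightarrow> (nat \<Rightarrow> 'i set)
    \<Rightarrow> (nat \<Rightarrow> ('i \<Rightarrow> 'a) \<Rightarrow> 'i \<Rightarrow> 'a) \<Rightarrow> nat \<Rightarrow> (('i \<Rightarrow> 'a) \<Rightarrow> 'k) set" where
  "Bc \<rho> J D n = (case n of 0 \<Rightarrow> {0} | Suc m \<Rightarrow> (\<lambda>w x. w (D m x)) ` Hm \<rho> (J m))"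

definition chi :: "(nat \<Rightarrow> nat \<Rightarrow> ('i \<Rightarrow> 'a) \<Rightarrow> 'i \<Rightarrow> 'a) \<Rightarrow> nat \<Rightarrow> nat
    \<Rightarrow> (('i \<Rightarrow> 'a) \<Rightarrow> 'k) \<Rightarrow> ('i \<Rightarrow> 'a) \<Rightarrow> 'k" where
  "chi T j n u = (\<lambda>x. u (T j n x))"

lemma Zc_I: "u \<in> Hm \<rho> (J n) \<Longrightarrow> (\<And>x. u (D n x) = 0) \<Longrightarrow> u \<in> Zc \<rho> J D n"
  by (simp add: Zc_def)
lemma Zc_Hm: "u \<in> Zc \<rho> J D n \<Longrightarrow> u \<in> Hm \<rho> (J n)"
  and Zc_D: "u \<in> Zc \<rho> J D n \<Longrightarrow> u (D n x) = 0"
  by (simp_all add: Zc_def)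
lemma Bc_0: "Bc \<rho> J D 0 = {0}"
  and Bc_Suc: "Bc \<rho> J D (Suc m) = (\<lambda>w x. w (D m x)) ` Hm \<rho> (J m)"
  by (simp_all add: Bc_def)
lemma Bc_I: "w \<in> Hm \<rho> (J m) \<Longrightarrow> (\<And>x. u x = w (D m x)) \<Longrightarrow> u \<in> Bc \<rho> J D (Suc m)"
  unfolding Bc_Suc by auto

lemma Zc_subspace: "vec.subspace (Zc \<rho> J D n)"
  using Hm_subspace[of \<rho> "J n"] unfolding vec.subspace_def by (simp add: Zc_def)

lemma Bc_subspace: "vec.subspace (Bc \<rho> J D n)"
proof (cases n)
  case 0
  then show ?thesis by (simp add: Bc_0)
next
  case (Suc m)
  have H: "vec.subspace (Hm \<rho> (J m))" by (rule Hm_subspace)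
  show ?thesis unfolding vec.subspace_def Suc
  proof (intro conjI ballI allI)
    show "0 \<in> Bc \<rho> J D (Suc m)"
      by (rule Bc_I[of 0]) (simp_all add: vec.subspace_0[OF H])
    fix x y assume "x \<in> Bc \<rho> J D (Suc m)" "y \<in> Bc \<rho> J D (Suc m)"
    then obtain v w where "v \<in> Hm \<rho> (J m)" "w \<in> Hm \<rho> (J m)" "x = (\<lambda>z. v (D m z))" "y = (\<lambda>z. w (D m z))"
      unfolding Bc_Suc by auto
    then show "x + y \<in> Bc \<rho> J D (Suc m)"
      by (intro Bc_I[of "v + w"]) (simp_all add: vec.subspace_add[OF H])
  next
    fix c x assume "x \<in> Bc \<rho> J D (Suc m)"
    then obtain v where "v \<in> Hm \<rho> (J m)" "x = (\<lambda>z. v (D m z))"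
      unfolding Bc_Suc by auto
    then show "sc c x \<in> Bc \<rho> J D (Suc m)"
      by (intro Bc_I[of "sc c v"]) (simp_all add: vec.subspace_scale[OF H])
  qed
qed

lemma ci_lift_finite: "ci_lift f p J D T \<Longrightarrow> finite (J n)"
  and ci_lift_D: "ci_lift f p J D T \<Longrightarrow> Lin (J (Suc n)) (J n) (D n)"
  and ci_lift_T: "ci_lift f p J D T \<Longrightarrow> Lin (J (Suc (Suc n))) (J n) (T j n)"
  and ci_lift_DD: "ci_lift f p J D T \<Longrightarrow> D n (D (Suc n) x) = (\<Sum>j=1..p. sc (f j) (T j n x))"
  by (simp_all add: ci_lift_def)

lemma ci_lift_DD_iv: "ci_lift f p J D T \<Longrightarrow> D n (D (Suc n) x) \<in> iv f p"
  by (simp only: ci_lift_DD iv_gens)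

lemma ci_lift_shift: "ci_lift f p J D T \<Longrightarrow>
    ci_lift f p (\<lambda>n. J (Suc (Suc n))) (\<lambda>n. D (Suc (Suc n))) (\<lambda>j n. T j (Suc (Suc n)))"
  by (simp add: ci_lift_def)

lemma exact_modD:
  assumes "exact_mod f p J D" "x \<in> fr (J (Suc n))" "D n x \<in> iv f p"
  obtains y where "y \<in> fr (J (Suc (Suc n)))" "x - D (Suc n) y \<in> iv f p"
  using assms unfolding exact_mod_def by blast

text \<open>The field \<open>k\<close> enters only through a ring homomorphism that kills the regular sequence; the maximal
  ideal is its kernel.\<close>

locale residue_ci =
  fixes \<rho> :: "'a::comm_ring_1 \<Rightarrow> 'k::field" and f :: "nat \<Rightarrow> 'a" and c :: nat
  assumes rho_1 [simp]: "\<rho> 1 = 1" and rho_add: "\<rho> (x + y) = \<rho> x + \<rho> y"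
    and rho_mult: "\<rho> (x * y) = \<rho> x * \<rho> y"
    and rho_f: "j \<in> {1..c} \<Longrightarrow> \<rho> (f j) = 0"
    and regular: "q \<in> {1..c} \<Longrightarrow> f q * x \<in> gen_ideal f (q - 1) \<Longrightarrow> x \<in> gen_ideal f (q - 1)"
begin

lemma rho_0 [simp]: "\<rho> 0 = 0"
  using rho_add[of 0 0] by (simp only: add_0_left add_cancel_right_right)

lemma rho_sum: "\<rho> (sum g A) = (\<Sum>i\<in>A. \<rho> (g i))"
  by (induction A rule: infinite_finite_induct) (simp_all add: rho_add)

lemma rho_gen_ideal:
  assumes "x \<in> gen_ideal f p" "p \<le> c" shows "\<rho> x = 0"
proof -
  obtain a where "x = (\<Sum>j=1..p. f j * a j)" using assms by (auto simp: gen_ideal_iff)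
  then show ?thesis using assms(2) by (auto simp: rho_sum rho_mult rho_f intro!: sum.neutral)
qed

lemma Hm_vanish:
  assumes "u \<in> Hm \<rho> J" "finite J" "\<And>i. i \<in> J \<Longrightarrow> \<rho> (x i) = 0"
  shows "u x = 0"
  unfolding Hm_expand[OF assms(1,2), of x] using assms(3) by (simp add: sum.neutral)

lemma Hm_iv:
  assumes "u \<in> Hm \<rho> J" "finite J" "x \<in> iv f p" "p \<le> c"
  shows "u x = 0"
  using assms rho_gen_ideal by (intro Hm_vanish[OF assms(1,2)]) (auto simp: iv_def)

lemma Hm_cong_iv:
  assumes "u \<in> Hm \<rho> J" "finite J" "x - y \<in> iv f p" "p \<le> c"
  shows "u x = u y"
  using Hm_iv[OF assms] Hm_diff[OF assms(1)] by simp

text \<open>The vector form of \<open>regular_coefficients\<close>.\<close>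

lemma coefficients_iv:
  assumes "(\<Sum>j=1..p. sc (f j) (a j)) = 0" "j \<in> {1..p}" "p \<le> c"
  shows "a j \<in> iv f p"
  unfolding iv_def
proof clarify
  fix i
  have "(\<Sum>j=1..p. sc (f j) (a j)) i = 0" using assms(1) by simp
  then have "(\<Sum>j=1..p. f j * a j i) = 0" by (simp add: sum_apply)
  then show "a j i \<in> gen_ideal f p"
    by (intro regular_coefficients[of p f "\<lambda>j. a j i"])
      (use regular assms(2,3) in auto)
qed

lemma Bc_subset_Zc:
  assumes S: "ci_lift f p J D T" and "p \<le> c"
  shows "Bc \<rho> J D n \<subseteq> Zc \<rho> J D n"
proof (cases n)
  case 0
  then show ?thesis by (simp add: Bc_0 vec.subspace_0[OF Zc_subspace])
next
  case (Suc m)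
  show ?thesis
  proof
    fix u assume "u \<in> Bc \<rho> J D n"
    then obtain w where w: "w \<in> Hm \<rho> (J m)" "u = (\<lambda>x. w (D m x))"
      unfolding Suc Bc_Suc by auto
    have "u \<in> Hm \<rho> (J n)" unfolding w Suc by (rule Hm_comp[OF w(1) ci_lift_D[OF S]])
    moreover have "u (D n x) = 0" for x
      unfolding w Suc by (rule Hm_iv[OF w(1) ci_lift_finite[OF S] ci_lift_DD_iv[OF S] assms(2)])
    ultimately show "u \<in> Zc \<rho> J D n" by (rule Zc_I)
  qed
qed

text \<open>Compare the coefficients of \<open>f\<^sub>j\<close> in \<open>D\<^sup>2 D = D D\<^sup>2\<close>.\<close>

lemma T_chain_map:
  assumes S: "ci_lift f p J D T" and p: "p \<le> c" and j: "j \<in> {1..p}"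
  shows "T j n (D (Suc (Suc n)) x) - D n (T j (Suc n) x) \<in> iv f p"
proof -
  have "D n (D (Suc n) (D (Suc (Suc n)) x)) = (\<Sum>j=1..p. sc (f j) (D n (T j (Suc n) x)))"
    by (simp only: ci_lift_DD[OF S, of "Suc n"] Lin_sum[OF ci_lift_D[OF S]] Lin_sc[OF ci_lift_D[OF S]])
  then have "(\<Sum>j=1..p. sc (f j) (T j n (D (Suc (Suc n)) x) - D n (T j (Suc n) x))) = 0"
    by (simp add: ci_lift_DD[OF S, of n] vec.scale_right_diff_distrib sum_subtractf)
  from coefficients_iv[OF this j p] show ?thesis .
qed

text \<open>Write \<open>\<alpha> D - D' \<alpha> = \<Sum> f\<^sub>j s\<^sub>j\<close> and compare the coefficients of \<open>f\<^sub>j\<close> in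
  \<open>\<alpha> D\<^sup>2 - D'\<^sup>2 \<alpha> = (\<alpha> D - D' \<alpha>) D + D' (\<alpha> D - D' \<alpha>)\<close>: the \<open>s\<^sub>j\<close> are the required homotopies.\<close>

lemma T_natural:
  assumes S: "ci_lift f p J D T" and S': "ci_lift f p J' D' T'" and p: "p \<le> c" and j: "j \<in> {1..p}"
    and a: "\<And>n. Lin (J n) (J' n) (\<alpha> n)"
    and chain: "\<And>n x. \<alpha> n (D n x) - D' n (\<alpha> (Suc n) x) \<in> iv f p"
  obtains s where "\<And>n. Lin (J (Suc n)) (J' n) (s n)"
    "\<And>n x. \<alpha> n (T j n x) - T' j n (\<alpha> (Suc (Suc n)) x)
        - (s n (D (Suc n) x) + D' n (s (Suc n) x)) \<in> iv f p"
proof -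
  have L: "Lin (J (Suc n)) (J' n) (\<lambda>x. \<alpha> n (D n x) - D' n (\<alpha> (Suc n) x))" for n
    by (intro Lin_minus_fun Lin_comp[OF ci_lift_D[OF S] a] Lin_comp[OF a ci_lift_D[OF S']])
  have "\<exists>s. (\<forall>j. Lin (J (Suc n)) (J' n) (s j)) \<and>
      (\<forall>x. \<alpha> n (D n x) - D' n (\<alpha> (Suc n) x) = (\<Sum>j=1..p. sc (f j) (s j x)))" for n
    using Lin_decompose[OF ci_lift_finite[OF S] L chain] by metis
  then obtain s where s: "\<And>n j. Lin (J (Suc n)) (J' n) (s n j)"
    "\<And>n x. \<alpha> n (D n x) - D' n (\<alpha> (Suc n) x) = (\<Sum>j=1..p. sc (f j) (s n j x))"
    by metis
  have "\<alpha> n (T j n x) - T' j n (\<alpha> (Suc (Suc n)) x)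
        - (s n j (D (Suc n) x) + D' n (s (Suc n) j x)) \<in> iv f p" for n x
  proof (rule coefficients_iv[OF _ j p, where a = "\<lambda>j. \<alpha> n (T j n x) - T' j n (\<alpha> (Suc (Suc n)) x)
        - (s n j (D (Suc n) x) + D' n (s (Suc n) j x))"])
    have 1: "(\<Sum>j=1..p. sc (f j) (\<alpha> n (T j n x))) = \<alpha> n (D n (D (Suc n) x))"
      by (simp only: ci_lift_DD[OF S] Lin_sum[OF a] Lin_sc[OF a])
    have 2: "(\<Sum>j=1..p. sc (f j) (T' j n (\<alpha> (Suc (Suc n)) x))) = D' n (D' (Suc n) (\<alpha> (Suc (Suc n)) x))"
      by (simp only: ci_lift_DD[OF S'])
    have 3: "(\<Sum>j=1..p. sc (f j) (s n j (D (Suc n) x)))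
        = \<alpha> n (D n (D (Suc n) x)) - D' n (\<alpha> (Suc n) (D (Suc n) x))"
      by (simp only: s(2))
    have "(\<Sum>j=1..p. sc (f j) (D' n (s (Suc n) j x))) = D' n (\<Sum>j=1..p. sc (f j) (s (Suc n) j x))"
      by (simp only: Lin_sum[OF ci_lift_D[OF S']] Lin_sc[OF ci_lift_D[OF S']])
    then have 4: "(\<Sum>j=1..p. sc (f j) (D' n (s (Suc n) j x)))
        = D' n (\<alpha> (Suc n) (D (Suc n) x)) - D' n (D' (Suc n) (\<alpha> (Suc (Suc n)) x))"
      by (simp only: s(2)[symmetric] Lin_diff[OF ci_lift_D[OF S']])
    show "(\<Sum>j=1..p. sc (f j) (\<alpha> n (T j n x) - T' j n (\<alpha> (Suc (Suc n)) x)
        - (s n j (D (Suc n) x) + D' n (s (Suc n) j x)))) = 0"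
      by (simp only: vec.scale_right_diff_distrib vec.scale_right_distrib sum_subtractf sum.distrib
          1 2 3 4) simp
  qed
  with s(1) show thesis by (rule that)
qed

lemma chi_in_Zc:
  assumes S: "ci_lift f p J D T" and p: "p \<le> c" and j: "j \<in> {1..p}" and u: "u \<in> Zc \<rho> J D n"
  shows "chi T j n u \<in> Zc \<rho> J D (Suc (Suc n))"
proof (rule Zc_I)
  show "chi T j n u \<in> Hm \<rho> (J (Suc (Suc n)))"
    unfolding chi_def by (rule Hm_comp[OF Zc_Hm[OF u] ci_lift_T[OF S]])
  show "chi T j n u (D (Suc (Suc n)) x) = 0" for x
    using Hm_cong_iv[OF Zc_Hm[OF u] ci_lift_finite[OF S] T_chain_map[OF S p j] p] Zc_D[OF u]
    by (simp add: chi_def)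
qed

lemma chi_in_Bc:
  assumes S: "ci_lift f p J D T" and p: "p \<le> c" and j: "j \<in> {1..p}" and u: "u \<in> Bc \<rho> J D n"
  shows "chi T j n u \<in> Bc \<rho> J D (Suc (Suc n))"
proof (cases n)
  case 0
  then have "chi T j n u = 0" using u by (auto simp: Bc_0 chi_def)
  then show ?thesis by (simp add: vec.subspace_0[OF Bc_subspace])
next
  case (Suc m)
  then obtain w where w: "w \<in> Hm \<rho> (J m)" "u = (\<lambda>x. w (D m x))"
    using u by (auto simp: Bc_Suc)
  show ?thesis unfolding Suc
  proof (rule Bc_I)
    show "(\<lambda>x. w (T j m x)) \<in> Hm \<rho> (J (Suc (Suc m)))" by (rule Hm_comp[OF w(1) ci_lift_T[OF S]])
    show "chi T j (Suc m) u x = w (T j m (D (Suc (Suc m)) x))" for x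
      unfolding chi_def w
      using Hm_cong_iv[OF w(1) ci_lift_finite[OF S] T_chain_map[OF S p j] p] by simp
  qed
qed

lemma chi_add: "chi T j n (u + v) = chi T j n u + chi T j n v"
  and chi_sc: "chi T j n (sc a u) = sc a (chi T j n u)"
  by (auto simp: chi_def)

lemma chi_natural:
  assumes S: "ci_lift f p J D T" and S': "ci_lift f p J' D' T'" and p: "p \<le> c" and j: "j \<in> {1..p}"
    and a: "\<And>n. Lin (J n) (J' n) (\<alpha> n)"
    and chain: "\<And>n x. \<alpha> n (D n x) - D' n (\<alpha> (Suc n) x) \<in> iv f p"
    and u: "u \<in> Zc \<rho> J' D' n"
  shows "chi T j n (\<lambda>x. u (\<alpha> n x)) - (\<lambda>x. chi T' j n u (\<alpha> (Suc (Suc n)) x)) \<in> Bc \<rho> J D (Suc (Suc n))"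
proof -
  obtain s where s: "\<And>n. Lin (J (Suc n)) (J' n) (s n)"
    "\<And>n x. \<alpha> n (T j n x) - T' j n (\<alpha> (Suc (Suc n)) x)
        - (s n (D (Suc n) x) + D' n (s (Suc n) x)) \<in> iv f p"
    using T_natural[OF S S' p j a chain] by metis
  show ?thesis
  proof (rule Bc_I)
    show "(\<lambda>x. u (s n x)) \<in> Hm \<rho> (J (Suc n))" by (rule Hm_comp[OF Zc_Hm[OF u] s(1)])
    fix x
    have "u (\<alpha> n (T j n x) - T' j n (\<alpha> (Suc (Suc n)) x)) = u (s n (D (Suc n) x) + D' n (s (Suc n) x))"
      by (rule Hm_cong_iv[OF Zc_Hm[OF u] ci_lift_finite[OF S'] s(2) p])
    then show "(chi T j n (\<lambda>x. u (\<alpha> n x)) - (\<lambda>x. chi T' j n u (\<alpha> (Suc (Suc n)) x))) x = u (s n (D (Suc n) x))"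
      using Zc_D[OF u] by (simp add: chi_def Hm_diff[OF Zc_Hm[OF u]] Hm_add[OF Zc_Hm[OF u]])
  qed
qed

text \<open>Naturality applied to the chain map \<open>T\<^sub>i\<close> itself, from the complex shifted by two degrees.\<close>

lemma chi_commute:
  assumes S: "ci_lift f p J D T" and p: "p \<le> c" and i: "i \<in> {1..p}" and j: "j \<in> {1..p}"
    and u: "u \<in> Zc \<rho> J D n"
  shows "chi T j (Suc (Suc n)) (chi T i n u) - chi T i (Suc (Suc n)) (chi T j n u)
    \<in> Bc \<rho> J D (Suc (Suc (Suc (Suc n))))"
proof -
  have "chi (\<lambda>j n. T j (Suc (Suc n))) j n (\<lambda>x. u (T i n x))
      - (\<lambda>x. chi T j n u (T i (Suc (Suc n)) x))
     \<in> Bc \<rho> (\<lambda>n. J (Suc (Suc n))) (\<lambda>n. D (Suc (Suc n))) (Suc (Suc n))"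
    by (rule chi_natural[OF ci_lift_shift[OF S] S p j ci_lift_T[OF S] T_chain_map[OF S p i] u])
  then show ?thesis by (simp add: chi_def Bc_Suc)
qed

section \<open>Comparison of resolutions\<close>

text \<open>The usual degreewise construction; the given map \<open>a0\<close> is kept in degree 0.\<close>

lemma comparison_map:
  assumes S: "ci_lift f p J D T" and S': "ci_lift f p J' D' T'" and ex: "exact_mod f p J' D'"
    and a0: "Lin (J 0) (J' 0) a0" "\<And>x. \<exists>y\<in>fr (J' 1). a0 (D 0 x) - D' 0 y \<in> iv f p"
  obtains \<alpha> where "\<alpha> 0 = a0" "\<And>n. Lin (J n) (J' n) (\<alpha> n)"
    "\<And>n x. \<alpha> n (D n x) - D' n (\<alpha> (Suc n) x) \<in> iv f p"
proof -
  define P where "P n a \<longleftrightarrow> Lin (J n) (J' n) a \<and> (n = 0 \<longrightarrow> a = a0) \<and>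
     (\<forall>x. \<exists>y\<in>fr (J' (Suc n)). a (D n x) - D' n y \<in> iv f p)" for n a
  define Q where "Q n a b \<longleftrightarrow> (\<forall>x. a (D n x) - D' n (b x) \<in> iv f p)" for n a and b :: "('b \<Rightarrow> 'a) \<Rightarrow> 'c \<Rightarrow> 'a"
  have "\<exists>\<alpha>. \<forall>n. P n (\<alpha> n) \<and> Q n (\<alpha> n) (\<alpha> (Suc n))"
  proof (rule dependent_nat_choice)
    show "\<exists>a. P 0 a" using a0 by (auto simp: P_def)
    fix a n assume P: "P n a"
    then have a: "Lin (J n) (J' n) a" by (simp add: P_def)
    obtain b where b: "Lin (J (Suc n)) (J' (Suc n)) b" "\<And>x. a (D n x) - D' n (b x) \<in> iv f p"
      using lift_through[OF ci_lift_finite[OF S] Lin_comp[OF ci_lift_D[OF S] a] ci_lift_D[OF S']] P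
      unfolding P_def by metis
    have "\<exists>y\<in>fr (J' (Suc (Suc n))). b (D (Suc n) x) - D' (Suc n) y \<in> iv f p" for x
    proof -
      have "a (D n (D (Suc n) x)) \<in> iv f p"
        by (rule Lin_iv'[OF a ci_lift_finite[OF S] ci_lift_DD_iv[OF S]])
      from iv_diff[OF this b(2)[of "D (Suc n) x"]]
      have "D' n (b (D (Suc n) x)) \<in> iv f p" by simp
      then show ?thesis using exact_modD[OF ex Lin_fr[OF b(1)]] by metis
    qed
    then show "\<exists>b. P (Suc n) b \<and> Q n a b" using b by (auto simp: P_def Q_def)
  qed
  then obtain \<alpha> where "\<And>n. P n (\<alpha> n)" "\<And>n. Q n (\<alpha> n) (\<alpha> (Suc n))" by auto
  then show thesis by (intro that[of \<alpha>]) (auto simp: P_def Q_def)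
qed

lemma null_homotopy:
  assumes S: "ci_lift f p J D T" and S': "ci_lift f p J' D' T'" and ex: "exact_mod f p J' D'"
    and e: "\<And>n. Lin (J n) (J' n) (\<eta> n)" "\<And>n x. \<eta> n (D n x) - D' n (\<eta> (Suc n) x) \<in> iv f p"
    and e0: "\<And>x. \<exists>y\<in>fr (J' 1). \<eta> 0 x - D' 0 y \<in> iv f p"
  obtains s where "\<And>n. Lin (J n) (J' (Suc n)) (s n)" "\<And>x. \<eta> 0 x - D' 0 (s 0 x) \<in> iv f p"
    "\<And>n x. \<eta> (Suc n) x - s n (D n x) - D' (Suc n) (s (Suc n) x) \<in> iv f p"
proof -
  define P where "P n s \<longleftrightarrow> Lin (J n) (J' (Suc n)) s \<and> (n = 0 \<longrightarrow> (\<forall>x. \<eta> 0 x - D' 0 (s x) \<in> iv f p)) \<and>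
     (\<forall>x. D' n (\<eta> (Suc n) x - s (D n x)) \<in> iv f p)" for n s
  define Q where "Q n s s' \<longleftrightarrow> (\<forall>x. \<eta> (Suc n) x - s (D n x) - D' (Suc n) (s' x) \<in> iv f p)"
    for n s and s' :: "('b \<Rightarrow> 'a) \<Rightarrow> 'c \<Rightarrow> 'a"
  have "\<exists>s. \<forall>n. P n (s n) \<and> Q n (s n) (s (Suc n))"
  proof (rule dependent_nat_choice)
    obtain s where s: "Lin (J 0) (J' (Suc 0)) s" "\<And>x. \<eta> 0 x - D' 0 (s x) \<in> iv f p"
      using lift_through[OF ci_lift_finite[OF S] e(1) ci_lift_D[OF S']] e0 unfolding One_nat_def by metis
    have "D' 0 (\<eta> (Suc 0) x - s (D 0 x)) \<in> iv f p" for x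
      using iv_diff[OF s(2)[of "D 0 x"] e(2)[of 0 x]] by (simp add: Lin_diff[OF ci_lift_D[OF S']])
    with s show "\<exists>s. P 0 s" by (auto simp: P_def)
  next
    fix s n assume P: "P n s"
    then have s: "Lin (J n) (J' (Suc n)) s" by (simp add: P_def)
    have L: "Lin (J (Suc n)) (J' (Suc n)) (\<lambda>x. \<eta> (Suc n) x - s (D n x))"
      by (intro Lin_minus_fun e Lin_comp[OF ci_lift_D[OF S] s])
    have "\<exists>y\<in>fr (J' (Suc (Suc n))). \<eta> (Suc n) x - s (D n x) - D' (Suc n) y \<in> iv f p" for x
      using exact_modD[OF ex Lin_fr[OF L]] P unfolding P_def by metis
    then obtain s' where s': "Lin (J (Suc n)) (J' (Suc (Suc n))) s'"
      "\<And>x. \<eta> (Suc n) x - s (D n x) - D' (Suc n) (s' x) \<in> iv f p"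
      using lift_through[OF ci_lift_finite[OF S] L ci_lift_D[OF S']] by metis
    have "D' (Suc n) (\<eta> (Suc (Suc n)) x - s' (D (Suc n) x)) \<in> iv f p" for x
    proof -
      have "s (D n (D (Suc n) x)) \<in> iv f p"
        by (rule Lin_iv'[OF s ci_lift_finite[OF S] ci_lift_DD_iv[OF S]])
      from iv_add[OF iv_diff[OF s'(2)[of "D (Suc n) x"] e(2)[of "Suc n" x]] this]
      show ?thesis by (simp add: Lin_diff[OF ci_lift_D[OF S']])
    qed
    with s' show "\<exists>s'. P (Suc n) s' \<and> Q n s s'" by (auto simp: P_def Q_def)
  qed
  then obtain s where "\<And>n. P n (s n)" "\<And>n. Q n (s n) (s (Suc n))" by auto
  then show thesis by (intro that[of s]) (auto simp: P_def Q_def)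
qed

lemma pullback_Zc:
  assumes S': "ci_lift f p J' D' T'" and p: "p \<le> c"
    and a: "\<And>n. Lin (J n) (J' n) (\<alpha> n)" "\<And>n x. \<alpha> n (D n x) - D' n (\<alpha> (Suc n) x) \<in> iv f p"
    and u: "u \<in> Zc \<rho> J' D' n"
  shows "(\<lambda>x. u (\<alpha> n x)) \<in> Zc \<rho> J D n"
  using Hm_cong_iv[OF Zc_Hm[OF u] ci_lift_finite[OF S'] a(2) p] Zc_D[OF u]
  by (intro Zc_I Hm_comp[OF Zc_Hm[OF u] a(1)]) simp

lemma pullback_Bc:
  assumes S': "ci_lift f p J' D' T'" and p: "p \<le> c"
    and a: "\<And>n. Lin (J n) (J' n) (\<alpha> n)" "\<And>n x. \<alpha> n (D n x) - D' n (\<alpha> (Suc n) x) \<in> iv f p"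
    and u: "u \<in> Bc \<rho> J' D' n"
  shows "(\<lambda>x. u (\<alpha> n x)) \<in> Bc \<rho> J D n"
proof (cases n)
  case 0
  then show ?thesis using u by (simp add: Bc_0 zero_fun_def)
next
  case (Suc m)
  then obtain w where w: "w \<in> Hm \<rho> (J' m)" "u = (\<lambda>x. w (D' m x))"
    using u by (auto simp: Bc_Suc)
  show ?thesis unfolding Suc w
    using Hm_cong_iv[OF w(1) ci_lift_finite[OF S'] a(2) p]
    by (intro Bc_I[where w = "\<lambda>x. w (\<alpha> m x)"] Hm_comp[OF w(1) a(1)]) simp
qed

text \<open>The difference of \<open>\<gamma>\<close> and the identity is null-homotopic, and a cocycle composed with a
  null-homotopic map is a coboundary.\<close>

lemma pullback_homotopic_id:
  assumes S: "ci_lift f p J D T" and ex: "exact_mod f p J D" and p: "p \<le> c"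
    and g: "\<And>n. Lin (J n) (J n) (\<gamma> n)" "\<And>n x. \<gamma> n (D n x) - D n (\<gamma> (Suc n) x) \<in> iv f p"
    and g0: "\<And>x. x \<in> fr (J 0) \<Longrightarrow> \<exists>y\<in>fr (J 1). \<gamma> 0 x - x - D 0 y \<in> iv f p"
    and u: "u \<in> Zc \<rho> J D n"
  shows "(\<lambda>x. u (\<gamma> n x)) - u \<in> Bc \<rho> J D n"
proof -
  define \<eta> where "\<eta> n x = \<gamma> n x - tr (J n) x" for n x
  have L: "Lin (J n) (J n) (\<eta> n)" for n
    unfolding \<eta>_def by (intro Lin_minus_fun g Lin_trunc)
  have "\<exists>y\<in>fr (J 1). \<eta> 0 x - D 0 y \<in> iv f p" for x
    using g0[OF tr_fr[of "J 0" x]] by (simp add: \<eta>_def Lin_tr[OF g(1)])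
  moreover have "\<eta> n (D n x) - D n (\<eta> (Suc n) x) \<in> iv f p" for n x
    using g(2)[of n x] unfolding \<eta>_def
    by (simp add: Lin_diff[OF ci_lift_D[OF S]] Lin_tr[OF ci_lift_D[OF S]] tr_id[OF Lin_fr[OF ci_lift_D[OF S]]])
  ultimately obtain s where s: "\<And>n. Lin (J n) (J (Suc n)) (s n)" "\<And>x. \<eta> 0 x - D 0 (s 0 x) \<in> iv f p"
    "\<And>n x. \<eta> (Suc n) x - s n (D n x) - D (Suc n) (s (Suc n) x) \<in> iv f p"
    using null_homotopy[OF S S ex L] by metis
  have *: "((\<lambda>x. u (\<gamma> n x)) - u) x = u (\<eta> n x)" for x
    by (simp add: \<eta>_def Hm_diff[OF Zc_Hm[OF u]] Hm_tr[OF Zc_Hm[OF u]])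
  show ?thesis
  proof (cases n)
    case 0
    have "u (\<eta> 0 x) = u (D 0 (s 0 x))" for x
      using Hm_cong_iv[OF Zc_Hm[OF u] ci_lift_finite[OF S], of "\<eta> 0 x" "D 0 (s 0 x)" p] s(2) p by blast
    then have "((\<lambda>x. u (\<gamma> n x)) - u) = 0"
      using * Zc_D[OF u] by (simp add: fun_eq_iff 0)
    then show ?thesis by (simp add: 0 Bc_0)
  next
    case (Suc m)
    note H = Zc_Hm[OF u]
    show ?thesis unfolding Suc
    proof (rule Bc_I)
      show "(\<lambda>x. u (s m x)) \<in> Hm \<rho> (J m)"
        using Hm_comp[OF _ s(1)] H by (simp add: Suc)
      fix x
      have "u (\<eta> (Suc m) x - s m (D m x)) = u (D (Suc m) (s (Suc m) x))"
        by (rule Hm_cong_iv[OF H ci_lift_finite[OF S] s(3) p])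
      then show "((\<lambda>x. u (\<gamma> (Suc m) x)) - u) x = u (s m (D m x))"
        using * Zc_D[OF u] by (simp add: Suc Hm_diff[OF H])
    qed
  qed
qed

end

section \<open>Bases modulo a subspace\<close>

text \<open>The classes of the vectors \<open>a x\<close>, \<open>x \<in> X\<close>, form a basis of \<open>Z / B\<close>.  Cohomology is handled in this
  form, without choosing a model of the quotient.\<close>

definition basis_mod :: "('k::field \<Rightarrow> 'v \<Rightarrow> 'v) \<Rightarrow> 'v::ab_group_add set \<Rightarrow> 'v set \<Rightarrow> 'x set
    \<Rightarrow> ('x \<Rightarrow> 'v) \<Rightarrow> bool" where
  "basis_mod s Z B X a \<longleftrightarrow> (\<forall>x\<in>X. a x \<in> Z) \<and>
     (\<forall>u\<in>Z. \<exists>\<kappa>. u - (\<Sum>x\<in>X. s (\<kappa> x) (a x)) \<in> B) \<and>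
     (\<forall>\<kappa>. (\<Sum>x\<in>X. s (\<kappa> x) (a x)) \<in> B \<longrightarrow> (\<forall>x\<in>X. \<kappa> x = 0))"

lemma basis_modD:
  assumes "basis_mod s Z B X a"
  shows basis_mod_in: "x \<in> X \<Longrightarrow> a x \<in> Z"
    and basis_mod_span: "u \<in> Z \<Longrightarrow> \<exists>\<kappa>. u - (\<Sum>x\<in>X. s (\<kappa> x) (a x)) \<in> B"
    and basis_mod_indep: "(\<Sum>x\<in>X. s (\<kappa> x) (a x)) \<in> B \<Longrightarrow> x \<in> X \<Longrightarrow> \<kappa> x = 0"
  using assms unfolding basis_mod_def by blast+

lemma submoduleD:
  assumes "submodule s X"
  shows submodule_module: "module s"
    and submodule_0: "0 \<in> X"
    and submodule_add: "x \<in> X \<Longrightarrow> y \<in> X \<Longrightarrow> x + y \<in> X"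
    and submodule_diff: "x \<in> X \<Longrightarrow> y \<in> X \<Longrightarrow> x - y \<in> X"
    and submodule_minus: "x \<in> X \<Longrightarrow> - x \<in> X"
    and submodule_scale: "x \<in> X \<Longrightarrow> s r x \<in> X"
    and submodule_sum: "(\<And>i. i \<in> A \<Longrightarrow> g i \<in> X) \<Longrightarrow> sum g A \<in> X"
proof -
  have m: "module s" and X: "module.subspace s X" using assms by (auto simp: submodule_def)
  show "module s" by fact
  interpret module s by fact
  show "0 \<in> X" "x \<in> X \<Longrightarrow> y \<in> X \<Longrightarrow> x + y \<in> X" "x \<in> X \<Longrightarrow> y \<in> X \<Longrightarrow> x - y \<in> X" "x \<in> X \<Longrightarrow> - x \<in> X"
    "x \<in> X \<Longrightarrow> s r x \<in> X" "(\<And>i. i \<in> A \<Longrightarrow> g i \<in> X) \<Longrightarrow> sum g A \<in> X"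
    using X by (auto intro: subspace_0 subspace_add subspace_diff subspace_neg subspace_scale subspace_sum)
qed

lemma submodule_diff_mem:
  assumes "submodule s X" "x - y \<in> X"
  shows "x \<in> X \<longleftrightarrow> y \<in> X"
  using submodule_add[OF assms(1) assms(2), of y] submodule_diff[OF assms(1) _ assms(2), of x] by auto

lemma lin_onD:
  assumes "semilinear_on \<sigma> s X s' Y g"
  shows lin_on_in: "x \<in> X \<Longrightarrow> g x \<in> Y"
    and lin_on_add: "x \<in> X \<Longrightarrow> y \<in> X \<Longrightarrow> g (x + y) = g x + g y"
    and lin_on_scale: "x \<in> X \<Longrightarrow> g (s r x) = s' (\<sigma> r) (g x)"
  using assms by (auto simp: semilinear_on_def)

lemma lin_on_0:
  fixes g :: "'v::ab_group_add \<Rightarrow> 'w::ab_group_add"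
  assumes "semilinear_on \<sigma> s X s' Y g" "submodule s X"
  shows "g 0 = 0"
  using lin_on_add[OF assms(1), of 0 0] submodule_0[OF assms(2)] by simp

lemma lin_on_diff:
  fixes g :: "'v::ab_group_add \<Rightarrow> 'w::ab_group_add"
  assumes g: "semilinear_on \<sigma> s X s' Y g" "submodule s X" and "x \<in> X" "y \<in> X"
  shows "g (x - y) = g x - g y"
  using lin_on_add[OF g(1), of "x - y" y] submodule_diff[OF g(2)] assms(3,4) by simp

lemma lin_on_sum:
  fixes g :: "'v::ab_group_add \<Rightarrow> 'w::ab_group_add"
  assumes g: "semilinear_on \<sigma> s X s' Y g" "submodule s X" and a: "\<And>i. i \<in> A \<Longrightarrow> a i \<in> X"
  shows "g (sum a A) = (\<Sum>i\<in>A. g (a i))"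
  using a
proof (induction A rule: infinite_finite_induct)
  case (insert x A)
  then have "sum a A \<in> X" by (intro submodule_sum[OF g(2)]) auto
  then show ?case using insert by (simp add: lin_on_add[OF g(1)])
qed (simp_all add: lin_on_0[OF g])

lemma lin_on_comb:
  fixes g :: "'v::ab_group_add \<Rightarrow> 'w::ab_group_add"
  assumes g: "semilinear_on \<sigma> s X s' Y g" "submodule s X" and a: "\<And>i. i \<in> A \<Longrightarrow> a i \<in> X"
  shows "g (\<Sum>i\<in>A. s (\<kappa> i) (a i)) = (\<Sum>i\<in>A. s' (\<sigma> (\<kappa> i)) (g (a i)))"
  using a by (subst lin_on_sum[OF g]) (auto simp: lin_on_scale[OF g(1)] intro!: submodule_scale[OF g(2)])

lemma comb_diff:
  assumes "module s"
  shows "(\<Sum>x\<in>X. s (\<kappa> x) (a x)) - (\<Sum>x\<in>X. s (\<kappa> x) (b x)) = (\<Sum>x\<in>X. s (\<kappa> x) (a x - b x))"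
  by (simp add: module.scale_right_diff_distrib[OF assms] sum_subtractf)

lemma basis_mod_cong:
  assumes B: "submodule s B" and a: "basis_mod s Z B X a"
    and b: "\<And>x. x \<in> X \<Longrightarrow> b x \<in> Z" "\<And>x. x \<in> X \<Longrightarrow> a x - b x \<in> B"
  shows "basis_mod s Z B X b"
proof -
  have eq: "(\<Sum>x\<in>X. s (\<kappa> x) (a x)) - (\<Sum>x\<in>X. s (\<kappa> x) (b x)) \<in> B" for \<kappa>
    unfolding comb_diff[OF submodule_module[OF B]]
    by (intro submodule_sum[OF B] submodule_scale[OF B] b)
  show ?thesis unfolding basis_mod_def
  proof (intro conjI ballI allI impI)
    fix u assume "u \<in> Z"
    then obtain \<kappa> where "u - (\<Sum>x\<in>X. s (\<kappa> x) (a x)) \<in> B" using basis_mod_span[OF a] by blast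
    from submodule_add[OF B this eq[of \<kappa>]]
    show "\<exists>\<kappa>. u - (\<Sum>x\<in>X. s (\<kappa> x) (b x)) \<in> B" by auto
  next
    fix \<kappa> x assume "(\<Sum>x\<in>X. s (\<kappa> x) (b x)) \<in> B" "x \<in> X"
    then show "\<kappa> x = 0"
      using basis_mod_indep[OF a, of \<kappa> x] submodule_diff_mem[OF B eq[of \<kappa>]] by blast
  qed (rule b)
qed

text \<open>The maps \<open>Z/B \<rightarrow> Z'/B'\<close> in question are onto, with a kernel that has the basis \<open>a y\<close>, \<open>y \<in> Y\<close>;
  the \<open>a x\<close> with \<open>x \<in> X\<close> lift a basis of the target.\<close>

lemma basis_mod_extension:
  fixes g :: "'v::ab_group_add \<Rightarrow> 'w::ab_group_add"
  assumes Z: "submodule s Z" and B: "submodule s B" and B': "submodule s' B'" and BZ: "B \<subseteq> Z"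
    and g: "lin_on s Z s' Z' g" and gB: "\<And>u. u \<in> B \<Longrightarrow> g u \<in> B'"
    and fin: "finite X" "finite Y" "X \<inter> Y = {}"
    and b: "basis_mod s' Z' B' X b"
    and aX: "\<And>x. x \<in> X \<Longrightarrow> a x \<in> Z" "\<And>x. x \<in> X \<Longrightarrow> g (a x) - b x \<in> B'"
    and aY: "\<And>y. y \<in> Y \<Longrightarrow> a y \<in> Z" "\<And>y. y \<in> Y \<Longrightarrow> g (a y) \<in> B'"
    and kernel: "\<And>u. u \<in> Z \<Longrightarrow> g u \<in> B' \<Longrightarrow> \<exists>\<kappa>. u - (\<Sum>y\<in>Y. s (\<kappa> y) (a y)) \<in> B"
    and indep: "\<And>\<kappa> y. (\<Sum>y\<in>Y. s (\<kappa> y) (a y)) \<in> B \<Longrightarrow> y \<in> Y \<Longrightarrow> \<kappa> y = 0"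
  shows "basis_mod s Z B (X \<union> Y) a"
proof -
  note m' = submodule_module[OF B']
  have XZ: "(\<Sum>x\<in>X. s (\<kappa> x) (a x)) \<in> Z" for \<kappa>
    by (intro submodule_sum[OF Z] submodule_scale[OF Z] aX)
  have YZ: "(\<Sum>y\<in>Y. s (\<kappa> y) (a y)) \<in> Z" for \<kappa>
    by (intro submodule_sum[OF Z] submodule_scale[OF Z] aY)
  have gX: "g (\<Sum>x\<in>X. s (\<kappa> x) (a x)) - (\<Sum>x\<in>X. s' (\<kappa> x) (b x)) \<in> B'" for \<kappa>
    by (simp only: lin_on_comb[OF g Z aX(1)] comb_diff[OF m'])
      (intro submodule_sum[OF B'] submodule_scale[OF B'] aX)
  have gY: "g (\<Sum>y\<in>Y. s (\<kappa> y) (a y)) \<in> B'" for \<kappa>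
    by (simp only: lin_on_comb[OF g Z aY(1)])
      (intro submodule_sum[OF B'] submodule_scale[OF B'] aY)
  show ?thesis unfolding basis_mod_def
  proof (intro conjI ballI allI impI)
    show "a x \<in> Z" if "x \<in> X \<union> Y" for x using that aX aY by auto
    fix u assume u: "u \<in> Z"
    then obtain \<kappa> where \<kappa>: "g u - (\<Sum>x\<in>X. s' (\<kappa> x) (b x)) \<in> B'"
      using basis_mod_span[OF b] lin_on_in[OF g] by blast
    let ?v = "u - (\<Sum>x\<in>X. s (\<kappa> x) (a x))"
    from submodule_diff[OF B' \<kappa> gX[of \<kappa>]] have "g ?v \<in> B'"
      by (simp add: lin_on_diff[OF g Z u XZ])
    then obtain \<nu> where \<nu>: "?v - (\<Sum>y\<in>Y. s (\<nu> y) (a y)) \<in> B"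
      using kernel submodule_diff[OF Z u XZ] by blast
    let ?k = "\<lambda>x. if x \<in> X then \<kappa> x else \<nu> x"
    have "(\<Sum>x\<in>X \<union> Y. s (?k x) (a x)) = (\<Sum>x\<in>X. s (?k x) (a x)) + (\<Sum>y\<in>Y. s (?k y) (a y))"
      by (rule sum.union_disjoint[OF fin])
    also have "(\<Sum>y\<in>Y. s (?k y) (a y)) = (\<Sum>y\<in>Y. s (\<nu> y) (a y))"
      using fin(3) by (intro sum.cong) auto
    finally show "\<exists>\<kappa>. u - (\<Sum>x\<in>X \<union> Y. s (\<kappa> x) (a x)) \<in> B"
      using \<nu> by (intro exI[of _ ?k]) (simp add: diff_diff_add)
  next
    fix \<kappa> x assume sum: "(\<Sum>x\<in>X \<union> Y. s (\<kappa> x) (a x)) \<in> B" and x: "x \<in> X \<union> Y"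
    let ?x = "\<Sum>x\<in>X. s (\<kappa> x) (a x)" and ?y = "\<Sum>y\<in>Y. s (\<kappa> y) (a y)"
    have sum': "?x + ?y \<in> B" using sum by (simp add: sum.union_disjoint[OF fin])
    then have "g ?x + g ?y \<in> B'" using gB lin_on_add[OF g XZ YZ] by metis
    then have "g ?x \<in> B'" using submodule_diff[OF B' _ gY[of \<kappa>]] by fastforce
    then have "(\<Sum>x\<in>X. s' (\<kappa> x) (b x)) \<in> B'" using submodule_diff_mem[OF B' gX[of \<kappa>]] by blast
    then have 0: "\<kappa> x = 0" if "x \<in> X" for x using basis_mod_indep[OF b] that by blast
    then have "?x = 0" by (intro sum.neutral) (simp add: module.scale_zero_left[OF submodule_module[OF B]])
    then have "?y \<in> B" using sum' by simp
    then show "\<kappa> x = 0" using x 0 indep by blast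
  qed
qed

lemma basis_mod_image:
  fixes g :: "'v::ab_group_add \<Rightarrow> 'w::ab_group_add"
  assumes Z: "submodule s Z" and B': "submodule s' B'"
    and g: "lin_on s Z s' Z' g" and inj: "\<And>u. u \<in> Z \<Longrightarrow> g u \<in> B' \<Longrightarrow> u \<in> B"
    and gB: "\<And>u. u \<in> B \<Longrightarrow> g u \<in> B'"
    and surj: "\<And>z. z \<in> Z' \<Longrightarrow> \<exists>u\<in>Z. z - g u \<in> B'"
    and a: "basis_mod s Z B X a"
  shows "basis_mod s' Z' B' X (\<lambda>x. g (a x))"
proof -
  have XZ: "(\<Sum>x\<in>X. s (\<kappa> x) (a x)) \<in> Z" for \<kappa>
    by (intro submodule_sum[OF Z] submodule_scale[OF Z] basis_mod_in[OF a])
  show ?thesis unfolding basis_mod_def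
  proof (intro conjI ballI allI impI)
    show "g (a x) \<in> Z'" if "x \<in> X" for x using lin_on_in[OF g] basis_mod_in[OF a] that by blast
    fix z assume "z \<in> Z'"
    then obtain u where u: "u \<in> Z" "z - g u \<in> B'" using surj by blast
    then obtain \<kappa> where \<kappa>: "u - (\<Sum>x\<in>X. s (\<kappa> x) (a x)) \<in> B" using basis_mod_span[OF a] by blast
    from submodule_add[OF B' u(2) gB[OF this]]
    show "\<exists>\<kappa>. z - (\<Sum>x\<in>X. s' (\<kappa> x) (g (a x))) \<in> B'"
      by (auto simp: lin_on_diff[OF g Z u(1) XZ] lin_on_comb[OF g Z basis_mod_in[OF a]])
  next
    fix \<kappa> x assume "(\<Sum>x\<in>X. s' (\<kappa> x) (g (a x))) \<in> B'" "x \<in> X"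
    then show "\<kappa> x = 0"
      using basis_mod_indep[OF a inj[OF XZ]] by (simp add: lin_on_comb[OF g Z basis_mod_in[OF a]])
  qed
qed

section \<open>Monomial bases of graded spaces with operators\<close>

text \<open>The monomials in \<open>\<chi>\<^sub>p, \<dots>, \<chi>\<^sub>c\<close>.  Letters decrease, so that the words with letters up to \<open>c + 1\<close>
  are powers of \<open>c + 1\<close> followed by words with letters up to \<open>c\<close>; this matches the induction on \<open>c\<close>,
  which adds powers of \<open>\<chi>\<^sub>c\<^sub>+\<^sub>1\<close> on the outside, before the operators are known to commute.\<close>

definition words :: "nat \<Rightarrow> nat \<Rightarrow> nat list set" where
  "words p c = {w. sorted_wrt (\<ge>) w \<and> set w \<subseteq> {p..c}}"

text \<open>The labels \<open>(q, i, l, w)\<close> of basis elements in degree \<open>n\<close>: the monomial \<open>w\<close> in \<open>\<chi>\<^sub>q, \<dots>, \<chi>\<^sub>c\<close> applied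
  to the generator with label \<open>l\<close> in the \<open>i\<close>-th part of \<open>Hom(\<B>(q), k)\<close>.  The bounds \<open>P\<close> for \<open>q\<close> and \<open>c\<close> for
  the letters are separate, as adding \<open>\<B>(c+1)\<close> and adding \<open>\<chi>\<^sub>c\<^sub>+\<^sub>1\<close> are different steps.\<close>

definition Idx :: "(nat \<Rightarrow> nat \<Rightarrow> 'l set) \<Rightarrow> nat \<Rightarrow> nat \<Rightarrow> nat \<Rightarrow> (nat \<times> nat \<times> 'l \<times> nat list) set" where
  "Idx L P c n = {(q, i, l, w). q \<in> {1..P} \<and> i < 2 \<and> l \<in> L i q \<and> w \<in> words q c \<and> i + 2 * length w = n}"

fun act :: "(nat \<Rightarrow> nat \<Rightarrow> 'v \<Rightarrow> 'v) \<Rightarrow> nat \<Rightarrow> nat list \<Rightarrow> 'v \<Rightarrow> 'v" where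
  "act \<chi> i [] v = v"
| "act \<chi> i (j # w) v = \<chi> j (i + 2 * length w) (act \<chi> i w v)"

abbreviation monomial :: "(nat \<Rightarrow> nat \<Rightarrow> 'v \<Rightarrow> 'v) \<Rightarrow> (nat \<Rightarrow> nat \<Rightarrow> 'l \<Rightarrow> 'v)
    \<Rightarrow> nat \<times> nat \<times> 'l \<times> nat list \<Rightarrow> 'v" where
  "monomial \<chi> v \<equiv> (\<lambda>(q, i, l, w). act \<chi> i w (v q i l))"

text \<open>The spaces \<open>Z n / B n\<close> have the bases of monomials in the operators \<open>\<chi>\<close> applied to the generators \<open>v\<close>.\<close>

definition expands :: "('k::field \<Rightarrow> 'v \<Rightarrow> 'v) \<Rightarrow> (nat \<Rightarrow> 'v::ab_group_add set) \<Rightarrow> (nat \<Rightarrow> 'v set)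
    \<Rightarrow> (nat \<Rightarrow> nat \<Rightarrow> 'v \<Rightarrow> 'v) \<Rightarrow> (nat \<Rightarrow> nat \<Rightarrow> 'l set) \<Rightarrow> nat \<Rightarrow> nat
    \<Rightarrow> (nat \<Rightarrow> nat \<Rightarrow> 'l \<Rightarrow> 'v) \<Rightarrow> bool" where
  "expands s Z B \<chi> L P c v \<longleftrightarrow> (\<forall>q\<in>{1..P}. \<forall>i<2. \<forall>l\<in>L i q. v q i l \<in> Z i) \<and>
     (\<forall>n. basis_mod s (Z n) (B n) (Idx L P c n) (monomial \<chi> v))"

text \<open>Graded spaces \<open>Z n / B n\<close> with operators of degree 2, and their homomorphisms: compatibility with
  the operators is required only modulo \<open>B\<close>.\<close>

definition graded_ops :: "('k::field \<Rightarrow> 'v \<Rightarrow> 'v) \<Rightarrow> (nat \<Rightarrow> 'v::ab_group_add set) \<Rightarrow> (nat \<Rightarrow> 'v set)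
    \<Rightarrow> (nat \<Rightarrow> nat \<Rightarrow> 'v \<Rightarrow> 'v) \<Rightarrow> nat \<Rightarrow> bool" where
  "graded_ops s Z B \<chi> c \<longleftrightarrow> (\<forall>n. submodule s (Z n) \<and> submodule s (B n) \<and> B n \<subseteq> Z n) \<and>
     (\<forall>j\<in>{1..c}. \<forall>n. lin_on s (Z n) s (Z (Suc (Suc n))) (\<chi> j n) \<and> \<chi> j n ` B n \<subseteq> B (Suc (Suc n)))"

definition graded_map :: "('k::field \<Rightarrow> 'v \<Rightarrow> 'v) \<Rightarrow> (nat \<Rightarrow> 'v::ab_group_add set) \<Rightarrow> (nat \<Rightarrow> 'v set)
    \<Rightarrow> (nat \<Rightarrow> nat \<Rightarrow> 'v \<Rightarrow> 'v) \<Rightarrow> ('k \<Rightarrow> 'w \<Rightarrow> 'w) \<Rightarrow> (nat \<Rightarrow> 'w::ab_group_add set) \<Rightarrow> (nat \<Rightarrow> 'w set)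
    \<Rightarrow> (nat \<Rightarrow> nat \<Rightarrow> 'w \<Rightarrow> 'w) \<Rightarrow> nat \<Rightarrow> (nat \<Rightarrow> 'v \<Rightarrow> 'w) \<Rightarrow> bool" where
  "graded_map s Z B \<chi> s' Z' B' \<chi>' c g \<longleftrightarrow> (\<forall>n. lin_on s (Z n) s' (Z' n) (g n) \<and> g n ` B n \<subseteq> B' n \<and>
     (\<forall>j\<in>{1..c}. \<forall>u\<in>Z n. g (Suc (Suc n)) (\<chi> j n u) - \<chi>' j n (g n u) \<in> B' (Suc (Suc n))))"

lemma opsD:
  assumes "graded_ops s Z B \<chi> c"
  shows ops_Z: "submodule s (Z n)" and ops_B: "submodule s (B n)" and ops_BZ: "B n \<subseteq> Z n"
    and ops_lin: "j \<in> {1..c} \<Longrightarrow> lin_on s (Z n) s (Z (Suc (Suc n))) (\<chi> j n)"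
    and ops_chi_B: "j \<in> {1..c} \<Longrightarrow> u \<in> B n \<Longrightarrow> \<chi> j n u \<in> B (Suc (Suc n))"
  using assms unfolding graded_ops_def by blast+

lemma ops_mono: "graded_ops s Z B \<chi> c \<Longrightarrow> p \<le> c \<Longrightarrow> graded_ops s Z B \<chi> p"
  unfolding graded_ops_def by auto

lemma graded_mapD:
  assumes "graded_map s Z B \<chi> s' Z' B' \<chi>' c g"
  shows graded_map_lin: "lin_on s (Z n) s' (Z' n) (g n)"
    and graded_map_B: "u \<in> B n \<Longrightarrow> g n u \<in> B' n"
    and graded_map_chi: "j \<in> {1..c} \<Longrightarrow> u \<in> Z n \<Longrightarrow>
       g (Suc (Suc n)) (\<chi> j n u) - \<chi>' j n (g n u) \<in> B' (Suc (Suc n))"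
  using assms unfolding graded_map_def by blast+

lemma words_subset: "w \<in> words q c \<Longrightarrow> 1 \<le> q \<Longrightarrow> set w \<subseteq> {1..c}"
  by (auto simp: words_def)

lemma finite_words_length: "finite {w \<in> words q c. length w = n}"
  by (rule finite_subset[OF _ finite_lists_length_eq[of "{q..c}" n]]) (auto simp: words_def)

lemma finite_Idx:
  assumes "\<And>i q. finite (L i q)"
  shows "finite (Idx L P c n)"
proof (rule finite_subset)
  let ?W = "\<Union>q\<in>{1..P}. \<Union>m\<in>{..n}. {w \<in> words q c. length w = m}"
  show "Idx L P c n \<subseteq> {1..P} \<times> {..<2} \<times> (\<Union>q\<in>{1..P}. \<Union>i\<in>{..<2}. L i q) \<times> ?W"
    by (auto simp: Idx_def)
  show "finite ({1..P} \<times> {..<2::nat} \<times> (\<Union>q\<in>{1..P}. \<Union>i\<in>{..<2}. L i q) \<times> ?W)"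
    using assms finite_words_length by blast
qed

lemma act_in:
  assumes "graded_ops s Z B \<chi> c" "v \<in> Z i" "set w \<subseteq> {1..c}"
  shows "act \<chi> i w v \<in> Z (i + 2 * length w)"
  using assms(3)
proof (induction w)
  case (Cons j w)
  then show ?case using lin_on_in[OF ops_lin[OF assms(1), of j "i + 2 * length w"]] by simp
qed (use assms in simp)

lemma act_morph:
  assumes O: "graded_ops s Z B \<chi> c" and O': "graded_ops s' Z' B' \<chi>' c" and g: "graded_map s Z B \<chi> s' Z' B' \<chi>' c g"
    and v: "v \<in> Z i" "v' \<in> Z' i" "g i v - v' \<in> B' i" and w: "set w \<subseteq> {1..c}"
  shows "g (i + 2 * length w) (act \<chi> i w v) - act \<chi>' i w v' \<in> B' (i + 2 * length w)"
  using w
proof (induction w)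
  case (Cons j w)
  let ?n = "i + 2 * length w"
  have j: "j \<in> {1..c}" and w: "set w \<subseteq> {1..c}" using Cons.prems by auto
  have a: "act \<chi> i w v \<in> Z ?n" by (rule act_in[OF O v(1) w])
  have a': "act \<chi>' i w v' \<in> Z' ?n" by (rule act_in[OF O' v(2) w])
  have ga: "g ?n (act \<chi> i w v) \<in> Z' ?n" by (rule lin_on_in[OF graded_map_lin[OF g] a])
  have 1: "g (Suc (Suc ?n)) (\<chi> j ?n (act \<chi> i w v)) - \<chi>' j ?n (g ?n (act \<chi> i w v)) \<in> B' (Suc (Suc ?n))"
    by (rule graded_map_chi[OF g j a])
  have 2: "\<chi>' j ?n (g ?n (act \<chi> i w v)) - \<chi>' j ?n (act \<chi>' i w v') \<in> B' (Suc (Suc ?n))"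
    using ops_chi_B[OF O' j Cons.IH[OF w]] by (simp add: lin_on_diff[OF ops_lin[OF O' j] ops_Z[OF O'] ga a'])
  show ?case using submodule_add[OF ops_B[OF O'] 1 2] by simp
qed (use v in simp)

lemma expandsD:
  assumes "expands s Z B \<chi> L P c v"
  shows expands_gen: "q \<in> {1..P} \<Longrightarrow> i < 2 \<Longrightarrow> l \<in> L i q \<Longrightarrow> v q i l \<in> Z i"
    and expands_basis: "basis_mod s (Z n) (B n) (Idx L P c n) (monomial \<chi> v)"
  using assms unfolding expands_def by blast+

lemma expands_transfer:
  assumes O: "graded_ops s Z B \<chi> c" and O': "graded_ops s' Z' B' \<chi>' c" and g: "graded_map s Z B \<chi> s' Z' B' \<chi>' c g"
    and inj: "\<And>n u. u \<in> Z n \<Longrightarrow> g n u \<in> B' n \<Longrightarrow> u \<in> B n"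
    and surj: "\<And>n z. z \<in> Z' n \<Longrightarrow> \<exists>u\<in>Z n. z - g n u \<in> B' n"
    and v: "expands s Z B \<chi> L P c v"
  shows "expands s' Z' B' \<chi>' L P c (\<lambda>q i l. g i (v q i l))"
  unfolding expands_def
proof (intro conjI allI ballI impI)
  fix n
  have "basis_mod s' (Z' n) (B' n) (Idx L P c n) (\<lambda>x. g n (monomial \<chi> v x))"
    by (rule basis_mod_image[OF ops_Z[OF O] ops_B[OF O'] graded_map_lin[OF g] inj graded_map_B[OF g] surj
          expands_basis[OF v]])
  then show "basis_mod s' (Z' n) (B' n) (Idx L P c n) (monomial \<chi>' (\<lambda>q i l. g i (v q i l)))"
  proof (rule basis_mod_cong[OF ops_B[OF O']])
    fix x assume "x \<in> Idx L P c n"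
    then obtain q i l w where x: "x = (q, i, l, w)" "q \<in> {1..P}" "i < 2" "l \<in> L i q" "w \<in> words q c"
      "n = i + 2 * length w"
      by (auto simp: Idx_def)
    note w = words_subset[OF x(5)]
    have vZ: "v q i l \<in> Z i" by (rule expands_gen[OF v x(2,3,4)])
    then have gvZ: "g i (v q i l) \<in> Z' i" by (rule lin_on_in[OF graded_map_lin[OF g]])
    show "monomial \<chi>' (\<lambda>q i l. g i (v q i l)) x \<in> Z' n"
      using act_in[OF O' gvZ w] x by simp
    show "g n (monomial \<chi> v x) - monomial \<chi>' (\<lambda>q i l. g i (v q i l)) x \<in> B' n"
      using act_morph[OF O O' g vZ gvZ _ w] x submodule_0[OF ops_B[OF O']] by simp
  qed
qed (use expands_gen[OF v] lin_on_in[OF graded_map_lin[OF g]] in blast)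

lemma words_Suc:
  assumes "q \<le> Suc p"
  shows "words q (Suc p) = words q p \<union> (#) (Suc p) ` words q (Suc p)"
proof (intro subset_antisym subsetI)
  fix w assume w: "w \<in> words q (Suc p)"
  show "w \<in> words q p \<union> (#) (Suc p) ` words q (Suc p)"
  proof (cases w)
    case (Cons j u)
    show ?thesis
    proof (cases "j = Suc p")
      case True
      then show ?thesis using w Cons by (auto simp: words_def)
    next
      case False
      then have "w \<in> words q p" using w Cons by (fastforce simp: words_def)
      then show ?thesis by simp
    qed
  qed (simp add: words_def)
qed (use assms in \<open>force simp: words_def\<close>)

text \<open>Here \<open>\<chi>\<^sub>c\<close> with \<open>c = p + 1\<close> is injective and \<open>\<iota>\<close> is the quotient by its image.  A basis in degree \<open>n\<close>
  consists of lifts of the basis of the target, which are the words without \<open>c\<close>, and of the image under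
  \<open>\<chi>\<^sub>c\<close> of a basis in degree \<open>n - 2\<close>, which are the words that start with \<open>c\<close>.\<close>

lemma expands_step:
  fixes \<iota> :: "nat \<Rightarrow> 'v::ab_group_add \<Rightarrow> 'w::ab_group_add"
  assumes O: "graded_ops s Z B \<chi> (Suc p)" and O': "graded_ops s' Z' B' \<chi>' p" and g: "graded_map s Z B \<chi> s' Z' B' \<chi>' p \<iota>"
    and surj: "\<And>n z. z \<in> Z' n \<Longrightarrow> \<exists>u\<in>Z n. z - \<iota> n u \<in> B' n"
    and ker0: "\<And>n u. n < 2 \<Longrightarrow> u \<in> Z n \<Longrightarrow> \<iota> n u \<in> B' n \<Longrightarrow> u \<in> B n"
    and ker: "\<And>n u. u \<in> Z (Suc (Suc n)) \<Longrightarrow> \<iota> (Suc (Suc n)) u \<in> B' (Suc (Suc n)) \<Longrightarrow>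
        \<exists>u1\<in>Z n. u - \<chi> (Suc p) n u1 \<in> B (Suc (Suc n))"
    and \<iota>\<chi>: "\<And>n u. u \<in> Z n \<Longrightarrow> \<iota> (Suc (Suc n)) (\<chi> (Suc p) n u) \<in> B' (Suc (Suc n))"
    and inj: "\<And>n u. u \<in> Z n \<Longrightarrow> \<chi> (Suc p) n u \<in> B (Suc (Suc n)) \<Longrightarrow> u \<in> B n"
    and v': "expands s' Z' B' \<chi>' L P p v'" and L: "\<And>i q. finite (L i q)" and P: "P \<le> Suc p"
  shows "\<exists>v. expands s Z B \<chi> L P (Suc p) v"
proof -
  have "\<exists>u. q \<in> {1..P} \<and> i < 2 \<and> l \<in> L i q \<longrightarrow> u \<in> Z i \<and> \<iota> i u - v' q i l \<in> B' i" for q i l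
    using surj[OF expands_gen[OF v', of q i l]] submodule_minus[OF ops_B[OF O']]
    by (metis minus_diff_eq)
  then obtain v where v: "\<And>q i l. q \<in> {1..P} \<and> i < 2 \<and> l \<in> L i q \<longrightarrow>
      v q i l \<in> Z i \<and> \<iota> i (v q i l) - v' q i l \<in> B' i"
    by metis
  have "basis_mod s (Z n) (B n) (Idx L P (Suc p) n) (monomial \<chi> v)" for n
  proof (induction n rule: less_induct)
    case (less n)
    let ?X = "Idx L P p n" and ?c = "\<lambda>(q, i, l, w). (q, i, l, Suc p # w)"
    define Y where "Y = (if n < 2 then {} else ?c ` Idx L P (Suc p) (n - 2))"
    have X_Y: "Idx L P (Suc p) n = ?X \<union> Y"
    proof (intro subset_antisym subsetI)
      fix x assume "x \<in> Idx L P (Suc p) n"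
      then obtain q i l w where x: "x = (q, i, l, w)" "q \<in> {1..P}" "i < 2" "l \<in> L i q"
        "w \<in> words q (Suc p)" "i + 2 * length w = n"
        by (auto simp: Idx_def)
      have "w \<in> words q p \<union> (#) (Suc p) ` words q (Suc p)"
        using words_Suc[of q p] x(2,5) P by auto
      then show "x \<in> ?X \<union> Y"
      proof
        assume "w \<in> (#) (Suc p) ` words q (Suc p)"
        then obtain w' where w': "w = Suc p # w'" "w' \<in> words q (Suc p)" by auto
        then have "(q, i, l, w') \<in> Idx L P (Suc p) (n - 2)" "\<not> n < 2" using x by (auto simp: Idx_def)
        then show ?thesis using x(1) w'(1) by (force simp: Y_def)
      qed (use x in \<open>simp add: Idx_def\<close>)
    next
      fix x assume x: "x \<in> ?X \<union> Y"
      show "x \<in> Idx L P (Suc p) n"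
      proof (cases "x \<in> ?X")
        case True
        then show ?thesis by (auto simp: Idx_def words_def)
      next
        case False
        then obtain q i l w where x: "x = (q, i, l, Suc p # w)" "(q, i, l, w) \<in> Idx L P (Suc p) (n - 2)"
          "\<not> n < 2"
          using x by (auto simp: Y_def split: if_splits)
        then have "Suc p # w \<in> words q (Suc p)" using words_Suc[of q p] P by (auto simp: Idx_def)
        then show ?thesis using x by (auto simp: Idx_def)
      qed
    qed
    have finX: "finite ?X" by (rule finite_Idx[OF L])
    have "finite (?c ` Idx L P (Suc p) (n - 2))" by (rule finite_imageI[OF finite_Idx[OF L]])
    then have finY: "finite Y" unfolding Y_def by (cases "n < 2") simp_all
    have disj: "?X \<inter> Y = {}"
    proof (rule equals0I)
      fix x assume x: "x \<in> ?X \<inter> Y"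
      have "Y \<subseteq> ?c ` Idx L P (Suc p) (n - 2)" by (simp add: Y_def)
      then obtain q i l w where "x = (q, i, l, Suc p # w)" using x by fast
      then have "Suc p # w \<in> words q p" using x by (simp add: Idx_def)
      then show False by (simp add: words_def)
    qed
    have "basis_mod s (Z n) (B n) (?X \<union> Y) (monomial \<chi> v)"
    proof (rule basis_mod_extension[OF ops_Z[OF O] ops_B[OF O] ops_B[OF O'] ops_BZ[OF O]
          graded_map_lin[OF g] graded_map_B[OF g] finX finY disj expands_basis[OF v']])
      fix x assume "x \<in> ?X"
      then obtain q i l w where x: "x = (q, i, l, w)" "q \<in> {1..P}" "i < 2" "l \<in> L i q" "w \<in> words q p"
        "n = i + 2 * length w"
        by (auto simp: Idx_def)
      note w = words_subset[OF x(5)]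
      have vv: "v q i l \<in> Z i" "\<iota> i (v q i l) - v' q i l \<in> B' i" using v x by auto
      show "monomial \<chi> v x \<in> Z n" using act_in[OF ops_mono[OF O] vv(1) w] x by simp
      show "\<iota> n (monomial \<chi> v x) - monomial \<chi>' v' x \<in> B' n"
        using act_morph[OF ops_mono[OF O] O' g vv(1) expands_gen[OF v' x(2,3,4)] vv(2) w] x by simp
    next
      fix y assume "y \<in> Y"
      then obtain q i l w where y: "y = (q, i, l, Suc p # w)" "(q, i, l, w) \<in> Idx L P (Suc p) (n - 2)"
          "\<not> n < 2"
        by (auto simp: Y_def split: if_splits)
      have n: "n = Suc (Suc (n - 2))" using y(3) by auto
      have n2: "i + 2 * length w = n - 2" using y(2) by (simp add: Idx_def)
      have a: "act \<chi> i w (v q i l) \<in> Z (n - 2)"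
        using basis_mod_in[OF less[of "n - 2"] y(2)] y(3) by simp
      show "monomial \<chi> v y \<in> Z n" using lin_on_in[OF ops_lin[OF O] a] n n2 y(1) by simp
      show "\<iota> n (monomial \<chi> v y) \<in> B' n" using \<iota>\<chi>[OF a] n n2 y(1) by simp
    next
      have sumY: "\<exists>\<nu>. (\<forall>x\<in>Idx L P (Suc p) m. \<nu> x = \<kappa> (?c x)) \<and> (\<Sum>y\<in>Y. s (\<kappa> y) (monomial \<chi> v y))
          = \<chi> (Suc p) m (\<Sum>x\<in>Idx L P (Suc p) m. s (\<nu> x) (monomial \<chi> v x))" if m: "n = Suc (Suc m)" for m \<kappa>
      proof (intro exI[of _ "\<lambda>x. \<kappa> (?c x)"] conjI ballI refl)
        have Y: "Y = ?c ` Idx L P (Suc p) m" using m by (simp add: Y_def)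
        have i: "inj_on ?c (Idx L P (Suc p) m)" by (auto simp: inj_on_def)
        have aZ: "monomial \<chi> v x \<in> Z m" if "x \<in> Idx L P (Suc p) m" for x
          using basis_mod_in[OF less[of m] that] m by simp
        have "(\<Sum>y\<in>Y. s (\<kappa> y) (monomial \<chi> v y)) = (\<Sum>x\<in>Idx L P (Suc p) m. s (\<kappa> (?c x)) (monomial \<chi> v (?c x)))"
          unfolding Y by (subst sum.reindex[OF i]) simp
        also have "\<dots> = (\<Sum>x\<in>Idx L P (Suc p) m. s (\<kappa> (?c x)) (\<chi> (Suc p) m (monomial \<chi> v x)))"
          by (rule sum.cong) (auto simp: Idx_def)
        also have "\<dots> = \<chi> (Suc p) m (\<Sum>x\<in>Idx L P (Suc p) m. s (\<kappa> (?c x)) (monomial \<chi> v x))"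
          by (rule lin_on_comb[OF ops_lin[OF O] ops_Z[OF O] aZ, symmetric]) auto
        finally show "(\<Sum>y\<in>Y. s (\<kappa> y) (monomial \<chi> v y))
            = \<chi> (Suc p) m (\<Sum>x\<in>Idx L P (Suc p) m. s (\<kappa> (?c x)) (monomial \<chi> v x))" .
      qed
      show "\<exists>\<kappa>. u - (\<Sum>y\<in>Y. s (\<kappa> y) (monomial \<chi> v y)) \<in> B n" if u: "u \<in> Z n" "\<iota> n u \<in> B' n" for u
      proof (cases "n < 2")
        case True
        then show ?thesis using ker0 u by (simp add: Y_def)
      next
        case False
        define m where "m = n - 2"
        have m: "n = Suc (Suc m)" using False by (simp add: m_def)
        obtain u1 where u1: "u1 \<in> Z m" "u - \<chi> (Suc p) m u1 \<in> B n" using ker u unfolding m by blast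
        have bm: "basis_mod s (Z m) (B m) (Idx L P (Suc p) m) (monomial \<chi> v)" using less m by simp
        obtain \<kappa> where \<kappa>: "u1 - (\<Sum>x\<in>Idx L P (Suc p) m. s (\<kappa> x) (monomial \<chi> v x)) \<in> B m"
          using basis_mod_span[OF bm u1(1)] by blast
        let ?k = "\<lambda>(q, i, l, w). \<kappa> (q, i, l, tl w)"
        obtain \<nu> where \<nu>: "\<And>x. x \<in> Idx L P (Suc p) m \<Longrightarrow> \<nu> x = ?k (?c x)"
          "(\<Sum>y\<in>Y. s (?k y) (monomial \<chi> v y)) = \<chi> (Suc p) m (\<Sum>x\<in>Idx L P (Suc p) m. s (\<nu> x) (monomial \<chi> v x))"
          using sumY[OF m, of ?k] by blast
        have "(\<Sum>x\<in>Idx L P (Suc p) m. s (\<nu> x) (monomial \<chi> v x)) = (\<Sum>x\<in>Idx L P (Suc p) m. s (\<kappa> x) (monomial \<chi> v x))"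
          (is "_ = ?S") by (rule sum.cong) (auto simp: \<nu>)
        with \<nu>(2) have Y: "(\<Sum>y\<in>Y. s (?k y) (monomial \<chi> v y)) = \<chi> (Suc p) m ?S" by simp
        have "?S \<in> Z m"
          by (intro submodule_sum[OF ops_Z[OF O]] submodule_scale[OF ops_Z[OF O]] basis_mod_in[OF bm])
        then have "\<chi> (Suc p) m u1 - \<chi> (Suc p) m ?S \<in> B n"
          using ops_chi_B[OF O _ \<kappa>, of "Suc p"] lin_on_diff[OF ops_lin[OF O] ops_Z[OF O] u1(1)]
          by (simp add: m)
        from submodule_add[OF ops_B[OF O] u1(2) this] show ?thesis
          by (intro exI[of _ ?k]) (simp add: Y)
      qed
      show "\<kappa> y = 0" if sum: "(\<Sum>y\<in>Y. s (\<kappa> y) (monomial \<chi> v y)) \<in> B n" and y: "y \<in> Y" for \<kappa> y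
      proof -
        define m where "m = n - 2"
        have m: "n = Suc (Suc m)" using y by (auto simp: m_def Y_def split: if_splits)
        have bm: "basis_mod s (Z m) (B m) (Idx L P (Suc p) m) (monomial \<chi> v)" using less m by simp
        obtain \<nu> where \<nu>: "\<And>x. x \<in> Idx L P (Suc p) m \<Longrightarrow> \<nu> x = \<kappa> (?c x)"
          "(\<Sum>y\<in>Y. s (\<kappa> y) (monomial \<chi> v y)) = \<chi> (Suc p) m (\<Sum>x\<in>Idx L P (Suc p) m. s (\<nu> x) (monomial \<chi> v x))"
          using sumY[OF m, of \<kappa>] by blast
        have S: "(\<Sum>x\<in>Idx L P (Suc p) m. s (\<nu> x) (monomial \<chi> v x)) \<in> Z m"
          by (intro submodule_sum[OF ops_Z[OF O]] submodule_scale[OF ops_Z[OF O]] basis_mod_in[OF bm])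
        have "(\<Sum>y\<in>Y. s (\<kappa> y) (monomial \<chi> v y)) \<in> B (Suc (Suc m))" using sum unfolding m .
        then have "(\<Sum>x\<in>Idx L P (Suc p) m. s (\<nu> x) (monomial \<chi> v x)) \<in> B m"
          unfolding \<nu>(2) by (rule inj[OF S])
        then have 0: "\<nu> x = 0" if "x \<in> Idx L P (Suc p) m" for x
          using basis_mod_indep[OF bm, of \<nu> x] that by blast
        obtain x where "x \<in> Idx L P (Suc p) m" "y = ?c x" using y m by (auto simp: Y_def)
        then show ?thesis using 0[of x] \<nu>(1)[of x] by simp
      qed
    qed auto
    then show ?case by (simp only: X_Y)
  qed
  then show ?thesis using v unfolding expands_def by blast
qed

section \<open>Cohomology\<close>

lemma submodule_sc: "submodule sc X \<longleftrightarrow> vec.subspace X"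
  by (simp add: submodule_def module_sc)

context residue_ci
begin

lemma ops_sys:
  assumes "ci_lift f p J D T" "p \<le> c"
  shows "graded_ops sc (Zc \<rho> J D) (Bc \<rho> J D) (chi T) p"
  unfolding graded_ops_def submodule_sc
  using Bc_subset_Zc[OF assms] chi_in_Zc[OF assms] chi_in_Bc[OF assms]
  by (auto simp: Zc_subspace Bc_subspace semilinear_on_def chi_add chi_sc)

text \<open>Comparison maps in both directions induce inverse isomorphisms on cohomology.\<close>

lemma expands_compare:
  assumes S: "ci_lift f p J D T" and S': "ci_lift f p J' D' T'" and p: "p \<le> c"
    and ex: "exact_mod f p J D" and ex': "exact_mod f p J' D'"
    and a: "Lin (J 0) (J' 0) a" "\<And>x. \<exists>y\<in>fr (J' 1). a (D 0 x) - D' 0 y \<in> iv f p"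
    and b: "Lin (J' 0) (J 0) b" "\<And>x. \<exists>y\<in>fr (J 1). b (D' 0 x) - D 0 y \<in> iv f p"
    and ba: "\<And>x. x \<in> fr (J 0) \<Longrightarrow> \<exists>y\<in>fr (J 1). b (a x) - x - D 0 y \<in> iv f p"
    and ab: "\<And>x. x \<in> fr (J' 0) \<Longrightarrow> \<exists>y\<in>fr (J' 1). a (b x) - x - D' 0 y \<in> iv f p"
    and v: "expands sc (Zc \<rho> J D) (Bc \<rho> J D) (chi T) L P p v"
  shows "\<exists>v'. expands sc (Zc \<rho> J' D') (Bc \<rho> J' D') (chi T') L P p v'"
proof -
  obtain \<alpha> where \<alpha>: "\<alpha> 0 = a" "\<And>n. Lin (J n) (J' n) (\<alpha> n)"
    "\<And>n x. \<alpha> n (D n x) - D' n (\<alpha> (Suc n) x) \<in> iv f p"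
    using comparison_map[OF S S' ex' a] by metis
  obtain \<beta> where \<beta>: "\<beta> 0 = b" "\<And>n. Lin (J' n) (J n) (\<beta> n)"
    "\<And>n x. \<beta> n (D' n x) - D n (\<beta> (Suc n) x) \<in> iv f p"
    using comparison_map[OF S' S ex b] by metis
  have ba': "(\<lambda>x. u (\<beta> n (\<alpha> n x))) - u \<in> Bc \<rho> J D n" if "u \<in> Zc \<rho> J D n" for u n
  proof (rule pullback_homotopic_id[OF S ex p _ _ _ that, where \<gamma> = "\<lambda>n x. \<beta> n (\<alpha> n x)"])
    show "Lin (J n) (J n) (\<lambda>x. \<beta> n (\<alpha> n x))" for n by (rule Lin_comp[OF \<alpha>(2) \<beta>(2)])
    show "\<beta> n (\<alpha> n (D n x)) - D n (\<beta> (Suc n) (\<alpha> (Suc n) x)) \<in> iv f p" for n x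
      using iv_add[OF Lin_iv'[OF \<beta>(2)[of n] ci_lift_finite[OF S'] \<alpha>(3)[of n x]] \<beta>(3)[of n "\<alpha> (Suc n) x"]]
      by (simp add: Lin_diff[OF \<beta>(2)])
  qed (use ba in \<open>simp add: \<alpha> \<beta>\<close>)
  have ab': "(\<lambda>x. u (\<alpha> n (\<beta> n x))) - u \<in> Bc \<rho> J' D' n" if "u \<in> Zc \<rho> J' D' n" for u n
  proof (rule pullback_homotopic_id[OF S' ex' p _ _ _ that, where \<gamma> = "\<lambda>n x. \<alpha> n (\<beta> n x)"])
    show "Lin (J' n) (J' n) (\<lambda>x. \<alpha> n (\<beta> n x))" for n by (rule Lin_comp[OF \<beta>(2) \<alpha>(2)])
    show "\<alpha> n (\<beta> n (D' n x)) - D' n (\<alpha> (Suc n) (\<beta> (Suc n) x)) \<in> iv f p" for n x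
      using iv_add[OF Lin_iv'[OF \<alpha>(2)[of n] ci_lift_finite[OF S] \<beta>(3)[of n x]] \<alpha>(3)[of n "\<beta> (Suc n) x"]]
      by (simp add: Lin_diff[OF \<alpha>(2)])
  qed (use ab in \<open>simp add: \<alpha> \<beta>\<close>)
  let ?g = "\<lambda>n u x. u (\<beta> n x)"
  have gm: "graded_map sc (Zc \<rho> J D) (Bc \<rho> J D) (chi T) sc (Zc \<rho> J' D') (Bc \<rho> J' D') (chi T') p ?g"
    unfolding graded_map_def
  proof (intro allI conjI ballI)
    fix n
    show "lin_on sc (Zc \<rho> J D n) sc (Zc \<rho> J' D' n) (\<lambda>u x. u (\<beta> n x))"
      using pullback_Zc[OF S p \<beta>(2,3)] by (auto simp: semilinear_on_def)
    show "(\<lambda>u x. u (\<beta> n x)) ` Bc \<rho> J D n \<subseteq> Bc \<rho> J' D' n"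
      using pullback_Bc[OF S p \<beta>(2,3)] by auto
    fix j u assume j: "j \<in> {1..p}" and u: "u \<in> Zc \<rho> J D n"
    show "(\<lambda>x. chi T j n u (\<beta> (Suc (Suc n)) x)) - chi T' j n (\<lambda>x. u (\<beta> n x)) \<in> Bc \<rho> J' D' (Suc (Suc n))"
      using vec.subspace_neg[OF Bc_subspace chi_natural[OF S' S p j \<beta>(2,3) u]] by simp
  qed
  have "expands sc (Zc \<rho> J' D') (Bc \<rho> J' D') (chi T') L P p (\<lambda>q i l. ?g i (v q i l))"
  proof (rule expands_transfer[OF ops_sys[OF S p] ops_sys[OF S' p] gm _ _ v])
    fix n u assume u: "u \<in> Zc \<rho> J D n" "(\<lambda>x. u (\<beta> n x)) \<in> Bc \<rho> J' D' n"
    from pullback_Bc[OF S' p \<alpha>(2,3) this(2)]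
    show "u \<in> Bc \<rho> J D n"
      using vec.subspace_diff[OF Bc_subspace _ ba'[OF u(1)]] by fastforce
  next
    fix n z assume z: "z \<in> Zc \<rho> J' D' n"
    show "\<exists>u\<in>Zc \<rho> J D n. z - (\<lambda>x. u (\<beta> n x)) \<in> Bc \<rho> J' D' n"
      by (rule bexI[OF _ pullback_Zc[OF S' p \<alpha>(2,3) z]])
        (use vec.subspace_neg[OF Bc_subspace ab'[OF z]] in simp)
  qed
  then show ?thesis by blast
qed

end

section \<open>Noetherian rings: finitely generated submodules and resolutions\<close>

text \<open>Induction on the number of coordinates: the values of one coordinate form a finitely generated
  ideal, and the vectors on which it vanishes have one coordinate less.\<close>

lemma noetherian_submodule:
  fixes U :: "('i \<Rightarrow> 'a::comm_ring_1) set"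
  assumes noeth: "noetherian TYPE('a)" and "finite K" "vec.subspace U" "U \<subseteq> fr K"
  shows "\<exists>X. finite X \<and> X \<subseteq> U \<and> U \<subseteq> vec.span X"
  using assms(2-)
proof (induction K arbitrary: U rule: finite_induct)
  case empty
  have "U \<subseteq> {0}" using empty.prems(2) by (auto simp: fr_def fun_eq_iff)
  then have "U \<subseteq> vec.span {}" by (simp only: vec.span_empty)
  then show ?case by blast
next
  case (insert k K)
  note U = insert.prems(1)
  have "is_ideal ((\<lambda>x. x k) ` U)"
    unfolding is_ideal_def submodule_def
  proof (intro conjI ring_module.module_axioms)
    show "ring_module.subspace ((\<lambda>x. x k) ` U)"
      unfolding ring_module.subspace_def
    proof (intro conjI ballI allI)
      show "0 \<in> (\<lambda>x. x k) ` U" using vec.subspace_0[OF U] by (intro image_eqI[of _ _ 0]) auto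
      fix a b assume "a \<in> (\<lambda>x. x k) ` U" "b \<in> (\<lambda>x. x k) ` U"
      then obtain x y where "x \<in> U" "y \<in> U" "a = x k" "b = y k" by auto
      then show "a + b \<in> (\<lambda>x. x k) ` U"
        using vec.subspace_add[OF U] by (intro image_eqI[of _ _ "x + y"]) auto
    next
      fix r a assume "a \<in> (\<lambda>x. x k) ` U"
      then obtain x where "x \<in> U" "a = x k" by auto
      then show "r * a \<in> (\<lambda>x. x k) ` U"
        using vec.subspace_scale[OF U] by (intro image_eqI[of _ _ "sc r x"]) auto
    qed
  qed
  then obtain B where B: "finite B" "ring_module.span B = (\<lambda>x. x k) ` U"
    using noeth unfolding noetherian_def by blast
  have "B \<subseteq> (\<lambda>x. x k) ` U" using ring_module.span_superset[of B] B by auto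
  then obtain X1 where X1: "finite X1" "X1 \<subseteq> U" "B = (\<lambda>x. x k) ` X1"
    using finite_subset_image[OF B(1)] by metis
  let ?U = "{x \<in> U. x k = 0}"
  have U0: "vec.subspace ?U" using U unfolding vec.subspace_def by simp
  have U1: "?U \<subseteq> fr K" using insert.prems(2) by (auto simp: fr_def)
  obtain X2 where X2: "finite X2" "X2 \<subseteq> ?U" "?U \<subseteq> vec.span X2"
    using insert.IH[OF U0 U1] by (elim exE conjE) (rule that)
  have "x \<in> vec.span (X1 \<union> X2)" if x: "x \<in> U" for x
  proof -
    have "x k \<in> ring_module.span ((\<lambda>x. x k) ` X1)" using x B X1 by auto
    also have "ring_module.span ((\<lambda>x. x k) ` X1) \<subseteq> (\<lambda>x. x k) ` vec.span X1"
    proof (rule ring_module.span_minimal)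
      show "(\<lambda>x. x k) ` X1 \<subseteq> (\<lambda>x. x k) ` vec.span X1" using vec.span_superset by blast
      show "ring_module.subspace ((\<lambda>x. x k) ` vec.span X1)"
        unfolding ring_module.subspace_def
      proof (intro conjI ballI allI)
        show "0 \<in> (\<lambda>x. x k) ` vec.span X1" using vec.span_zero[of X1] by (intro image_eqI[of _ _ 0]) auto
        fix a b assume "a \<in> (\<lambda>x. x k) ` vec.span X1" "b \<in> (\<lambda>x. x k) ` vec.span X1"
        then obtain x y where "x \<in> vec.span X1" "y \<in> vec.span X1" "a = x k" "b = y k" by auto
        then show "a + b \<in> (\<lambda>x. x k) ` vec.span X1"
          using vec.span_add by (intro image_eqI[of _ _ "x + y"]) auto
      next
        fix r a assume "a \<in> (\<lambda>x. x k) ` vec.span X1"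
        then obtain x where "x \<in> vec.span X1" "a = x k" by auto
        then show "r * a \<in> (\<lambda>x. x k) ` vec.span X1"
          using vec.span_scale by (intro image_eqI[of _ _ "sc r x"]) auto
      qed
    qed
    finally obtain y where y: "y \<in> vec.span X1" "x k = y k" by auto
    have "y \<in> U" using vec.span_minimal[OF X1(2) U] y by auto
    then have "x - y \<in> ?U" using vec.subspace_diff[OF U x] y by simp
    then have "x - y \<in> vec.span (X1 \<union> X2)" using X2(3) vec.span_mono[of X2 "X1 \<union> X2"] by auto
    moreover have "y \<in> vec.span (X1 \<union> X2)" using y vec.span_mono[of X1 "X1 \<union> X2"] by auto
    ultimately have "x - y + y \<in> vec.span (X1 \<union> X2)" by (rule vec.span_add)
    then show ?thesis by simp
  qed
  then have "U \<subseteq> vec.span (X1 \<union> X2)" by blast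
  moreover have "finite (X1 \<union> X2)" "X1 \<union> X2 \<subseteq> U" using X1 X2 by auto
  ultimately show ?case by blast
qed

lemma noetherian_cover:
  fixes U :: "('i \<Rightarrow> 'a::comm_ring_1) set"
  assumes noeth: "noetherian TYPE('a)" and "finite K" "vec.subspace U" "U \<subseteq> fr K"
  shows "\<exists>(K' :: nat set) g. finite K' \<and> Lin K' K g \<and> range g \<subseteq> U \<and> U \<subseteq> g ` fr K'"
proof -
  obtain X where X: "finite X" "X \<subseteq> U" "U \<subseteq> vec.span X"
    using noetherian_submodule[OF assms] by blast
  obtain e where e: "bij_betw e {..<card X} X"
    using ex_bij_betw_nat_finite[OF X(1)] by (auto simp: atLeast0LessThan)
  let ?g = "lin_ext {..<card X} e"
  have eX: "e j \<in> X" if "j < card X" for j using e that by (auto simp: bij_betw_def)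
  show ?thesis
  proof (intro exI conjI subsetI)
    show "Lin {..<card X} K ?g" using eX X(2) assms(4) by (intro Lin_lin_ext) auto
    fix x assume "x \<in> range ?g"
    then show "x \<in> U" unfolding lin_ext_def
      using eX X(2) by (auto intro!: vec.subspace_sum[OF assms(3)] vec.subspace_scale[OF assms(3)])
  next
    fix x assume "x \<in> U"
    then obtain a where a: "x = (\<Sum>v\<in>X. sc (a v) v)" using X vec.span_finite[OF X(1)] by auto
    have "x = ?g (tr {..<card X} (\<lambda>j. a (e j)))"
      unfolding a lin_ext_def by (subst sum.reindex_bij_betw[OF e, symmetric]) (simp add: tr_def)
    then show "x \<in> ?g ` fr {..<card X}" by (metis tr_fr imageI)
  qed simp
qed

text \<open>Starting from any first map, every further module covers the kernel modulo \<open>I\<^sub>p\<close> of the preceding map.\<close>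

lemma resolution_exists:
  fixes K0 K1 :: "nat set" and g0 :: "(nat \<Rightarrow> 'a::comm_ring_1) \<Rightarrow> nat \<Rightarrow> 'a"
  assumes noeth: "noetherian TYPE('a)" and fin: "finite K0" "finite K1" and g0: "Lin K1 K0 g0"
  obtains J D T where "ci_lift f p J D T" "exact_mod f p J D" "J 0 = K0" "J 1 = K1" "D 0 = g0"
proof -
  define P :: "nat \<Rightarrow> nat set \<times> nat set \<times> ((nat \<Rightarrow> 'a) \<Rightarrow> nat \<Rightarrow> 'a) \<Rightarrow> bool"
    where "P n = (\<lambda>(A, B, g). finite A \<and> finite B \<and> Lin A B g \<and> (n = 0 \<longrightarrow> A = K1 \<and> B = K0 \<and> g = g0))" for n
  define Q :: "nat \<Rightarrow> nat set \<times> nat set \<times> ((nat \<Rightarrow> 'a) \<Rightarrow> nat \<Rightarrow> 'a) \<Rightarrow> nat set \<times> nat set \<times> ((nat \<Rightarrow> 'a) \<Rightarrow> nat \<Rightarrow> 'a) \<Rightarrow> bool"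
    where "Q n = (\<lambda>(A, B, g) (A', B', g'). B' = A \<and> (\<forall>y. g (g' y) \<in> iv f p) \<and>
       (\<forall>x\<in>fr A. g x \<in> iv f p \<longrightarrow> (\<exists>y\<in>fr A'. x - g' y \<in> iv f p)))" for n
  have "\<exists>s. \<forall>n. P n (s n) \<and> Q n (s n) (s (Suc n))"
  proof (rule dependent_nat_choice)
    show "\<exists>s. P 0 s" using fin g0 by (intro exI[of _ "(K1, K0, g0)"]) (simp add: P_def)
    fix s n assume P: "P n s"
    obtain A B g where s: "s = (A, B, g)" by (cases s)
    have A: "finite A" "Lin A B g" using P by (auto simp: P_def s)
    let ?U = "{x \<in> fr A. g x \<in> iv f p}"
    have U: "vec.subspace ?U" unfolding vec.subspace_def
      by (simp add: Lin_zero[OF A(2)] Lin_add[OF A(2)] Lin_sc[OF A(2)] fr_add fr_sc iv_add iv_sc)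
    obtain K' g' where K': "finite (K' :: nat set)" "Lin K' A g'" "range g' \<subseteq> ?U" "?U \<subseteq> g' ` fr K'"
      using noetherian_cover[OF noeth A(1) U Collect_restrict] by blast
    have "\<exists>y\<in>fr K'. x - g' y \<in> iv f p" if "x \<in> ?U" for x
      using subsetD[OF K'(4) that] by force
    then have "Q n s (K', A, g')" using K'(3) by (auto simp: Q_def s)
    moreover have "P (Suc n) (K', A, g')" using K' A by (simp add: P_def)
    ultimately show "\<exists>s'. P (Suc n) s' \<and> Q n s s'" by blast
  qed
  then obtain s where s: "\<And>n. P n (s n)" "\<And>n. Q n (s n) (s (Suc n))" by auto
  define J where "J n = fst (snd (s n))" for n
  define D where "D n = snd (snd (s n))" for n
  have JS: "J (Suc n) = fst (s n)" for n
    using s(2)[of n] by (auto simp: Q_def J_def split: prod.splits)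
  have J: "finite (J n)" for n using s(1)[of n] by (auto simp: P_def J_def split: prod.splits)
  have D: "Lin (J (Suc n)) (J n) (D n)" for n
    using s(1)[of n] unfolding JS by (auto simp: P_def J_def D_def split: prod.splits)
  have DD: "D n (D (Suc n) x) \<in> iv f p" for n x
    using s(2)[of n] by (auto simp: Q_def D_def split: prod.splits)
  have "\<exists>T. (\<forall>j. Lin (J (Suc (Suc n))) (J n) (T j)) \<and> (\<forall>x. D n (D (Suc n) x) = (\<Sum>j=1..p. sc (f j) (T j x)))" for n
    using Lin_decompose[OF J Lin_comp[OF D D] DD] by metis
  then obtain T where T: "\<And>n j. Lin (J (Suc (Suc n))) (J n) (T n j)"
    "\<And>n x. D n (D (Suc n) x) = (\<Sum>j=1..p. sc (f j) (T n j x))" by metis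
  show thesis
  proof (rule that[of J D "\<lambda>j n. T n j"])
    show "ci_lift f p J D (\<lambda>j n. T n j)" using J D T by (simp add: ci_lift_def)
    show "exact_mod f p J D" unfolding exact_mod_def
    proof
      fix n
      obtain A B g A' B' g' where "s n = (A, B, g)" "s (Suc n) = (A', B', g')"
        by (metis prod_cases3)
      then show "\<forall>x\<in>fr (J (Suc n)). D n x \<in> iv f p \<longrightarrow>
          (\<exists>y\<in>fr (J (Suc (Suc n))). x - D (Suc n) y \<in> iv f p)"
        using s(2)[of n] by (simp add: Q_def JS D_def)
    qed
    show "J 0 = K0" "J 1 = K1" "D 0 = g0"
      using s(1)[of 0] JS[of 0] by (auto simp: P_def J_def D_def split: prod.splits)
  qed
qed

section \<open>Minimal higher matrix factorizations in coordinates\<close>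

text \<open>The modules \<open>A\<^sub>i(p)\<close> are free on nested sets \<open>N i p\<close>, so that \<open>B\<^sub>i(p)\<close> is free on the difference of
  two successive ones.  Minimality is stated through \<open>\<rho>\<close>, whose kernel is the maximal ideal.\<close>

locale hmf_coords = residue_ci \<rho> f c
  for \<rho> :: "'a::comm_ring_1 \<Rightarrow> 'k::field" and f :: "nat \<Rightarrow> 'a" and c :: nat +
  fixes N :: "nat \<Rightarrow> nat \<Rightarrow> nat set" and d :: "(nat \<Rightarrow> 'a) \<Rightarrow> nat \<Rightarrow> 'a"
    and h :: "nat \<Rightarrow> (nat \<Rightarrow> 'a) \<Rightarrow> nat \<Rightarrow> 'a"
  assumes noeth: "noetherian TYPE('a)"
    and N_finite: "finite (N i p)" and N_0: "N i 0 = {}" and N_mono: "p \<le> q \<Longrightarrow> N i p \<subseteq> N i q"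
    and d_lin: "Lin (N 1 c) (N 0 c) d"
    and d_filt: "p \<le> c \<Longrightarrow> x \<in> fr (N 1 p) \<Longrightarrow> d x \<in> fr (N 0 p)"
    and h_lin: "p \<in> {1..c} \<Longrightarrow> Lin (N 0 p) (N 1 p) (h p)"
    and dh: "p \<in> {1..c} \<Longrightarrow> x \<in> fr (N 0 p) \<Longrightarrow> d (h p x) - sc (f p) x \<in> iv f (p - 1)"
    and hd: "p \<in> {1..c} \<Longrightarrow> x \<in> fr (N 1 p) \<Longrightarrow> k \<in> N 1 p - N 1 (p - 1) \<Longrightarrow>
       (h p (d x) - sc (f p) x) k \<in> gen_ideal f (p - 1)"
    and d_min: "\<rho> (d x k) = 0" and h_min: "p \<in> {1..c} \<Longrightarrow> \<rho> (h p x k) = 0"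
begin

definition L :: "nat \<Rightarrow> nat \<Rightarrow> nat set" where
  "L i p = N i p - N i (p - 1)"

lemma L_finite: "finite (L i p)" by (simp add: L_def N_finite)

text \<open>The map \<open>d\<^sub>p : A\<^sub>1(p) \<rightarrow> A\<^sub>0(p)\<close>.\<close>

definition dp :: "nat \<Rightarrow> (nat \<Rightarrow> 'a) \<Rightarrow> nat \<Rightarrow> 'a" where
  "dp p x = d (tr (N 1 p) x)"

lemma dp_lin: assumes "p \<le> c" shows "Lin (N 1 p) (N 0 p) (dp p)"
proof -
  have L: "Lin (N 1 p) (N 0 c) (dp p)"
    unfolding dp_def by (rule Lin_restrict[OF d_lin N_mono[OF assms]])
  show ?thesis
  proof (rule LinI)
    show "dp p x \<in> fr (N 0 p)" for x unfolding dp_def by (rule d_filt[OF assms tr_fr])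
  qed (use L in \<open>simp_all add: Lin_def\<close>)
qed

lemma dp_id: "x \<in> fr (N 1 p) \<Longrightarrow> dp p x = d x"
  by (simp add: dp_def tr_id)

lemma dp_min: "\<rho> (dp p x k) = 0"
  by (simp add: dp_def d_min)

lemma dp_mono: "p \<le> q \<Longrightarrow> dp q (tr (N 1 p) x) = dp p x"
  using N_mono[of p q 1] by (simp add: dp_def tr_tr inf_absorb2)

lemma regular_iv:
  assumes "q \<in> {1..c}" "sc (f q) x \<in> iv f (q - 1)" shows "x \<in> iv f (q - 1)"
  using assms regular[OF assms(1)] by (auto simp: iv_def)

text \<open>Apply \<open>\<pi>\<^sub>p h\<^sub>p\<close> to \<open>d x\<close>: the result is \<open>f\<^sub>p \<pi>\<^sub>p x\<close> modulo \<open>I\<^sub>p\<^sub>-\<^sub>1\<close>, so \<open>f\<^sub>p\<close> kills \<open>\<pi>\<^sub>p x\<close>, and \<open>f\<^sub>p\<close> is regular, modulo \<open>I\<^sub>p\<^sub>-\<^sub>1\<close>.\<close>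

lemma kernel_d:
  assumes p: "p \<in> {1..c}" and x: "x \<in> fr (N 1 p)" "d x \<in> iv f (p - 1)" and k: "k \<notin> N 1 (p - 1)"
  shows "x k \<in> gen_ideal f (p - 1)"
proof (cases "k \<in> N 1 p")
  case True
  then have "(h p (d x) - sc (f p) x) k \<in> gen_ideal f (p - 1)" using hd[OF p x(1)] k by blast
  moreover have "h p (d x) k \<in> gen_ideal f (p - 1)"
    using Lin_iv'[OF h_lin[OF p] N_finite x(2)] by (simp add: iv_def)
  ultimately have "f p * x k \<in> gen_ideal f (p - 1)"
    using gi_diff[of "h p (d x) k" f "p - 1" "(h p (d x) - sc (f p) x) k"] by simp
  then show ?thesis by (rule regular[OF p])
next
  case False
  then show ?thesis using x(1) by (simp add: fr_def)
qed

text \<open>Over \<open>S/I\<^sub>p\<close> the presentation \<open>d\<^sub>p\<close> is minimal also in the sense that its kernel lies in the maximal ideal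
  times \<open>A\<^sub>1(p)\<close>.  Modify \<open>x\<close> by an element of \<open>im h\<^sub>p\<close>, which has coordinates in the maximal ideal, such
  that \<open>d x\<close> loses its \<open>f\<^sub>p\<close>-component; by \<open>kernel_d\<close> the rest comes from \<open>A\<^sub>1(p-1)\<close>.\<close>

lemma syzygy_minimal:
  assumes "p \<le> c" "x \<in> fr (N 1 p)" "d x \<in> iv f p"
  shows "\<rho> (x k) = 0"
  using assms
proof (induction p arbitrary: x)
  case 0
  then show ?case by (simp add: fr_def N_0)
next
  case (Suc p)
  let ?q = "Suc p"
  have q: "?q \<in> {1..c}" using Suc.prems by auto
  note dl = d_lin
  obtain a where a: "\<And>j. a j \<in> fr (N 0 ?q)" "d x = (\<Sum>j=1..?q. sc (f j) (a j))"
    using iv_decompose[OF Suc.prems(3) d_filt[OF Suc.prems(1,2)]] by metis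
  define y where "y = x - h ?q (a ?q)"
  have y: "y \<in> fr (N 1 ?q)" unfolding y_def by (intro fr_diff Suc.prems Lin_fr[OF h_lin[OF q]])
  have "d y = (\<Sum>j=1..p. sc (f j) (a j)) - (d (h ?q (a ?q)) - sc (f ?q) (a ?q))"
    by (simp add: y_def Lin_diff[OF dl] a(2))
  also have "\<dots> \<in> iv f p" using iv_diff[OF iv_gens dh[OF q a(1)]] by simp
  finally have dy: "d y \<in> iv f p" .
  let ?z = "tr (N 1 p) y"
  have yz: "y - ?z \<in> iv f p"
    using kernel_d[OF q y] dy by (auto simp: iv_def tr_def)
  have "d (y - ?z) \<in> iv f p" by (rule Lin_iv'[OF dl N_finite yz])
  from iv_diff[OF dy this] have "d ?z \<in> iv f p" by (simp add: Lin_diff[OF dl])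
  then have "\<rho> (?z k) = 0" using Suc.IH[of ?z] Suc.prems(1) by simp
  moreover have "\<rho> ((y - ?z) k) = 0"
    by (rule rho_gen_ideal[of _ p]) (use yz Suc.prems(1) in \<open>auto simp: iv_def\<close>)
  moreover have "x k = ?z k + (y - ?z) k + h ?q (a ?q) k" by (simp add: y_def)
  ultimately show ?case by (simp only: rho_add h_min[OF q]) simp
qed

definition coord :: "nat \<Rightarrow> (nat \<Rightarrow> 'a) \<Rightarrow> 'k" where
  "coord l x = \<rho> (x l)"

lemma coord_Hm: "l \<in> K \<Longrightarrow> coord l \<in> Hm \<rho> K"
  by (rule HmI) (simp_all add: coord_def rho_add rho_mult tr_def)

lemma coord_unit: "coord l (unit_vec k) = (if l = k then 1 else 0)"
  by (simp add: coord_def unit_vec_def)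

text \<open>A differential that vanishes modulo the maximal ideal has no coboundaries with values in \<open>k\<close>.\<close>

lemma Bc_low:
  assumes "finite (J 0)" "\<And>x k. \<rho> (D 0 x k) = 0" "n < 2"
  shows "Bc \<rho> J D n = {0}"
proof (cases n)
  case (Suc m)
  then have n: "n = Suc 0" using assms(3) by simp
  have "w (D 0 x) = 0" if "w \<in> Hm \<rho> (J 0)" for w x
    by (rule Hm_vanish[OF that assms(1,2)])
  then have "Bc \<rho> J D n \<subseteq> {0}" by (auto simp: n Bc_Suc)
  then show ?thesis using vec.subspace_0[OF Bc_subspace, of \<rho> J D n] by auto
qed (simp add: Bc_0)

text \<open>The complex starts with \<open>d\<^sub>p : A\<^sub>1(p) \<rightarrow> A\<^sub>0(p)\<close> itself, so that its modules in degrees 0 and 1 can be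
  exchanged for those of \<open>A(p+1)\<close>.\<close>

definition adapted :: "nat \<Rightarrow> (nat \<Rightarrow> nat set) \<Rightarrow> (nat \<Rightarrow> (nat \<Rightarrow> 'a) \<Rightarrow> nat \<Rightarrow> 'a) \<Rightarrow> bool" where
  "adapted p J D \<longleftrightarrow> J 0 = N 0 p \<and> J 1 = N 1 p \<and> D 0 = dp p"

abbreviation "expanded J D T P p v \<equiv>
  expands sc (Zc \<rho> J D) (Bc \<rho> J D) (chi T) L P p v"

lemma words_empty: "words (Suc p) p = {[]}"
  by (auto simp: words_def)

text \<open>Replace \<open>A\<^sub>1(p) \<rightarrow> A\<^sub>0(p)\<close> by \<open>A\<^sub>1(p+1) \<rightarrow> A\<^sub>0(p+1)\<close>.  By \<open>kernel_d\<close> no new cycles arise in degree 1.  On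
  cochains, restriction to the old complex is onto, with kernel \<open>Hom(\<B>(p+1), k)\<close> in degrees 0 and 1; all
  coboundaries in these degrees vanish by minimality.\<close>

lemma box:
  fixes J :: "nat \<Rightarrow> nat set"
  assumes p: "p < c" and S: "ci_lift f p J D T" and ex: "exact_mod f p J D" and ad: "adapted p J D"
    and v: "expanded J D T p p v"
  obtains J' D' v' where "ci_lift f p J' D' T" "exact_mod f p J' D'" "adapted (Suc p) J' D'"
    "expanded J' D' T (Suc p) p v'"
proof -
  let ?q = "Suc p"
  have q: "?q \<in> {1..c}" "?q \<le> c" and pc: "p \<le> c" using p by auto
  define J' where "J' n = (if n < 2 then N n ?q else J n)" for n
  define D' where "D' n = (case n of 0 \<Rightarrow> dp ?q | Suc m \<Rightarrow> D n)" for n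
  have J01: "J 0 = N 0 p" "J (Suc 0) = N 1 p" and D0: "D 0 = dp p" using ad by (auto simp: adapted_def)
  have J'01: "J' 0 = N 0 ?q" "J' (Suc 0) = N 1 ?q" and J'2: "J' (Suc (Suc n)) = J (Suc (Suc n))"
    and D'0: "D' 0 = dp ?q" and D'S: "D' (Suc n) = D (Suc n)" for n
    by (simp_all add: J'_def D'_def)
  have sub: "J n \<subseteq> J' n" for n
    using N_mono[of p ?q] J01 by (cases n; cases "n - 1") (auto simp: J'_def)
  have fin: "finite (J' n)" for n using ci_lift_finite[OF S] by (simp add: J'_def N_finite)
  have D'D: "D' n (tr (J (Suc n)) x) = D n x" for n x
    using dp_mono[of p ?q x] by (cases n) (simp_all add: D'0 D'S D0 J01 Lin_tr[OF ci_lift_D[OF S]])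
  have D'D': "D' n (D (Suc n) x) = D n (D (Suc n) x)" for n x
    using D'D[of n "D (Suc n) x"] by (simp add: tr_id[OF Lin_fr[OF ci_lift_D[OF S]]])
  have linD': "Lin (J' (Suc n)) (J' n) (D' n)" for n
  proof (cases n)
    case 0
    then show ?thesis using dp_lin[OF q(2)] by (simp add: J'01 D'0)
  next
    case (Suc m)
    have "Lin (J (Suc n)) (J' n) (D n)" by (rule Lin_target[OF ci_lift_D[OF S] sub])
    then show ?thesis by (simp add: Suc J'2 D'S)
  qed
  have S': "ci_lift f p J' D' T" unfolding ci_lift_def
  proof (intro conjI allI fin linD')
    show "Lin (J' (Suc (Suc n))) (J' n) (T j n)" for j n
      unfolding J'2 by (rule Lin_target[OF ci_lift_T[OF S] sub])
    show "D' n (D' (Suc n) x) = (\<Sum>j=1..p. sc (f j) (T j n x))" for n x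
      by (simp add: D'S D'D' ci_lift_DD[OF S])
  qed
  have ex': "exact_mod f p J' D'" unfolding exact_mod_def
  proof (intro allI ballI impI)
    fix n x assume x: "x \<in> fr (J' (Suc n))" "D' n x \<in> iv f p"
    show "\<exists>y\<in>fr (J' (Suc (Suc n))). x - D' (Suc n) y \<in> iv f p"
    proof (cases n)
      case 0
      have x': "x \<in> fr (N 1 ?q)" using x 0 by (simp add: J'01)
      have dx: "d x \<in> iv f p" using x 0 by (simp add: D'0 dp_id[OF x'])
      let ?z = "tr (N 1 p) x"
      have xz: "x - ?z \<in> iv f p"
        using kernel_d[OF q(1) x'] dx by (auto simp: iv_def tr_def)
      have "d (x - ?z) \<in> iv f p" by (rule Lin_iv'[OF d_lin N_finite xz])
      from iv_diff[OF dx this] have "D 0 ?z \<in> iv f p"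
        by (simp add: Lin_diff[OF d_lin] D0 dp_id)
      then obtain y where y: "y \<in> fr (J (Suc (Suc 0)))" "?z - D (Suc 0) y \<in> iv f p"
        using exact_modD[OF ex, of ?z 0] by (auto simp: J01)
      from iv_add[OF xz y(2)] y(1) show ?thesis by (auto simp: 0 J'2 D'S)
    next
      case (Suc m)
      then show ?thesis using x exact_modD[OF ex, of x n] by (metis J'2 D'S)
    qed
  qed
  note O = ops_sys[OF S pc] and O' = ops_sys[OF S' pc]
  have B': "Bc \<rho> J' D' n = {0}" if "n < 2" for n
    by (rule Bc_low[OF fin]) (simp_all add: that D'0 dp_min)
  have B: "Bc \<rho> J D n = {0}" if "n < 2" for n
    by (rule Bc_low[OF ci_lift_finite[OF S]]) (simp_all add: that D0 dp_min)
  have ZZ': "u \<in> Zc \<rho> J' D' n" if u: "u \<in> Zc \<rho> J D n" for u n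
  proof (rule Zc_I)
    show uH: "u \<in> Hm \<rho> (J' n)" by (rule Hm_mono[OF Zc_Hm[OF u] sub])
    show "u (D' n x) = 0" for x
    proof (cases n)
      case 0
      then show ?thesis using Hm_vanish[OF uH fin, of "dp ?q x"] by (simp add: D'0 dp_min)
    qed (use Zc_D[OF u] in \<open>simp add: D'S\<close>)
  qed
  have Z'Z: "(\<lambda>x. u (tr (J n) x)) \<in> Zc \<rho> J D n" if u: "u \<in> Zc \<rho> J' D' n" for u n
  proof (rule Zc_I)
    show "(\<lambda>x. u (tr (J n) x)) \<in> Hm \<rho> (J n)"
      by (rule Hm_comp[OF Zc_Hm[OF u] Lin_target[OF Lin_trunc sub]])
    show "u (tr (J n) (D n x)) = 0" for x
      using Zc_D[OF u, of "tr (J (Suc n)) x"] by (simp add: tr_id[OF Lin_fr[OF ci_lift_D[OF S]]] D'D)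
  qed
  have coordZ: "coord l \<in> Zc \<rho> J' D' i" if "i < 2" "l \<in> L i ?q" for i l
  proof (rule Zc_I)
    have l: "l \<in> J' i" "l \<notin> J i" using that less_2_cases[OF that(1)] by (auto simp: L_def J'_def J01)
    show "coord l \<in> Hm \<rho> (J' i)" by (rule coord_Hm[OF l(1)])
    show "coord l (D' i x) = 0" for x
    proof (cases i)
      case (Suc m)
      then show ?thesis using l Lin_fr[OF ci_lift_D[OF S], of i x] by (simp add: D'S fr_def coord_def)
    qed (simp add: D'0 dp_min coord_def)
  qed
  define v' where "v' r i l = (if r \<le> p then v r i l else coord l)" for r i l
  have "expanded J' D' T ?q p v'"
    unfolding expands_def
  proof (intro conjI ballI allI impI)
    show "v' r i l \<in> Zc \<rho> J' D' i" if "r \<in> {1..?q}" "i < 2" "l \<in> L i r" for r i l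
      using that expands_gen[OF v, of r i l] ZZ' coordZ le_Suc_eq[of r p] by (auto simp: v'_def)
    fix n
    let ?X = "Idx L p p n" and ?m = "monomial (chi T) v'"
    define Y where "Y = (\<lambda>l. (?q, n, l, [] :: nat list)) ` (if n < 2 then L n ?q else {})"
    have XY: "Idx L ?q p n = ?X \<union> Y"
      by (auto simp: Idx_def Y_def le_Suc_eq words_empty)
    have mX: "?m x = monomial (chi T) v x" if "x \<in> ?X" for x
      using that by (auto simp: Idx_def v'_def)
    have sumY: "(\<Sum>y\<in>Y. sc (\<kappa> y) (?m y)) = (\<Sum>l\<in>(if n < 2 then L n ?q else {}). sc (\<kappa> (?q, n, l, [])) (coord l))" for \<kappa>
      unfolding Y_def by (subst sum.reindex) (auto simp: inj_on_def v'_def)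
    have "basis_mod sc (Zc \<rho> J' D' n) (Bc \<rho> J' D' n) (?X \<union> Y) ?m"
    proof (rule basis_mod_extension[OF ops_Z[OF O'] ops_B[OF O'] ops_B[OF O] ops_BZ[OF O'] _ _ _ _ _
          expands_basis[OF v], where g = "\<lambda>u x. u (tr (J n) x)"])
      show "lin_on sc (Zc \<rho> J' D' n) sc (Zc \<rho> J D n) (\<lambda>u x. u (tr (J n) x))"
        using Z'Z by (auto simp: semilinear_on_def)
      show "(\<lambda>x. u (tr (J n) x)) \<in> Bc \<rho> J D n" if u: "u \<in> Bc \<rho> J' D' n" for u
      proof (cases n)
        case 0
        then show ?thesis using u by (simp add: Bc_0 zero_fun_def)
      next
        case (Suc m)
        then obtain w where w: "w \<in> Hm \<rho> (J' m)" "u = (\<lambda>x. w (D' m x))" using u by (auto simp: Bc_Suc)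
        show ?thesis unfolding Suc
        proof (rule Bc_I)
          show "(\<lambda>x. w (tr (J m) x)) \<in> Hm \<rho> (J m)"
            by (rule Hm_comp[OF w(1) Lin_target[OF Lin_trunc sub]])
          show "u (tr (J (Suc m)) x) = w (tr (J m) (D m x))" for x
            by (simp add: w(2) D'D tr_id[OF Lin_fr[OF ci_lift_D[OF S]]])
        qed
      qed
      show "finite ?X" by (rule finite_Idx[OF L_finite])
      show "finite Y" by (simp add: Y_def L_finite)
      show "?X \<inter> Y = {}" by (auto simp: Idx_def Y_def)
      fix x assume x: "x \<in> ?X"
      have mZ: "?m x \<in> Zc \<rho> J D n" using basis_mod_in[OF expands_basis[OF v] x] mX[OF x] by simp
      then show "?m x \<in> Zc \<rho> J' D' n" by (rule ZZ')
      have "(\<lambda>z. ?m x (tr (J n) z)) = ?m x" using Hm_tr[OF Zc_Hm[OF mZ]] by blast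
      then show "(\<lambda>z. ?m x (tr (J n) z)) - monomial (chi T) v x \<in> Bc \<rho> J D n"
        using vec.subspace_0[OF Bc_subspace] by (simp only: mX[OF x]) simp
    next
      fix y assume "y \<in> Y"
      then obtain l where y: "y = (?q, n, l, [])" "n < 2" "l \<in> L n ?q" by (auto simp: Y_def split: if_splits)
      show "?m y \<in> Zc \<rho> J' D' n" using coordZ y by (simp add: v'_def)
      have "l \<notin> J n" using y less_2_cases[OF y(2)] by (auto simp: L_def J01)
      then have "(\<lambda>x. ?m y (tr (J n) x)) = 0" by (auto simp: y v'_def coord_def tr_def)
      then show "(\<lambda>x. ?m y (tr (J n) x)) \<in> Bc \<rho> J D n"
        using vec.subspace_0[OF Bc_subspace] by simp
    next
      fix u assume u: "u \<in> Zc \<rho> J' D' n" "(\<lambda>x. u (tr (J n) x)) \<in> Bc \<rho> J D n"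
      note uH = Zc_Hm[OF u(1)]
      show "\<exists>\<kappa>. u - (\<Sum>y\<in>Y. sc (\<kappa> y) (?m y)) \<in> Bc \<rho> J' D' n"
      proof (cases "n < 2")
        case True
        then have "(\<lambda>x. u (tr (J n) x)) = 0" using u(2) B by auto
        then have 0: "u (tr (J n) x) = 0" for x by (metis zero_fun_apply)
        have Jn: "J' n = L n ?q \<union> J n" "L n ?q \<inter> J n = {}"
          using less_2_cases[OF True] N_mono[of p ?q n] by (auto simp: L_def J'_def J01)
        have "u x = (\<Sum>l\<in>L n ?q. sc (u (unit_vec l)) (coord l)) x" for x
        proof -
          have "u (unit_vec k) = 0" if "k \<in> J n" for k
            using 0[of "unit_vec k"] by (simp add: tr_id unit_fr that)
          then have "(\<Sum>k\<in>J n. \<rho> (x k) * u (unit_vec k)) = 0" by simp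
          moreover have "u x = (\<Sum>k\<in>L n ?q \<union> J n. \<rho> (x k) * u (unit_vec k))"
            using Hm_expand[OF uH fin, of x] unfolding Jn(1) .
          ultimately have "u x = (\<Sum>l\<in>L n ?q. \<rho> (x l) * u (unit_vec l))"
            by (simp add: sum.union_disjoint[OF L_finite ci_lift_finite[OF S] Jn(2)])
          then show ?thesis by (simp add: sum_apply coord_def mult.commute)
        qed
        then have "u = (\<Sum>l\<in>L n ?q. sc (u (unit_vec l)) (coord l))" by blast
        then have "u - (\<Sum>y\<in>Y. sc ((\<lambda>(_, _, l, _). u (unit_vec l)) y) (?m y)) = 0"
          unfolding sumY using True by simp
        then have "u - (\<Sum>y\<in>Y. sc ((\<lambda>(_, _, l, _). u (unit_vec l)) y) (?m y)) \<in> Bc \<rho> J' D' n"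
          by (simp only: vec.subspace_0[OF Bc_subspace])
        then show ?thesis by (rule exI[where x = "\<lambda>(_, _, l, _). u (unit_vec l)"])
      next
        case False
        then obtain m where m: "n = Suc (Suc m)" by (metis add_2_eq_Suc le_Suc_ex not_less)
        have "(\<lambda>x. u (tr (J n) x)) = u" using Hm_tr[OF uH] by (auto simp: m J'2)
        then have "u \<in> Bc \<rho> J D n" using u(2) by simp
        then obtain w where w: "w \<in> Hm \<rho> (J (Suc m))" "u = (\<lambda>x. w (D (Suc m) x))"
          by (auto simp: m Bc_Suc)
        have "u \<in> Bc \<rho> J' D' n"
          unfolding m by (rule Bc_I[where w = w]) (simp_all add: w(2) D'S Hm_mono[OF w(1) sub])
        then show ?thesis unfolding sumY using False by simp
      qed
    next
      fix \<kappa> y assume sum: "(\<Sum>y\<in>Y. sc (\<kappa> y) (?m y)) \<in> Bc \<rho> J' D' n" and "y \<in> Y"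
      then obtain l where y: "y = (?q, n, l, [])" "n < 2" "l \<in> L n ?q" by (auto simp: Y_def split: if_splits)
      have "(\<Sum>l\<in>L n ?q. sc (\<kappa> (?q, n, l, [])) (coord l)) = 0"
        using sum B'[OF y(2)] unfolding sumY by (simp add: y(2))
      then have "(\<Sum>l\<in>L n ?q. sc (\<kappa> (?q, n, l, [])) (coord l)) (unit_vec l) = 0" by simp
      then show "\<kappa> y = 0"
        using y(1,3) by (simp add: sum_apply coord_unit L_finite if_distrib sum.delta cong: if_cong)
    qed
    then show "basis_mod sc (Zc \<rho> J' D' n) (Bc \<rho> J' D' n) (Idx L ?q p n) ?m" by (simp only: XY)
  qed
  then show thesis using that S' ex' by (simp add: adapted_def J'01 D'0)
qed

end

text \<open>Vectors over a disjoint union of index sets.\<close>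

lemma tr_zero: "tr K 0 = 0" by (auto simp: tr_def)

lemma case_sum_plus: "case_sum a b + case_sum a' b' = case_sum (a + a') (b + b')"
  and case_sum_minus: "case_sum a b - case_sum a' b' = case_sum (a - a') (b - b')"
  and case_sum_zero: "case_sum 0 0 = 0"
  by (auto simp: fun_eq_iff split: sum.split)

lemma case_sum_sc: "sc r (case_sum a b) = case_sum (sc r a) (sc r b)"
  by (auto simp: fun_eq_iff split: sum.split)

lemma case_sum_sum: "(\<Sum>j\<in>A. case_sum (a j) (b j)) = case_sum (\<Sum>j\<in>A. a j) (\<Sum>j\<in>A. b j)"
  by (auto simp: fun_eq_iff sum_apply split: sum.split)

lemma comp_plus: "(x + y) \<circ> g = (x \<circ> g) + (y \<circ> g)" by (auto simp: fun_eq_iff)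
lemma comp_sc: "sc r x \<circ> g = sc r (x \<circ> g)" by (auto simp: fun_eq_iff)

lemma case_sum_iv: "case_sum a b \<in> iv f p \<longleftrightarrow> a \<in> iv f p \<and> b \<in> iv f p"
  by (auto simp: iv_def split: sum.split)

lemma case_sum_fr: "case_sum a b \<in> fr (Inl ` K \<union> Inr ` M) \<longleftrightarrow> a \<in> fr K \<and> b \<in> fr M"
proof
  assume *: "case_sum a b \<in> fr (Inl ` K \<union> Inr ` M)"
  have "a i = 0" if "i \<notin> K" for i
  proof -
    have "Inl i \<notin> Inl ` K \<union> Inr ` M" using that by auto
    then have "case_sum a b (Inl i) = 0" using * unfolding fr_def by blast
    then show ?thesis by simp
  qed
  moreover have "b i = 0" if "i \<notin> M" for i
  proof -
    have "Inr i \<notin> Inl ` K \<union> Inr ` M" using that by auto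
    then have "case_sum a b (Inr i) = 0" using * unfolding fr_def by blast
    then show ?thesis by simp
  qed
  ultimately show "a \<in> fr K \<and> b \<in> fr M" by (simp add: fr_def)
next
  assume "a \<in> fr K \<and> b \<in> fr M"
  then show "case_sum a b \<in> fr (Inl ` K \<union> Inr ` M)"
    by (force simp: fr_def split: sum.split)
qed

lemma sum_split: "case_sum (z \<circ> Inl) (z \<circ> Inr) = z"
  by (auto simp: fun_eq_iff split: sum.split)

lemma fr_Inl: "z \<in> fr (Inl ` K \<union> Inr ` M) \<Longrightarrow> z \<circ> Inl \<in> fr K"
  and fr_Inr: "z \<in> fr (Inl ` K \<union> Inr ` M) \<Longrightarrow> z \<circ> Inr \<in> fr M"
  using case_sum_fr[of "z \<circ> Inl" "z \<circ> Inr" K M] by (simp_all add: sum_split)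

lemma tr_Inl: "tr (Inl ` K \<union> Inr ` M) z \<circ> Inl = tr K (z \<circ> Inl)"
  and tr_Inr: "tr (Inl ` K \<union> Inr ` M) z \<circ> Inr = tr M (z \<circ> Inr)"
  by (auto simp: tr_def fun_eq_iff)

lemma tr_case_sum: "tr (Inl ` K \<union> Inr ` M) (case_sum a b) = case_sum (tr K a) (tr M b)"
  by (auto simp: tr_def fun_eq_iff split: sum.split)

lemma Lin_Inl: "Lin K P g \<Longrightarrow> Lin (Inl ` K \<union> Inr ` M) P (\<lambda>z. g (z \<circ> Inl))"
  and Lin_Inr: "Lin M P g \<Longrightarrow> Lin (Inl ` K \<union> Inr ` M) P (\<lambda>z. g (z \<circ> Inr))"
  by (simp_all add: Lin_def comp_plus comp_sc tr_Inl tr_Inr)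

lemma Lin_pair: "Lin J K g \<Longrightarrow> Lin J M g' \<Longrightarrow> Lin J (Inl ` K \<union> Inr ` M) (\<lambda>z. case_sum (g z) (g' z))"
  by (simp add: Lin_def case_sum_plus case_sum_sc case_sum_fr)

lemma Hm_Inl: "u \<in> Hm \<rho> K \<Longrightarrow> (\<lambda>z. u (z \<circ> Inl)) \<in> Hm \<rho> (Inl ` K \<union> Inr ` M)"
  and Hm_Inr: "w \<in> Hm \<rho> M \<Longrightarrow> (\<lambda>z. w (z \<circ> Inr)) \<in> Hm \<rho> (Inl ` K \<union> Inr ` M)"
  by (simp_all add: Hm_def comp_plus comp_sc tr_Inl tr_Inr)

lemma Hm_case_sum_left:
  assumes W: "W \<in> Hm \<rho> (Inl ` K \<union> Inr ` M)"
  shows "(\<lambda>x. W (case_sum x 0)) \<in> Hm \<rho> K"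
proof (rule HmI)
  show "W (case_sum (x + y) 0) = W (case_sum x 0) + W (case_sum y 0)" for x y
    using Hm_add[OF W, of "case_sum x 0" "case_sum y 0"] by (simp add: case_sum_plus)
  show "W (case_sum (sc r x) 0) = \<rho> r * W (case_sum x 0)" for r x
    using Hm_sc[OF W, of r "case_sum x 0"] by (simp only: case_sum_sc vec.scale_zero_right)
  show "W (case_sum (tr K x) 0) = W (case_sum x 0)" for x
    using Hm_tr[OF W, of "case_sum x 0"] by (simp add: tr_case_sum tr_zero)
qed

lemma Hm_case_sum_right:
  assumes W: "W \<in> Hm \<rho> (Inl ` K \<union> Inr ` M)"
  shows "(\<lambda>x. W (case_sum 0 x)) \<in> Hm \<rho> M"
proof (rule HmI)
  show "W (case_sum 0 (x + y)) = W (case_sum 0 x) + W (case_sum 0 y)" for x y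
    using Hm_add[OF W, of "case_sum 0 x" "case_sum 0 y"] by (simp add: case_sum_plus)
  show "W (case_sum 0 (sc r x)) = \<rho> r * W (case_sum 0 x)" for r x
    using Hm_sc[OF W, of r "case_sum 0 x"] by (simp only: case_sum_sc vec.scale_zero_right)
  show "W (case_sum 0 (tr M x)) = W (case_sum 0 x)" for x
    using Hm_tr[OF W, of "case_sum 0 x"] by (simp add: tr_case_sum tr_zero)
qed

lemma Hm_split:
  assumes W: "W \<in> Hm \<rho> (Inl ` K \<union> Inr ` M)"
  shows "W (case_sum x y) = W (case_sum x 0) + W (case_sum 0 y)"
  using Hm_add[OF W, of "case_sum x 0" "case_sum 0 y"] by (simp add: case_sum_plus)

section \<open>Resolutions over one equation less\<close>

text \<open>The module \<open>G\<^sub>n\<^sub>-\<^sub>1\<close>, read as 0 for \<open>n = 0\<close>.\<close>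

definition prv :: "(nat \<Rightarrow> 'i set) \<Rightarrow> nat \<Rightarrow> 'i set" where
  "prv J n = (case n of 0 \<Rightarrow> {} | Suc m \<Rightarrow> J m)"

text \<open>The complex \<open>G\<^sub>n \<oplus> G\<^sub>n\<^sub>-\<^sub>1\<close> with differential \<open>(x, y) \<mapsto> (D x + r y, - t x - D y)\<close>.  For a complex over a
  quotient by one more element \<open>r\<close>, with \<open>t\<close> the component of \<open>D\<^sup>2\<close> at \<open>r\<close>, this is a complex before passing
  to the quotient by \<open>r\<close>.\<close>

definition JL :: "(nat \<Rightarrow> 'i set) \<Rightarrow> nat \<Rightarrow> ('i + 'i) set" where
  "JL J n = Inl ` J n \<union> Inr ` prv J n"

definition DL :: "'a::comm_ring_1 \<Rightarrow> (nat \<Rightarrow> 'i set) \<Rightarrow> (nat \<Rightarrow> ('i \<Rightarrow> 'a) \<Rightarrow> 'i \<Rightarrow> 'a)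
    \<Rightarrow> (nat \<Rightarrow> ('i \<Rightarrow> 'a) \<Rightarrow> 'i \<Rightarrow> 'a) \<Rightarrow> nat \<Rightarrow> ('i + 'i \<Rightarrow> 'a) \<Rightarrow> 'i + 'i \<Rightarrow> 'a" where
  "DL r J D t n z = case_sum (D n (z \<circ> Inl) + sc r (tr (J n) (z \<circ> Inr)))
     (case n of 0 \<Rightarrow> 0 | Suc m \<Rightarrow> - t m (z \<circ> Inl) - D m (z \<circ> Inr))"

text \<open>The components of the square of this differential.  The maps \<open>s\<^sub>j\<close> come from \<open>t D - D t = \<Sum> f\<^sub>j s\<^sub>j\<close>.\<close>

definition TL :: "(nat \<Rightarrow> nat \<Rightarrow> ('i \<Rightarrow> 'a::comm_ring_1) \<Rightarrow> 'i \<Rightarrow> 'a)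
    \<Rightarrow> (nat \<Rightarrow> nat \<Rightarrow> ('i \<Rightarrow> 'a) \<Rightarrow> 'i \<Rightarrow> 'a) \<Rightarrow> nat \<Rightarrow> nat \<Rightarrow> ('i + 'i \<Rightarrow> 'a) \<Rightarrow> 'i + 'i \<Rightarrow> 'a" where
  "TL T s j n z = case_sum (T j n (z \<circ> Inl))
     (case n of 0 \<Rightarrow> 0 | Suc m \<Rightarrow> T j m (z \<circ> Inr) - s j m (z \<circ> Inl))"

lemma TL_Inl: "TL T s j n z \<circ> Inl = T j n (z \<circ> Inl)"
  by (simp add: TL_def case_sum_o_inj)

lemma prv_simps [simp]: "prv J 0 = {}" "prv J (Suc m) = J m"
  by (simp_all add: prv_def)

context residue_ci
begin

text \<open>For the last component the chain map property holds even modulo \<open>I\<^sub>p\<close> instead of \<open>I\<^sub>p\<^sub>+\<^sub>1\<close>, as \<open>f\<^sub>p\<^sub>+\<^sub>1\<close> is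
  regular modulo \<open>I\<^sub>p\<close>.\<close>

lemma T_top_chain_map:
  assumes S: "ci_lift f (Suc p) J D T" and p: "Suc p \<le> c"
  shows "T (Suc p) n (D (Suc (Suc n)) x) - D n (T (Suc p) (Suc n) x) \<in> iv f p"
proof -
  let ?a = "\<lambda>j. T j n (D (Suc (Suc n)) x) - D n (T j (Suc n) x)"
  have "D n (D (Suc n) (D (Suc (Suc n)) x)) = (\<Sum>j=1..Suc p. sc (f j) (D n (T j (Suc n) x)))"
    by (simp only: ci_lift_DD[OF S, of "Suc n"] Lin_sum[OF ci_lift_D[OF S]] Lin_sc[OF ci_lift_D[OF S]])
  moreover have "D n (D (Suc n) (D (Suc (Suc n)) x)) = (\<Sum>j=1..Suc p. sc (f j) (T j n (D (Suc (Suc n)) x)))"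
    by (rule ci_lift_DD[OF S])
  ultimately have "(\<Sum>j=1..Suc p. sc (f j) (?a j)) = 0"
    by (simp only: vec.scale_right_diff_distrib sum_subtractf) simp
  then have "sc (f (Suc p)) (?a (Suc p)) = - (\<Sum>j=1..p. sc (f j) (?a j))"
    by (simp add: eq_neg_iff_add_eq_0 add.commute)
  also have "\<dots> \<in> iv f p" by (intro iv_minus iv_gens)
  finally show ?thesis using regular[of "Suc p"] p by (auto simp: iv_def)
qed

text \<open>For exactness let \<open>(x, y)\<close> be a cycle modulo \<open>I\<^sub>p\<close>, and put \<open>r = f\<^sub>p\<^sub>+\<^sub>1\<close>.  Then \<open>x\<close> is a cycle modulo \<open>I\<^sub>p\<^sub>+\<^sub>1\<close>, so
  \<open>x = D x' + r y'\<close> modulo \<open>I\<^sub>p\<close>; applying \<open>D\<close> gives \<open>r (y + t x' + D y') = 0\<close> modulo \<open>I\<^sub>p\<close>, and \<open>r\<close> can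
  be cancelled.\<close>

lemma cone:
  assumes S: "ci_lift f (Suc p) J D T" and p: "Suc p \<le> c" and ex: "exact_mod f (Suc p) J D"
  obtains s where "ci_lift f p (JL J) (DL (f (Suc p)) J D (T (Suc p))) (TL T s)"
    "exact_mod f p (JL J) (DL (f (Suc p)) J D (T (Suc p)))"
proof -
  let ?r = "f (Suc p)" and ?t = "T (Suc p)"
  let ?D = "DL ?r J D ?t"
  note LD = ci_lift_D[OF S] and LT = ci_lift_T[OF S] and fin = ci_lift_finite[OF S]
  have "\<exists>s. (\<forall>j. Lin (J (Suc (Suc (Suc n)))) (J n) (s j)) \<and>
      (\<forall>x. ?t n (D (Suc (Suc n)) x) - D n (?t (Suc n) x) = (\<Sum>j=1..p. sc (f j) (s j x)))" for n
    using Lin_decompose[OF fin Lin_minus_fun[OF Lin_comp[OF LD LT] Lin_comp[OF LT LD]] T_top_chain_map[OF S p]]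
    by metis
  then obtain s0 where s0: "\<And>n j. Lin (J (Suc (Suc (Suc n)))) (J n) (s0 n j)"
    "\<And>n x. ?t n (D (Suc (Suc n)) x) - D n (?t (Suc n) x) = (\<Sum>j=1..p. sc (f j) (s0 n j x))"
    by metis
  define s where "s j n = s0 n j" for j n
  have linD: "Lin (JL J (Suc n)) (JL J n) (?D n)" for n
    unfolding JL_def DL_def
  proof (rule Lin_pair)
    show "Lin (Inl ` J (Suc n) \<union> Inr ` prv J (Suc n)) (J n) (\<lambda>z. D n (z \<circ> Inl) + sc ?r (tr (J n) (z \<circ> Inr)))"
      by (intro Lin_plus Lin_scale Lin_Inl LD Lin_Inr) (simp add: Lin_trunc)
    show "Lin (Inl ` J (Suc n) \<union> Inr ` prv J (Suc n)) (prv J n)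
       (\<lambda>z. case n of 0 \<Rightarrow> 0 | Suc m \<Rightarrow> - ?t m (z \<circ> Inl) - D m (z \<circ> Inr))"
    proof (cases n)
      case (Suc m)
      have "Lin (Inl ` J (Suc (Suc m)) \<union> Inr ` J (Suc m)) (J m) (\<lambda>z. - ?t m (z \<circ> Inl) - D m (z \<circ> Inr))"
        by (intro Lin_minus_fun Lin_uminus Lin_Inl[OF LT] Lin_Inr[OF LD])
      then show ?thesis by (simp add: Suc)
    qed (simp add: Lin_null)
  qed
  have linT: "Lin (JL J (Suc (Suc n))) (JL J n) (TL T s j n)" for j n
    unfolding JL_def TL_def
  proof (rule Lin_pair)
    show "Lin (Inl ` J (Suc (Suc n)) \<union> Inr ` prv J (Suc (Suc n))) (J n) (\<lambda>z. T j n (z \<circ> Inl))"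
      by (intro Lin_Inl LT)
    show "Lin (Inl ` J (Suc (Suc n)) \<union> Inr ` prv J (Suc (Suc n))) (prv J n)
       (\<lambda>z. case n of 0 \<Rightarrow> 0 | Suc m \<Rightarrow> T j m (z \<circ> Inr) - s j m (z \<circ> Inl))"
    proof (cases n)
      case (Suc m)
      have "Lin (Inl ` J (Suc (Suc (Suc m))) \<union> Inr ` J (Suc (Suc m))) (J m)
          (\<lambda>z. T j m (z \<circ> Inr) - s j m (z \<circ> Inl))"
        unfolding s_def by (intro Lin_minus_fun Lin_Inl[OF s0(1)] Lin_Inr[OF LT])
      then show ?thesis by (simp add: Suc)
    qed (simp add: Lin_null)
  qed
  have "?D n (?D (Suc n) z) = (\<Sum>j=1..p. sc (f j) (TL T s j n z))" for n z
  proof -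
    define x where "x = z \<circ> Inl"
    define y where "y = z \<circ> Inr"
    have DDx: "D n (D (Suc n) x) = (\<Sum>j=1..p. sc (f j) (T j n x)) + sc ?r (?t n x)"
      using ci_lift_DD[OF S, of n x] by simp
    have eq1: "?D (Suc n) z = case_sum (D (Suc n) x + sc ?r (tr (J (Suc n)) y)) (- ?t n x - D n y)"
      by (simp add: DL_def x_def y_def)
    have trt: "tr (J n) (- ?t n x - D n y) = - ?t n x - D n y"
      by (intro tr_id fr_diff fr_minus Lin_fr[OF LT] Lin_fr[OF LD])
    have "D n (D (Suc n) x + sc ?r (tr (J (Suc n)) y)) + sc ?r (- ?t n x - D n y)
      = (\<Sum>j=1..p. sc (f j) (T j n x))"
      by (simp add: Lin_add[OF LD] Lin_sc[OF LD] Lin_tr[OF LD] DDx vec.scale_right_diff_distrib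
          vec.scale_minus_right)
    moreover have "- ?t m (D n' x + sc ?r (tr (J n') y)) - D m (- ?t n x - D n y)
      = (\<Sum>j=1..p. sc (f j) (T j m y - s j m x))" if n: "n = Suc m" "n' = Suc n" for m n'
    proof -
      have "D m (D (Suc m) y) = (\<Sum>j=1..p. sc (f j) (T j m y)) + sc ?r (?t m y)"
        using ci_lift_DD[OF S, of m y] by simp
      then show ?thesis
        using s0(2)[of m x] unfolding s_def n
        by (simp add: Lin_add[OF LT] Lin_sc[OF LT] Lin_tr[OF LT] Lin_diff[OF LD] Lin_minus[OF LD]
            vec.scale_right_diff_distrib sum_subtractf algebra_simps)
    qed
    ultimately show ?thesis
      unfolding eq1 DL_def[of _ _ _ _ n] TL_def case_sum_o_inj trt case_sum_sc case_sum_sum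
        x_def[symmetric] y_def[symmetric]
      by (cases n) (simp_all)
  qed
  then have sysL: "ci_lift f p (JL J) ?D (TL T s)"
    using linD linT fin by (simp add: ci_lift_def JL_def prv_def split: nat.split)
  have "exact_mod f p (JL J) ?D" unfolding exact_mod_def
  proof (intro allI ballI impI)
    fix n z assume z: "z \<in> fr (JL J (Suc n))" "?D n z \<in> iv f p"
    define x where "x = z \<circ> Inl"
    define y where "y = z \<circ> Inr"
    have zz: "z = case_sum x y" by (simp add: x_def y_def sum_split)
    have x: "x \<in> fr (J (Suc n))" and y: "y \<in> fr (J n)"
      using z(1) unfolding JL_def x_def y_def by (auto dest: fr_Inl fr_Inr)
    have 1: "D n x + sc ?r y \<in> iv f p"
      using z(2) by (simp add: DL_def case_sum_iv x_def[symmetric] y_def[symmetric] tr_id[OF y])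
    have "D n x \<in> iv f (Suc p)"
      using iv_diff[OF iv_mono[OF _ 1, of "Suc p"] iv_gen[of "Suc p" "Suc p" f y]] by simp
    then obtain x' where x': "x' \<in> fr (J (Suc (Suc n)))" "x - D (Suc n) x' \<in> iv f (Suc p)"
      using exact_modD[OF ex x] by metis
    have "x - D (Suc n) x' \<in> fr (J (Suc n))" by (intro fr_diff x Lin_fr[OF LD])
    then obtain a where a: "\<And>j. a j \<in> fr (J (Suc n))" "x - D (Suc n) x' = (\<Sum>j=1..Suc p. sc (f j) (a j))"
      using iv_decompose[OF x'(2)] by metis
    let ?y = "a (Suc p)"
    have xe: "x - D (Suc n) x' - sc ?r ?y \<in> iv f p" unfolding a(2) using iv_gens[of f a p] by simp
    have b1: "D n x - D n (D (Suc n) x') - sc ?r (D n ?y) \<in> iv f p"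
      using Lin_iv'[OF LD fin xe] by (simp add: Lin_diff[OF LD] Lin_sc[OF LD])
    have b2: "D n (D (Suc n) x') - sc ?r (?t n x') \<in> iv f p"
      using iv_gens[of f "\<lambda>j. T j n x'" p] by (simp add: ci_lift_DD[OF S, of n])
    have "D n x - sc ?r (?t n x') - sc ?r (D n ?y) \<in> iv f p"
      using iv_add[OF b1 b2] by (simp add: algebra_simps)
    from iv_diff[OF 1 this] have "sc ?r (y + ?t n x' + D n ?y) \<in> iv f p"
      by (simp add: vec.scale_right_distrib algebra_simps)
    then have ye: "y + ?t n x' + D n ?y \<in> iv f p"
      using regular[of "Suc p"] p by (auto simp: iv_def)
    have "z - ?D (Suc n) (case_sum x' ?y) \<in> iv f p"
      using xe ye by (simp add: zz DL_def case_sum_o_inj case_sum_minus case_sum_iv tr_id[OF a(1)]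
          algebra_simps)
    moreover have "case_sum x' ?y \<in> fr (JL J (Suc (Suc n)))"
      using x'(1) a(1) by (simp add: JL_def case_sum_fr)
    ultimately show "\<exists>y\<in>fr (JL J (Suc (Suc n))). z - ?D (Suc n) y \<in> iv f p" by blast
  qed
  with sysL show thesis by (rule that)
qed

end

section \<open>Adding one equation\<close>

context hmf_coords
begin

lemma adaptedD:
  assumes "adapted p J D"
  shows "J 0 = N 0 p" "J (Suc 0) = N 1 p" "J 1 = N 1 p" "D 0 = dp p"
  using assms by (simp_all add: adapted_def)

lemma adapted_minimal:
  assumes S: "ci_lift f p J D T" and p: "p \<le> c" and ad: "adapted p J D"
  shows "\<rho> (D (Suc 0) x k) = 0"
proof (rule syzygy_minimal[OF p])
  show *: "D (Suc 0) x \<in> fr (N 1 p)" using Lin_fr[OF ci_lift_D[OF S], of "Suc 0"] adaptedD[OF ad] by simp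
  have "D 0 (D (Suc 0) x) \<in> iv f p" by (rule ci_lift_DD_iv[OF S])
  then show "d (D (Suc 0) x) \<in> iv f p" by (simp add: adaptedD[OF ad] dp_id[OF *])
qed

text \<open>Put \<open>T = T\<^sub>p\<^sub>+\<^sub>1 : G\<^sub>2 \<rightarrow> A\<^sub>0\<close>.  Given \<open>a \<in> A\<^sub>0\<close>, the element
  \<open>h a\<close> is a cycle modulo \<open>I\<^sub>p\<^sub>+\<^sub>1\<close> because \<open>d h a = f\<^sub>p\<^sub>+\<^sub>1 a\<close> modulo \<open>I\<^sub>p\<close>; write \<open>h a = D g + \<Sum> f\<^sub>j z\<^sub>j\<close> and
  compare the coefficients of \<open>f\<^sub>p\<^sub>+\<^sub>1\<close> in \<open>d h a\<close>: they give \<open>a = T g + d z\<close>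
  modulo \<open>I\<^sub>p\<close>, with \<open>z = z\<^sub>p\<^sub>+\<^sub>1\<close>.  As \<open>d\<close> is minimal, \<open>T\<close> is onto modulo the maximal ideal, so a functional
  that vanishes on its image is zero.\<close>

lemma T_top_onto:
  assumes S: "ci_lift f (Suc p) J D T" and ex: "exact_mod f (Suc p) J D" and p: "Suc p \<le> c"
    and ad: "adapted (Suc p) J D"
    and w: "w \<in> Hm \<rho> (J 0)" "\<And>x. w (T (Suc p) 0 x) = 0"
  shows "w a = 0"
proof -
  let ?q = "Suc p"
  note A = adaptedD[OF ad]
  have q: "?q \<in> {1..c}" using p by simp
  define a' where "a' = tr (N 0 ?q) a"
  have a': "a' \<in> fr (N 0 ?q)" by (simp add: a'_def)
  have ha: "h ?q a' \<in> fr (N 1 ?q)" by (rule Lin_fr[OF h_lin[OF q]])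
  have e: "d (h ?q a') - sc (f ?q) a' \<in> iv f p" using dh[OF q a'] by simp
  have "D 0 (h ?q a') \<in> iv f ?q"
    using iv_add[OF iv_mono[OF _ e, of ?q] iv_gen[of ?q ?q f a']] by (simp add: A dp_id[OF ha])
  then obtain g where g: "g \<in> fr (J (Suc (Suc 0)))" "h ?q a' - D (Suc 0) g \<in> iv f ?q"
    using exact_modD[OF ex, of "h ?q a'" 0] ha by (auto simp: A)
  have "h ?q a' - D (Suc 0) g \<in> fr (N 1 ?q)"
    using Lin_fr[OF ci_lift_D[OF S], of "Suc 0" g] by (intro fr_diff ha) (simp add: A)
  then obtain z where z: "\<And>j. z j \<in> fr (N 1 ?q)" "h ?q a' - D (Suc 0) g = (\<Sum>j=1..?q. sc (f j) (z j))"
    using iv_decompose[OF g(2)] by metis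
  have L0: "Lin (J (Suc 0)) (J 0) (D 0)" by (rule ci_lift_D[OF S])
  have "D 0 (h ?q a') = D 0 (D (Suc 0) g) + D 0 (\<Sum>j=1..?q. sc (f j) (z j))"
    unfolding z(2)[symmetric] by (simp add: Lin_diff[OF L0])
  also have "\<dots> = (\<Sum>j=1..?q. sc (f j) (T j 0 g + D 0 (z j)))"
    by (simp only: ci_lift_DD[OF S] Lin_sum[OF L0] Lin_sc[OF L0] vec.scale_right_distrib sum.distrib)
  finally have "D 0 (h ?q a') - sc (f ?q) (T ?q 0 g + D 0 (z ?q)) = (\<Sum>j=1..p. sc (f j) (T j 0 g + D 0 (z j)))"
    by simp
  also have "\<dots> \<in> iv f p" by (rule iv_gens)
  finally have "D 0 (h ?q a') - sc (f ?q) (T ?q 0 g + D 0 (z ?q)) \<in> iv f p" .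
  from iv_diff[OF this e] have "sc (f ?q) (a' - (T ?q 0 g + D 0 (z ?q))) \<in> iv f p"
    by (simp add: A dp_id[OF ha] vec.scale_right_diff_distrib)
  then have "a' - (T ?q 0 g + D 0 (z ?q)) \<in> iv f p" using regular_iv[OF q] by simp
  then have "w a' = w (T ?q 0 g + D 0 (z ?q))"
    using Hm_cong_iv[OF w(1) ci_lift_finite[OF S]] p by simp
  also have "\<dots> = w (D 0 (z ?q))" by (simp add: Hm_add[OF w(1)] w(2))
  also have "\<dots> = 0" by (rule Hm_vanish[OF w(1) ci_lift_finite[OF S]]) (simp add: A dp_min)
  finally show ?thesis using Hm_tr[OF w(1), of a] by (simp add: a'_def A)
qed

text \<open>The complex \<open>(J', D')\<close> is the one from \<open>box\<close>; it resolves the same module modulo \<open>I\<^sub>p\<close> as the cone over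
  \<open>(J, D)\<close>, since \<open>d h = f\<^sub>p\<^sub>+\<^sub>1\<close> modulo \<open>I\<^sub>p\<close> makes the summand \<open>f\<^sub>p\<^sub>+\<^sub>1 A\<^sub>0\<close> of the boundaries of the cone superfluous.
  So the monomial basis carries over to the cone.\<close>

lemma hypersurface_step:
  fixes J J' :: "nat \<Rightarrow> nat set"
  assumes p: "Suc p \<le> c"
    and S: "ci_lift f (Suc p) J D T" and ex: "exact_mod f (Suc p) J D" and ad: "adapted (Suc p) J D"
    and S': "ci_lift f p J' D' T'" and ex': "exact_mod f p J' D'" and ad': "adapted (Suc p) J' D'"
    and v': "expanded J' D' T' (Suc p) p v'"
  shows "\<exists>v. expanded J D T (Suc p) (Suc p) v"
proof -
  let ?q = "Suc p" and ?J = "JL J" and ?D = "DL (f (Suc p)) J D (T (Suc p))"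
  have q: "?q \<in> {1..c}" and pc: "p \<le> c" using p by auto
  note A = adaptedD[OF ad] and A' = adaptedD[OF ad'] and fin = ci_lift_finite[OF S]
    and LD = ci_lift_D[OF S] and LT = ci_lift_T[OF S]
  obtain s where SL: "ci_lift f p ?J ?D (TL T s)" and exL: "exact_mod f p ?J ?D"
    using cone[OF S p ex] by metis
  let ?T = "TL T s"
  have J0: "?J 0 = Inl ` N 0 ?q" by (simp add: JL_def A)
  have J0': "?J 0 = Inl ` N 0 ?q \<union> Inr ` {}" by (simp add: J0)
  have J1: "?J 1 = Inl ` N 1 ?q \<union> Inr ` N 0 ?q" by (simp add: JL_def A)
  have J_eq: "?J n = Inl ` J n \<union> Inr ` prv J n" for n by (simp add: JL_def)
  have D0z: "?D 0 z = case_sum (dp ?q (z \<circ> Inl) + sc (f ?q) (tr (N 0 ?q) (z \<circ> Inr))) 0" for z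
    by (simp add: DL_def A)
  have "\<exists>vL. expands sc (Zc \<rho> ?J ?D) (Bc \<rho> ?J ?D) (chi ?T) L ?q p vL"
  proof (rule expands_compare[OF S' SL pc ex' exL _ _ _ _ _ _ v',
        where a = "\<lambda>x. case_sum (tr (N 0 ?q) x) 0" and b = "\<lambda>z. tr (N 0 ?q) (z \<circ> Inl)"])
    show "Lin (J' 0) (?J 0) (\<lambda>x. case_sum (tr (N 0 ?q) x) 0)"
      unfolding J0' A' by (intro Lin_pair Lin_trunc Lin_null)
    show "Lin (?J 0) (J' 0) (\<lambda>z. tr (N 0 ?q) (z \<circ> Inl))"
      unfolding J0' A' by (intro Lin_Inl Lin_trunc)
    show "\<exists>y\<in>fr (?J 1). case_sum (tr (N 0 ?q) (D' 0 x)) 0 - ?D 0 y \<in> iv f p" for x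
    proof
      let ?y = "case_sum (tr (N 1 ?q) x) (0 :: nat \<Rightarrow> 'a)"
      show "?y \<in> fr (?J 1)" unfolding J1 case_sum_fr by simp
      have "tr (N 0 ?q) (dp ?q x) = dp ?q (tr (N 1 ?q) x)"
        by (simp only: tr_id[OF Lin_fr[OF dp_lin[OF p]]] Lin_tr[OF dp_lin[OF p]])
      then show "case_sum (tr (N 0 ?q) (D' 0 x)) 0 - ?D 0 ?y \<in> iv f p"
        by (simp add: D0z A' case_sum_o_inj tr_zero)
    qed
    show "\<exists>y\<in>fr (J' 1). tr (N 0 ?q) (?D 0 z \<circ> Inl) - D' 0 y \<in> iv f p" for z
    proof
      let ?a = "tr (N 0 ?q) (z \<circ> Inr)"
      let ?y = "tr (N 1 ?q) (z \<circ> Inl) + h ?q ?a"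
      have ha: "h ?q ?a \<in> fr (N 1 ?q)" by (rule Lin_fr[OF h_lin[OF q]])
      show "?y \<in> fr (J' 1)" unfolding A' by (intro fr_add tr_fr ha)
      have "dp ?q ?y = dp ?q (z \<circ> Inl) + d (h ?q ?a)"
        by (simp only: Lin_add[OF dp_lin[OF p]] Lin_tr[OF dp_lin[OF p]] dp_id[OF ha])
      moreover have "tr (N 0 ?q) (?D 0 z \<circ> Inl) = dp ?q (z \<circ> Inl) + sc (f ?q) ?a"
        unfolding D0z case_sum_o_inj by (intro tr_id fr_add fr_sc tr_fr Lin_fr[OF dp_lin[OF p]])
      ultimately have "tr (N 0 ?q) (?D 0 z \<circ> Inl) - D' 0 ?y = - (d (h ?q ?a) - sc (f ?q) ?a)"
        by (simp add: A')
      also have "\<dots> \<in> iv f p" using iv_minus[OF dh[OF q tr_fr]] by simp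
      finally show "tr (N 0 ?q) (?D 0 z \<circ> Inl) - D' 0 ?y \<in> iv f p" .
    qed
    show "\<exists>y\<in>fr (J' 1). tr (N 0 ?q) (case_sum (tr (N 0 ?q) x) 0 \<circ> Inl) - x - D' 0 y \<in> iv f p"
      if "x \<in> fr (J' 0)" for x
      by (rule bexI[of _ 0]) (use that in \<open>simp_all add: case_sum_o_inj A' tr_id Lin_zero[OF dp_lin[OF p]]\<close>)
    show "\<exists>y\<in>fr (?J 1). case_sum (tr (N 0 ?q) (tr (N 0 ?q) (z \<circ> Inl))) 0 - z - ?D 0 y \<in> iv f p"
      if z: "z \<in> fr (?J 0)" for z
    proof -
      have "z \<circ> Inl \<in> fr (N 0 ?q)" "z \<circ> Inr = 0"
        using fr_Inl[OF z[unfolded J0']] fr_Inr[OF z[unfolded J0']] by (auto simp: fr_def fun_eq_iff)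
      then have "case_sum (tr (N 0 ?q) (tr (N 0 ?q) (z \<circ> Inl))) 0 = z"
        using sum_split[of z] by (simp add: tr_id)
      then show ?thesis by (intro bexI[of _ 0]) (simp_all add: Lin_zero[OF ci_lift_D[OF SL]])
    qed
  qed
  then obtain vL where vL: "expands sc (Zc \<rho> ?J ?D) (Bc \<rho> ?J ?D) (chi ?T) L ?q p vL" ..
  define \<iota> where "\<iota> u = (\<lambda>z :: nat + nat \<Rightarrow> 'a. (u :: (nat \<Rightarrow> 'a) \<Rightarrow> 'k) (z \<circ> Inl))" for u
  note O = ops_sys[OF S p] and OL = ops_sys[OF SL pc]
  have rf: "\<rho> (f ?q) = 0" by (rule rho_f[OF q])
  have D_left: "?D n (case_sum x 0) = case_sum (D n x) (case n of 0 \<Rightarrow> 0 | Suc m \<Rightarrow> - T ?q m x)" for n x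
    by (cases n) (simp_all add: DL_def case_sum_o_inj tr_zero Lin_zero[OF LD])
  have D_right: "?D n (case_sum 0 y) = case_sum (sc (f ?q) (tr (J n) y)) (case n of 0 \<Rightarrow> 0 | Suc m \<Rightarrow> - D m y)" for n y
    by (cases n) (simp_all add: DL_def case_sum_o_inj Lin_zero[OF LD] Lin_zero[OF LT])
  have \<iota>Z: "\<iota> u \<in> Zc \<rho> ?J ?D n" if u: "u \<in> Zc \<rho> J D n" for u n
  proof (rule Zc_I)
    note H = Zc_Hm[OF u]
    show "\<iota> u \<in> Hm \<rho> (?J n)" unfolding \<iota>_def J_eq by (rule Hm_Inl[OF H])
    show "\<iota> u (?D n z) = 0" for z
      unfolding \<iota>_def DL_def case_sum_o_inj by (simp add: Hm_add[OF H] Hm_sc[OF H] Zc_D[OF u] rf)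
  qed
  have \<iota>B: "\<iota> u \<in> Bc \<rho> ?J ?D n" if u: "u \<in> Bc \<rho> J D n" for u n
  proof (cases n)
    case 0
    then show ?thesis using u by (simp add: Bc_0 \<iota>_def zero_fun_def)
  next
    case (Suc m)
    then obtain w where w: "w \<in> Hm \<rho> (J m)" "u = (\<lambda>x. w (D m x))" using u by (auto simp: Bc_Suc)
    show ?thesis unfolding Suc
    proof (rule Bc_I)
      show "(\<lambda>z. w (z \<circ> Inl)) \<in> Hm \<rho> (?J m)" unfolding J_eq by (rule Hm_Inl[OF w(1)])
      show "\<iota> u z = w (?D m z \<circ> Inl)" for z
        unfolding \<iota>_def DL_def case_sum_o_inj
        by (simp add: w(2) Hm_add[OF w(1)] Hm_sc[OF w(1)] rf)
    qed
  qed
  have gm: "graded_map sc (Zc \<rho> J D) (Bc \<rho> J D) (chi T) sc (Zc \<rho> ?J ?D) (Bc \<rho> ?J ?D) (chi ?T) p (\<lambda>_. \<iota>)"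
    unfolding graded_map_def
  proof (intro allI conjI ballI)
    fix n
    show "lin_on sc (Zc \<rho> J D n) sc (Zc \<rho> ?J ?D n) \<iota>"
      using \<iota>Z by (auto simp: semilinear_on_def \<iota>_def)
    show "\<iota> ` Bc \<rho> J D n \<subseteq> Bc \<rho> ?J ?D n" using \<iota>B by auto
    fix j u
    have "\<iota> (chi T j n u) = chi ?T j n (\<iota> u)" by (simp add: \<iota>_def chi_def TL_Inl)
    then show "\<iota> (chi T j n u) - chi ?T j n (\<iota> u) \<in> Bc \<rho> ?J ?D (Suc (Suc n))"
      using vec.subspace_0[OF Bc_subspace] by simp
  qed
  \<comment> \<open>\<open>H(\<iota>)\<close> is onto: in degrees 0 and 1 by minimality, and then because
    the target is generated in these degrees.\<close>
  have surj: "\<exists>u\<in>Zc \<rho> J D n. z - \<iota> u \<in> Bc \<rho> ?J ?D n" if "z \<in> Zc \<rho> ?J ?D n" for n z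
    using that
  proof (induction n arbitrary: z rule: less_induct)
    case (less n)
    note H = Zc_Hm[OF less.prems, unfolded J_eq]
    define u where "u x = z (case_sum x 0)" for x
    have uH: "u \<in> Hm \<rho> (J n)" unfolding u_def by (rule Hm_case_sum_left[OF H])
    have DD: "u (D n x) = - z (case_sum 0 (case n of 0 \<Rightarrow> 0 | Suc m \<Rightarrow> - T ?q m x))" for x
      using Zc_D[OF less.prems, of "case_sum x 0"]
        Hm_split[OF H, of "D n x" "case n of 0 \<Rightarrow> 0 | Suc m \<Rightarrow> - T ?q m x"]
      unfolding D_left u_def by (simp add: eq_neg_iff_add_eq_0)
    consider "n = 0" | "n = Suc 0" | "n \<ge> 2" by linarith
    then show ?case
    proof cases
      case 1
      have "z (case_sum 0 y) = 0" for y
      proof -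
        have "tr {} y = 0" by (auto simp: tr_def)
        then show ?thesis
          using Hm_tr[OF H, of "case_sum 0 y"] Hm_zero[OF H]
          by (simp only: 1 prv_simps tr_case_sum tr_zero case_sum_zero)
      qed
      then have "z = \<iota> u"
        unfolding \<iota>_def u_def using Hm_split[OF H] sum_split by (metis add.right_neutral)
      moreover have "u \<in> Zc \<rho> J D n"
        using DD Hm_zero[OF H] by (intro Zc_I uH) (simp add: 1 case_sum_zero)
      ultimately show ?thesis
        using vec.subspace_0[OF Bc_subspace, of \<rho> ?J ?D n] by (intro bexI[of _ u]) (simp_all only: diff_self)
    next
      case 2
      define w where "w y = z (case_sum 0 y)" for y
      have w: "w \<in> Hm \<rho> (J 0)" unfolding w_def using Hm_case_sum_right[OF H] by (simp add: 2)
      have uD: "u (D n x) = 0" for x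
        by (rule Hm_vanish[OF uH fin]) (simp add: 2 adapted_minimal[OF S p ad])
      then have "w (T ?q 0 x) = 0" for x
        using DD[of x] Hm_minus[OF w, of "T ?q 0 x"] by (simp add: 2 w_def)
      then have "w y = 0" for y by (rule T_top_onto[OF S ex p ad w])
      then have "z = \<iota> u"
        unfolding \<iota>_def u_def w_def using Hm_split[OF H] sum_split by (metis add.right_neutral)
      moreover have "u \<in> Zc \<rho> J D n" using uD by (intro Zc_I uH)
      ultimately show ?thesis
        using vec.subspace_0[OF Bc_subspace, of \<rho> ?J ?D n] by (intro bexI[of _ u]) (simp_all only: diff_self)
    next
      case 3
      let ?S = "{y \<in> Zc \<rho> ?J ?D n. \<exists>u\<in>Zc \<rho> J D n. y - \<iota> u \<in> Bc \<rho> ?J ?D n}"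
      have sub: "vec.subspace ?S"
        unfolding vec.subspace_def
      proof (intro conjI ballI allI)
        have "\<iota> 0 = 0" by (simp add: \<iota>_def zero_fun_def)
        then have "0 - \<iota> 0 \<in> Bc \<rho> ?J ?D n" by (simp only: diff_self vec.subspace_0[OF Bc_subspace])
        then show "0 \<in> ?S"
          using vec.subspace_0[OF Zc_subspace, of \<rho> J D n] vec.subspace_0[OF Zc_subspace, of \<rho> ?J ?D n]
          by blast
        fix x y assume "x \<in> ?S" "y \<in> ?S"
        then obtain a b where ab: "x \<in> Zc \<rho> ?J ?D n" "y \<in> Zc \<rho> ?J ?D n" "a \<in> Zc \<rho> J D n" "b \<in> Zc \<rho> J D n"
          "x - \<iota> a \<in> Bc \<rho> ?J ?D n" "y - \<iota> b \<in> Bc \<rho> ?J ?D n" by auto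
        have e: "\<iota> (a + b) = \<iota> a + \<iota> b" by (auto simp: \<iota>_def)
        have "x + y - \<iota> (a + b) \<in> Bc \<rho> ?J ?D n"
          using vec.subspace_add[OF Bc_subspace ab(5,6)] unfolding e by (simp add: algebra_simps)
        then show "x + y \<in> ?S"
          using vec.subspace_add[OF Zc_subspace ab(1,2)] vec.subspace_add[OF Zc_subspace ab(3,4)] by blast
      next
        fix r x assume "x \<in> ?S"
        then obtain a where ab: "x \<in> Zc \<rho> ?J ?D n" "a \<in> Zc \<rho> J D n" "x - \<iota> a \<in> Bc \<rho> ?J ?D n" by auto
        have e: "\<iota> (sc r a) = sc r (\<iota> a)" by (auto simp: \<iota>_def)
        have "sc r x - \<iota> (sc r a) \<in> Bc \<rho> ?J ?D n"
          using vec.subspace_scale[OF Bc_subspace ab(3)] unfolding e vec.scale_right_diff_distrib .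
        then show "sc r x \<in> ?S"
          using vec.subspace_scale[OF Zc_subspace ab(1)] vec.subspace_scale[OF Zc_subspace ab(2)] by blast
      qed
      have bm: "basis_mod sc (Zc \<rho> ?J ?D n) (Bc \<rho> ?J ?D n) (Idx L ?q p n) (monomial (chi ?T) vL)"
        by (rule expands_basis[OF vL])
      have "monomial (chi ?T) vL x \<in> ?S" if x: "x \<in> Idx L ?q p n" for x
      proof -
        obtain r i l w where w: "x = (r, i, l, w)" "r \<in> {1..?q}" "i < 2" "l \<in> L i r" "w \<in> words r p"
            "i + 2 * length w = n"
          using x by (auto simp: Idx_def)
        obtain j w' where jw: "w = j # w'" using w 3 by (cases w) auto
        define m where "m = i + 2 * length w'"
        have m: "n = Suc (Suc m)" using w jw by (simp add: m_def)
        have js: "j \<in> {1..p}" "set w' \<subseteq> {1..p}" using words_subset[OF w(5)] w(2) jw by auto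
        define y where "y = act (chi ?T) i w' (vL r i l)"
        have y: "y \<in> Zc \<rho> ?J ?D m" unfolding y_def m_def
          by (rule act_in[OF OL expands_gen[OF vL w(2-4)] js(2)])
        have "m < n" using m by simp
        then obtain u where u: "u \<in> Zc \<rho> J D m" "y - \<iota> u \<in> Bc \<rho> ?J ?D m"
          using less.IH[OF _ y] by blast
        have "monomial (chi ?T) vL x = chi ?T j m y" by (simp add: w(1) jw y_def m_def)
        moreover have "chi ?T j m y - \<iota> (chi T j m u) = chi ?T j m (y - \<iota> u)"
          by (auto simp: \<iota>_def chi_def TL_Inl)
        ultimately have "monomial (chi ?T) vL x - \<iota> (chi T j m u) \<in> Bc \<rho> ?J ?D n"
          using chi_in_Bc[OF SL pc js(1) u(2)] m by simp
        moreover have "chi T j m u \<in> Zc \<rho> J D n" unfolding m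
          by (rule chi_in_Zc[OF S p _ u(1)]) (use js in auto)
        ultimately show ?thesis using basis_mod_in[OF bm x] by blast
      qed
      then have comb: "(\<Sum>x\<in>Idx L ?q p n. sc (\<kappa> x) (monomial (chi ?T) vL x)) \<in> ?S" for \<kappa>
        by (intro vec.subspace_sum[OF sub] vec.subspace_scale[OF sub])
      obtain \<kappa> where \<kappa>: "z - (\<Sum>x\<in>Idx L ?q p n. sc (\<kappa> x) (monomial (chi ?T) vL x)) \<in> Bc \<rho> ?J ?D n"
        using basis_mod_span[OF bm less.prems] by blast
      from comb[of \<kappa>] obtain u where u: "u \<in> Zc \<rho> J D n"
        "(\<Sum>x\<in>Idx L ?q p n. sc (\<kappa> x) (monomial (chi ?T) vL x)) - \<iota> u \<in> Bc \<rho> ?J ?D n" by blast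
      from vec.subspace_add[OF Bc_subspace \<kappa> u(2)] have "z - \<iota> u \<in> Bc \<rho> ?J ?D n"
        by (simp only: diff_add_cancel diff_add_eq add_diff_eq)
      with u(1) show ?thesis by blast
    qed
  qed
  have kernel: "(n < 2 \<longrightarrow> u \<in> Bc \<rho> J D n) \<and>
      (\<forall>m. n = Suc (Suc m) \<longrightarrow> (\<exists>u1\<in>Zc \<rho> J D m. u - chi T ?q m u1 \<in> Bc \<rho> J D n))"
    if u: "u \<in> Zc \<rho> J D n" "\<iota> u \<in> Bc \<rho> ?J ?D n" for n u
  proof (cases n)
    case 0
    then have "\<iota> u = 0" using u(2) by (simp add: Bc_0)
    then have "\<iota> u (case_sum x 0) = 0" for x by simp
    then have "u = 0" by (auto simp: \<iota>_def case_sum_o_inj)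
    then show ?thesis by (simp add: 0 Bc_0)
  next
    case (Suc m)
    then obtain W where W: "W \<in> Hm \<rho> (?J m)" "\<And>z. \<iota> u z = W (?D m z)"
      using u(2) by (auto simp: Bc_Suc fun_eq_iff)
    note H = W(1)[unfolded J_eq]
    define u' where "u' x = W (case_sum x 0)" for x
    define w' where "w' x = W (case_sum 0 x)" for x
    have u': "u' \<in> Hm \<rho> (J m)" unfolding u'_def by (rule Hm_case_sum_left[OF H])
    have w': "w' \<in> Hm \<rho> (prv J m)" unfolding w'_def by (rule Hm_case_sum_right[OF H])
    have ux: "u x = u' (D m x) + w' (case m of 0 \<Rightarrow> 0 | Suc k \<Rightarrow> - T ?q k x)" for x
      using W(2)[of "case_sum x 0"]
        Hm_split[OF H, of "D m x" "case m of 0 \<Rightarrow> 0 | Suc k \<Rightarrow> - T ?q k x"]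
      unfolding D_left u'_def w'_def by (simp add: \<iota>_def case_sum_o_inj)
    show ?thesis
    proof (cases m)
      case 0
      then have "u \<in> Bc \<rho> J D n"
        unfolding Suc using ux Hm_zero[OF w'] by (intro Bc_I[where w = u'] u') simp
      then show ?thesis by (simp add: Suc 0)
    next
      case (Suc k)
      have wH: "w' \<in> Hm \<rho> (J k)" using w' Suc by simp
      have "w' (D k y) = 0" for y
      proof -
        have "0 = W (?D m (case_sum 0 y))"
          using W(2)[of "case_sum 0 y"] Hm_zero[OF Zc_Hm[OF u(1)]] by (simp add: \<iota>_def case_sum_o_inj)
        also have "\<dots> = u' (sc (f ?q) (tr (J m) y)) + w' (- D k y)"
          using Hm_split[OF H, of "sc (f ?q) (tr (J m) y)" "- D k y"]
          unfolding D_right u'_def w'_def by (simp add: Suc)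
        finally show ?thesis using Hm_sc[OF u'] Hm_minus[OF wH] rf by simp
      qed
      then have "w' \<in> Zc \<rho> J D k" by (intro Zc_I wH)
      then have wZ: "- w' \<in> Zc \<rho> J D k" by (rule vec.subspace_neg[OF Zc_subspace])
      have "u - chi T ?q k (- w') \<in> Bc \<rho> J D n"
        unfolding \<open>n = Suc m\<close>
        using ux Hm_minus[OF wH] by (intro Bc_I[where w = u'] u') (simp add: chi_def Suc)
      then show ?thesis using wZ \<open>n = Suc m\<close> Suc by auto
    qed
  qed
  have \<iota>\<chi>: "\<iota> (chi T ?q n u) \<in> Bc \<rho> ?J ?D (Suc (Suc n))" if u: "u \<in> Zc \<rho> J D n" for n u
  proof (rule Bc_I)
    note uH = Zc_Hm[OF vec.subspace_neg[OF Zc_subspace u]]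
    show "(\<lambda>z. (- u) (z \<circ> Inr)) \<in> Hm \<rho> (?J (Suc n))"
      using Hm_Inr[OF uH, of "J (Suc n)"] by (simp add: J_eq)
    show "\<iota> (chi T ?q n u) z = (- u) (?D (Suc n) z \<circ> Inr)" for z
      using Hm_minus[OF Zc_Hm[OF u], of "T ?q n (z \<circ> Inl)"]
      by (simp add: \<iota>_def chi_def DL_def case_sum_o_inj Hm_diff[OF Zc_Hm[OF u]] Zc_D[OF u])
  qed
  have inj: "u \<in> Bc \<rho> J D n" if u: "u \<in> Zc \<rho> J D n" "chi T ?q n u \<in> Bc \<rho> J D (Suc (Suc n))" for n u
  proof -
    note uH = Zc_Hm[OF u(1)]
    obtain u' where u': "u' \<in> Hm \<rho> (J (Suc n))" "\<And>x. u (T ?q n x) = u' (D (Suc n) x)"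
      using u(2) unfolding Bc_Suc by (auto simp: chi_def fun_eq_iff)
    \<comment> \<open>The pair \<open>(u', u)\<close> is a cocycle of the cone, hence cohomologous to one with second component 0.\<close>
    define W where "W z = u' (z \<circ> Inl) + u (z \<circ> Inr)" for z :: "nat + nat \<Rightarrow> 'a"
    have "W = (\<lambda>z. u' (z \<circ> Inl)) + (\<lambda>z. u (z \<circ> Inr))" by (auto simp: W_def)
    moreover have "(\<lambda>z. u' (z \<circ> Inl)) \<in> Hm \<rho> (?J (Suc n))" "(\<lambda>z. u (z \<circ> Inr)) \<in> Hm \<rho> (?J (Suc n))"
      using Hm_Inl[OF u'(1), of "J n"] Hm_Inr[OF uH, of "J (Suc n)"] by (simp_all add: J_eq)
    ultimately have WH: "W \<in> Hm \<rho> (?J (Suc n))" using vec.subspace_add[OF Hm_subspace] by simp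
    have "W (?D (Suc n) z) = 0" for z
      unfolding W_def DL_def case_sum_o_inj
      by (simp add: Hm_add[OF u'(1)] Hm_sc[OF u'(1)] Hm_diff[OF uH] Hm_minus[OF uH] rf u'(2)[symmetric] Zc_D[OF u(1)])
    then have "W \<in> Zc \<rho> ?J ?D (Suc n)" by (intro Zc_I WH)
    then obtain u'' where u'': "u'' \<in> Zc \<rho> J D (Suc n)" "W - \<iota> u'' \<in> Bc \<rho> ?J ?D (Suc n)"
      using surj by blast
    then obtain V where V: "V \<in> Hm \<rho> (?J n)" "\<And>z. W z - \<iota> u'' z = V (?D n z)"
      unfolding Bc_Suc by (auto simp: fun_eq_iff)
    note H = V(1)[unfolded J_eq]
    have uy: "u y = V (case_sum 0 (case n of 0 \<Rightarrow> 0 | Suc m \<Rightarrow> - D m y))" for y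
    proof -
      have "V (case_sum (sc (f ?q) (tr (J n) y)) 0) = 0"
        using Hm_sc[OF Hm_case_sum_left[OF H], of "f ?q" "tr (J n) y"] rf by simp
      then show ?thesis
        using V(2)[of "case_sum 0 y"] Hm_zero[OF u'(1)] Hm_zero[OF Zc_Hm[OF u''(1)]]
          Hm_split[OF H, of "sc (f ?q) (tr (J n) y)" "case n of 0 \<Rightarrow> 0 | Suc m \<Rightarrow> - D m y"]
        unfolding D_right by (simp add: W_def \<iota>_def case_sum_o_inj)
    qed
    show ?thesis
    proof (cases n)
      case 0
      then have "u = 0" using uy Hm_zero[OF V(1)] by (auto simp: case_sum_zero fun_eq_iff)
      then show ?thesis by (simp add: 0 Bc_0)
    next
      case (Suc m)
      define w where "w y = V (case_sum 0 y)" for y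
      have w: "w \<in> Hm \<rho> (J m)" unfolding w_def using Hm_case_sum_right[OF H] Suc by simp
      have w': "- w \<in> Hm \<rho> (J m)" by (rule vec.subspace_neg[OF Hm_subspace w])
      show ?thesis unfolding Suc
        using uy Hm_minus[OF w] by (intro Bc_I[where w = "- w"] w') (simp add: Suc w_def)
    qed
  qed
  show ?thesis
    by (rule expands_step[OF O OL gm surj _ _ \<iota>\<chi> inj vL L_finite]) (use kernel in auto)
qed

lemma adapted_exists:
  assumes "p \<le> c"
  obtains J D T where "ci_lift f p J D T" "exact_mod f p J D" "adapted p J D"
  using resolution_exists[OF noeth N_finite N_finite dp_lin[OF assms]]
  unfolding adapted_def by metis

text \<open>The induction on the number of equations.\<close>

theorem adapted_expansion:
  assumes "p \<le> c"
  obtains J D T v where "ci_lift f p J D T" "exact_mod f p J D" "adapted p J D" "expanded J D T p p v"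
proof -
  have "\<exists>J D T v. ci_lift f p J D T \<and> exact_mod f p J D \<and> adapted p J D \<and> expanded J D T p p v"
    using assms
  proof (induction p)
    case 0
    define J :: "nat \<Rightarrow> nat set" where "J n = {}" for n
    define D :: "nat \<Rightarrow> (nat \<Rightarrow> 'a) \<Rightarrow> nat \<Rightarrow> 'a" where "D n x = 0" for n x
    define T :: "nat \<Rightarrow> nat \<Rightarrow> (nat \<Rightarrow> 'a) \<Rightarrow> nat \<Rightarrow> 'a" where "T j n x = 0" for j n x
    have S: "ci_lift f 0 J D T" by (simp add: ci_lift_def J_def D_def T_def Lin_def)
    have fr0: "fr {} = {0}" by (auto simp: fr_def)
    have "exact_mod f 0 J D" by (auto simp: exact_mod_def J_def D_def fr0)
    moreover have "adapted 0 J D"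
    proof -
      have "D 0 = dp 0"
        using Lin_fr[OF dp_lin[of 0]] by (auto simp: D_def N_0 fr0)
      then show ?thesis by (simp add: adapted_def J_def N_0)
    qed
    moreover have "expanded J D T 0 0 (\<lambda>_ _ _. 0)"
    proof -
      have null: "u = 0" if "u \<in> Hm \<rho> {}" for u :: "(nat \<Rightarrow> 'a) \<Rightarrow> 'k"
      proof
        fix x :: "nat \<Rightarrow> 'a"
        have "tr {} x = 0" by (auto simp: tr_def)
        then show "u x = 0 x" using Hm_tr[OF that, of x] Hm_zero[OF that] by simp
      qed
      have "u \<in> Bc \<rho> J D n" if "u \<in> Zc \<rho> J D n" for u n
        using null[of u] Zc_Hm[OF that] vec.subspace_0[OF Bc_subspace, of \<rho> J D n] by (simp add: J_def)
      moreover have "Idx L 0 0 n = {}" for n by (auto simp: Idx_def)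
      ultimately show ?thesis by (simp add: expands_def basis_mod_def)
    qed
    ultimately show ?case using S by blast
  next
    case (Suc p)
    obtain J D T v where *: "ci_lift f p J D T" "exact_mod f p J D" "adapted p J D" "expanded J D T p p v"
      using Suc.IH[OF Suc_leD[OF Suc.prems]] by blast
    obtain J' D' v' where J': "ci_lift f p J' D' T" "exact_mod f p J' D'" "adapted (Suc p) J' D'"
        "expanded J' D' T (Suc p) p v'"
      using box[OF _ *] Suc.prems by (metis Suc_le_lessD)
    obtain J'' D'' T'' where J'': "ci_lift f (Suc p) J'' D'' T''" "exact_mod f (Suc p) J'' D''"
        "adapted (Suc p) J'' D''"
      using adapted_exists[OF Suc.prems] by metis
    show ?case using hypersurface_step[OF Suc.prems J'' J'] J'' by blast
  qed
  then show thesis using that by blast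
qed

end

section \<open>Local rings\<close>

lemma proper_ideal_in_maximal:
  assumes "is_ideal (I :: 'a::comm_ring_1 set)" "I \<noteq> UNIV"
  obtains J where "maximal_ideal J" "I \<subseteq> J"
proof -
  have ideal: "is_ideal K \<longleftrightarrow> ring_module.subspace K" for K :: "'a set"
    by (simp add: is_ideal_def submodule_def ring_module.module_axioms)
  have proper: "K \<noteq> UNIV \<longleftrightarrow> 1 \<notin> K" if "is_ideal K" for K :: "'a set"
    using ring_module.subspace_scale[of K 1] that unfolding ideal by auto
  let ?A = "{K. is_ideal K \<and> I \<subseteq> K \<and> K \<noteq> UNIV}"
  have "\<exists>J\<in>?A. \<forall>K\<in>?A. J \<subseteq> K \<longrightarrow> K = J"
  proof (rule subset_Zorn_nonempty)
    show "?A \<noteq> {}" using assms by auto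
    fix C assume C: "C \<noteq> {}" "subset.chain ?A C"
    have CA: "K \<in> ?A" if "K \<in> C" for K using C(2) that unfolding subset_chain_def by blast
    obtain K0 where K0: "K0 \<in> C" using C(1) by auto
    have "is_ideal (\<Union>C)" unfolding ideal ring_module.subspace_def
    proof (intro conjI ballI allI)
      show "0 \<in> \<Union>C" using K0 CA[OF K0] ring_module.subspace_0 ideal by blast
      fix x y assume "x \<in> \<Union>C" "y \<in> \<Union>C"
      then obtain K K' where K: "K \<in> C" "x \<in> K" "K' \<in> C" "y \<in> K'" by auto
      then have "K \<subseteq> K' \<or> K' \<subseteq> K" using C(2) unfolding subset_chain_def by blast
      then have "\<exists>K''\<in>C. x \<in> K'' \<and> y \<in> K''" using K by blast
      then show "x + y \<in> \<Union>C" using CA ring_module.subspace_add ideal by blast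
    next
      fix r x assume "x \<in> \<Union>C"
      then show "r * x \<in> \<Union>C" using CA ring_module.subspace_scale ideal by blast
    qed
    moreover have "1 \<notin> \<Union>C" using CA proper by blast
    moreover have "I \<subseteq> \<Union>C" using CA[OF K0] K0 by blast
    ultimately show "\<Union>C \<in> ?A" using proper by blast
  qed
  then obtain J where "J \<in> ?A" "\<forall>K\<in>?A. J \<subseteq> K \<longrightarrow> K = J" by blast
  then have "maximal_ideal J" "I \<subseteq> J" unfolding maximal_ideal_def by auto
  then show thesis by (rule that)
qed

section \<open>Coordinates\<close>

text \<open>Linear combinations of a family \<open>b\<close>, families that are bases, and coordinates.\<close>

definition lc :: "('a \<Rightarrow> 'm \<Rightarrow> 'm) \<Rightarrow> 'i set \<Rightarrow> ('i \<Rightarrow> 'm) \<Rightarrow> ('i \<Rightarrow> 'a) \<Rightarrow> 'm::comm_monoid_add" where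
  "lc s K b x = (\<Sum>k\<in>K. s (x k) (b k))"

definition free_on :: "('a::comm_ring_1 \<Rightarrow> 'm \<Rightarrow> 'm) \<Rightarrow> 'i set \<Rightarrow> ('i \<Rightarrow> 'm) \<Rightarrow> 'm::ab_group_add set \<Rightarrow> bool" where
  "free_on s K b X \<longleftrightarrow> module s \<and> finite K \<and> (\<forall>x\<in>fr K. lc s K b x = 0 \<longrightarrow> x = 0) \<and> lc s K b ` fr K = X"

definition crd :: "('a::comm_ring_1 \<Rightarrow> 'm \<Rightarrow> 'm) \<Rightarrow> 'i set \<Rightarrow> ('i \<Rightarrow> 'm) \<Rightarrow> 'm::ab_group_add \<Rightarrow> 'i \<Rightarrow> 'a" where
  "crd s K b = inv_into (fr K) (lc s K b)"

lemma lc_cong: "(\<And>k. k \<in> K \<Longrightarrow> x k = y k) \<Longrightarrow> lc s K b x = lc s K b y"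
  unfolding lc_def by (intro sum.cong) simp_all

lemma lc_tr: "lc s K b (tr K x) = lc s K b x"
  by (rule lc_cong) (simp add: tr_def)

lemma lc_add: "module s \<Longrightarrow> lc s K b (x + y) = lc s K b x + lc s K b y"
  by (simp add: lc_def module.scale_left_distrib sum.distrib)

lemma lc_sc: "module s \<Longrightarrow> lc s K b (sc r x) = s r (lc s K b x)"
  by (simp add: lc_def module.scale_sum_right module.scale_scale)

lemma lc_diff: "module s \<Longrightarrow> lc s K b (x - y) = lc s K b x - lc s K b y"
  by (simp add: lc_def module.scale_left_diff_distrib sum_subtractf)

lemma lc_sub:
  assumes "module s" "finite K" "K' \<subseteq> K" "x \<in> fr K'"
  shows "lc s K b x = lc s K' b x"
  unfolding lc_def
  by (rule sum.mono_neutral_right[OF assms(2,3)])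
    (use assms(4) in \<open>auto simp: fr_def module.scale_zero_left[OF assms(1)]\<close>)

lemma lc_unit: "module s \<Longrightarrow> finite K \<Longrightarrow> k \<in> K \<Longrightarrow> lc s K b (unit_vec k) = b k"
proof -
  assume s: "module s" and K: "finite K" "k \<in> K"
  have "lc s K b (unit_vec k) = (\<Sum>i\<in>K. if i = k then b k else 0)"
    unfolding lc_def by (rule sum.cong) (auto simp: unit_vec_def module.scale_one[OF s] module.scale_zero_left[OF s])
  then show ?thesis using K by simp
qed

context
  fixes s :: "'a::comm_ring_1 \<Rightarrow> 'm \<Rightarrow> 'm::ab_group_add" and K :: "'i set" and b X
  assumes free: "free_on s K b X"
begin

lemma free_on_module: "module s" and free_on_finite: "finite K"
  and free_on_zero: "x \<in> fr K \<Longrightarrow> lc s K b x = 0 \<Longrightarrow> x = 0"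
  and free_on_image: "lc s K b ` fr K = X"
  using free by (auto simp: free_on_def)

lemma lc_in: "lc s K b x \<in> X"
  using free_on_image lc_tr[of s K b x] tr_fr[of K x] by (metis imageI)

lemma free_on_in: "k \<in> K \<Longrightarrow> b k \<in> X"
  using lc_in[of "unit_vec k"] lc_unit[OF free_on_module free_on_finite] by simp

lemma free_on_inj: "inj_on (lc s K b) (fr K)"
proof (rule inj_onI)
  fix x y assume "x \<in> fr K" "y \<in> fr K" "lc s K b x = lc s K b y"
  then have "x - y = 0" by (intro free_on_zero) (simp_all add: fr_diff lc_diff[OF free_on_module])
  then show "x = y" by simp
qed

lemma crd_fr: "y \<in> X \<Longrightarrow> crd s K b y \<in> fr K"
  unfolding crd_def by (rule inv_into_into) (simp add: free_on_image)

lemma lc_crd: "y \<in> X \<Longrightarrow> lc s K b (crd s K b y) = y"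
  unfolding crd_def using f_inv_into_f[of y "lc s K b" "fr K"] free_on_image by simp

lemma crd_lc: "crd s K b (lc s K b x) = tr K x"
  using inv_into_f_f[OF free_on_inj tr_fr[of K x]] by (simp add: crd_def lc_tr)

lemma crd_eqI: "x \<in> fr K \<Longrightarrow> lc s K b x = y \<Longrightarrow> crd s K b y = x"
  using crd_lc[of x] by (simp add: tr_id)

lemma free_on_submodule: "submodule s X"
  unfolding submodule_def module.subspace_def[OF free_on_module]
proof (intro conjI free_on_module ballI allI)
  show "0 \<in> X" using lc_in[of 0] by (simp add: lc_def module.scale_zero_left[OF free_on_module])
  fix x y assume "x \<in> X" "y \<in> X"
  then show "x + y \<in> X" using lc_in[of "crd s K b x + crd s K b y"]
    by (simp add: lc_add[OF free_on_module] lc_crd)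
next
  fix r x assume "x \<in> X"
  then show "s r x \<in> X" using lc_in[of "sc r (crd s K b x)"]
    by (simp only: lc_sc[OF free_on_module] lc_crd)
qed

lemma crd_add: "x \<in> X \<Longrightarrow> y \<in> X \<Longrightarrow> crd s K b (x + y) = crd s K b x + crd s K b y"
  by (rule crd_eqI) (simp_all add: fr_add crd_fr lc_add[OF free_on_module] lc_crd)

lemma crd_diff: "x \<in> X \<Longrightarrow> y \<in> X \<Longrightarrow> crd s K b (x - y) = crd s K b x - crd s K b y"
  by (rule crd_eqI) (simp_all add: fr_diff crd_fr lc_diff[OF free_on_module] lc_crd)

lemma crd_scale: "x \<in> X \<Longrightarrow> crd s K b (s r x) = sc r (crd s K b x)"
  by (rule crd_eqI) (simp_all only: fr_sc crd_fr lc_sc[OF free_on_module] lc_crd)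

lemma crd_sub:
  assumes "K' \<subseteq> K" "y \<in> lc s K' b ` fr K'"
  shows "crd s K b y \<in> fr K'"
proof -
  obtain x where x: "x \<in> fr K'" "y = lc s K' b x" using assms(2) by auto
  then have "crd s K b y = x"
    using lc_sub[OF free_on_module free_on_finite assms(1) x(1)] fr_mono[OF assms(1) x(1)]
    by (intro crd_eqI) simp_all
  then show ?thesis using x by simp
qed

lemma ideal_times_crd:
  assumes J: "is_ideal J" and y: "y \<in> ideal_times s J X"
  shows "y \<in> X" "crd s K b y k \<in> J"
proof -
  have J': "ring_module.subspace J" using J by (simp add: is_ideal_def submodule_def)
  let ?S = "{y \<in> X. \<forall>k. crd s K b y k \<in> J}"
  have "module.subspace s ?S" unfolding module.subspace_def[OF free_on_module]
  proof (intro conjI ballI allI)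
    have "crd s K b 0 = 0" by (rule crd_eqI) (simp_all add: lc_def module.scale_zero_left[OF free_on_module])
    then show "0 \<in> ?S" using submodule_0[OF free_on_submodule] ring_module.subspace_0[OF J'] by simp
    show "x + y \<in> ?S" if "x \<in> ?S" "y \<in> ?S" for x y
      using that submodule_add[OF free_on_submodule] ring_module.subspace_add[OF J'] by (simp add: crd_add)
    show "s r x \<in> ?S" if "x \<in> ?S" for r x
      using that submodule_scale[OF free_on_submodule] ring_module.subspace_scale[OF J'] by (simp add: crd_scale)
  qed
  moreover have "{s r x | r x. r \<in> J \<and> x \<in> X} \<subseteq> ?S"
  proof clarify
    fix r x assume "r \<in> J" "x \<in> X"
    then show "s r x \<in> X \<and> (\<forall>k. crd s K b (s r x) k \<in> J)"
      using submodule_scale[OF free_on_submodule] ring_module.subspace_scale[OF J', of r]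
      by (simp add: crd_scale mult.commute[of r])
  qed
  ultimately have "ideal_times s J X \<subseteq> ?S"
    unfolding ideal_times_def by (rule module.span_minimal[OF free_on_module, rotated])
  then show "y \<in> X" "crd s K b y k \<in> J" using y by auto
qed

lemma crd_ideal_times:
  assumes "y \<in> X" "\<And>k. crd s K b y k \<in> J"
  shows "y \<in> ideal_times s J X"
proof -
  have "lc s K b (crd s K b y) \<in> ideal_times s J X"
    unfolding lc_def ideal_times_def
    by (intro module.span_sum[OF free_on_module] module.span_base[OF free_on_module])
      (use assms(2) free_on_in in blast)
  then show ?thesis by (simp add: lc_crd assms(1))
qed

end

text \<open>The indices can be chosen outside a given finite set, as needed for nested bases.\<close>

lemma fin_free_free_on:
  fixes s :: "'a::comm_ring_1 \<Rightarrow> 'm \<Rightarrow> 'm::ab_group_add" and K0 :: "nat set"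
  assumes "fin_free s X" "finite K0"
  obtains K :: "nat set" and b where "K \<inter> K0 = {}" "free_on s K b X"
proof -
  obtain B where s: "module s" and B: "finite B" "\<not> module.dependent s B" "module.span s B = X"
    using assms(1) by (auto simp: fin_free_def)
  interpret module s by (rule s)
  obtain m where m: "\<And>k. k \<in> K0 \<Longrightarrow> k < m" using assms(2) by (meson finite_nat_set_iff_bounded)
  obtain e where e: "bij_betw e B {..<card B}"
    using ex_bij_betw_finite_nat[OF B(1)] by (auto simp: atLeast0LessThan)
  define g where "g v = m + e v" for v
  have g: "inj_on g B" using e by (auto simp: g_def inj_on_def bij_betw_def)
  let ?K = "g ` B" and ?b = "inv_into B g"
  have lc: "lc s ?K ?b x = (\<Sum>v\<in>B. s (x (g v)) v)" for x
    unfolding lc_def by (simp add: sum.reindex[OF g] inv_into_f_f[OF g])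
  show thesis
  proof (rule that)
    show "?K \<inter> K0 = {}" using m by (fastforce simp: g_def)
    show "free_on s ?K ?b X" unfolding free_on_def
    proof (intro conjI ballI impI s subset_antisym subsetI)
      show "finite ?K" using B by simp
      fix x assume x: "x \<in> fr ?K" "lc s ?K ?b x = 0"
      have "x (g v) = 0" if "v \<in> B" for v
        using independentD[OF _ B(1) subset_refl x(2)[unfolded lc] that] B(2) by simp
      then have "x k = 0" for k using x(1) by (cases "k \<in> ?K") (auto simp: fr_def)
      then show "x = 0" by (simp add: fun_eq_iff)
    next
      fix y assume "y \<in> lc s ?K ?b ` fr ?K"
      then obtain x where "y = (\<Sum>v\<in>B. s (x (g v)) v)" unfolding lc by blast
      then show "y \<in> X" unfolding B(3)[symmetric]
        by (simp only:) (intro span_sum span_scale span_base)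
    next
      fix y assume "y \<in> X"
      then obtain u where u: "y = (\<Sum>v\<in>B. s (u v) v)" using B(3) span_finite[OF B(1)] by auto
      let ?x = "tr ?K (\<lambda>k. u (?b k))"
      have "lc s ?K ?b ?x = y" unfolding lc u
        by (rule sum.cong) (simp_all add: tr_def inv_into_f_f[OF g])
      then show "y \<in> lc s ?K ?b ` fr ?K" by (metis imageI tr_fr)
    qed
  qed
qed

lemma quotient_byD:
  assumes "quotient_by \<sigma> s X s' Y N g"
  shows quotient_submodule: "submodule s' Y" and quotient_lin: "semilinear_on \<sigma> s X s' Y g"
    and quotient_image: "g ` X = Y" and quotient_kernel: "x \<in> X \<Longrightarrow> g x = 0 \<longleftrightarrow> x \<in> N"
    and quotient_subset: "N \<subseteq> X"
  using assms by (auto simp: quotient_by_def)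

lemma free_on_extension:
  fixes K K' :: "nat set"
  assumes X: "submodule s X" and N: "free_on s K b N" and Y: "free_on s' K' \<beta> Y" and disj: "K \<inter> K' = {}"
    and q: "quotient_by (\<lambda>r. r) s X s' Y N g"
    and b': "\<And>k. k \<in> K' \<Longrightarrow> b' k \<in> X \<and> g (b' k) = \<beta> k" "\<And>k. k \<in> K \<Longrightarrow> b' k = b k"
  shows "free_on s (K \<union> K') b' X"
proof -
  note s = free_on_module[OF N] and s' = free_on_module[OF Y] and fin = free_on_finite[OF N] free_on_finite[OF Y]
  have split: "lc s (K \<union> K') b' x = lc s K b x + lc s K' b' x" for x
    unfolding lc_def by (simp add: sum.union_disjoint[OF fin disj] b'(2))
  have KX: "lc s K b x \<in> X" for x using lc_in[OF N] quotient_subset[OF q] by blast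
  have g0: "g (lc s K b x) = 0" for x using lc_in[OF N] quotient_kernel[OF q KX] by blast
  have K'X: "lc s K' b' x \<in> X" for x
    unfolding lc_def using b' by (intro submodule_sum[OF X] submodule_scale[OF X]) auto
  have "g (lc s K' b' x) = (\<Sum>k\<in>K'. s' (x k) (g (b' k)))" for x
    unfolding lc_def using b' by (intro lin_on_comb[OF quotient_lin[OF q] X]) auto
  then have g': "g (lc s K' b' x) = lc s' K' \<beta> x" for x
    unfolding lc_def using b' by simp
  have gx: "g (lc s (K \<union> K') b' x) = lc s' K' \<beta> x" for x
    unfolding split lin_on_add[OF quotient_lin[OF q] KX K'X] g0 g' by simp
  show ?thesis unfolding free_on_def
  proof (intro conjI ballI impI s subset_antisym subsetI)
    show "finite (K \<union> K')" using fin by simp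
    fix x assume x: "x \<in> fr (K \<union> K')" "lc s (K \<union> K') b' x = 0"
    have "lc s' K' \<beta> (tr K' x) = 0"
      using gx[of x] lin_on_0[OF quotient_lin[OF q] X] by (simp add: x(2) lc_tr)
    then have 1: "tr K' x = 0" by (rule free_on_zero[OF Y tr_fr])
    then have "lc s K' b' x = 0"
      using lc_tr[of s K' b' x] by (simp add: lc_def module.scale_zero_left[OF s])
    then have "lc s K b (tr K x) = 0" using x(2) by (simp add: split lc_tr)
    then have 2: "tr K x = 0" by (rule free_on_zero[OF N tr_fr])
    show "x = 0"
    proof
      fix k
      show "x k = 0 k"
        using fun_cong[OF 1, of k] fun_cong[OF 2, of k] x(1) by (auto simp: tr_def fr_def split: if_splits)
    qed
  next
    fix y assume "y \<in> lc s (K \<union> K') b' ` fr (K \<union> K')"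
    then show "y \<in> X" using submodule_add[OF X KX K'X] by (auto simp: split)
  next
    fix y assume y: "y \<in> X"
    then have gy: "g y \<in> Y" using quotient_image[OF q] by blast
    let ?x' = "crd s' K' \<beta> (g y)"
    have "g (y - lc s K' b' ?x') = 0"
      using lin_on_diff[OF quotient_lin[OF q] X y K'X] by (simp add: g' lc_crd[OF Y gy])
    then have N': "y - lc s K' b' ?x' \<in> N" using quotient_kernel[OF q] submodule_diff[OF X y K'X] by blast
    let ?x0 = "crd s K b (y - lc s K' b' ?x')"
    have x0: "?x0 \<in> fr K" and x': "?x' \<in> fr K'" using crd_fr[OF N N'] crd_fr[OF Y gy] by auto
    have "lc s K b (?x0 + ?x') = lc s K b ?x0" "lc s K' b' (?x0 + ?x') = lc s K' b' ?x'"
      using x0 x' disj by (auto intro!: lc_cong simp: fr_def)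
    then have "y = lc s (K \<union> K') b' (?x0 + ?x')" by (simp add: split lc_crd[OF N N'])
    moreover have "?x0 + ?x' \<in> fr (K \<union> K')"
      using x0 x' by (intro fr_add) (auto intro: fr_mono[rotated])
    ultimately show "y \<in> lc s (K \<union> K') b' ` fr (K \<union> K')" by (rule image_eqI)
  qed
qed

text \<open>Each basis of \<open>A p\<close> is extended by lifts of a basis of the quotient \<open>B (p+1)\<close>.  Beyond \<open>n\<close> the
  sequence \<open>K\<close> is constant, which keeps it monotone.\<close>

lemma nested_bases:
  fixes A :: "nat \<Rightarrow> 'm::ab_group_add set" and B :: "nat \<Rightarrow> 'b::ab_group_add set"
  assumes sA: "module sA" and A0: "A 0 = {0}" and AX: "\<And>p. p \<le> n \<Longrightarrow> submodule sA (A p)"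
    and q: "\<And>p. p \<in> {1..n} \<Longrightarrow> quotient_by (\<lambda>r. r) sA (A p) sB (B p) (A (p - 1)) (\<pi> p)"
    and B: "\<And>p. p \<in> {1..n} \<Longrightarrow> fin_free sB (B p)"
  shows "\<exists>(K :: nat \<Rightarrow> nat set) b. K 0 = {} \<and> (\<forall>p. finite (K p)) \<and> (\<forall>p q. p \<le> q \<longrightarrow> K p \<subseteq> K q) \<and>
     (\<forall>p\<ge>n. K p = K n) \<and> (\<forall>p\<le>n. free_on sA (K p) b (A p)) \<and>
     (\<forall>p\<in>{1..n}. free_on sB (K p - K (p - 1)) (\<pi> p \<circ> b) (B p))"
  using AX q B
proof (induction n)
  case 0
  have "free_on sA {} b {0}" for b :: "nat \<Rightarrow> 'm"
    using sA by (auto simp: free_on_def lc_def fr_def fun_eq_iff intro!: image_eqI[of _ _ 0])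
  then show ?case by (intro exI[of _ "\<lambda>_. {}"]) (simp add: A0)
next
  case (Suc n)
  have "\<exists>(K :: nat \<Rightarrow> nat set) b. K 0 = {} \<and> (\<forall>p. finite (K p)) \<and> (\<forall>p q. p \<le> q \<longrightarrow> K p \<subseteq> K q) \<and>
     (\<forall>p\<ge>n. K p = K n) \<and> (\<forall>p\<le>n. free_on sA (K p) b (A p)) \<and>
     (\<forall>p\<in>{1..n}. free_on sB (K p - K (p - 1)) (\<pi> p \<circ> b) (B p))"
    by (rule Suc.IH) (use Suc.prems in auto)
  then obtain K :: "nat \<Rightarrow> nat set" and b where Kb: "K 0 = {} \<and> (\<forall>p. finite (K p)) \<and>
     (\<forall>p q. p \<le> q \<longrightarrow> K p \<subseteq> K q) \<and> (\<forall>p\<ge>n. K p = K n) \<and> (\<forall>p\<le>n. free_on sA (K p) b (A p)) \<and>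
     (\<forall>p\<in>{1..n}. free_on sB (K p - K (p - 1)) (\<pi> p \<circ> b) (B p))"
    by (elim exE)
  then have K: "K 0 = {}" "\<And>p. finite (K p)" "\<And>p q. p \<le> q \<Longrightarrow> K p \<subseteq> K q"
    "\<And>p. p \<ge> n \<Longrightarrow> K p = K n" "\<And>p. p \<le> n \<Longrightarrow> free_on sA (K p) b (A p)"
    "\<And>p. p \<in> {1..n} \<Longrightarrow> free_on sB (K p - K (p - 1)) (\<pi> p \<circ> b) (B p)"
    by blast+
  obtain K' \<beta> where K': "K' \<inter> K n = {}" "free_on sB K' \<beta> (B (Suc n))"
    using fin_free_free_on[OF Suc.prems(3)[of "Suc n"] K(2)[of n]] by auto
  have q: "quotient_by (\<lambda>r. r) sA (A (Suc n)) sB (B (Suc n)) (A n) (\<pi> (Suc n))"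
    using Suc.prems(2)[of "Suc n"] by simp
  have "\<exists>a. k \<in> K' \<longrightarrow> a \<in> A (Suc n) \<and> \<pi> (Suc n) a = \<beta> k" for k
    using free_on_in[OF K'(2)] quotient_image[OF q] by (metis imageE)
  then obtain a where a: "\<And>k. k \<in> K' \<Longrightarrow> a k \<in> A (Suc n) \<and> \<pi> (Suc n) (a k) = \<beta> k" by metis
  define b' where "b' k = (if k \<in> K' then a k else b k)" for k
  define K1 where "K1 p = (if p \<le> n then K p else K n \<union> K')" for p
  have disj: "K p \<inter> K' = {}" if "p \<le> n" for p using K'(1) K(3)[OF that] by auto
  have lceq: "lc s (K p - M) (\<tau> \<circ> b') = lc s (K p - M) (\<tau> \<circ> b)" if "p \<le> n" for s p M and \<tau> :: "'m \<Rightarrow> 'x::comm_monoid_add"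
    unfolding lc_def using disj[OF that] by (intro ext sum.cong) (auto simp: b'_def)
  have fA: "free_on sA (K p) b' (A p)" if "p \<le> n" for p
    using K(5)[OF that] lceq[OF that, of sA "{}" "\<lambda>x. x"] by (simp add: free_on_def comp_def)
  have fB: "free_on sB (K p - K (p - 1)) (\<pi> p \<circ> b') (B p)" if "p \<in> {1..n}" for p
    using K(6)[OF that] lceq[of p sB "K (p - 1)" "\<pi> p"] that by (simp add: free_on_def)
  have fA1: "free_on sA (K n \<union> K') b' (A (Suc n))"
  proof (rule free_on_extension[OF Suc.prems(1) K(5) K'(2) disj q])
    show "b' k \<in> A (Suc n) \<and> \<pi> (Suc n) (b' k) = \<beta> k" if "k \<in> K'" for k using a[OF that] that by (simp add: b'_def)
    show "b' k = b k" if "k \<in> K n" for k using disj[of n] that by (auto simp: b'_def)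
  qed simp_all
  have "lc sB K' (\<pi> (Suc n) \<circ> b') = lc sB K' \<beta>"
    unfolding lc_def using a by (intro ext sum.cong) (auto simp: b'_def)
  moreover have "K n \<union> K' - K n = K'" using disj[of n] by auto
  ultimately have fB1: "free_on sB (K n \<union> K' - K n) (\<pi> (Suc n) \<circ> b') (B (Suc n))"
    using K'(2) by (simp add: free_on_def)
  show ?case
  proof (intro exI[of _ K1] exI[of _ b'] conjI allI impI ballI)
    show "K1 0 = {}" by (simp add: K1_def K)
    show "finite (K1 p)" for p using K(2) free_on_finite[OF K'(2)] by (simp add: K1_def)
    show "K1 p \<subseteq> K1 r" if "p \<le> r" for p r using K(3)[OF that] K(3)[of p n] that by (auto simp: K1_def)
    show "K1 p = K1 (Suc n)" if "Suc n \<le> p" for p using that by (simp add: K1_def)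
    show "free_on sA (K1 p) b' (A p)" if "p \<le> Suc n" for p
      using fA fA1 that by (cases "p = Suc n") (auto simp: K1_def)
    show "free_on sB (K1 p - K1 (p - 1)) (\<pi> p \<circ> b') (B p)" if "p \<in> {1..Suc n}" for p
      using fB[of p] fB1 that by (cases "p = Suc n") (auto simp: K1_def)
  qed
qed

text \<open>A homomorphism in coordinates.\<close>

definition mat :: "('a::comm_ring_1 \<Rightarrow> 'm \<Rightarrow> 'm) \<Rightarrow> 'i set \<Rightarrow> ('i \<Rightarrow> 'm::ab_group_add)
    \<Rightarrow> ('a \<Rightarrow> 'n \<Rightarrow> 'n) \<Rightarrow> 'j set \<Rightarrow> ('j \<Rightarrow> 'n::ab_group_add) \<Rightarrow> ('m \<Rightarrow> 'n) \<Rightarrow> ('i \<Rightarrow> 'a) \<Rightarrow> 'j \<Rightarrow> 'a" where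
  "mat s K b s' K' b' g x = crd s' K' b' (g (lc s K b x))"

lemma mat_Lin:
  assumes X: "free_on s K b X" and Y: "free_on s' K' b' Y" and g: "lin_on s X s' Y g"
  shows "Lin K K' (mat s K b s' K' b' g)"
proof (rule LinI)
  note gi = lin_on_in[OF g lc_in[OF X]]
  show "mat s K b s' K' b' g (x + y) = mat s K b s' K' b' g x + mat s K b s' K' b' g y" for x y
    unfolding mat_def lc_add[OF free_on_module[OF X]] lin_on_add[OF g lc_in[OF X] lc_in[OF X]]
    by (rule crd_add[OF Y gi gi])
  show "mat s K b s' K' b' g (sc r x) = sc r (mat s K b s' K' b' g x)" for r x
    unfolding mat_def lc_sc[OF free_on_module[OF X]] lin_on_scale[OF g lc_in[OF X]]
    by (rule crd_scale[OF Y gi])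
  show "mat s K b s' K' b' g x \<in> fr K'" for x unfolding mat_def by (rule crd_fr[OF Y gi])
  show "mat s K b s' K' b' g (tr K x) = mat s K b s' K' b' g x" for x unfolding mat_def lc_tr ..
qed

lemma lc_mat:
  assumes X: "free_on s K b X" and Y: "free_on s' K' b' Y" and g: "lin_on s X s' Y g"
  shows "lc s' K' b' (mat s K b s' K' b' g x) = g (lc s K b x)"
  unfolding mat_def by (rule lc_crd[OF Y lin_on_in[OF g lc_in[OF X]]])

lemma gen_ideal_ideal: "is_ideal (gen_ideal f p)"
  unfolding is_ideal_def submodule_def gen_ideal_def
  by (intro conjI ring_module.module_axioms ring_module.subspace_span)

lemma ideal_times_mono: "module s \<Longrightarrow> X \<subseteq> Y \<Longrightarrow> ideal_times s J X \<subseteq> ideal_times s J Y"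
  unfolding ideal_times_def by (rule module.span_mono) auto

lemma fin_free_submodule: "fin_free s X \<Longrightarrow> submodule s X"
  using fin_free_free_on[of s X "{}"] free_on_submodule by (metis finite.emptyI)

lemma inj_at_add: "inj_at p (x + y) = inj_at p x + (inj_at p y :: nat \<Rightarrow> 'm::ab_group_add)"
  by (auto simp: inj_at_def)

text \<open>A translation of the data into coordinates: ideal multiples of a free module are the vectors with
  coordinates in the ideal, and the projections \<open>\<pi>\<^sub>p\<close> forget the coordinates that belong to \<open>A(p-1)\<close>.\<close>

lemma hmf_coordinates:
  fixes A :: "nat \<Rightarrow> nat \<Rightarrow> 'm::ab_group_add set" and B :: "nat \<Rightarrow> nat \<Rightarrow> 'b::ab_group_add set"
    and f :: "nat \<Rightarrow> 'a::comm_ring_1" and \<rho> :: "'a \<Rightarrow> 'k::field"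
  assumes rc: "residue_ci \<rho> f c" and noeth: "noetherian TYPE('a)" and m: "is_ideal {x. \<rho> x = 0}"
    and hmf: "higher_matrix_factorization c f sA A sB B \<pi> d h"
    and min: "hmf_minimal c {x. \<rho> x = 0} sA A d h"
  shows "\<exists>N bA d' h'. hmf_coords \<rho> f c N d' h' \<and>
     (\<forall>i\<in>{0,1}. \<forall>p\<in>{1..c}. free_on sB (N i p - N i (p - 1)) (\<pi> i p \<circ> bA i) (B i p)) \<and>
     (\<forall>i\<in>{0,1}. free_on sA (N i c) (bA i) (A i c)) \<and>
     (\<forall>x. lc sA (N 0 c) (bA 0) (d' x) = d (lc sA (N 1 c) (bA 1) x))"
proof -
  note H = hmf[unfolded higher_matrix_factorization_def]
  have A0: "A i 0 = {0}" and Ac: "fin_free sA (A i c)"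
    and Ap: "p \<in> {1..c} \<Longrightarrow> fin_free sA (A i (p - 1))"
    and q: "p \<in> {1..c} \<Longrightarrow> quotient_by (\<lambda>r. r) sA (A i p) sB (B i p) (A i (p - 1)) (\<pi> i p)"
    and fB: "p \<in> {1..c} \<Longrightarrow> fin_free sB (B i p)" if "i \<in> {0,1}" for i p
    using H that by blast+
  have dl: "lin_on sA (A 1 c) sA (A 0 c) d"
    and hl: "lin_on (\<lambda>r x q. sA r (x q)) (fam_sum (A 0) c) sA (A 1 c) h"
    and df: "\<And>p. p \<in> {1..c} \<Longrightarrow> d ` A 1 p \<subseteq> A 0 p"
    and hf: "\<And>p. p \<in> {1..c} \<Longrightarrow> h ` fam_sum (A 0) p \<subseteq> A 1 p"
    and dh: "\<And>p x. p \<in> {1..c} \<Longrightarrow> x \<in> A 0 p \<Longrightarrow>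
        d (h (inj_at p x)) - sA (f p) x \<in> ideal_times sA (gen_ideal f (p - 1)) (A 0 p)"
    and hd: "\<And>p x. p \<in> {1..c} \<Longrightarrow> x \<in> A 1 p \<Longrightarrow>
        \<pi> 1 p (h (inj_at p (d x))) - sB (f p) (\<pi> 1 p x) \<in> ideal_times sB (gen_ideal f (p - 1)) (B 1 p)"
    using H by blast+
  have fA: "fin_free sA (A i p)" if "i \<in> {0,1}" "p \<le> c" for i p
    using Ac[OF that(1)] Ap[OF that(1), of "Suc p"] that(2) by (cases "p = c") auto
  have sA: "module sA" using Ac[of 0] by (simp add: fin_free_def)
  have bases: "\<exists>(K :: nat \<Rightarrow> nat set) b. K 0 = {} \<and> (\<forall>p. finite (K p)) \<and> (\<forall>p q. p \<le> q \<longrightarrow> K p \<subseteq> K q) \<and>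
     (\<forall>p\<ge>c. K p = K c) \<and> (\<forall>p\<le>c. free_on sA (K p) b (A i p)) \<and>
     (\<forall>p\<in>{1..c}. free_on sB (K p - K (p - 1)) (\<pi> i p \<circ> b) (B i p))" if "i \<in> {0,1}" for i
    by (rule nested_bases[OF sA A0[OF that] _ q[OF that] fB[OF that]])
      (use fA[OF that] fin_free_submodule in blast)
  have "\<forall>i. \<exists>(K :: nat \<Rightarrow> nat set) b. K 0 = {} \<and> (\<forall>p. finite (K p)) \<and> (\<forall>p q. p \<le> q \<longrightarrow> K p \<subseteq> K q) \<and>
     (i \<in> {0,1} \<longrightarrow> (\<forall>p\<le>c. free_on sA (K p) b (A i p)) \<and>
     (\<forall>p\<in>{1..c}. free_on sB (K p - K (p - 1)) (\<pi> i p \<circ> b) (B i p)))"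
  proof
    fix i
    show "\<exists>(K :: nat \<Rightarrow> nat set) b. K 0 = {} \<and> (\<forall>p. finite (K p)) \<and> (\<forall>p q. p \<le> q \<longrightarrow> K p \<subseteq> K q) \<and>
     (i \<in> {0,1} \<longrightarrow> (\<forall>p\<le>c. free_on sA (K p) b (A i p)) \<and>
     (\<forall>p\<in>{1..c}. free_on sB (K p - K (p - 1)) (\<pi> i p \<circ> b) (B i p)))"
    proof (cases "i \<in> {0,1}")
      case True
      from bases[OF this] show ?thesis by blast
    next
      case False
      then show ?thesis by (intro exI[of _ "\<lambda>_. {}"]) simp
    qed
  qed
  from this[THEN choice] obtain N :: "nat \<Rightarrow> nat \<Rightarrow> nat set" where "\<forall>i. \<exists>b. N i 0 = {} \<and> (\<forall>p. finite (N i p)) \<and>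
     (\<forall>p q. p \<le> q \<longrightarrow> N i p \<subseteq> N i q) \<and> (i \<in> {0,1} \<longrightarrow> (\<forall>p\<le>c. free_on sA (N i p) b (A i p)) \<and>
     (\<forall>p\<in>{1..c}. free_on sB (N i p - N i (p - 1)) (\<pi> i p \<circ> b) (B i p)))" by (elim exE)
  from this[THEN choice] obtain bA where Nb: "\<forall>i. N i 0 = {} \<and> (\<forall>p. finite (N i p)) \<and>
     (\<forall>p q. p \<le> q \<longrightarrow> N i p \<subseteq> N i q) \<and> (i \<in> {0,1} \<longrightarrow> (\<forall>p\<le>c. free_on sA (N i p) (bA i) (A i p)) \<and>
     (\<forall>p\<in>{1..c}. free_on sB (N i p - N i (p - 1)) (\<pi> i p \<circ> bA i) (B i p)))" by (elim exE)
  have N0: "N i 0 = {}" for i using spec[OF Nb, of i] by (elim conjE)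
  have Nfin: "finite (N i p)" for i p using spec[OF Nb, of i] by (elim conjE) (rule spec)
  have Nmono: "N i p \<subseteq> N i q" if "p \<le> q" for i p q
    using spec[OF Nb, of i] that by (elim conjE) (simp only:)
  have freeA: "free_on sA (N i p) (bA i) (A i p)" if "i \<in> {0,1}" "p \<le> c" for i p
    using spec[OF Nb, of i] that by (elim conjE) (simp only:)
  have freeB: "free_on sB (N i p - N i (p - 1)) (\<pi> i p \<circ> bA i) (B i p)" if "i \<in> {0,1}" "p \<in> {1..c}" for i p
    using spec[OF Nb, of i] that by (elim conjE) (drule mp, assumption, elim conjE, erule bspec)
  have free0: "free_on sA (N 0 p) (bA 0) (A 0 p)" and free1: "free_on sA (N 1 p) (bA 1) (A 1 p)" if "p \<le> c" for p
    using freeA[of _ p] that by auto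
  note free0c = free0[OF order_refl] and free1c = free1[OF order_refl]
  have lc_eq: "lc sA (N i c) (bA i) x = lc sA (N i p) (bA i) x" if "p \<le> c" "x \<in> fr (N i p)" for i p x
    by (rule lc_sub[OF sA Nfin Nmono[OF that(1)] that(2)])
  have AA: "A i p \<subseteq> A i c" if i: "i \<in> {0,1}" "p \<le> c" for i p
  proof
    fix y assume "y \<in> A i p"
    then obtain x where "x \<in> fr (N i p)" "y = lc sA (N i p) (bA i) x"
      using free_on_image[OF freeA[OF i]] by blast
    then show "y \<in> A i c" using lc_eq[OF i(2)] lc_in[OF freeA[OF i(1) order_refl]] by metis
  qed
  define d' where "d' = mat sA (N 1 c) (bA 1) sA (N 0 c) (bA 0) d"
  define hp where "hp p y = h (inj_at p y)" for p y
  define h' where "h' p = mat sA (N 0 p) (bA 0) sA (N 1 p) (bA 1) (hp p)" for p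
  have inj_mem: "inj_at p y \<in> fam_sum (A 0) r" if "p \<in> {1..r}" "y \<in> A 0 p" "r \<le> c" for p r y
  proof -
    have "0 \<in> A 0 q" if "q \<le> c" for q by (rule submodule_0[OF free_on_submodule[OF free0[OF that]]])
    then show ?thesis using that by (auto simp: fam_sum_def inj_at_def)
  qed
  have hp_lin: "lin_on sA (A 0 p) sA (A 1 p) (hp p)" if p: "p \<in> {1..c}" for p
    unfolding semilinear_on_def
  proof (intro conjI ballI allI)
    show "hp p ` A 0 p \<subseteq> A 1 p" using hf[OF p] inj_mem[of p p] p by (auto simp: hp_def)
    show "hp p (x + y) = hp p x + hp p y" if "x \<in> A 0 p" "y \<in> A 0 p" for x y
      unfolding hp_def inj_at_add by (rule lin_on_add[OF hl inj_mem[OF p] inj_mem[OF p]]) (rule that order_refl)+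
    show "hp p (sA r x) = sA r (hp p x)" if "x \<in> A 0 p" for r x
    proof -
      have "inj_at p (sA r x) = (\<lambda>q. sA r (inj_at p x q))"
        by (auto simp: inj_at_def module.scale_zero_right[OF sA])
      then show ?thesis unfolding hp_def using lin_on_scale[OF hl inj_mem[OF p that order_refl]] by simp
    qed
  qed
  have lc_d: "lc sA (N 0 c) (bA 0) (d' x) = d (lc sA (N 1 c) (bA 1) x)" for x
    unfolding d'_def by (rule lc_mat[OF free1c free0c dl])
  have d'L: "Lin (N 1 c) (N 0 c) d'" unfolding d'_def by (rule mat_Lin[OF free1c free0c dl])
  have h'L: "Lin (N 0 p) (N 1 p) (h' p)" if p: "p \<in> {1..c}" for p
    unfolding h'_def using p by (intro mat_Lin[OF free0 free1 hp_lin]) auto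
  have lc_h: "lc sA (N 1 c) (bA 1) (h' p x) = hp p (lc sA (N 0 p) (bA 0) x)" if p: "p \<in> {1..c}" for p x
  proof -
    have "lc sA (N 1 c) (bA 1) (h' p x) = lc sA (N 1 p) (bA 1) (h' p x)"
      using p by (intro lc_eq Lin_fr[OF h'L]) auto
    then show ?thesis unfolding h'_def using lc_mat[OF free0 free1 hp_lin] p by simp
  qed
  have d'f: "d' x \<in> fr (N 0 p)" if p: "p \<le> c" and x: "x \<in> fr (N 1 p)" for p x
  proof (cases "p = 0")
    case True
    then have "x = 0" using x by (auto simp: N0 fr_def)
    then show ?thesis using Lin_zero[OF d'L] by simp
  next
    case False
    have "lc sA (N 1 c) (bA 1) x \<in> A 1 p" using lc_eq[OF p x] lc_in[OF free1[OF p]] by simp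
    then have "d (lc sA (N 1 c) (bA 1) x) \<in> lc sA (N 0 p) (bA 0) ` fr (N 0 p)"
      using df[of p] False p free_on_image[OF free0[OF p]] by auto
    then show ?thesis unfolding d'_def mat_def by (rule crd_sub[OF free0c Nmono[OF p]])
  qed
  have "hmf_coords \<rho> f c N d' h'"
  proof (intro hmf_coords.intro rc hmf_coords_axioms.intro noeth Nfin N0 Nmono d'L d'f h'L)
    fix p and x :: "nat \<Rightarrow> 'a" assume p: "p \<in> {1..c}" and x: "x \<in> fr (N 0 p)"
    have pc: "p \<le> c" using p by simp
    let ?y = "lc sA (N 0 p) (bA 0) x"
    have y: "?y \<in> A 0 p" by (rule lc_in[OF free0[OF pc]])
    have yc: "?y \<in> A 0 c" using AA[of 0 p] pc y by auto
    have hy: "d (hp p ?y) \<in> A 0 c"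
      using lin_on_in[OF hp_lin[OF p] y] AA[of 1 p] pc lin_on_in[OF dl] by auto
    have "x = crd sA (N 0 c) (bA 0) ?y"
      by (rule crd_eqI[OF free0c, symmetric]) (use lc_eq[OF pc x] fr_mono[OF Nmono[OF pc] x] in auto)
    moreover have "d' (h' p x) = crd sA (N 0 c) (bA 0) (d (hp p ?y))"
      unfolding d'_def mat_def lc_h[OF p] ..
    ultimately have "d' (h' p x) - sc (f p) x = crd sA (N 0 c) (bA 0) (d (hp p ?y) - sA (f p) ?y)"
      using crd_diff[OF free0c hy submodule_scale[OF free_on_submodule[OF free0c] yc]]
        crd_scale[OF free0c yc] by metis
    moreover have "d (hp p ?y) - sA (f p) ?y \<in> ideal_times sA (gen_ideal f (p - 1)) (A 0 c)"
      using dh[OF p y] ideal_times_mono[OF sA AA[of 0 p]] pc unfolding hp_def by blast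
    ultimately show "d' (h' p x) - sc (f p) x \<in> iv f (p - 1)"
      using ideal_times_crd(2)[OF free0c gen_ideal_ideal] by (simp add: iv_def)
  next
    fix p k and x :: "nat \<Rightarrow> 'a" assume p: "p \<in> {1..c}" and x: "x \<in> fr (N 1 p)" and k: "k \<in> N 1 p - N 1 (p - 1)"
    have pc: "p \<le> c" using p by simp
    let ?y = "lc sA (N 1 p) (bA 1) x"
    have y: "?y \<in> A 1 p" by (rule lc_in[OF free1[OF pc]])
    have dy: "d ?y \<in> A 0 p" using df[OF p] y by blast
    have xy: "x = crd sA (N 1 p) (bA 1) ?y" by (rule crd_eqI[OF free1[OF pc] x refl, symmetric])
    have "lc sA (N 0 p) (bA 0) (d' x) = d ?y"
      using lc_eq[OF pc d'f[OF pc x]] lc_d[of x] lc_eq[OF pc x] by simp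
    then have "h' p (d' x) = crd sA (N 1 p) (bA 1) (hp p (d ?y))" unfolding h'_def mat_def by simp
    moreover have hd1: "hp p (d ?y) \<in> A 1 p" by (rule lin_on_in[OF hp_lin[OF p] dy])
    ultimately have eq: "h' p (d' x) - sc (f p) x = crd sA (N 1 p) (bA 1) (hp p (d ?y) - sA (f p) ?y)"
      using crd_diff[OF free1[OF pc] hd1 submodule_scale[OF free_on_submodule[OF free1[OF pc]] y]]
        crd_scale[OF free1[OF pc] y] xy by metis
    let ?z = "hp p (d ?y) - sA (f p) ?y"
    let ?L = "N 1 p - N 1 (p - 1)"
    have AS: "submodule sA (A 1 p)" by (rule free_on_submodule[OF free1[OF pc]])
    have z: "?z \<in> A 1 p" by (intro submodule_diff[OF AS] hd1 submodule_scale[OF AS] y)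
    have q1: "quotient_by (\<lambda>r. r) sA (A 1 p) sB (B 1 p) (A 1 (p - 1)) (\<pi> 1 p)" using q[of 1] p by simp
    have fB1: "free_on sB ?L (\<pi> 1 p \<circ> bA 1) (B 1 p)" using freeB[of 1] p by simp
    have \<pi>lc: "\<pi> 1 p (lc sA (N 1 p) (bA 1) w) = lc sB ?L (\<pi> 1 p \<circ> bA 1) w" for w
    proof -
      have b1: "bA 1 i \<in> A 1 p" if "i \<in> N 1 p" for i by (rule free_on_in[OF free1[OF pc] that])
      have b0: "\<pi> 1 p (bA 1 i) = 0" if "i \<in> N 1 (p - 1)" for i
      proof -
        have "bA 1 i \<in> A 1 (p - 1)" by (rule free_on_in[OF free1 that]) (use pc in simp)
        then show ?thesis using quotient_kernel[OF q1] quotient_subset[OF q1] by blast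
      qed
      have "\<pi> 1 p (lc sA (N 1 p) (bA 1) w) = (\<Sum>i\<in>N 1 p. sB (w i) (\<pi> 1 p (bA 1 i)))"
        unfolding lc_def by (rule lin_on_comb[OF quotient_lin[OF q1] AS b1])
      also have "\<dots> = (\<Sum>i\<in>?L. sB (w i) (\<pi> 1 p (bA 1 i)))"
        by (rule sum.mono_neutral_right[OF Nfin])
          (use b0 module.scale_zero_right[OF submodule_module[OF quotient_submodule[OF q1]]] in auto)
      finally show ?thesis by (simp add: lc_def)
    qed
    have "\<pi> 1 p ?z \<in> ideal_times sB (gen_ideal f (p - 1)) (B 1 p)"
      using hd[OF p y] lin_on_diff[OF quotient_lin[OF q1] AS hd1 submodule_scale[OF AS y]]
        lin_on_scale[OF quotient_lin[OF q1] y] unfolding hp_def by simp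
    then have "crd sB ?L (\<pi> 1 p \<circ> bA 1) (\<pi> 1 p ?z) k \<in> gen_ideal f (p - 1)"
      by (rule ideal_times_crd(2)[OF fB1 gen_ideal_ideal])
    moreover have "crd sB ?L (\<pi> 1 p \<circ> bA 1) (\<pi> 1 p ?z) = tr ?L (crd sA (N 1 p) (bA 1) ?z)"
      using \<pi>lc[of "crd sA (N 1 p) (bA 1) ?z"] crd_lc[OF fB1] by (simp only: lc_crd[OF free1[OF pc] z])
    ultimately show "(h' p (d' x) - sc (f p) x) k \<in> gen_ideal f (p - 1)"
      unfolding eq using k by (simp add: tr_def)
  next
    fix x :: "nat \<Rightarrow> 'a" and k
    have "d (lc sA (N 1 c) (bA 1) x) \<in> ideal_times sA {x. \<rho> x = 0} (A 0 c)"
      using min lc_in[OF free1c] unfolding hmf_minimal_def by blast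
    then show "\<rho> (d' x k) = 0"
      unfolding d'_def mat_def using ideal_times_crd(2)[OF free0c m] by blast
  next
    fix p k and x :: "nat \<Rightarrow> 'a" assume p: "p \<in> {1..c}"
    have pc: "p \<le> c" using p by simp
    let ?y = "lc sA (N 0 p) (bA 0) x"
    have y: "?y \<in> A 0 p" by (rule lc_in[OF free0[OF pc]])
    have hy: "hp p ?y \<in> ideal_times sA {x. \<rho> x = 0} (A 1 c)"
      using min inj_mem[OF p y order_refl] unfolding hmf_minimal_def hp_def by blast
    have "h' p x = crd sA (N 1 c) (bA 1) (hp p ?y)"
      using lc_h[OF p, of x] fr_mono[OF Nmono[OF pc] Lin_fr[OF h'L[OF p]]]
      by (intro crd_eqI[OF free1c, symmetric]) auto
    then show "\<rho> (h' p x k) = 0" using ideal_times_crd(2)[OF free1c m hy] by auto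
  qed
  then show ?thesis using freeB freeA[OF _ order_refl] lc_d by blast
qed

section \<open>Augmented systems\<close>

text \<open>The map \<open>e\<close> exhibits \<open>M\<close> as the cokernel of \<open>D 0\<close> over the quotient ring.\<close>

definition augments :: "(nat \<Rightarrow> 'a::comm_ring_1) \<Rightarrow> nat \<Rightarrow> ('a \<Rightarrow> 'r) \<Rightarrow> ('r \<Rightarrow> 'n \<Rightarrow> 'n) \<Rightarrow> 'n::ab_group_add set
    \<Rightarrow> (nat \<Rightarrow> 'i set) \<Rightarrow> (nat \<Rightarrow> ('i \<Rightarrow> 'a) \<Rightarrow> 'i \<Rightarrow> 'a) \<Rightarrow> (('i \<Rightarrow> 'a) \<Rightarrow> 'n) \<Rightarrow> bool" where
  "augments f c \<phi> s M J D e \<longleftrightarrow> (\<forall>x y. e (x + y) = e x + e y) \<and> (\<forall>r x. e (sc r x) = s (\<phi> r) (e x)) \<and>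
     (\<forall>x. e (tr (J 0) x) = e x) \<and> range e = M \<and>
     (\<forall>x\<in>fr (J 0). e x = 0 \<longleftrightarrow> (\<exists>y\<in>fr (J 1). x - D 0 y \<in> iv f c))"

lemma augmentsD:
  assumes "augments f c \<phi> s M J D e"
  shows aug_add: "e (x + y) = e x + e y" and aug_sc: "e (sc r x) = s (\<phi> r) (e x)"
    and aug_tr: "e (tr (J 0) x) = e x" and aug_range: "range e = M"
    and aug_zero: "x \<in> fr (J 0) \<Longrightarrow> e x = 0 \<longleftrightarrow> (\<exists>y\<in>fr (J 1). x - D 0 y \<in> iv f c)"
  using assms by (auto simp: augments_def)

lemma aug_diff: "augments f c \<phi> s M J D e \<Longrightarrow> e (x - y) = e x - e y"
  using aug_add[of f c \<phi> s M J D e "x - y" y] by simp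

lemma aug_sum: "augments f c \<phi> s M J D e \<Longrightarrow> e (sum g K) = (\<Sum>k\<in>K. e (g k))"
  using aug_add[of f c \<phi> s M J D e 0 0]
  by (induction K rule: infinite_finite_induct) (simp_all add: aug_add)

lemma aug_lift:
  assumes e: "augments f c \<phi> s M J D e" and e': "augments f c \<phi> s M J' D' e'" and fin: "finite (J 0)"
  obtains a where "Lin (J 0) (J' 0) a" "\<And>x. e' (a x) = e x"
proof -
  have "\<exists>y. e' y = e (unit_vec k)" for k using aug_range[OF e] aug_range[OF e'] by (metis rangeE rangeI)
  then obtain y where y: "\<And>k. e' (y k) = e (unit_vec k)" by metis
  let ?a = "lin_ext (J 0) (\<lambda>k. tr (J' 0) (y k))"
  show thesis
  proof (rule that)
    show "Lin (J 0) (J' 0) ?a" by (rule Lin_lin_ext) simp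
    fix x
    have "e' (?a x) = (\<Sum>k\<in>J 0. s (\<phi> (x k)) (e (unit_vec k)))"
      unfolding lin_ext_def by (simp only: aug_sum[OF e'] aug_sc[OF e'] aug_tr[OF e'] y)
    also have "\<dots> = e (tr (J 0) x)"
      unfolding fr_expand[OF fin] by (simp only: aug_sum[OF e] aug_sc[OF e])
    finally show "e' (?a x) = e x" by (simp only: aug_tr[OF e])
  qed
qed

text \<open>Augmentations to one module lift to maps in degree 0 that satisfy the hypotheses of
  \<open>expands_compare\<close>.\<close>

lemma (in residue_ci) expands_augmented:
  assumes S: "ci_lift f c J D T" and S': "ci_lift f c J' D' T'"
    and ex: "exact_mod f c J D" and ex': "exact_mod f c J' D'"
    and e: "augments f c \<phi> s M J D e" and e': "augments f c \<phi> s M J' D' e'"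
    and v: "expands sc (Zc \<rho> J D) (Bc \<rho> J D) (chi T) L c c v"
  shows "\<exists>v'. expands sc (Zc \<rho> J' D') (Bc \<rho> J' D') (chi T') L c c v'"
proof -
  obtain a where a: "Lin (J 0) (J' 0) a" "\<And>x. e' (a x) = e x"
    using aug_lift[OF e e' ci_lift_finite[OF S]] by metis
  obtain b where b: "Lin (J' 0) (J 0) b" "\<And>x. e (b x) = e' x"
    using aug_lift[OF e' e ci_lift_finite[OF S']] by metis
  have eD: "e (D 0 x) = 0" for x
  proof -
    have "D 0 x - D 0 (tr (J 1) x) \<in> iv f c" using Lin_tr[OF ci_lift_D[OF S], of 0 x] by simp
    then show ?thesis using aug_zero[OF e Lin_fr[OF ci_lift_D[OF S]]] tr_fr by blast
  qed
  have eD': "e' (D' 0 x) = 0" for x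
  proof -
    have "D' 0 x - D' 0 (tr (J' 1) x) \<in> iv f c" using Lin_tr[OF ci_lift_D[OF S'], of 0 x] by simp
    then show ?thesis using aug_zero[OF e' Lin_fr[OF ci_lift_D[OF S']]] tr_fr by blast
  qed
  show ?thesis
  proof (rule expands_compare[OF S S' order_refl ex ex' a(1) _ b(1) _ _ _ v])
    show "\<exists>y\<in>fr (J' 1). a (D 0 x) - D' 0 y \<in> iv f c" for x
      using aug_zero[OF e' Lin_fr[OF a(1)], of "D 0 x"] by (simp add: a(2) eD)
    show "\<exists>y\<in>fr (J 1). b (D' 0 x) - D 0 y \<in> iv f c" for x
      using aug_zero[OF e Lin_fr[OF b(1)], of "D' 0 x"] by (simp add: b(2) eD')
    show "\<exists>y\<in>fr (J 1). b (a x) - x - D 0 y \<in> iv f c" if "x \<in> fr (J 0)" for x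
      by (rule iffD1[OF aug_zero[OF e fr_diff[OF Lin_fr[OF b(1)] that]]])
        (simp only: aug_diff[OF e] a(2) b(2) diff_self)
    show "\<exists>y\<in>fr (J' 1). a (b x) - x - D' 0 y \<in> iv f c" if "x \<in> fr (J' 0)" for x
      by (rule iffD1[OF aug_zero[OF e' fr_diff[OF Lin_fr[OF a(1)] that]]])
        (simp only: aug_diff[OF e'] a(2) b(2) diff_self)
  qed
qed

section \<open>From coordinates to the given resolution\<close>

text \<open>\<open>q n\<close> is the composition of a coordinate isomorphism with \<open>G\<^sub>n \<rightarrow> R \<otimes> G\<^sub>n = F\<^sub>n\<close>.\<close>

definition presents :: "(nat \<Rightarrow> 'a::comm_ring_1) \<Rightarrow> nat \<Rightarrow> ('a \<Rightarrow> 'r) \<Rightarrow> ('r \<Rightarrow> 'f \<Rightarrow> 'f)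
    \<Rightarrow> (nat \<Rightarrow> 'f::ab_group_add set) \<Rightarrow> (nat \<Rightarrow> 'f \<Rightarrow> 'f) \<Rightarrow> (nat \<Rightarrow> nat \<Rightarrow> 'f \<Rightarrow> 'f) \<Rightarrow> (nat \<Rightarrow> nat set)
    \<Rightarrow> (nat \<Rightarrow> (nat \<Rightarrow> 'a) \<Rightarrow> nat \<Rightarrow> 'a) \<Rightarrow> (nat \<Rightarrow> nat \<Rightarrow> (nat \<Rightarrow> 'a) \<Rightarrow> nat \<Rightarrow> 'a)
    \<Rightarrow> (nat \<Rightarrow> (nat \<Rightarrow> 'a) \<Rightarrow> 'f) \<Rightarrow> bool" where
  "presents f c \<phi> sF F \<delta> t K D T q \<longleftrightarrow>
     (\<forall>n x y. q n (x + y) = q n x + q n y) \<and> (\<forall>n r x. q n (sc r x) = sF (\<phi> r) (q n x)) \<and>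
     (\<forall>n x. q n (tr (K n) x) = q n x) \<and> (\<forall>n. range (q n) = F n) \<and>
     (\<forall>n. \<forall>x\<in>fr (K n). q n x = 0 \<longleftrightarrow> x \<in> iv f c) \<and>
     (\<forall>n x. q n (D n x) = \<delta> n (q (Suc n) x)) \<and>
     (\<forall>j\<in>{1..c}. \<forall>n x. q n (T j n x) = t j n (q (Suc (Suc n)) x))"

lemma presentsD:
  assumes "presents f c \<phi> sF F \<delta> t K D T q"
  shows pres_add: "q n (x + y) = q n x + q n y" and pres_sc: "q n (sc r x) = sF (\<phi> r) (q n x)"
    and pres_tr: "q n (tr (K n) x) = q n x" and pres_range: "range (q n) = F n"
    and pres_zero: "x \<in> fr (K n) \<Longrightarrow> q n x = 0 \<longleftrightarrow> x \<in> iv f c"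
    and pres_D: "q n (D n x) = \<delta> n (q (Suc n) x)"
    and pres_T: "j \<in> {1..c} \<Longrightarrow> q n (T j n x) = t j n (q (Suc (Suc n)) x)"
  using assms by (simp_all add: presents_def)

lemma pres_in: "presents f c \<phi> sF F \<delta> t K D T q \<Longrightarrow> q n x \<in> F n"
  using pres_range by blast

lemma pres_diff: "presents f c \<phi> sF F \<delta> t K D T q \<Longrightarrow> q n (x - y) = q n x - q n y"
  using pres_add[of f c \<phi> sF F \<delta> t K D T q n "x - y" y] by simp

text \<open>Exactness of \<open>F\<close> over \<open>R\<close> becomes exactness modulo \<open>I\<^sub>c\<close>, because \<open>F\<^sub>n = G\<^sub>n / I\<^sub>c G\<^sub>n\<close>.\<close>

lemma lifted_coordinates:
  fixes f :: "nat \<Rightarrow> 'a::comm_ring_1"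
  assumes "quotient_ring \<phi> (gen_ideal f c)"
    and lift: "ci_system c f \<phi> sF F \<delta> sG G \<theta> D T t"
    and resolution: "free_resolution sF F \<delta> sM M \<epsilon>"
  obtains K D' T' q where "ci_lift f c K D' T'" "exact_mod f c K D'" "presents f c \<phi> sF F \<delta> t K D' T' q"
proof -
  note Ld = lift[unfolded ci_system_def]
  have G: "fin_free sG (G n)" and \<theta>: "quotient_by \<phi> sG (G n) sF (F n) (ideal_times sG (gen_ideal f c) (G n)) (\<theta> n)"
    and D: "lin_on sG (G (Suc n)) sG (G n) (D n)"
    and \<theta>D: "x \<in> G (Suc n) \<Longrightarrow> \<theta> n (D n x) = \<delta> n (\<theta> (Suc n) x)"
    and DD: "x \<in> G (Suc (Suc n)) \<Longrightarrow> D n (D (Suc n) x) = (\<Sum>j=1..c. sG (f j) (T j n x))"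
    and T: "j \<in> {1..c} \<Longrightarrow> lin_on sG (G (Suc (Suc n))) sG (G n) (T j n)"
    and \<theta>T: "j \<in> {1..c} \<Longrightarrow> x \<in> G (Suc (Suc n)) \<Longrightarrow> t j n (\<theta> (Suc (Suc n)) x) = \<theta> n (T j n x)" for n x j
    using Ld by (simp_all add: add_2_eq_Suc')
  have "\<exists>(K :: nat set) b. free_on sG K b (G n)" for n
    using fin_free_free_on[OF G[of n], of "{}"] by blast
  then obtain K :: "nat \<Rightarrow> nat set" and b where Kb: "\<And>n. free_on sG (K n) (b n) (G n)" by metis
  define D' where "D' n = mat sG (K (Suc n)) (b (Suc n)) sG (K n) (b n) (D n)" for n
  define T' where "T' j n = (if j \<in> {1..c} then mat sG (K (Suc (Suc n))) (b (Suc (Suc n))) sG (K n) (b n) (T j n)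
      else (\<lambda>x. 0))" for j n
  define l where "l n = lc sG (K n) (b n)" for n
  define q where "q n x = \<theta> n (l n x)" for n x
  have sG: "module sG" using G[of 0] by (simp add: fin_free_def)
  have lG: "l n x \<in> G n" for n x unfolding l_def by (rule lc_in[OF Kb])
  have lD: "l n (D' n x) = D n (l (Suc n) x)" for n x
    unfolding l_def D'_def by (rule lc_mat[OF Kb Kb D])
  have lT: "l n (T' j n x) = T j n (l (Suc (Suc n)) x)" if "j \<in> {1..c}" for j n x
    using lc_mat[OF Kb Kb T[OF that]] that unfolding l_def T'_def by simp
  have linD: "Lin (K (Suc n)) (K n) (D' n)" for n unfolding D'_def by (rule mat_Lin[OF Kb Kb D])
  have linT: "Lin (K (Suc (Suc n))) (K n) (T' j n)" for j n
    using mat_Lin[OF Kb Kb T] by (simp add: T'_def Lin_null)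
  have l_inj: "x = y" if "l n x = l n y" "x \<in> fr (K n)" "y \<in> fr (K n)" for n x y
    using free_on_inj[OF Kb] that unfolding l_def inj_on_def by blast
  have S: "ci_lift f c K D' T'" unfolding ci_lift_def
  proof (intro conjI allI free_on_finite[OF Kb] linD linT)
    fix n x
    have sum: "l n (\<Sum>j=1..c. sc (f j) (T' j n x)) = (\<Sum>j=1..c. sG (f j) (l n (T' j n x)))"
    proof -
      have l0: "l n 0 = 0" by (simp add: l_def lc_def module.scale_zero_left[OF sG])
      have "l n (sum g A) = (\<Sum>i\<in>A. l n (g i))" for g and A :: "nat set"
        by (induction A rule: infinite_finite_induct)
          (simp_all only: sum.infinite sum.empty sum.insert l0[unfolded l_def] l_def lc_add[OF sG] not_False_eq_True)
      then show ?thesis by (simp only:) (simp only: l_def lc_sc[OF sG])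
    qed
    show "D' n (D' (Suc n) x) = (\<Sum>j=1..c. sc (f j) (T' j n x))"
    proof (rule l_inj)
      have "l n (D' n (D' (Suc n) x)) = (\<Sum>j=1..c. sG (f j) (T j n (l (Suc (Suc n)) x)))"
        by (simp only: lD DD[OF lG])
      also have "\<dots> = l n (\<Sum>j=1..c. sc (f j) (T' j n x))"
        unfolding sum by (rule sum.cong) (simp_all add: lT)
      finally show "l n (D' n (D' (Suc n) x)) = l n (\<Sum>j=1..c. sc (f j) (T' j n x))" .
    qed (intro Lin_fr[OF linD] fr_sum fr_sc Lin_fr[OF linT])+
  qed
  have pres: "presents f c \<phi> sF F \<delta> t K D' T' q" unfolding presents_def
  proof (intro conjI allI ballI)
    fix n x y r
    show "q n (x + y) = q n x + q n y"
      unfolding q_def by (simp add: l_def lc_add[OF sG] lin_on_add[OF quotient_lin[OF \<theta>]] lG[unfolded l_def])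
    show "q n (sc r x) = sF (\<phi> r) (q n x)"
      unfolding q_def l_def lc_sc[OF sG] by (rule lin_on_scale[OF quotient_lin[OF \<theta>] lG[unfolded l_def]])
    show "q n (tr (K n) x) = q n x" by (simp add: q_def l_def lc_tr)
    show "range (q n) = F n"
    proof
      show "range (q n) \<subseteq> F n" using lin_on_in[OF quotient_lin[OF \<theta>] lG] by (auto simp: q_def)
      show "F n \<subseteq> range (q n)"
      proof
        fix y assume "y \<in> F n"
        then have "y \<in> \<theta> n ` G n" by (simp only: quotient_image[OF \<theta>])
        then obtain g where "g \<in> G n" "\<theta> n g = y" by (rule imageE) simp
        then have "q n (crd sG (K n) (b n) g) = y" by (simp add: q_def l_def lc_crd[OF Kb])
        then show "y \<in> range (q n)" by blast
      qed
    qed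
    show "q n (D' n x) = \<delta> n (q (Suc n) x)" by (simp add: q_def lD \<theta>D[OF lG])
    show "q n (T' j n x) = t j n (q (Suc (Suc n)) x)" if "j \<in> {1..c}" for j
      by (simp add: q_def lT[OF that] \<theta>T[OF that lG])
  next
    fix n and x :: "nat \<Rightarrow> 'a" assume x: "x \<in> fr (K n)"
    have c: "crd sG (K n) (b n) (l n x) = x" unfolding l_def by (rule crd_eqI[OF Kb x refl])
    have "q n x = 0 \<longleftrightarrow> l n x \<in> ideal_times sG (gen_ideal f c) (G n)"
      unfolding q_def by (rule quotient_kernel[OF \<theta> lG])
    also have "\<dots> \<longleftrightarrow> x \<in> iv f c"
      using ideal_times_crd(2)[OF Kb[of n] gen_ideal_ideal[of f c], of "l n x"]
        crd_ideal_times[OF Kb[of n] lG[of n x], of "gen_ideal f c"] unfolding c iv_def by blast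
    finally show "q n x = 0 \<longleftrightarrow> x \<in> iv f c" .
  qed
  have "exact_mod f c K D'" unfolding exact_mod_def
  proof (intro allI ballI impI)
    fix n and x :: "nat \<Rightarrow> 'a" assume x: "x \<in> fr (K (Suc n))" "D' n x \<in> iv f c"
    have "\<delta> n (q (Suc n) x) = 0"
      using x(2) pres_zero[OF pres Lin_fr[OF linD]] pres_D[OF pres] by metis
    then have "q (Suc n) x \<in> \<delta> (Suc n) ` F (Suc (Suc n))"
      using resolution pres_in[OF pres] unfolding free_resolution_def by blast
    then obtain y where "q (Suc n) x = \<delta> (Suc n) (q (Suc (Suc n)) y)"
      unfolding pres_range[OF pres, of "Suc (Suc n)", symmetric] by blast
    then have "q (Suc n) x = q (Suc n) (D' (Suc n) (tr (K (Suc (Suc n))) y))"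
      by (simp add: pres_D[OF pres] pres_tr[OF pres])
    then have "q (Suc n) (x - D' (Suc n) (tr (K (Suc (Suc n))) y)) = 0"
      by (simp only: pres_diff[OF pres] diff_self)
    then have "x - D' (Suc n) (tr (K (Suc (Suc n))) y) \<in> iv f c"
      using pres_zero[OF pres fr_diff[OF x(1) Lin_fr[OF linD]]] by blast
    then show "\<exists>y\<in>fr (K (Suc (Suc n))). x - D' (Suc n) y \<in> iv f c" using tr_fr by blast
  qed
  with S pres show thesis by (intro that)
qed

lemma augments_resolution:
  fixes f :: "nat \<Rightarrow> 'a::comm_ring_1"
  assumes S: "ci_lift f c K D T" and pres: "presents f c \<phi> sF F \<delta> t K D T q"
    and res: "free_resolution sF F \<delta> sM M \<epsilon>"
  shows "augments f c \<phi> sM M K D (\<lambda>x. \<epsilon> (q 0 x))"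
  unfolding augments_def
proof (intro conjI allI ballI)
  have \<epsilon>: "quotient_by (\<lambda>r. r) sF (F 0) sM M (\<delta> 0 ` F (Suc 0)) \<epsilon>"
    using res by (simp add: free_resolution_def)
  note in0 = pres_in[OF pres, of 0]
  show "\<epsilon> (q 0 (x + y)) = \<epsilon> (q 0 x) + \<epsilon> (q 0 y)" for x y
    by (simp add: pres_add[OF pres] lin_on_add[OF quotient_lin[OF \<epsilon>] in0 in0])
  show "\<epsilon> (q 0 (sc r x)) = sM (\<phi> r) (\<epsilon> (q 0 x))" for r x
    unfolding pres_sc[OF pres] by (rule lin_on_scale[OF quotient_lin[OF \<epsilon>] in0])
  show "\<epsilon> (q 0 (tr (K 0) x)) = \<epsilon> (q 0 x)" for x by (simp add: pres_tr[OF pres])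
  show "range (\<lambda>x. \<epsilon> (q 0 x)) = M"
    using quotient_image[OF \<epsilon>] pres_range[OF pres, of 0] by (metis image_image)
  fix x :: "nat \<Rightarrow> 'a" assume x: "x \<in> fr (K 0)"
  have "\<epsilon> (q 0 x) = 0 \<longleftrightarrow> (\<exists>y. q 0 x = \<delta> 0 (q (Suc 0) y))"
    unfolding quotient_kernel[OF \<epsilon> in0] pres_range[OF pres, of "Suc 0", symmetric] by blast
  also have "\<dots> \<longleftrightarrow> (\<exists>y\<in>fr (K 1). q 0 x = \<delta> 0 (q (Suc 0) y))"
    using pres_tr[OF pres, of "Suc 0"] tr_fr[of "K 1"] by (metis One_nat_def)
  also have "\<dots> \<longleftrightarrow> (\<exists>y\<in>fr (K 1). x - D 0 y \<in> iv f c)"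
  proof (rule bex_cong[OF refl])
    fix y
    have "q 0 (x - D 0 y) = 0 \<longleftrightarrow> x - D 0 y \<in> iv f c"
      by (rule pres_zero[OF pres fr_diff[OF x Lin_fr[OF ci_lift_D[OF S]]]])
    then show "q 0 x = \<delta> 0 (q (Suc 0) y) \<longleftrightarrow> x - D 0 y \<in> iv f c"
      by (simp only: pres_diff[OF pres] pres_D[OF pres] right_minus_eq)
  qed
  finally show "\<epsilon> (q 0 x) = 0 \<longleftrightarrow> (\<exists>y\<in>fr (K 1). x - D 0 y \<in> iv f c)" .
qed

lemma augments_hmf_module:
  fixes f :: "nat \<Rightarrow> 'a::comm_ring_1" and J :: "nat \<Rightarrow> 'b set"
  assumes free: "free_on sA (J 0) b0 (A 0 c)" "free_on sA (J 1) b1 (A 1 c)"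
    and D: "Lin (J 1) (J 0) (D 0)" "\<And>x. lc sA (J 0) b0 (D 0 x) = d (lc sA (J 1) b1 x)"
    and M: "hmf_module c f \<phi> sA A d sM M \<mu>"
  shows "augments f c \<phi> sM M J D (\<lambda>x. \<mu> (lc sA (J 0) b0 x))"
  unfolding augments_def
proof (intro conjI allI ballI)
  let ?l = "lc sA (J 0) b0" and ?I = "ideal_times sA (gen_ideal f c) (A 0 c)"
  have \<mu>: "quotient_by \<phi> sA (A 0 c) sM M {x + y | x y. x \<in> ?I \<and> y \<in> d ` A 1 c} \<mu>"
    using M by (simp add: hmf_module_def)
  note sA = free_on_module[OF free(1)] and l_in = lc_in[OF free(1)]
  show "\<mu> (?l (x + y)) = \<mu> (?l x) + \<mu> (?l y)" for x y
    unfolding lc_add[OF sA] by (rule lin_on_add[OF quotient_lin[OF \<mu>] l_in l_in])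
  show "\<mu> (?l (sc r x)) = sM (\<phi> r) (\<mu> (?l x))" for r x
    unfolding lc_sc[OF sA] by (rule lin_on_scale[OF quotient_lin[OF \<mu>] l_in])
  show "\<mu> (?l (tr (J 0) x)) = \<mu> (?l x)" for x by (simp add: lc_tr)
  show "range (\<lambda>x. \<mu> (?l x)) = M"
  proof -
    have "range ?l = A 0 c"
      using free_on_image[OF free(1)] lc_in[OF free(1)] by blast
    then show ?thesis using quotient_image[OF \<mu>] by (metis image_image)
  qed
  fix x :: "'b \<Rightarrow> 'a" assume x: "x \<in> fr (J 0)"
  have key: "?l z \<in> ?I \<longleftrightarrow> z \<in> iv f c" if z: "z \<in> fr (J 0)" for z
  proof -
    have c: "crd sA (J 0) b0 (?l z) = z" by (rule crd_eqI[OF free(1) z refl])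
    show ?thesis
      using ideal_times_crd(2)[OF free(1) gen_ideal_ideal[of f c], of "?l z"]
        crd_ideal_times[OF free(1) l_in[of z], of "gen_ideal f c"] unfolding c iv_def by blast
  qed
  have "\<mu> (?l x) = 0 \<longleftrightarrow> (\<exists>a b. ?l x = a + b \<and> a \<in> ?I \<and> b \<in> d ` A 1 c)"
    using quotient_kernel[OF \<mu> l_in] by blast
  also have "\<dots> \<longleftrightarrow> (\<exists>b\<in>d ` A 1 c. ?l x - b \<in> ?I)"
    by (metis add_diff_cancel_right' diff_add_cancel)
  also have "\<dots> \<longleftrightarrow> (\<exists>y\<in>fr (J 1). ?l x - d (lc sA (J 1) b1 y) \<in> ?I)"
    unfolding free_on_image[OF free(2), symmetric] by blast
  also have "\<dots> \<longleftrightarrow> (\<exists>y\<in>fr (J 1). x - D 0 y \<in> iv f c)"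
    using key[OF fr_diff[OF x Lin_fr[OF D(1)]]] by (simp add: lc_diff[OF sA] D(2))
  finally show "\<mu> (?l x) = 0 \<longleftrightarrow> (\<exists>y\<in>fr (J 1). x - D 0 y \<in> iv f c)" .
qed

text \<open>Functionals on \<open>G\<^sub>n\<close> with values in \<open>k\<close> vanish on \<open>I\<^sub>c G\<^sub>n\<close>, hence are the same as functionals on \<open>F\<^sub>n\<close>; this
  identifies the two cochain complexes together with the maps induced by \<open>t\<^sub>j\<close>.\<close>

lemma (in residue_ci) expands_Ext:
  fixes F :: "nat \<Rightarrow> 'f::ab_group_add set" and \<phi> :: "'a \<Rightarrow> 'r::comm_ring_1"
    and E :: "nat \<Rightarrow> 'e::ab_group_add set"
  assumes S: "ci_lift f c K D T" and pres: "presents f c \<phi> sF F \<delta> t K D T q"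
    and \<kappa>: "\<kappa> \<circ> \<phi> = \<rho>" and \<phi>: "surj \<phi>"
    and Ext: "is_Ext \<kappa> sF F \<delta> sE E cl" and CI: "ci_operators c \<kappa> sF F \<delta> t cl \<chi>"
    and v: "expands sc (Zc \<rho> K D) (Bc \<rho> K D) (chi T) L c c v"
  shows "graded_ops sE E (\<lambda>_. {0}) \<chi> c"
    and "\<exists>v. expands sE E (\<lambda>_. {0}) \<chi> L c c v"
    and "\<And>i j n e. i \<in> {1..c} \<Longrightarrow> j \<in> {1..c} \<Longrightarrow> e \<in> E n \<Longrightarrow>
      \<chi> i (Suc (Suc n)) (\<chi> j n e) = \<chi> j (Suc (Suc n)) (\<chi> i n e)"
proof -
  define g :: "nat \<Rightarrow> ((nat \<Rightarrow> 'a) \<Rightarrow> 'k) \<Rightarrow> 'f \<Rightarrow> 'k"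
    where "g n z y = (if y \<in> F n then z (SOME x. q n x = y) else 0)" for n z y
  have gq: "g n z (q n x) = z x" if z: "z \<in> Hm \<rho> (K n)" for n z x
  proof -
    let ?x = "SOME x'. q n x' = q n x"
    have "q n ?x = q n x" by (rule someI[of _ x]) simp
    then have "q n (tr (K n) (?x - x)) = 0" by (simp only: pres_tr[OF pres] pres_diff[OF pres] diff_self)
    then have "tr (K n) (?x - x) \<in> iv f c" using pres_zero[OF pres tr_fr] by blast
    then have "z (tr (K n) (?x - x)) = 0" by (intro Hm_iv[OF z ci_lift_finite[OF S]]) auto
    then have "z ?x = z x" by (simp only: Hm_tr[OF z] Hm_diff[OF z] right_minus_eq)
    then show ?thesis using pres_in[OF pres] by (simp add: g_def)
  qed
  have eqI: "u = w" if "\<And>x. u (q n x) = w (q n x)" "\<And>y. y \<notin> F n \<Longrightarrow> u y = w y" for n and u w :: "'f \<Rightarrow> 'k"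
  proof
    fix y
    show "u y = w y"
    proof (cases "y \<in> F n")
      case True
      then obtain x where "y = q n x" using pres_range[OF pres, of n] by blast
      then show ?thesis using that(1) by simp
    qed (rule that(2))
  qed
  have g_off: "g n z y = 0" if "y \<notin> F n" for n z y using that by (simp add: g_def)
  have gH: "g n z \<in> hom_k \<kappa> sF (F n)" if z: "z \<in> Hm \<rho> (K n)" for n z
    unfolding hom_k_def semilinear_on_def
  proof (intro CollectI conjI allI ballI impI)
    show "g n z ` F n \<subseteq> UNIV" by simp
    fix y assume "y \<in> F n"
    then obtain x where x: "y = q n x" using pres_range[OF pres, of n] by auto
    show "g n z (y + y') = g n z y + g n z y'" if y': "y' \<in> F n" for y'
    proof -
      obtain x' where x': "y' = q n x'" using pres_range[OF pres, of n] y' by auto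
      have "g n z (q n (x + x')) = g n z (q n x) + g n z (q n x')" by (simp only: gq[OF z] Hm_add[OF z])
      then show ?thesis by (simp add: x x' pres_add[OF pres])
    qed
    show "g n z (sF r y) = \<kappa> r * g n z y" for r
    proof -
      obtain a where a: "r = \<phi> a" using \<phi> by (metis surjD)
      have "g n z (q n (sc a x)) = \<rho> a * g n z (q n x)" by (simp only: gq[OF z] Hm_sc[OF z])
      moreover have "\<rho> a = \<kappa> (\<phi> a)" using \<kappa> by (metis comp_apply)
      ultimately show ?thesis unfolding a x pres_sc[OF pres] by simp
    qed
  qed (rule g_off)
  have Hq: "(\<lambda>x. u (q n x)) \<in> Hm \<rho> (K n)" if u: "u \<in> hom_k \<kappa> sF (F n)" for n u
  proof (rule HmI)
    have ul: "semilinear_on \<kappa> sF (F n) (*) UNIV u" using u by (simp add: hom_k_def)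
    note qF = pres_in[OF pres, of n]
    show "u (q n (x + y)) = u (q n x) + u (q n y)" for x y
      unfolding pres_add[OF pres] by (rule lin_on_add[OF ul qF qF])
    show "u (q n (sc r x)) = \<rho> r * u (q n x)" for r x
    proof -
      have "\<rho> r = \<kappa> (\<phi> r)" using \<kappa> by (metis comp_apply)
      then show ?thesis unfolding pres_sc[OF pres] using lin_on_scale[OF ul qF] by simp
    qed
    show "u (q n (tr (K n) x)) = u (q n x)" for x by (simp only: pres_tr[OF pres])
  qed
  have gZ: "g n z \<in> cocycles \<kappa> sF F \<delta> n" if z: "z \<in> Zc \<rho> K D n" for n z
    unfolding cocycles_def
  proof (intro CollectI conjI ballI gH Zc_Hm[OF z])
    fix y assume "y \<in> F (Suc n)"
    then obtain x where "y = q (Suc n) x" using pres_range[OF pres, of "Suc n"] by auto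
    then have "g n z (\<delta> n y) = g n z (q n (D n x))" by (simp only: pres_D[OF pres])
    then show "g n z (\<delta> n y) = 0" by (simp only: gq[OF Zc_Hm[OF z]] Zc_D[OF z])
  qed
  have gB: "g n z \<in> coboundaries \<kappa> sF F \<delta> n" if z: "z \<in> Bc \<rho> K D n" for n z
  proof (cases n)
    case 0
    then have "z = 0" using z by (simp add: Bc_0)
    then have "g n z = (\<lambda>x. 0)" by (auto simp: g_def fun_eq_iff)
    then show ?thesis by (simp add: coboundaries_def 0)
  next
    case (Suc m)
    then obtain w where w: "w \<in> Hm \<rho> (K m)" "z = (\<lambda>x. w (D m x))" using z by (auto simp: Bc_Suc)
    have zH: "z \<in> Hm \<rho> (K n)" unfolding w(2) Suc by (rule Hm_comp[OF w(1) ci_lift_D[OF S]])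
    have "g n z = restr (F n) (\<lambda>x. g m w (\<delta> m x))"
    proof (rule eqI[of _ n])
      fix x
      have "g m w (\<delta> m (q n x)) = g m w (q m (D m x))" by (simp add: pres_D[OF pres] Suc)
      then show "g n z (q n x) = restr (F n) (\<lambda>x. g m w (\<delta> m x)) (q n x)"
        using pres_in[OF pres, of n x] by (simp add: gq[OF zH] gq[OF w(1)] restr_def) (simp add: w(2))
    qed (simp add: g_off restr_def)
    then show ?thesis using gH[OF w(1)] by (auto simp: coboundaries_def Suc)
  qed
  have gB': "z \<in> Bc \<rho> K D n" if z: "z \<in> Zc \<rho> K D n" "g n z \<in> coboundaries \<kappa> sF F \<delta> n" for n z
  proof (cases n)
    case 0
    then have "g n z = (\<lambda>x. 0)" using z(2) by (simp add: coboundaries_def)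
    then have "z x = 0" for x using gq[OF Zc_Hm[OF z(1)], of x] by simp
    then show ?thesis by (auto simp: 0 Bc_0 fun_eq_iff)
  next
    case (Suc m)
    then obtain w where w: "w \<in> hom_k \<kappa> sF (F m)" "g n z = restr (F n) (\<lambda>x. w (\<delta> m x))"
      using z(2) by (auto simp: coboundaries_def)
    show ?thesis unfolding Suc
    proof (rule Bc_I[where w = "\<lambda>x. w (q m x)"])
      show "(\<lambda>x. w (q m x)) \<in> Hm \<rho> (K m)" by (rule Hq[OF w(1)])
      fix x
      have "z x = restr (F n) (\<lambda>x. w (\<delta> m x)) (q n x)" using gq[OF Zc_Hm[OF z(1)], of x] w(2) by simp
      then show "z x = w (q m (D m x))" using pres_in[OF pres, of n x] by (simp add: restr_def pres_D[OF pres] Suc)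
    qed
  qed
  have gsurj: "\<exists>z\<in>Zc \<rho> K D n. g n z = u" if u: "u \<in> cocycles \<kappa> sF F \<delta> n" for n u
  proof -
    have uH: "u \<in> hom_k \<kappa> sF (F n)" and u0: "\<And>x. x \<in> F (Suc n) \<Longrightarrow> u (\<delta> n x) = 0"
      using u by (auto simp: cocycles_def)
    have z: "(\<lambda>x. u (q n x)) \<in> Zc \<rho> K D n"
      by (intro Zc_I Hq[OF uH]) (simp add: pres_D[OF pres] u0 pres_in[OF pres])
    moreover have "g n (\<lambda>x. u (q n x)) = u"
      by (rule eqI[of _ n]) (use uH in \<open>simp_all add: gq[OF Zc_Hm[OF z]] g_off hom_k_def\<close>)
    ultimately show ?thesis by blast
  qed
  have cl: "quotient_by (\<lambda>a. a) sc (cocycles \<kappa> sF F \<delta> n) sE (E n) (coboundaries \<kappa> sF F \<delta> n) (cl n)" for n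
    using Ext unfolding is_Ext_def sc_def by blast
  define h where "h n z = cl n (g n z)" for n z
  have hE: "h n z \<in> E n" if "z \<in> Zc \<rho> K D n" for n z
    unfolding h_def by (rule lin_on_in[OF quotient_lin[OF cl] gZ[OF that]])
  have h0: "h n z = 0 \<longleftrightarrow> z \<in> Bc \<rho> K D n" if "z \<in> Zc \<rho> K D n" for n z
    unfolding h_def using quotient_kernel[OF cl gZ[OF that]] gB gB'[OF that] by blast
  have h_add: "h n (z + w) = h n z + h n w" if "z \<in> Zc \<rho> K D n" "w \<in> Zc \<rho> K D n" for n z w
  proof -
    have "g n (z + w) = g n z + g n w" by (auto simp: g_def)
    then show ?thesis unfolding h_def using lin_on_add[OF quotient_lin[OF cl] gZ gZ] that by simp
  qed
  have h_sc: "h n (sc a z) = sE a (h n z)" if "z \<in> Zc \<rho> K D n" for n a z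
  proof -
    have "g n (sc a z) = sc a (g n z)" by (auto simp: g_def)
    then show ?thesis unfolding h_def using lin_on_scale[OF quotient_lin[OF cl] gZ[OF that]] by (simp only:)
  qed
  have hsurj: "\<exists>z\<in>Zc \<rho> K D n. h n z = e" if "e \<in> E n" for n e
    using quotient_image[OF cl] that gsurj unfolding h_def by (metis imageE)
  have h\<chi>: "h (Suc (Suc n)) (chi T j n z) = \<chi> j n (h n z)" if j: "j \<in> {1..c}" and z: "z \<in> Zc \<rho> K D n" for j n z
  proof -
    have cH: "chi T j n z \<in> Hm \<rho> (K (Suc (Suc n)))"
      by (rule Zc_Hm[OF chi_in_Zc[OF S order_refl j z]])
    have "g (Suc (Suc n)) (chi T j n z) = restr (F (Suc (Suc n))) (\<lambda>x. g n z (t j n x))"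
    proof (rule eqI[of _ "Suc (Suc n)"])
      fix x
      have "g n z (t j n (q (Suc (Suc n)) x)) = z (T j n x)"
        by (simp only: pres_T[OF pres j, symmetric] gq[OF Zc_Hm[OF z]])
      then show "g (Suc (Suc n)) (chi T j n z) (q (Suc (Suc n)) x)
          = restr (F (Suc (Suc n))) (\<lambda>x. g n z (t j n x)) (q (Suc (Suc n)) x)"
        using pres_in[OF pres, of "Suc (Suc n)" x] unfolding gq[OF cH] by (simp add: restr_def chi_def)
    qed (simp add: g_off restr_def)
    moreover have "\<chi> j n (cl n (g n z)) = cl (n + 2) (restr (F (n + 2)) (\<lambda>x. g n z (t j n x)))"
      using CI j gZ[OF z] unfolding ci_operators_def by blast
    ultimately show ?thesis by (simp add: h_def)
  qed
  note Ssc = ops_Z[OF ops_sys[OF S order_refl]]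
  have sub: "submodule sE (E n)" for n by (rule quotient_submodule[OF cl])
  have mE: "module sE" by (rule submodule_module[OF sub])
  have sub0: "submodule sE {0}"
    using mE by (simp add: submodule_def module.subspace_single_0)
  have \<chi>0: "\<chi> j n 0 = 0" if "j \<in> {1..c}" for j n
  proof -
    have z: "0 \<in> Zc \<rho> K D n" by (rule vec.subspace_0[OF Zc_subspace])
    then have h00: "h n 0 = 0" using h0 vec.subspace_0[OF Bc_subspace] by blast
    have "chi T j n 0 = (0 :: (nat \<Rightarrow> 'a) \<Rightarrow> 'k)" by (auto simp: chi_def)
    then have "h (Suc (Suc n)) (chi T j n 0) = 0"
      using h0[OF vec.subspace_0[OF Zc_subspace]] vec.subspace_0[OF Bc_subspace] by simp
    then show ?thesis using h\<chi>[OF that z] h00 by simp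
  qed
  show O: "graded_ops sE E (\<lambda>_. {0}) \<chi> c" unfolding graded_ops_def
  proof (intro conjI allI ballI sub sub0)
    show "{0} \<subseteq> E n" for n using submodule_0[OF sub] by blast
    fix j n assume j: "j \<in> {1..c}"
    show "\<chi> j n ` {0} \<subseteq> {0}" using \<chi>0[OF j] by simp
    show "lin_on sE (E n) sE (E (Suc (Suc n))) (\<chi> j n)" unfolding semilinear_on_def
    proof (intro conjI ballI allI subsetI)
      fix y assume "y \<in> \<chi> j n ` E n"
      then obtain e where e: "e \<in> E n" "y = \<chi> j n e" by blast
      obtain z where z: "z \<in> Zc \<rho> K D n" "h n z = e" using hsurj[OF e(1)] by blast
      show "y \<in> E (Suc (Suc n))"
        using hE[OF chi_in_Zc[OF S order_refl j z(1)]] h\<chi>[OF j z(1)] z(2) e(2) by simp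
    next
      fix e assume "e \<in> E n"
      then obtain z where z: "z \<in> Zc \<rho> K D n" "h n z = e" using hsurj by blast
      note cz = chi_in_Zc[OF S order_refl j z(1)]
      show "\<chi> j n (e + e') = \<chi> j n e + \<chi> j n e'" if e': "e' \<in> E n" for e'
      proof -
        obtain z' where z': "z' \<in> Zc \<rho> K D n" "h n z' = e'" using hsurj[OF e'] by blast
        have "\<chi> j n (h n (z + z')) = h (Suc (Suc n)) (chi T j n z + chi T j n z')"
          unfolding chi_add[symmetric] by (rule h\<chi>[OF j vec.subspace_add[OF Zc_subspace z(1) z'(1)], symmetric])
        then show ?thesis
          using z z' by (simp only: h_add[OF z(1) z'(1)] h_add[OF cz chi_in_Zc[OF S order_refl j z'(1)]] h\<chi>[OF j])
      qed
      show "\<chi> j n (sE r e) = sE r (\<chi> j n e)" for r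
      proof -
        have "\<chi> j n (h n (sc r z)) = h (Suc (Suc n)) (sc r (chi T j n z))"
          unfolding chi_sc[symmetric] by (rule h\<chi>[OF j vec.subspace_scale[OF Zc_subspace z(1)], symmetric])
        then show ?thesis using z by (simp only: h_sc[OF z(1)] h_sc[OF cz] h\<chi>[OF j])
      qed
    qed
  qed
  have gm: "graded_map sc (Zc \<rho> K D) (Bc \<rho> K D) (chi T) sE E (\<lambda>_. {0}) \<chi> c h" unfolding graded_map_def
  proof (intro allI conjI ballI)
    show "lin_on sc (Zc \<rho> K D n) sE (E n) (h n)" for n
      using hE h_add h_sc unfolding semilinear_on_def by blast
    show "h n ` Bc \<rho> K D n \<subseteq> {0}" for n
      using h0 Bc_subset_Zc[OF S order_refl] by blast
    show "h (Suc (Suc n)) (chi T j n u) - \<chi> j n (h n u) \<in> {0}" if "j \<in> {1..c}" "u \<in> Zc \<rho> K D n" for j n u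
      using h\<chi>[OF that] by simp
  qed
  have "expands sE E (\<lambda>_. {0}) \<chi> L c c (\<lambda>q i l. h i (v q i l))"
  proof (rule expands_transfer[OF ops_sys[OF S order_refl] O gm _ _ v])
    show "u \<in> Bc \<rho> K D n" if "u \<in> Zc \<rho> K D n" "h n u \<in> {0}" for n u using that h0 by blast
    show "\<exists>u\<in>Zc \<rho> K D n. e - h n u \<in> {0}" if "e \<in> E n" for n e using hsurj[OF that] by force
  qed
  then show "\<exists>v. expands sE E (\<lambda>_. {0}) \<chi> L c c v" by blast
  fix i j n e assume i: "i \<in> {1..c}" and j: "j \<in> {1..c}" and "e \<in> E n"
  then obtain z where z: "z \<in> Zc \<rho> K D n" "h n z = e" using hsurj by blast
  let ?a = "chi T i (Suc (Suc n)) (chi T j n z)" and ?b = "chi T j (Suc (Suc n)) (chi T i n z)"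
  let ?N = "Suc (Suc (Suc (Suc n)))"
  note zi = chi_in_Zc[OF S order_refl i z(1)] and zj = chi_in_Zc[OF S order_refl j z(1)]
  have a: "?a \<in> Zc \<rho> K D ?N" by (rule chi_in_Zc[OF S order_refl i zj])
  have b: "?b \<in> Zc \<rho> K D ?N" by (rule chi_in_Zc[OF S order_refl j zi])
  have "h ?N (?a - ?b) = 0"
    using h0[OF vec.subspace_diff[OF Zc_subspace a b]] chi_commute[OF S order_refl j i z(1)] by blast
  moreover have "h ?N (?a - ?b) + h ?N ?b = h ?N ?a"
    using h_add[OF vec.subspace_diff[OF Zc_subspace a b] b] by simp
  ultimately have "h ?N ?a = h ?N ?b" by simp
  then show "\<chi> i (Suc (Suc n)) (\<chi> j n e) = \<chi> j (Suc (Suc n)) (\<chi> i n e)"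
    using z by (simp only: h\<chi>[OF i zj] h\<chi>[OF j z(1)] h\<chi>[OF j zi] h\<chi>[OF i z(1)])
qed

text \<open>The complex of \<open>adapted_expansion\<close> for all \<open>c\<close> equations and the lift \<open>G\<close> of the given resolution are both
  augmented to \<open>M\<close>, so the basis passes from the first to the second, and from there to the given \<open>Ext\<close>.\<close>

lemma Ext_monomial_basis:
  fixes \<mm> :: "'a::comm_ring_1 set" and \<phi> :: "'a \<Rightarrow> 'r::comm_ring_1" and \<rho> :: "'a \<Rightarrow> 'k::field"
  assumes local: "local_ring \<mm>"
    and regular: "regular_sequence c f"
    and R: "quotient_ring \<phi> (gen_ideal f c)"
    and k: "quotient_ring \<rho> \<mm>" "\<kappa> \<circ> \<phi> = \<rho>"
    and hmf: "higher_matrix_factorization c f sA A sB B \<pi> d h" "hmf_minimal c \<mm> sA A d h"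
    and M: "hmf_module c f \<phi> sA A d sM M \<mu>"
    and resolution: "free_resolution sF F \<delta> sM M \<epsilon>"
    and lift: "ci_system c f \<phi> sF F \<delta> sG G \<theta> D T t"
    and Ext: "is_Ext \<kappa> sF F \<delta> sE E cl"
    and CI: "ci_operators c \<kappa> sF F \<delta> t cl \<chi>"
  obtains L b v where "\<And>i p. finite (L i p :: nat set)"
    "\<And>i p. i \<in> {0,1} \<Longrightarrow> p \<in> {1..c} \<Longrightarrow> free_on sB (L i p) (b i p) (B i p)"
    "graded_ops sE E (\<lambda>_. {0}) \<chi> c" "expands sE E (\<lambda>_. {0}) \<chi> L c c v"
    "\<And>i j n e. i \<in> {1..c} \<Longrightarrow> j \<in> {1..c} \<Longrightarrow> e \<in> E n \<Longrightarrow>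
      \<chi> i (Suc (Suc n)) (\<chi> j n e) = \<chi> j (Suc (Suc n)) (\<chi> i n e)"
proof -
  have m: "\<mm> = {x. \<rho> x = 0}" using k(1) by (simp add: quotient_ring_def)
  have "maximal_ideal \<mm>" using local by (simp add: local_ring_def)
  then have mi: "is_ideal \<mm>" by (simp add: maximal_ideal_def)
  have Im: "gen_ideal f c \<subseteq> \<mm>"
    using proper_ideal_in_maximal[OF gen_ideal_ideal, of f c] regular local
    unfolding regular_sequence_def local_ring_def by metis
  interpret residue_ci \<rho> f c
  proof
    show "\<rho> 1 = 1" "\<rho> (x + y) = \<rho> x + \<rho> y" "\<rho> (x * y) = \<rho> x * \<rho> y" for x y
      using k(1) by (simp_all add: quotient_ring_def)
    show "\<rho> (f j) = 0" if "j \<in> {1..c}" for j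
      using gi_gen[of j c f 1] that Im m by auto
    show "x \<in> gen_ideal f (q - 1)" if "q \<in> {1..c}" "f q * x \<in> gen_ideal f (q - 1)" for q x
      using regular that unfolding regular_sequence_def by blast
  qed
  have noeth: "noetherian TYPE('a)" using local by (simp add: local_ring_def)
  obtain N bA d' h' where H: "hmf_coords \<rho> f c N d' h'"
    and fB: "\<And>i p. i \<in> {0,1} \<Longrightarrow> p \<in> {1..c} \<Longrightarrow> free_on sB (N i p - N i (p - 1)) (\<pi> i p \<circ> bA i) (B i p)"
    and fA: "\<And>i. i \<in> {0,1} \<Longrightarrow> free_on sA (N i c) (bA i) (A i c)"
    and d': "\<And>x. lc sA (N 0 c) (bA 0) (d' x) = d (lc sA (N 1 c) (bA 1) x)"
    using hmf_coordinates[OF residue_ci_axioms noeth mi[unfolded m] hmf(1) hmf(2)[unfolded m]] by blast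
  interpret hmf: hmf_coords \<rho> f c N d' h' by (rule H)
  obtain J D1 T1 v1 where X: "ci_lift f c J D1 T1" "exact_mod f c J D1" "hmf.adapted c J D1"
    "expands sc (Zc \<rho> J D1) (Bc \<rho> J D1) (chi T1) hmf.L c c v1"
    using hmf.adapted_expansion[OF order_refl] by blast
  have J: "J 0 = N 0 c" "J 1 = N 1 c" and D1: "D1 0 = hmf.dp c" using hmf.adaptedD[OF X(3)] by auto
  have D1': "D1 0 x = d' x" for x unfolding D1 hmf.dp_def by (rule Lin_tr[OF hmf.d_lin])
  have e1: "augments f c \<phi> sM M J D1 (\<lambda>x. \<mu> (lc sA (J 0) (bA 0) x))"
  proof (rule augments_hmf_module[where ?b1.0 = "bA 1", OF _ _ _ _ M])
    show "free_on sA (J 0) (bA 0) (A 0 c)" "free_on sA (J 1) (bA 1) (A 1 c)" unfolding J using fA by auto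
    show "Lin (J 1) (J 0) (D1 0)" using ci_lift_D[OF X(1), of 0] by simp
    show "lc sA (J 0) (bA 0) (D1 0 x) = d (lc sA (J 1) (bA 1) x)" for x unfolding J D1' by (rule d')
  qed
  obtain K D2 T2 q where Y: "ci_lift f c K D2 T2" "exact_mod f c K D2" "presents f c \<phi> sF F \<delta> t K D2 T2 q"
    using lifted_coordinates[OF R lift resolution] by metis
  obtain v2 where v2: "expands sc (Zc \<rho> K D2) (Bc \<rho> K D2) (chi T2) hmf.L c c v2"
    using expands_augmented[OF X(1) Y(1) X(2) Y(2) e1 augments_resolution[OF Y(1,3) resolution] X(4)] by blast
  have \<phi>: "surj \<phi>" using R by (simp add: quotient_ring_def)
  note E = expands_Ext[OF Y(1,3) k(2) \<phi> Ext CI v2]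
  obtain v where v: "expands sE E (\<lambda>_. {0}) \<chi> hmf.L c c v" using E(2) by blast
  show thesis
  proof (rule that[OF hmf.L_finite _ E(1) v E(3)])
    show "free_on sB (hmf.L i p) (\<pi> i p \<circ> bA i) (B i p)" if "i \<in> {0,1}" "p \<in> {1..c}" for i p
      unfolding hmf.L_def by (rule fB[OF that])
  qed
qed

section \<open>Tensor products\<close>

lemma lookup_pm_scale: "Poly_Mapping.lookup (pm_scale a w) k = a * Poly_Mapping.lookup w k"
  unfolding pm_scale_def by (simp add: Poly_Mapping.map.rep_eq when_def)

lemma keys_pm_scale: "Poly_Mapping.keys (pm_scale a w) \<subseteq> Poly_Mapping.keys w"
  by (auto simp: Poly_Mapping.in_keys_iff lookup_pm_scale)

lemma module_pm_scale: "module (pm_scale :: 'k::field \<Rightarrow> ('x \<Rightarrow>\<^sub>0 'k) \<Rightarrow> 'x \<Rightarrow>\<^sub>0 'k)"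
  by unfold_locales
    (auto intro!: poly_mapping_eqI simp: lookup_pm_scale Poly_Mapping.lookup_add distrib_left distrib_right)

lemma poly_mapping_expand:
  "w = (\<Sum>k\<in>Poly_Mapping.keys w. pm_scale (Poly_Mapping.lookup w k) (Poly_Mapping.single k 1))"
proof (rule poly_mapping_eqI)
  fix k
  have "Poly_Mapping.lookup (\<Sum>k\<in>Poly_Mapping.keys w. pm_scale (Poly_Mapping.lookup w k) (Poly_Mapping.single k 1)) k
     = (\<Sum>i\<in>Poly_Mapping.keys w. if i = k then Poly_Mapping.lookup w k else 0)"
    unfolding Poly_Mapping.lookup_sum
    by (rule sum.cong) (auto simp: lookup_pm_scale Poly_Mapping.lookup_single when_def)
  also have "\<dots> = Poly_Mapping.lookup w k"
    by (simp add: Poly_Mapping.in_keys_iff)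
  finally show "Poly_Mapping.lookup w k
     = Poly_Mapping.lookup (\<Sum>k\<in>Poly_Mapping.keys w. pm_scale (Poly_Mapping.lookup w k) (Poly_Mapping.single k 1)) k"
    by simp
qed

context
  fixes sU :: "'k::field \<Rightarrow> 'u \<Rightarrow> 'u::ab_group_add" and U and sV :: "'k \<Rightarrow> 'v \<Rightarrow> 'v::ab_group_add" and V
    and sT :: "'k \<Rightarrow> 't \<Rightarrow> 't::ab_group_add" and T \<tau>
  assumes tensor: "is_tensor sU U sV V sT T \<tau>" and U: "submodule sU U" and V: "submodule sV V"
begin

text \<open>The bilinearity relations among the generators of the tensor product.\<close>

definition trels :: "('u \<times> 'v \<Rightarrow>\<^sub>0 'k) set" where
  "trels = {Poly_Mapping.single (u + u', v) 1 - Poly_Mapping.single (u, v) 1 - Poly_Mapping.single (u', v) 1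
       | u u' v. u \<in> U \<and> u' \<in> U \<and> v \<in> V}
     \<union> {Poly_Mapping.single (u, v + v') 1 - Poly_Mapping.single (u, v) 1 - Poly_Mapping.single (u, v') 1
       | u v v'. u \<in> U \<and> v \<in> V \<and> v' \<in> V}
     \<union> {Poly_Mapping.single (sU a u, v) 1 - pm_scale a (Poly_Mapping.single (u, v) 1)
       | a u v. u \<in> U \<and> v \<in> V}
     \<union> {Poly_Mapping.single (u, sV a v) 1 - pm_scale a (Poly_Mapping.single (u, v) 1)
       | a u v. u \<in> U \<and> v \<in> V}"

lemma tensor_presentation:
  obtains Q where "quotient_by (\<lambda>a. a) pm_scale {w. Poly_Mapping.keys w \<subseteq> U \<times> V} sT T (module.span pm_scale trels) Q"
    "\<And>u v. u \<in> U \<Longrightarrow> v \<in> V \<Longrightarrow> Q (Poly_Mapping.single (u, v) 1) = \<tau> u v"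
  using tensor unfolding is_tensor_def Let_def trels_def by blast

lemma free_space: "submodule pm_scale {w :: 'u \<times> 'v \<Rightarrow>\<^sub>0 'k. Poly_Mapping.keys w \<subseteq> U \<times> V}"
  unfolding submodule_def module.subspace_def[OF module_pm_scale]
  using keys_pm_scale Poly_Mapping.keys_add by (fastforce intro: module_pm_scale)

lemma tensor_submodule: "submodule sT T"
  using tensor_presentation quotient_submodule by metis

lemma tensor_in: "u \<in> U \<Longrightarrow> v \<in> V \<Longrightarrow> \<tau> u v \<in> T"
proof -
  assume u: "u \<in> U" "v \<in> V"
  obtain Q where Q: "quotient_by (\<lambda>a. a) pm_scale {w. Poly_Mapping.keys w \<subseteq> U \<times> V} sT T (module.span pm_scale trels) Q"
    "\<And>u v. u \<in> U \<Longrightarrow> v \<in> V \<Longrightarrow> Q (Poly_Mapping.single (u, v) 1) = \<tau> u v"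
    using tensor_presentation by metis
  have "Q (Poly_Mapping.single (u, v) 1) \<in> T" by (rule lin_on_in[OF quotient_lin[OF Q(1)]]) (simp add: u)
  then show ?thesis using Q(2)[OF u] by simp
qed

lemma tensor_bilinear:
  shows tensor_lin_left: "v \<in> V \<Longrightarrow> lin_on sU U sT T (\<lambda>u. \<tau> u v)"
    and tensor_lin_right: "u \<in> U \<Longrightarrow> lin_on sV V sT T (\<tau> u)"
proof -
  obtain Q where Q: "quotient_by (\<lambda>a. a) pm_scale {w. Poly_Mapping.keys w \<subseteq> U \<times> V} sT T (module.span pm_scale trels) Q"
    "\<And>u v. u \<in> U \<Longrightarrow> v \<in> V \<Longrightarrow> Q (Poly_Mapping.single (u, v) 1) = \<tau> u v"
    using tensor_presentation by metis
  let ?F = "{w :: 'u \<times> 'v \<Rightarrow>\<^sub>0 'k. Poly_Mapping.keys w \<subseteq> U \<times> V}"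
  let ?e = "\<lambda>u v. Poly_Mapping.single (u, v) (1 :: 'k)"
  note lin = quotient_lin[OF Q(1)]
  have e: "?e u v \<in> ?F" if "u \<in> U" "v \<in> V" for u v using that by simp
  have rel: "Q w = 0" if "w \<in> trels" for w
  proof -
    have "w \<in> module.span pm_scale trels" by (rule module.span_base[OF module_pm_scale that])
    then show ?thesis using quotient_kernel[OF Q(1)] quotient_subset[OF Q(1)] by blast
  qed
  have add: "Q w = Q w1 + Q w2" if "w - w1 - w2 \<in> trels" "w \<in> ?F" "w1 \<in> ?F" "w2 \<in> ?F" for w w1 w2
  proof -
    have "Q (w - w1 - w2) = Q w - Q w1 - Q w2"
      using that submodule_diff[OF free_space that(2,3)] by (simp only: lin_on_diff[OF lin free_space])
    then show ?thesis using rel[OF that(1)] by (simp add: algebra_simps)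
  qed
  have scale: "Q w = sT a (Q w1)" if "w - pm_scale a w1 \<in> trels" "w \<in> ?F" "w1 \<in> ?F" for w w1 a
  proof -
    have "Q (w - pm_scale a w1) = Q w - sT a (Q w1)"
      using that submodule_scale[OF free_space that(3)]
      by (simp only: lin_on_diff[OF lin free_space] lin_on_scale[OF lin])
    then show ?thesis using rel[OF that(1)] by simp
  qed
  show "lin_on sU U sT T (\<lambda>u. \<tau> u v)" if v: "v \<in> V" unfolding semilinear_on_def
  proof (intro conjI ballI allI)
    show "(\<lambda>u. \<tau> u v) ` U \<subseteq> T" using tensor_in v by auto
    fix u assume u: "u \<in> U"
    show "\<tau> (u + u') v = \<tau> u v + \<tau> u' v" if u': "u' \<in> U" for u'
    proof -
      have "?e (u + u') v - ?e u v - ?e u' v \<in> trels" unfolding trels_def using u u' v by blast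
      from add[OF this e e e] show ?thesis using u u' v submodule_add[OF U] by (simp add: Q(2))
    qed
    show "\<tau> (sU a u) v = sT a (\<tau> u v)" for a
    proof -
      have "?e (sU a u) v - pm_scale a (?e u v) \<in> trels" unfolding trels_def using u v by blast
      from scale[OF this e e] show ?thesis using u v submodule_scale[OF U] by (simp add: Q(2))
    qed
  qed
  show "lin_on sV V sT T (\<tau> u)" if u: "u \<in> U" unfolding semilinear_on_def
  proof (intro conjI ballI allI)
    show "\<tau> u ` V \<subseteq> T" using tensor_in u by auto
    fix v assume v: "v \<in> V"
    show "\<tau> u (v + v') = \<tau> u v + \<tau> u v'" if v': "v' \<in> V" for v'
    proof -
      have "?e u (v + v') - ?e u v - ?e u v' \<in> trels" unfolding trels_def using v v' u by blast
      from add[OF this e e e] show ?thesis using v v' u submodule_add[OF V] by (simp add: Q(2))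
    qed
    show "\<tau> u (sV a v) = sT a (\<tau> u v)" for a
    proof -
      have "?e u (sV a v) - pm_scale a (?e u v) \<in> trels" unfolding trels_def using u v by blast
      from scale[OF this e e] show ?thesis using u v submodule_scale[OF V] by (simp add: Q(2))
    qed
  qed
qed

lemma tensor_induct:
  assumes y: "y \<in> T" and S: "submodule sT S" and gen: "\<And>u v. u \<in> U \<Longrightarrow> v \<in> V \<Longrightarrow> \<tau> u v \<in> S"
  shows "y \<in> S"
proof -
  obtain Q where Q: "quotient_by (\<lambda>a. a) pm_scale {w. Poly_Mapping.keys w \<subseteq> U \<times> V} sT T (module.span pm_scale trels) Q"
    "\<And>u v. u \<in> U \<Longrightarrow> v \<in> V \<Longrightarrow> Q (Poly_Mapping.single (u, v) 1) = \<tau> u v"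
    using tensor_presentation by metis
  have "y \<in> Q ` {w. Poly_Mapping.keys w \<subseteq> U \<times> V}" using y quotient_image[OF Q(1)] by simp
  then obtain w where w: "Poly_Mapping.keys w \<subseteq> U \<times> V" "y = Q w" by auto
  have "Q (\<Sum>k\<in>Poly_Mapping.keys w. pm_scale (Poly_Mapping.lookup w k) (Poly_Mapping.single k 1))
    = (\<Sum>k\<in>Poly_Mapping.keys w. sT (Poly_Mapping.lookup w k) (Q (Poly_Mapping.single k 1)))"
    by (rule lin_on_comb[OF quotient_lin[OF Q(1)] free_space]) (use w(1) in auto)
  also have "\<dots> \<in> S"
  proof (intro submodule_sum[OF S] submodule_scale[OF S])
    fix k assume "k \<in> Poly_Mapping.keys w"
    then obtain u v where "k = (u, v)" "u \<in> U" "v \<in> V" using w(1) by auto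
    then show "Q (Poly_Mapping.single k 1) \<in> S" using gen Q(2) by simp
  qed
  finally show ?thesis using w(2) poly_mapping_expand[of w] by simp
qed

text \<open>Extend \<open>\<beta>\<close> linearly to the free vector space on \<open>U \<times> V\<close>; bilinearity says that the extension kills
  the relations.\<close>

lemma tensor_universal:
  fixes \<beta> :: "'u \<Rightarrow> 'v \<Rightarrow> 'y::ab_group_add"
  assumes sY: "module sY"
    and left: "\<And>v. v \<in> V \<Longrightarrow> lin_on sU U sY UNIV (\<lambda>u. \<beta> u v)"
    and right: "\<And>u. u \<in> U \<Longrightarrow> lin_on sV V sY UNIV (\<beta> u)"
  obtains \<psi> where "lin_on sT T sY UNIV \<psi>" "\<And>u v. u \<in> U \<Longrightarrow> v \<in> V \<Longrightarrow> \<psi> (\<tau> u v) = \<beta> u v"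
proof -
  obtain Q where Q: "quotient_by (\<lambda>a. a) pm_scale {w. Poly_Mapping.keys w \<subseteq> U \<times> V} sT T (module.span pm_scale trels) Q"
    "\<And>u v. u \<in> U \<Longrightarrow> v \<in> V \<Longrightarrow> Q (Poly_Mapping.single (u, v) 1) = \<tau> u v"
    using tensor_presentation by metis
  let ?F = "{w :: 'u \<times> 'v \<Rightarrow>\<^sub>0 'k. Poly_Mapping.keys w \<subseteq> U \<times> V}"
  define P where "P w = (\<Sum>k\<in>Poly_Mapping.keys w. sY (Poly_Mapping.lookup w k) (\<beta> (fst k) (snd k)))"
    for w :: "'u \<times> 'v \<Rightarrow>\<^sub>0 'k"
  have Psup: "P w = (\<Sum>k\<in>X. sY (Poly_Mapping.lookup w k) (\<beta> (fst k) (snd k)))"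
    if "finite X" "Poly_Mapping.keys w \<subseteq> X" for w X
    unfolding P_def
    by (rule sum.mono_neutral_left[OF that]) (auto simp: Poly_Mapping.in_keys_iff module.scale_zero_left[OF sY])
  have Padd: "P (w + w') = P w + P w'" for w w'
  proof -
    let ?X = "Poly_Mapping.keys w \<union> Poly_Mapping.keys w'"
    have "P (w + w') = (\<Sum>k\<in>?X. sY (Poly_Mapping.lookup (w + w') k) (\<beta> (fst k) (snd k)))"
      by (rule Psup) (use Poly_Mapping.keys_add[of w w'] in auto)
    also have "\<dots> = (\<Sum>k\<in>?X. sY (Poly_Mapping.lookup w k) (\<beta> (fst k) (snd k)))
        + (\<Sum>k\<in>?X. sY (Poly_Mapping.lookup w' k) (\<beta> (fst k) (snd k)))"
      by (simp add: Poly_Mapping.lookup_add module.scale_left_distrib[OF sY] sum.distrib)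
    finally show ?thesis using Psup[of ?X w] Psup[of ?X w'] by simp
  qed
  have Psc: "P (pm_scale a w) = sY a (P w)" for a w
  proof -
    have "P (pm_scale a w) = (\<Sum>k\<in>Poly_Mapping.keys w. sY (Poly_Mapping.lookup (pm_scale a w) k) (\<beta> (fst k) (snd k)))"
      by (rule Psup) (simp_all add: keys_pm_scale)
    then show ?thesis
      by (simp add: P_def lookup_pm_scale module.scale_sum_right[OF sY] module.scale_scale[OF sY])
  qed
  have Pdiff: "P (w - w') = P w - P w'" for w w' using Padd[of "w - w'" w'] by simp
  have Pe: "P (Poly_Mapping.single (u, v) 1) = \<beta> u v" for u v
    by (simp add: P_def module.scale_one[OF sY])
  have "trels \<subseteq> {w. P w = 0}"
    unfolding trels_def
    by (auto simp: Pdiff Psc Pe lin_on_add[OF left] lin_on_add[OF right] lin_on_scale[OF left] lin_on_scale[OF right])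
  moreover have "module.subspace pm_scale {w. P w = 0}"
    unfolding module.subspace_def[OF module_pm_scale]
    by (simp add: Padd Psc module.scale_zero_right[OF sY]) (simp add: P_def)
  ultimately have span: "P w = 0" if "w \<in> module.span pm_scale trels" for w
    using module.span_minimal[OF module_pm_scale, of trels "{w. P w = 0}"] that by blast
  define \<psi> where "\<psi> y = P (SOME w. w \<in> ?F \<and> Q w = y)" for y
  have \<psi>Q: "\<psi> (Q w) = P w" if w: "w \<in> ?F" for w
  proof -
    let ?w = "SOME w'. w' \<in> ?F \<and> Q w' = Q w"
    have w': "?w \<in> ?F \<and> Q ?w = Q w" by (rule someI[of _ w]) (use w in simp)
    then have "Q (?w - w) = 0" using lin_on_diff[OF quotient_lin[OF Q(1)] free_space] w by simp
    moreover have "?w - w \<in> ?F" by (rule submodule_diff[OF free_space conjunct1[OF w'] w])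
    ultimately have "?w - w \<in> module.span pm_scale trels" using quotient_kernel[OF Q(1)] by simp
    then have "P (?w - w) = 0" by (rule span)
    then have "P ?w = P w" by (simp only: Pdiff right_minus_eq)
    then show ?thesis unfolding \<psi>_def .
  qed
  have surj: "\<exists>w\<in>?F. y = Q w" if "y \<in> T" for y
  proof -
    have "y \<in> Q ` ?F" using that quotient_image[OF Q(1)] by simp
    then show ?thesis by auto
  qed
  show thesis
  proof (rule that)
    show "lin_on sT T sY UNIV \<psi>" unfolding semilinear_on_def
    proof (intro conjI ballI allI)
      fix y assume "y \<in> T"
      then obtain w where w: "w \<in> ?F" "y = Q w" using surj by blast
      show "\<psi> (y + y') = \<psi> y + \<psi> y'" if y': "y' \<in> T" for y'
      proof -
        obtain w' where w': "w' \<in> ?F" "y' = Q w'" using surj[OF y'] by blast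
        have "\<psi> (Q (w + w')) = \<psi> (Q w) + \<psi> (Q w')"
          by (simp only: \<psi>Q[OF submodule_add[OF free_space w(1) w'(1)]] \<psi>Q[OF w(1)] \<psi>Q[OF w'(1)] Padd)
        then show ?thesis by (simp only: w(2) w'(2) lin_on_add[OF quotient_lin[OF Q(1)] w(1) w'(1)])
      qed
      show "\<psi> (sT a y) = sY a (\<psi> y)" for a
      proof -
        have "\<psi> (Q (pm_scale a w)) = sY a (\<psi> (Q w))"
          by (simp only: \<psi>Q[OF submodule_scale[OF free_space w(1)]] \<psi>Q[OF w(1)] Psc)
        then show ?thesis by (simp only: w(2) lin_on_scale[OF quotient_lin[OF Q(1)] w(1)])
      qed
    qed simp
    show "\<psi> (\<tau> u v) = \<beta> u v" if "u \<in> U" "v \<in> V" for u v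
      using \<psi>Q[of "Poly_Mapping.single (u, v) 1"] that by (simp add: Q(2) Pe)
  qed
qed

end

section \<open>Monomials and words\<close>

text \<open>The exponent vector of a word.  On nonincreasing words over \<open>{p..c}\<close> it is a bijection onto the exponent
  vectors of monomials in the variables \<open>\<chi>\<^sub>p, \<dots>, \<chi>\<^sub>c\<close> (\<open>mon_inj\<close>, \<open>mon_surj\<close>).\<close>

definition mon :: "nat list \<Rightarrow> nat \<Rightarrow>\<^sub>0 nat" where
  "mon w = sum_list (map (\<lambda>j. Poly_Mapping.single j 1) w)"

lemma mon_simps [simp]: "mon [] = 0" "mon (j # w) = Poly_Mapping.single j 1 + mon w"
  by (simp_all add: mon_def)

lemma lookup_mon: "Poly_Mapping.lookup (mon w) j = count_list w j"
  by (induction w) (simp_all add: Poly_Mapping.lookup_add Poly_Mapping.lookup_single when_def)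

lemma keys_mon: "Poly_Mapping.keys (mon w) = set w"
  by (auto simp: Poly_Mapping.in_keys_iff lookup_mon count_list_0_iff)

lemma degree_mon: "(\<Sum>i\<in>Poly_Mapping.keys (mon w). Poly_Mapping.lookup (mon w) i) = length w"
  by (simp add: keys_mon lookup_mon sum_count_set)

lemma words_Cons: "j # w \<in> words p c \<longleftrightarrow> (\<forall>i\<in>set w. i \<le> j) \<and> p \<le> j \<and> j \<le> c \<and> w \<in> words p c"
  by (auto simp: words_def)

lemma words_head: "j # w \<in> words p c \<Longrightarrow> j = Max (Poly_Mapping.keys (mon (j # w)))"
  unfolding keys_mon by (rule sym, rule Max_eqI) (auto simp: words_Cons)

text \<open>The first letter is recovered as the largest variable that occurs.\<close>

lemma mon_inj: "w \<in> words p c \<Longrightarrow> w' \<in> words p c \<Longrightarrow> mon w = mon w' \<Longrightarrow> w = w'"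
proof (induction w arbitrary: w')
  case Nil
  then show ?case using keys_mon[of w'] by simp
next
  case (Cons j w)
  have "set w' \<noteq> {}" using keys_mon[of w'] keys_mon[of "j # w"] Cons.prems(3) by auto
  then obtain j' u where w': "w' = j' # u" by (cases w') auto
  have j: "j = j'"
    using words_head[OF Cons.prems(1)] words_head[OF Cons.prems(2)[unfolded w']] Cons.prems(3) unfolding w' by simp
  then have "mon w = mon u" using Cons.prems(3) w' by simp
  then have "w = u" using Cons.IH[of u] Cons.prems(1,2) by (simp add: w' words_Cons)
  then show ?case using w' j by simp
qed

lemma mon_surj:
  assumes "Poly_Mapping.keys m \<subseteq> {p..c}"
  shows "\<exists>w\<in>words p c. mon w = m"
  using assms
proof (induction "\<Sum>i\<in>Poly_Mapping.keys m. Poly_Mapping.lookup m i" arbitrary: m rule: less_induct)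
  case less
  show ?case
  proof (cases "m = 0")
    case True
    then show ?thesis by (intro bexI[of _ "[]"]) (simp_all add: words_def)
  next
    case False
    then have ne: "Poly_Mapping.keys m \<noteq> {}" by simp
    define j where "j = Max (Poly_Mapping.keys m)"
    have j: "j \<in> Poly_Mapping.keys m" unfolding j_def using ne by (intro Max_in) auto
    define m' where "m' = m - Poly_Mapping.single j 1"
    have l: "Poly_Mapping.lookup m' i = Poly_Mapping.lookup m i - (if i = j then 1 else 0)" for i
      by (simp add: m'_def Poly_Mapping.lookup_minus Poly_Mapping.lookup_single when_def)
    have lj: "0 < Poly_Mapping.lookup m j" using j by (simp add: Poly_Mapping.in_keys_iff)
    have m: "m = Poly_Mapping.single j 1 + m'"
      by (rule poly_mapping_eqI) (use lj in \<open>auto simp: Poly_Mapping.lookup_add Poly_Mapping.lookup_single when_def l\<close>)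
    have keys: "Poly_Mapping.keys m' \<subseteq> Poly_Mapping.keys m"
      by (auto simp: Poly_Mapping.in_keys_iff l)
    have "(\<Sum>i\<in>Poly_Mapping.keys m'. Poly_Mapping.lookup m' i) = (\<Sum>i\<in>Poly_Mapping.keys m. Poly_Mapping.lookup m' i)"
      by (rule sum.mono_neutral_left) (use keys in \<open>auto simp: Poly_Mapping.in_keys_iff\<close>)
    also have "\<dots> < (\<Sum>i\<in>Poly_Mapping.keys m. Poly_Mapping.lookup m i)"
      by (rule sum_strict_mono_ex1) (use j lj in \<open>auto simp: l\<close>)
    finally obtain w where w: "w \<in> words p c" "mon w = m'" using less keys by (meson subset_trans)
    have "set w \<subseteq> Poly_Mapping.keys m" using keys keys_mon[of w] w by simp
    then have "\<forall>i\<in>set w. i \<le> j" unfolding j_def by auto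
    then have "j # w \<in> words p c" using w j less.prems by (auto simp: words_Cons)
    then show ?thesis using m w by (intro bexI[of _ "j # w"]) simp_all
  qed
qed

text \<open>Multiplication of a monomial by a variable.\<close>

fun ins :: "nat \<Rightarrow> nat list \<Rightarrow> nat list" where
  "ins i [] = [i]"
| "ins i (j # w) = (if j \<le> i then i # j # w else j # ins i w)"

lemma set_ins: "set (ins i w) = insert i (set w)"
  by (induction w) auto
lemma length_ins: "length (ins i w) = Suc (length w)"
  by (induction w) auto
lemma mon_ins: "mon (ins i w) = Poly_Mapping.single i 1 + mon w"
  by (induction w) (auto simp: add_ac)
lemma words_ins: "w \<in> words p c \<Longrightarrow> i \<in> {p..c} \<Longrightarrow> ins i w \<in> words p c"
  by (induction w) (auto simp: words_Cons set_ins words_def[of p c, THEN eqset_imp_iff, of "[]"])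

lemma words_ins_onto:
  assumes "w \<in> words p c" "i \<in> set w"
  shows "\<exists>u\<in>words p c. ins i u = w"
proof -
  define m where "m = mon w - Poly_Mapping.single i 1"
  have pos: "0 < Poly_Mapping.lookup (mon w) i" using assms(2) count_list_0_iff[of w i] by (simp add: lookup_mon)
  have eq: "mon w = Poly_Mapping.single i 1 + m"
    by (rule poly_mapping_eqI)
      (use pos in \<open>auto simp: m_def Poly_Mapping.lookup_add Poly_Mapping.lookup_minus Poly_Mapping.lookup_single when_def\<close>)
  have "Poly_Mapping.keys m \<subseteq> Poly_Mapping.keys (mon w)"
    by (auto simp: m_def Poly_Mapping.in_keys_iff Poly_Mapping.lookup_minus)
  also have "\<dots> \<subseteq> {p..c}" using assms(1) by (simp add: keys_mon words_def)
  finally obtain u where u: "u \<in> words p c" "mon u = m" using mon_surj by blast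
  have "i \<in> {p..c}" using assms by (auto simp: words_def)
  then have "ins i u = w"
    using mon_inj[OF words_ins[OF u(1)] assms(1)] mon_ins[of i u] u(2) eq by simp
  then show ?thesis using u(1) by blast
qed

lemma lookup_var_mult:
  fixes q :: "'k::field pol"
  shows "Poly_Mapping.lookup (pol_var i * q) (Poly_Mapping.single i 1 + m) = Poly_Mapping.lookup q m"
    and "i \<notin> Poly_Mapping.keys m' \<Longrightarrow> Poly_Mapping.lookup (pol_var i * q) m' = 0"
proof -
  have *: "Poly_Mapping.lookup (pol_var i * q) m'
     = (\<Sum>r. Poly_Mapping.lookup q r when m' = Poly_Mapping.single i 1 + r)" for m'
    by (simp add: Poly_Mapping.lookup_mult pol_var_def Poly_Mapping.lookup_single when_mult)
  show "Poly_Mapping.lookup (pol_var i * q) (Poly_Mapping.single i 1 + m) = Poly_Mapping.lookup q m"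
    by (simp add: *)
  assume i: "i \<notin> Poly_Mapping.keys m'"
  have "m' \<noteq> Poly_Mapping.single i 1 + r" for r
  proof
    assume "m' = Poly_Mapping.single i 1 + r"
    then have "Poly_Mapping.lookup m' i \<noteq> 0" by (simp add: Poly_Mapping.lookup_add)
    then show False using i by (simp add: Poly_Mapping.in_keys_iff)
  qed
  then show "Poly_Mapping.lookup (pol_var i * q) m' = 0" by (simp add: *)
qed

lemma act_ins:
  assumes O: "graded_ops s Z B \<chi> c" and v: "v \<in> Z n" and w: "set w \<subseteq> {1..c}" and i: "i \<in> {1..c}"
    and comm: "\<And>i j n e. i \<in> {1..c} \<Longrightarrow> j \<in> {1..c} \<Longrightarrow> e \<in> Z n \<Longrightarrow>
      \<chi> i (Suc (Suc n)) (\<chi> j n e) = \<chi> j (Suc (Suc n)) (\<chi> i n e)"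
  shows "act \<chi> n (ins i w) v = \<chi> i (n + 2 * length w) (act \<chi> n w v)"
  using w
proof (induction w)
  case (Cons j w)
  then show ?case
    using comm[OF i, of j "act \<chi> n w v" "n + 2 * length w"] act_in[OF O v, of w]
    by (simp add: length_ins)
qed simp

section \<open>Assembling monomial expansions\<close>

locale monomial_expansion =
  fixes sE :: "'k::field \<Rightarrow> 'e \<Rightarrow> 'e::ab_group_add" and E :: "nat \<Rightarrow> 'e set"
    and \<chi> :: "nat \<Rightarrow> nat \<Rightarrow> 'e \<Rightarrow> 'e" and L :: "nat \<Rightarrow> nat \<Rightarrow> nat set"
    and v :: "nat \<Rightarrow> nat \<Rightarrow> nat \<Rightarrow> 'e" and c :: nat
  assumes O: "graded_ops sE E (\<lambda>_. {0}) \<chi> c" and v: "expands sE E (\<lambda>_. {0}) \<chi> L c c v"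
    and L_fin: "finite (L i p)"
    and comm: "i \<in> {1..c} \<Longrightarrow> j \<in> {1..c} \<Longrightarrow> e \<in> E n \<Longrightarrow>
      \<chi> i (Suc (Suc n)) (\<chi> j n e) = \<chi> j (Suc (Suc n)) (\<chi> i n e)"
begin

lemma mE: "module sE" by (rule submodule_module[OF ops_Z[OF O]])

text \<open>Families of polynomials, one in \<open>k[\<chi>\<^sub>p, \<dots>, \<chi>\<^sub>c]\<close> for each generator that belongs to \<open>\<B>(p)\<close>.  They
  parametrise both sides of the theorem: the total \<open>Ext\<close> through \<open>comb\<close>, and the sum of the tensor products
  through the bases of the spaces \<open>Hom(\<B>(p), k)\<close>.\<close>

definition fam :: "(nat \<Rightarrow> nat \<Rightarrow> nat \<Rightarrow> 'k pol) set" where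
  "fam = {Q. \<forall>p i l. if p \<in> {1..c} \<and> i < 2 \<and> l \<in> L i p then Q p i l \<in> pol_ring p c else Q p i l = 0}"

lemma famD:
  assumes "Q \<in> fam"
  shows "p \<in> {1..c} \<Longrightarrow> i < 2 \<Longrightarrow> l \<in> L i p \<Longrightarrow> Q p i l \<in> pol_ring p c"
    and "\<not> (p \<in> {1..c} \<and> i < 2 \<and> l \<in> L i p) \<Longrightarrow> Q p i l = 0"
proof -
  have *: "if p \<in> {1..c} \<and> i < 2 \<and> l \<in> L i p then Q p i l \<in> pol_ring p c else Q p i l = 0"
    using assms unfolding fam_def by blast
  show "p \<in> {1..c} \<Longrightarrow> i < 2 \<Longrightarrow> l \<in> L i p \<Longrightarrow> Q p i l \<in> pol_ring p c"
    "\<not> (p \<in> {1..c} \<and> i < 2 \<and> l \<in> L i p) \<Longrightarrow> Q p i l = 0"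
    using * by argo+
qed

text \<open>The sum of \<open>Q p i l (\<chi>)\<close> applied to the generators \<open>v p i l\<close>, in degree \<open>n\<close>.\<close>

definition comb :: "(nat \<Rightarrow> nat \<Rightarrow> nat \<Rightarrow> 'k pol) \<Rightarrow> nat \<Rightarrow> 'e" where
  "comb Q n = (\<Sum>x\<in>Idx L c c n.
     sE (case x of (p, i, l, w) \<Rightarrow> Poly_Mapping.lookup (Q p i l) (mon w)) (monomial \<chi> v x))"

lemma finI: "finite (Idx L c c n)" by (rule finite_Idx[OF L_fin])

lemma mono_in: "x \<in> Idx L c c n \<Longrightarrow> monomial \<chi> v x \<in> E n"
  by (rule basis_mod_in[OF expands_basis[OF v]])

lemma comb_E: "comb Q n \<in> E n"
  unfolding comb_def by (intro submodule_sum[OF ops_Z[OF O]] submodule_scale[OF ops_Z[OF O]] mono_in)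

lemma comb_add: "comb (\<lambda>p i l. Q p i l + Q' p i l) = (\<lambda>n. comb Q n + comb Q' n)"
  unfolding comb_def sum.distrib[symmetric]
  by (intro ext sum.cong) (auto simp: Poly_Mapping.lookup_add module.scale_left_distrib[OF mE])

lemma comb_scale: "comb (\<lambda>p i l. pm_scale a (Q p i l)) = (\<lambda>n. sE a (comb Q n))"
  unfolding comb_def module.scale_sum_right[OF mE]
  by (intro ext sum.cong) (auto simp: lookup_pm_scale module.scale_scale[OF mE])

lemma comb_zero: "comb (\<lambda>p i l. 0) = (\<lambda>n. 0)"
  unfolding comb_def by (intro ext sum.neutral) (auto simp: module.scale_zero_left[OF mE])

lemma comb_sum: "comb (\<lambda>p i l. \<Sum>k\<in>K. Q k p i l) = (\<lambda>n. \<Sum>k\<in>K. comb (Q k) n)"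
  by (induction K rule: infinite_finite_induct) (simp_all add: comb_zero comb_add)

lemma finite_support:
  assumes Q: "Q \<in> fam" shows "finite {n. comb Q n \<noteq> 0}"
proof (rule finite_subset)
  let ?d = "\<lambda>m :: nat \<Rightarrow>\<^sub>0 nat. \<Sum>i\<in>Poly_Mapping.keys m. Poly_Mapping.lookup m i"
  let ?X = "\<Union>p\<in>{1..c}. \<Union>i\<in>{..<2}. \<Union>l\<in>L i p. (\<lambda>m. i + 2 * ?d m) ` Poly_Mapping.keys (Q p i l)"
  show "finite ?X" using L_fin by simp
  show "{n. comb Q n \<noteq> 0} \<subseteq> ?X"
  proof
    fix n assume "n \<in> {n. comb Q n \<noteq> 0}"
    then have "\<exists>x\<in>Idx L c c n. sE (case x of (p, i, l, w) \<Rightarrow> Poly_Mapping.lookup (Q p i l) (mon w)) (monomial \<chi> v x) \<noteq> 0"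
      unfolding comb_def by (auto intro: sum.neutral)
    then obtain p i l w where x: "(p, i, l, w) \<in> Idx L c c n" "Poly_Mapping.lookup (Q p i l) (mon w) \<noteq> 0"
      by (force simp: module.scale_zero_left[OF mE])
    then have "mon w \<in> Poly_Mapping.keys (Q p i l)" "n = i + 2 * ?d (mon w)"
      by (simp_all add: Poly_Mapping.in_keys_iff degree_mon Idx_def)
    then show "n \<in> ?X" using x(1) unfolding Idx_def by blast
  qed
qed

lemma comb_Ext_total: "Q \<in> fam \<Longrightarrow> comb Q \<in> Ext_total E"
  using finite_support comb_E by (simp add: Ext_total_def)

lemma comb_injective:
  assumes Q: "Q \<in> fam" and 0: "comb Q = (\<lambda>n. 0)"
  shows "Q p i l = 0"
proof (cases "p \<in> {1..c} \<and> i < 2 \<and> l \<in> L i p")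
  case True
  then have q: "Q p i l \<in> pol_ring p c" using famD(1)[OF Q] by blast
  have "Poly_Mapping.lookup (Q p i l) m = 0" for m
  proof (cases "m \<in> Poly_Mapping.keys (Q p i l)")
    case T: True
    then have "Poly_Mapping.keys m \<subseteq> {p..c}" using q by (simp add: pol_ring_def)
    then obtain w where w: "w \<in> words p c" "mon w = m" using mon_surj by blast
    define n where "n = i + 2 * length w"
    have x: "(p, i, l, w) \<in> Idx L c c n" using True w by (simp add: Idx_def n_def)
    have "comb Q n \<in> {0}" using 0 by simp
    from basis_mod_indep[OF expands_basis[OF v] this[unfolded comb_def] x]
    show ?thesis using w by simp
  qed (simp add: Poly_Mapping.in_keys_iff)
  then show ?thesis by (simp add: poly_mapping_eqI)
next
  case False
  then show ?thesis by (rule famD(2)[OF Q])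
qed

lemma fam_add: "Q \<in> fam \<Longrightarrow> Q' \<in> fam \<Longrightarrow> (\<lambda>p i l. Q p i l + Q' p i l) \<in> fam"
  and fam_scale: "Q \<in> fam \<Longrightarrow> (\<lambda>p i l. pm_scale a (Q p i l)) \<in> fam"
  and fam_zero: "(\<lambda>p i l. 0) \<in> fam"
proof -
  show "(\<lambda>p i l. 0) \<in> fam" by (simp add: fam_def pol_ring_def)
  show "(\<lambda>p i l. pm_scale a (Q p i l)) \<in> fam" if "Q \<in> fam"
  proof -
    have "pm_scale a q \<in> pol_ring p c" if "q \<in> pol_ring p c" for q p
      using that keys_pm_scale[of a q] by (auto simp: pol_ring_def)
    moreover have "pm_scale a (0 :: 'k pol) = 0" by (rule poly_mapping_eqI) (simp add: lookup_pm_scale)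
    ultimately show ?thesis using that by (simp add: fam_def)
  qed
  show "(\<lambda>p i l. Q p i l + Q' p i l) \<in> fam" if "Q \<in> fam" "Q' \<in> fam"
  proof -
    have "q + q' \<in> pol_ring p c" if "q \<in> pol_ring p c" "q' \<in> pol_ring p c" for q q' :: "'k pol" and p
      using that Poly_Mapping.keys_add[of q q'] by (auto simp: pol_ring_def)
    then show ?thesis using that by (simp add: fam_def)
  qed
qed

lemma fam_sum_family: "(\<And>k. k \<in> K \<Longrightarrow> Q k \<in> fam) \<Longrightarrow> (\<lambda>p i l. \<Sum>k\<in>K. Q k p i l) \<in> fam"
  by (induction K rule: infinite_finite_induct) (simp_all add: fam_zero fam_add)

text \<open>Homogeneous elements are combinations of monomials, and every element of the total \<open>Ext\<close> is a finite sum of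
  homogeneous ones.\<close>

lemma comb_surjective:
  assumes e: "e \<in> Ext_total E"
  shows "\<exists>Q\<in>fam. comb Q = e"
proof -
  have single: "\<exists>Q\<in>fam. comb Q = (\<lambda>m. if m = n then monomial \<chi> v x else 0)" if x: "x \<in> Idx L c c n" for n x
  proof -
    obtain p i l w where x': "x = (p, i, l, w)" "p \<in> {1..c}" "i < 2" "l \<in> L i p" "w \<in> words p c" "i + 2 * length w = n"
      using x by (auto simp: Idx_def)
    define Q where "Q p' i' l' = (if (p', i', l') = (p, i, l) then Poly_Mapping.single (mon w) (1 :: 'k) else 0)" for p' i' l'
    have "Q \<in> fam" using x' by (auto simp: fam_def Q_def pol_ring_def keys_mon words_def)
    moreover have "comb Q m = (if m = n then monomial \<chi> v x else 0)" for m
    proof -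
      have "comb Q m = (\<Sum>y\<in>Idx L c c m. if y = x then monomial \<chi> v x else 0)"
        unfolding comb_def
      proof (rule sum.cong[OF refl])
        fix y assume "y \<in> Idx L c c m"
        then obtain p' i' l' w' where y: "y = (p', i', l', w')" "w' \<in> words p' c" by (auto simp: Idx_def)
        show "sE (case y of (p, i, l, w) \<Rightarrow> Poly_Mapping.lookup (Q p i l) (mon w)) (monomial \<chi> v y)
            = (if y = x then monomial \<chi> v x else 0)"
          using mon_inj[OF x'(5), of w'] y
          by (auto simp: x'(1) Q_def Poly_Mapping.lookup_single when_def module.scale_one[OF mE]
              module.scale_zero_left[OF mE])
      qed
      also have "\<dots> = (if x \<in> Idx L c c m then monomial \<chi> v x else 0)" by (simp add: finI)
      also have "x \<in> Idx L c c m \<longleftrightarrow> m = n" using x' by (auto simp: Idx_def)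
      finally show ?thesis .
    qed
    ultimately show ?thesis by blast
  qed
  have homog: "\<exists>Q\<in>fam. comb Q = (\<lambda>m. if m = n then e n else 0)" for n
  proof -
    have "e n \<in> E n" using e by (simp add: Ext_total_def)
    then obtain \<kappa> where "e n - (\<Sum>x\<in>Idx L c c n. sE (\<kappa> x) (monomial \<chi> v x)) \<in> {0}"
      using basis_mod_span[OF expands_basis[OF v]] by blast
    then have en: "e n = (\<Sum>x\<in>Idx L c c n. sE (\<kappa> x) (monomial \<chi> v x))" by simp
    have "\<forall>x\<in>Idx L c c n. \<exists>Q. Q \<in> fam \<and> comb Q = (\<lambda>m. if m = n then monomial \<chi> v x else 0)"
      using single by blast
    from bchoice[OF this] obtain Q where Q: "\<And>x. x \<in> Idx L c c n \<Longrightarrow> Q x \<in> fam"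
      "\<And>x. x \<in> Idx L c c n \<Longrightarrow> comb (Q x) = (\<lambda>m. if m = n then monomial \<chi> v x else 0)" by blast
    let ?Q = "\<lambda>p i l. \<Sum>x\<in>Idx L c c n. pm_scale (\<kappa> x) (Q x p i l)"
    have "?Q \<in> fam" by (intro fam_sum_family fam_scale Q)
    moreover have "comb ?Q = (\<lambda>m. if m = n then e n else 0)"
    proof
      fix m
      have "comb ?Q m = (\<Sum>x\<in>Idx L c c n. sE (\<kappa> x) (comb (Q x) m))"
        by (simp only: comb_sum comb_scale)
      also have "\<dots> = (\<Sum>x\<in>Idx L c c n. sE (\<kappa> x) (if m = n then monomial \<chi> v x else 0))"
        by (rule sum.cong) (simp_all add: Q(2))
      also have "\<dots> = (if m = n then e n else 0)"
        by (cases "m = n") (simp_all add: en module.scale_zero_right[OF mE])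
      finally show "comb ?Q m = (if m = n then e n else 0)" .
    qed
    ultimately show ?thesis by blast
  qed
  then obtain Q where Q: "\<And>n. Q n \<in> fam" "\<And>n. comb (Q n) = (\<lambda>m. if m = n then e n else 0)" by metis
  let ?S = "{n. e n \<noteq> 0}"
  have S: "finite ?S" using e by (simp add: Ext_total_def)
  let ?Q = "\<lambda>p i l. \<Sum>n\<in>?S. Q n p i l"
  have "?Q \<in> fam" by (intro fam_sum_family Q)
  moreover have "comb ?Q = e"
  proof
    fix m
    have "comb ?Q m = (\<Sum>n\<in>?S. if m = n then e n else 0)" by (simp only: comb_sum Q)
    also have "\<dots> = e m" using S by simp
    finally show "comb ?Q m = e m" .
  qed
  ultimately show ?thesis by blast
qed

text \<open>Multiplication by \<open>\<chi>\<^sub>i\<close> maps the monomials in \<open>\<chi>\<^sub>p, \<dots>, \<chi>\<^sub>c\<close> bijectively to those that contain \<open>\<chi>\<^sub>i\<close>, as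
  \<open>i \<ge> p\<close>; moving \<open>\<chi>\<^sub>i\<close> to its place in the word uses that the operators commute.\<close>

lemma chi_comb:
  assumes p: "p \<in> {1..c}" and i: "i \<in> {p..c}" and Q: "\<And>p' i' l. p' \<noteq> p \<Longrightarrow> Q p' i' l = 0"
  shows "chi_total \<chi> i (comb Q) = comb (\<lambda>p' i' l. pol_var i * Q p' i' l)"
proof
  fix N
  have ic: "i \<in> {1..c}" using p i by auto
  let ?R = "\<lambda>p' i' l. pol_var i * Q p' i' l"
  let ?t = "\<lambda>Q x. sE (case x of (p, i, l, w) \<Rightarrow> Poly_Mapping.lookup (Q p i l) (mon w)) (monomial \<chi> v x)"
  let ?X = "\<lambda>n. {x \<in> Idx L c c n. fst x = p}"
  let ?Y = "{x \<in> Idx L c c N. fst x = p \<and> i \<in> set (snd (snd (snd x)))}"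
  have R: "comb ?R N = (\<Sum>x\<in>?Y. ?t ?R x)"
    unfolding comb_def
  proof (rule sum.mono_neutral_right[OF finI])
    show "\<forall>x\<in>Idx L c c N - ?Y. ?t ?R x = 0"
    proof
      fix x assume x: "x \<in> Idx L c c N - ?Y"
      obtain p' i' l w where x': "x = (p', i', l, w)" by (cases x)
      have "Poly_Mapping.lookup (?R p' i' l) (mon w) = 0"
      proof (cases "p' = p")
        case True
        then have "i \<notin> Poly_Mapping.keys (mon w)" using x x' by (simp add: keys_mon)
        then show ?thesis by (rule lookup_var_mult(2))
      qed (simp add: Q)
      then show "?t ?R x = 0" by (simp add: x' module.scale_zero_left[OF mE])
    qed
  qed auto
  show "chi_total \<chi> i (comb Q) N = comb ?R N"
  proof (cases "N < 2")
    case True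
    have "?Y = {}"
    proof (rule equals0I)
      fix x assume "x \<in> ?Y"
      then obtain i' l w where w: "i \<in> set w" "i' + 2 * length w = N" by (auto simp: Idx_def)
      then show False using True length_pos_if_in_set[OF w(1)] by linarith
    qed
    then show ?thesis using True by (simp only: R) (simp add: chi_total_def)
  next
    case False
    define n where "n = N - 2"
    have N: "N = Suc (Suc n)" using False by (simp add: n_def)
    let ?g = "\<lambda>(p, i', l, w). (p, i', l, ins i w)"
    have "chi_total \<chi> i (comb Q) N = \<chi> i n (comb Q n)" by (simp add: chi_total_def N)
    also have "\<dots> = (\<Sum>x\<in>Idx L c c n. sE (case x of (p, i, l, w) \<Rightarrow> Poly_Mapping.lookup (Q p i l) (mon w))
        (\<chi> i n (monomial \<chi> v x)))"
      unfolding comb_def by (rule lin_on_comb[OF ops_lin[OF O ic] ops_Z[OF O] mono_in])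
    also have "\<dots> = (\<Sum>x\<in>?X n. sE (case x of (p, i, l, w) \<Rightarrow> Poly_Mapping.lookup (Q p i l) (mon w))
        (\<chi> i n (monomial \<chi> v x)))"
    proof (rule sum.mono_neutral_right[OF finI])
      show "\<forall>x\<in>Idx L c c n - ?X n. sE (case x of (p, i, l, w) \<Rightarrow> Poly_Mapping.lookup (Q p i l) (mon w))
          (\<chi> i n (monomial \<chi> v x)) = 0"
      proof
        fix x assume x: "x \<in> Idx L c c n - ?X n"
        obtain p' i' l w where x': "x = (p', i', l, w)" by (cases x)
        then have "p' \<noteq> p" using x by auto
        then show "sE (case x of (p, i, l, w) \<Rightarrow> Poly_Mapping.lookup (Q p i l) (mon w)) (\<chi> i n (monomial \<chi> v x)) = 0"
          by (simp add: x' Q module.scale_zero_left[OF mE])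
      qed
    qed auto
    also have "\<dots> = (\<Sum>x\<in>?X n. ?t ?R (?g x))"
    proof (rule sum.cong[OF refl])
      fix x assume "x \<in> ?X n"
      then obtain i' l w where x: "x = (p, i', l, w)" "i' < 2" "l \<in> L i' p" "w \<in> words p c" "i' + 2 * length w = n"
        by (auto simp: Idx_def)
      have w: "set w \<subseteq> {1..c}" using words_subset[OF x(4)] p by simp
      have "act \<chi> i' (ins i w) (v p i' l) = \<chi> i (i' + 2 * length w) (act \<chi> i' w (v p i' l))"
        by (rule act_ins[OF O expands_gen[OF v p x(2,3)] w ic comm])
      then show "sE (case x of (p, i, l, w) \<Rightarrow> Poly_Mapping.lookup (Q p i l) (mon w)) (\<chi> i n (monomial \<chi> v x)) = ?t ?R (?g x)"
        using lookup_var_mult(1)[of i "Q p i' l" "mon w"] by (simp add: x(1) x(5) mon_ins)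
    qed
    also have "\<dots> = (\<Sum>x\<in>?Y. ?t ?R x)"
    proof (rule sum.reindex_bij_betw)
      show "bij_betw ?g (?X n) ?Y" unfolding bij_betw_def
      proof
        show "inj_on ?g (?X n)"
        proof (rule inj_onI)
          fix x y assume xy: "x \<in> ?X n" "y \<in> ?X n" "?g x = ?g y"
          obtain i1 l1 w1 where x: "x = (p, i1, l1, w1)" "w1 \<in> words p c" using xy(1) by (auto simp: Idx_def)
          obtain i2 l2 w2 where y: "y = (p, i2, l2, w2)" "w2 \<in> words p c" using xy(2) by (auto simp: Idx_def)
          have "ins i w1 = ins i w2" using xy(3) x y by simp
          then have "mon w1 = mon w2" using mon_ins[of i w1] mon_ins[of i w2] by simp
          then show "x = y" using mon_inj[OF x(2) y(2)] xy(3) x y by simp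
        qed
        show "?g ` ?X n = ?Y"
        proof (intro subset_antisym subsetI)
          fix y assume "y \<in> ?g ` ?X n"
          then obtain x where x: "x \<in> ?X n" "y = ?g x" by blast
          obtain p' i' l w where "x = (p', i', l, w)" by (cases x)
          with x have "y = (p, i', l, ins i w)" "(p, i', l, w) \<in> Idx L c c n" by auto
          then show "y \<in> ?Y" using words_ins[of w p c i] i by (auto simp: Idx_def set_ins length_ins N)
        next
          fix y assume yY: "y \<in> ?Y"
          obtain p' i' l w where "y = (p', i', l, w)" by (cases y)
          with yY have y: "y = (p, i', l, w)" "(p, i', l, w) \<in> Idx L c c N" "i \<in> set w" by auto
          from y(2,3) obtain u where u: "u \<in> words p c" "ins i u = w" using words_ins_onto[of w p c i] by (auto simp: Idx_def)
          have "(p, i', l, u) \<in> ?X n" using y(2) u length_ins[of i u] by (auto simp: Idx_def N)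
          then show "y \<in> ?g ` ?X n" using u(2) y(1) by (force simp: image_iff)
        qed
      qed
    qed
    finally show ?thesis by (simp only: R)
  qed
qed

end

lemma pol_ring_submodule: "submodule pm_scale (pol_ring p c :: 'k::field pol set)"
  unfolding submodule_def module.subspace_def[OF module_pm_scale]
proof (intro conjI ballI allI module_pm_scale)
  show "0 \<in> (pol_ring p c :: 'k pol set)" by (simp add: pol_ring_def)
  show "x + y \<in> pol_ring p c" if "x \<in> pol_ring p c" "y \<in> pol_ring p c" for x y :: "'k pol"
    using that Poly_Mapping.keys_add[of x y] by (auto simp: pol_ring_def)
  show "pm_scale a x \<in> pol_ring p c" if "x \<in> pol_ring p c" for a and x :: "'k pol"
    using that keys_pm_scale[of a x] by (auto simp: pol_ring_def)
qed

lemma pol_var_mult_pol_ring: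
  fixes q :: "'k::field pol"
  assumes q: "q \<in> pol_ring p c" and i: "i \<in> {p..c}"
  shows "pol_var i * q \<in> pol_ring p c"
  unfolding pol_ring_def
proof (intro CollectI ballI)
  fix m assume "m \<in> Poly_Mapping.keys (pol_var i * q)"
  then obtain a b where ab: "m = a + b" "a \<in> Poly_Mapping.keys (pol_var i :: 'k pol)" "b \<in> Poly_Mapping.keys q"
    using Poly_Mapping.keys_mult[of "pol_var i" q] by blast
  have "a = Poly_Mapping.single i 1" using ab(2) by (simp add: pol_var_def)
  then have "Poly_Mapping.keys m \<subseteq> {i} \<union> Poly_Mapping.keys b"
    using ab(1) Poly_Mapping.keys_add[of a b] by auto
  moreover have "Poly_Mapping.keys b \<subseteq> {p..c}" using q ab(3) by (simp add: pol_ring_def)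
  ultimately show "Poly_Mapping.keys m \<subseteq> {p..c}" using i by blast
qed

lemma module_fun2: "module (\<lambda>(a :: 'k::field) v i x. a * v i x)"
  by unfold_locales (auto simp: fun_eq_iff distrib_left distrib_right)

lemma hom_k_0: "(0 :: 'b::plus \<Rightarrow> 'k::field) \<in> hom_k \<rho> s X"
  by (simp add: hom_k_def semilinear_on_def)

lemma hom_k_add: "u \<in> hom_k \<rho> s X \<Longrightarrow> w \<in> hom_k \<rho> s X \<Longrightarrow> u + w \<in> hom_k \<rho> s X"
  by (simp add: hom_k_def semilinear_on_def distrib_left add_ac)

lemma hom_k_scale: "u \<in> hom_k \<rho> s X \<Longrightarrow> (\<lambda>x. a * u x) \<in> hom_k \<rho> s X"
  by (simp add: hom_k_def semilinear_on_def distrib_left mult.left_commute)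

lemma hom_B_D:
  assumes "v \<in> hom_B \<rho> sB B p"
  shows "i \<in> {0,1} \<Longrightarrow> v i \<in> hom_k \<rho> sB (B i p)" and "i \<notin> {0,1} \<Longrightarrow> v i = 0"
proof -
  have *: "if i \<in> {0,1} then v i \<in> hom_k \<rho> sB (B i p) else v i = 0"
    using assms unfolding hom_B_def by blast
  show "i \<in> {0,1} \<Longrightarrow> v i \<in> hom_k \<rho> sB (B i p)" "i \<notin> {0,1} \<Longrightarrow> v i = 0"
    using * by (simp_all only: if_True if_False)
qed

lemma hom_B_I:
  assumes "\<And>i. i \<in> {0,1} \<Longrightarrow> v i \<in> hom_k \<rho> sB (B i p)" "\<And>i. i \<notin> {0,1} \<Longrightarrow> v i = 0"
  shows "v \<in> hom_B \<rho> sB B p"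
  unfolding hom_B_def
proof (intro CollectI allI)
  show "if i \<in> {0,1} then v i \<in> hom_k \<rho> sB (B i p) else v i = 0" for i
    by (cases "i \<in> {0,1}") (simp_all only: assms if_True if_False not_False_eq_True)
qed

lemma hom_B_submodule: "submodule (\<lambda>(a :: 'k::field) v i x. a * v i x) (hom_B \<rho> sB B p)"
  unfolding submodule_def module.subspace_def[OF module_fun2]
proof (intro conjI ballI allI module_fun2)
  show "0 \<in> hom_B \<rho> sB B p" by (rule hom_B_I) (simp_all only: zero_fun_apply hom_k_0)
  show "x + y \<in> hom_B \<rho> sB B p" if "x \<in> hom_B \<rho> sB B p" "y \<in> hom_B \<rho> sB B p" for x y
    by (rule hom_B_I) (simp_all only: plus_fun_apply hom_k_add hom_B_D[OF that(1)] hom_B_D[OF that(2)] add_0_left not_False_eq_True)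
  show "(\<lambda>i z. a * x i z) \<in> hom_B \<rho> sB B p" if x: "x \<in> hom_B \<rho> sB B p" for a x
  proof (rule hom_B_I)
    show "(\<lambda>z. a * x i z) = 0" if "i \<notin> {0,1}" for i using hom_B_D(2)[OF x that] by (simp add: fun_eq_iff)
  qed (rule hom_k_scale[OF hom_B_D(1)[OF x]])
qed

section \<open>The decomposition of Ext\<close>

theorem corollary5p6:
  fixes \<mm> :: "'a::comm_ring_1 set"
    and c :: nat and f :: "nat \<Rightarrow> 'a"
    and \<phi> :: "'a \<Rightarrow> 'r::comm_ring_1" and \<rho> :: "'a \<Rightarrow> 'k::field" and \<kappa> :: "'r \<Rightarrow> 'k"
    and sA :: "'a \<Rightarrow> 'm \<Rightarrow> 'm::ab_group_add" and A :: "nat \<Rightarrow> nat \<Rightarrow> 'm set"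
    and sB :: "'a \<Rightarrow> 'b \<Rightarrow> 'b::ab_group_add" and B :: "nat \<Rightarrow> nat \<Rightarrow> 'b set"
    and \<pi> :: "nat \<Rightarrow> nat \<Rightarrow> 'm \<Rightarrow> 'b"
    and d :: "'m \<Rightarrow> 'm" and h :: "(nat \<Rightarrow> 'm) \<Rightarrow> 'm"
    and sM :: "'r \<Rightarrow> 'n \<Rightarrow> 'n::ab_group_add" and M :: "'n set" and \<mu> :: "'m \<Rightarrow> 'n"
    and sF :: "'r \<Rightarrow> 'f \<Rightarrow> 'f::ab_group_add" and F :: "nat \<Rightarrow> 'f set"
    and \<delta> :: "nat \<Rightarrow> 'f \<Rightarrow> 'f" and \<epsilon> :: "'f \<Rightarrow> 'n"
    and sG :: "'a \<Rightarrow> 'g \<Rightarrow> 'g::ab_group_add" and G :: "nat \<Rightarrow> 'g set"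
    and \<theta> :: "nat \<Rightarrow> 'g \<Rightarrow> 'f" and D :: "nat \<Rightarrow> 'g \<Rightarrow> 'g"
    and T :: "nat \<Rightarrow> nat \<Rightarrow> 'g \<Rightarrow> 'g" and t :: "nat \<Rightarrow> nat \<Rightarrow> 'f \<Rightarrow> 'f"
    and sE :: "'k \<Rightarrow> 'e \<Rightarrow> 'e::ab_group_add" and E :: "nat \<Rightarrow> 'e set"
    and cl :: "nat \<Rightarrow> ('f \<Rightarrow> 'k) \<Rightarrow> 'e" and \<chi> :: "nat \<Rightarrow> nat \<Rightarrow> 'e \<Rightarrow> 'e"
    and sW :: "'k \<Rightarrow> 'w \<Rightarrow> 'w::ab_group_add" and W :: "nat \<Rightarrow> 'w set"
    and \<tau> :: "nat \<Rightarrow> 'k pol \<Rightarrow> (nat \<Rightarrow> 'b \<Rightarrow> 'k) \<Rightarrow> 'w"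
  assumes local: "local_ring \<mm>"
    and regular: "regular_sequence c f"
    and R: "quotient_ring \<phi> (gen_ideal f c)"
    and k: "quotient_ring \<rho> \<mm>" "\<kappa> \<circ> \<phi> = \<rho>"
    and hmf: "higher_matrix_factorization c f sA A sB B \<pi> d h" "hmf_minimal c \<mm> sA A d h"
    and M: "hmf_module c f \<phi> sA A d sM M \<mu>"
    and resolution: "free_resolution sF F \<delta> sM M \<epsilon>"
    and lift: "ci_system c f \<phi> sF F \<delta> sG G \<theta> D T t"
    and Ext: "is_Ext \<kappa> sF F \<delta> sE E cl"
    and CI: "ci_operators c \<kappa> sF F \<delta> t cl \<chi>"
    and tensor: "\<And>p. p \<in> {1..c} \<Longrightarrow>
        is_tensor pm_scale (pol_ring p c) (\<lambda>a v i x. a * v i x) (hom_B \<rho> sB B p) sW (W p) (\<tau> p)"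
  shows "\<exists>\<Phi> :: (nat \<Rightarrow> 'w) \<Rightarrow> (nat \<Rightarrow> 'e).
    lin_on (\<lambda>a x p. sW a (x p)) (fam_sum W c) (\<lambda>a e n. sE a (e n)) (Ext_total E) \<Phi> \<and>
    bij_betw \<Phi> (fam_sum W c) (Ext_total E) \<and>
    (\<forall>p\<in>{1..c}. \<forall>i\<in>{0,1}. \<forall>j. \<forall>q\<in>pol_ring p c. \<forall>v\<in>hom_B \<rho> sB B p.
       pol_homogeneous j q \<and> (\<forall>i'. i' \<noteq> i \<longrightarrow> v i' = 0) \<longrightarrow>
       (\<forall>n. n \<noteq> 2 * j + i \<longrightarrow> \<Phi> (inj_at p (\<tau> p q v)) n = 0)) \<and>
    (\<forall>p\<in>{1..c}. \<forall>i\<in>{p..c}.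
       (\<forall>y\<in>W p. chi_total \<chi> i (\<Phi> (inj_at p y)) \<in> (\<lambda>z. \<Phi> (inj_at p z)) ` W p) \<and>
       (\<forall>q\<in>pol_ring p c. \<forall>v\<in>hom_B \<rho> sB B p.
          chi_total \<chi> i (\<Phi> (inj_at p (\<tau> p q v))) = \<Phi> (inj_at p (\<tau> p (pol_var i * q) v))))"
proof -
  have kap: "\<rho> 1 = 1" "\<And>x y. \<rho> (x + y) = \<rho> x + \<rho> y" "\<And>x y. \<rho> (x * y) = \<rho> x * \<rho> y"
    using k(1) by (simp_all add: quotient_ring_def)
  have rho0: "\<rho> 0 = 0" using kap(2)[of 0 0] by (simp only: add_0_left add_cancel_right_right)
  obtain L b v where L_fin: "\<And>i p. finite (L i p :: nat set)"
    and free: "\<And>i p. i \<in> {0,1} \<Longrightarrow> p \<in> {1..c} \<Longrightarrow> free_on sB (L i p) (b i p) (B i p)"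
    and O: "graded_ops sE E (\<lambda>_. {0}) \<chi> c" and v: "expands sE E (\<lambda>_. {0}) \<chi> L c c v"
    and comm: "\<And>i j n e. i \<in> {1..c} \<Longrightarrow> j \<in> {1..c} \<Longrightarrow> e \<in> E n \<Longrightarrow>
      \<chi> i (Suc (Suc n)) (\<chi> j n e) = \<chi> j (Suc (Suc n)) (\<chi> i n e)"
    using Ext_monomial_basis[OF assms(1-12)] by metis
  interpret monomial_expansion sE E \<chi> L v c
    by unfold_locales (fact O v L_fin comm)+
  let ?sH = "\<lambda>a v i x. a * v i x :: 'k" and ?H = "\<lambda>p. hom_B \<rho> sB B p" and ?U = "\<lambda>p. pol_ring p c :: 'k pol set"
  let ?sY = "\<lambda>a e (n :: nat). sE a (e n)"
  have mY: "module ?sY"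
    by unfold_locales (simp_all add: fun_eq_iff module.scale_right_distrib[OF mE] module.scale_left_distrib[OF mE]
        module.scale_scale[OF mE] module.scale_one[OF mE])
  note U = pol_ring_submodule and H = hom_B_submodule
  have W: "submodule sW (W p)" if "p \<in> {1..c}" for p by (rule tensor_submodule[OF tensor[OF that] U H])
  \<comment> \<open>The basis of \<open>Hom(\<B>(p), k)\<close> dual to the chosen bases.\<close>
  define du where "du p i0 l0 = (\<lambda>i y. if i = i0 \<and> y \<in> B i p then \<rho> (crd sB (L i p) (b i p) y l0) else 0)"
    for p i0 l0
  have du_in: "du p i0 l0 \<in> ?H p" if p: "p \<in> {1..c}" and i0: "i0 \<in> {0,1}" for p i0 l0
  proof (rule hom_B_I)
    show "du p i0 l0 i = 0" if "i \<notin> {0,1}" for i using that i0 by (auto simp: du_def fun_eq_iff)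
    fix i :: nat assume i: "i \<in> {0,1}"
    show "du p i0 l0 i \<in> hom_k \<rho> sB (B i p)"
    proof (cases "i = i0")
      case True
      note f = free[OF i0 p]
      note S = free_on_submodule[OF f]
      show ?thesis
        using True submodule_add[OF S] submodule_scale[OF S]
        by (auto simp: hom_k_def semilinear_on_def du_def crd_add[OF f] crd_scale[OF f] kap)
    next
      case False
      then have "du p i0 l0 i = 0" by (simp add: du_def fun_eq_iff)
      then show ?thesis by (simp only: hom_k_0)
    qed
  qed
  have du_b: "du p i0 l0 i (b i p l) = (if i = i0 \<and> l = l0 then 1 else 0)"
    if p: "p \<in> {1..c}" and i: "i \<in> {0,1}" and l: "l \<in> L i p" for p i0 l0 i l
  proof -
    note f = free[OF i p]
    have "crd sB (L i p) (b i p) (b i p l) = unit_vec l"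
      by (rule crd_eqI[OF f unit_fr[OF l] lc_unit[OF free_on_module[OF f] L_fin l]])
    then show ?thesis
      using free_on_in[OF f l] by (cases "i = i0") (auto simp: du_def unit_vec_def kap rho0)
  qed
  let ?I = "\<lambda>p. Sigma {0,1} (\<lambda>i. L i p)"
  have finI: "finite (?I p)" for p using L_fin by simp
  have H_expand: "V = (\<Sum>x\<in>?I p. ?sH (V (fst x) (b (fst x) p (snd x))) (du p (fst x) (snd x)))"
    if p: "p \<in> {1..c}" and V: "V \<in> ?H p" for p V
  proof (intro ext)
    fix i y
    have "(\<Sum>x\<in>?I p. ?sH (V (fst x) (b (fst x) p (snd x))) (du p (fst x) (snd x))) i y
      = (\<Sum>i0\<in>{0,1}. \<Sum>l\<in>L i0 p. V i0 (b i0 p l) * du p i0 l i y)"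
      using L_fin by (simp only: sum_apply) (simp add: sum.Sigma split_def)
    also have "\<dots> = V i y"
    proof (cases "i \<in> {0,1} \<and> y \<in> B i p")
      case True
      then have i: "i \<in> {0,1}" and y: "y \<in> B i p" by auto
      note f = free[OF i p]
      have Vl: "semilinear_on \<rho> sB (B i p) (*) UNIV (V i)" using hom_B_D(1)[OF V i] by (simp add: hom_k_def)
      have "(\<Sum>i0\<in>{0,1}. \<Sum>l\<in>L i0 p. V i0 (b i0 p l) * du p i0 l i y)
        = (\<Sum>i0\<in>{0,1}. if i0 = i then \<Sum>l\<in>L i p. \<rho> (crd sB (L i p) (b i p) y l) * V i (b i p l) else 0)"
        using y by (intro sum.cong) (auto simp: du_def mult.commute)
      also have "\<dots> = (\<Sum>l\<in>L i p. \<rho> (crd sB (L i p) (b i p) y l) * V i (b i p l))"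
        using i by auto
      also have "\<dots> = V i (lc sB (L i p) (b i p) (crd sB (L i p) (b i p) y))"
        unfolding lc_def
        by (rule lin_on_comb[OF Vl free_on_submodule[OF f] free_on_in[OF f], symmetric])
      also have "\<dots> = V i y" by (simp only: lc_crd[OF f y])
      finally show ?thesis .
    next
      case False
      have "V i y = 0"
      proof (cases "i \<in> {0,1}")
        case True
        then show ?thesis using hom_B_D(1)[OF V True] False by (simp add: hom_k_def)
      next
        case False
        then show ?thesis using hom_B_D(2)[OF V False] by simp
      qed
      moreover have "du p i0 l i y = 0" if "i0 \<in> {0,1}" for i0 l using False that by (auto simp: du_def)
      ultimately show ?thesis by (simp add: sum.neutral)
    qed
    finally show "V i y = (\<Sum>x\<in>?I p. ?sH (V (fst x) (b (fst x) p (snd x))) (du p (fst x) (snd x))) i y" by simp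
  qed
  \<comment> \<open>The family that corresponds to \<open>q \<otimes> V\<close>: expand \<open>V\<close> in the dual basis.\<close>
  define emb where "emb p q V = (\<lambda>p' i l. if p' = p \<and> i < 2 \<and> l \<in> L i p then pm_scale (V i (b i p l)) q else 0)"
    for p and q :: "'k pol" and V :: "nat \<Rightarrow> 'b \<Rightarrow> 'k"
  note lookups = lookup_pm_scale Poly_Mapping.lookup_add
  have emb_fam: "emb p q V \<in> fam" if "p \<in> {1..c}" "q \<in> ?U p" for p q V
    using that submodule_scale[OF U] submodule_0[OF U] by (auto simp: fam_def emb_def)
  have "\<exists>\<psi>. lin_on sW (W p) ?sY UNIV \<psi> \<and> (\<forall>q\<in>?U p. \<forall>V\<in>?H p. \<psi> (\<tau> p q V) = comb (emb p q V))"
    if p: "p \<in> {1..c}" for p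
  proof -
    have left: "lin_on pm_scale (?U p) ?sY UNIV (\<lambda>q. comb (emb p q V))" for V
      unfolding semilinear_on_def
    proof (intro conjI ballI allI)
      have e: "emb p (q + q') V = (\<lambda>p' i l. emb p q V p' i l + emb p q' V p' i l)" for q q'
        by (intro ext poly_mapping_eqI) (simp add: emb_def lookups distrib_left)
      show "comb (emb p (q + q') V) = comb (emb p q V) + comb (emb p q' V)" for q q'
        unfolding e comb_add by (rule ext) (simp only: plus_fun_apply)
      have e: "emb p (pm_scale a q) V = (\<lambda>p' i l. pm_scale a (emb p q V p' i l))" for a q
        by (intro ext poly_mapping_eqI) (simp add: emb_def lookups mult.left_commute)
      show "comb (emb p (pm_scale a q) V) = (\<lambda>n. sE a (comb (emb p q V) n))" for a q
        unfolding e comb_scale ..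
    qed simp
    have right: "lin_on ?sH (?H p) ?sY UNIV (\<lambda>V. comb (emb p q V))" for q
      unfolding semilinear_on_def
    proof (intro conjI ballI allI)
      have e: "emb p q (V + V') = (\<lambda>p' i l. emb p q V p' i l + emb p q V' p' i l)" for V V'
        by (intro ext poly_mapping_eqI) (simp add: emb_def lookups distrib_right)
      show "comb (emb p q (V + V')) = comb (emb p q V) + comb (emb p q V')" for V V'
        unfolding e comb_add by (rule ext) (simp only: plus_fun_apply)
      have e: "emb p q (\<lambda>i x. a * V i x) = (\<lambda>p' i l. pm_scale a (emb p q V p' i l))" for a V
        by (intro ext poly_mapping_eqI) (simp add: emb_def lookups mult.assoc)
      show "comb (emb p q (\<lambda>i x. a * V i x)) = (\<lambda>n. sE a (comb (emb p q V) n))" for a V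
        unfolding e comb_scale ..
    qed simp
    from tensor_universal[OF tensor[OF p] U H mY left right] show ?thesis by metis
  qed
  then obtain \<psi> where \<psi>: "\<And>p. p \<in> {1..c} \<Longrightarrow> lin_on sW (W p) ?sY UNIV (\<psi> p)"
    "\<And>p q V. p \<in> {1..c} \<Longrightarrow> q \<in> ?U p \<Longrightarrow> V \<in> ?H p \<Longrightarrow> \<psi> p (\<tau> p q V) = comb (emb p q V)"
    by metis
  define fromQ where "fromQ Q p = (\<Sum>x\<in>?I p. \<tau> p (Q p (fst x) (snd x)) (du p (fst x) (snd x)))"
    for Q :: "nat \<Rightarrow> nat \<Rightarrow> nat \<Rightarrow> 'k pol" and p
  have fam_pol: "Q p (fst x) (snd x) \<in> ?U p" if "Q \<in> fam" "p \<in> {1..c}" "x \<in> ?I p" for Q p x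
  proof -
    have "fst x < 2" "snd x \<in> L (fst x) p" using that(3) by auto
    then show ?thesis by (rule famD(1)[OF that(1,2)])
  qed
  have fromQ_W: "fromQ Q p \<in> W p" if "Q \<in> fam" "p \<in> {1..c}" for Q p
    unfolding fromQ_def
    by (intro submodule_sum[OF W[OF that(2)]] tensor_in[OF tensor[OF that(2)] U H] fam_pol[OF that])
      (use du_in that(2) in auto)
  have \<psi>_fromQ: "\<psi> p (fromQ Q p) = comb (\<lambda>p' i l. if p' = p then Q p i l else 0)"
    if Q: "Q \<in> fam" and p: "p \<in> {1..c}" for Q p
  proof -
    have "\<psi> p (fromQ Q p) = (\<Sum>x\<in>?I p. \<psi> p (\<tau> p (Q p (fst x) (snd x)) (du p (fst x) (snd x))))"
      unfolding fromQ_def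
      by (rule lin_on_sum[OF \<psi>(1)[OF p] W[OF p]]) (use tensor_in[OF tensor[OF p] U H fam_pol[OF Q p]] du_in[OF p] in auto)
    also have "\<dots> = (\<Sum>x\<in>?I p. comb (emb p (Q p (fst x) (snd x)) (du p (fst x) (snd x))))"
      by (rule sum.cong[OF refl], rule \<psi>(2)[OF p fam_pol[OF Q p]]) (use du_in[OF p] in auto)
    also have "\<dots> = comb (\<lambda>p' i l. \<Sum>x\<in>?I p. emb p (Q p (fst x) (snd x)) (du p (fst x) (snd x)) p' i l)"
      unfolding comb_sum by (rule ext) (simp only: sum_apply)
    also have "(\<lambda>p' i l. \<Sum>x\<in>?I p. emb p (Q p (fst x) (snd x)) (du p (fst x) (snd x)) p' i l)
      = (\<lambda>p' i l. if p' = p then Q p i l else 0)"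
    proof (intro ext)
      fix p' i l
      show "(\<Sum>x\<in>?I p. emb p (Q p (fst x) (snd x)) (du p (fst x) (snd x)) p' i l) = (if p' = p then Q p i l else 0)"
      proof (cases "p' = p \<and> i < 2 \<and> l \<in> L i p")
        case True
        then have i: "i \<in> {0,1}" and l: "l \<in> L i p" by auto
        have s1: "pm_scale 1 q = q" and s0: "pm_scale 0 q = 0" for q :: "'k pol"
          by (rule poly_mapping_eqI; simp add: lookups)+
        have "(\<Sum>x\<in>?I p. emb p (Q p (fst x) (snd x)) (du p (fst x) (snd x)) p' i l)
           = (\<Sum>x\<in>?I p. if x = (i, l) then Q p i l else 0)"
          using True by (intro sum.cong) (auto simp: emb_def du_b[OF p i l] s0 s1)
        also have "\<dots> = Q p i l" using finI[of p] i l by (subst sum.delta) auto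
        finally show ?thesis using True by simp
      next
        case False
        have "p' = p \<Longrightarrow> Q p i l = 0" by (rule famD(2)[OF Q]) (use False in blast)
        then show ?thesis using False by (auto simp: emb_def)
      qed
    qed
    finally show ?thesis .
  qed
  have fromQ_surj: "\<exists>Q\<in>fam. y = fromQ Q p" if p: "p \<in> {1..c}" and y: "y \<in> W p" for p y
  proof -
    let ?S = "(\<lambda>Q. fromQ Q p) ` fam"
    have tl: "lin_on pm_scale (?U p) sW (W p) (\<lambda>q. \<tau> p q (du p (fst x) (snd x)))" if "x \<in> ?I p" for x
      by (rule tensor_lin_left[OF tensor[OF p] U H du_in[OF p]]) (use that in auto)
    have add: "fromQ (\<lambda>p i l. Q p i l + Q' p i l) p = fromQ Q p + fromQ Q' p" if "Q \<in> fam" "Q' \<in> fam" for Q Q'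
      unfolding fromQ_def sum.distrib[symmetric]
      by (rule sum.cong[OF refl], rule lin_on_add[OF tl]) (use fam_pol p that in auto)
    have scale: "fromQ (\<lambda>p i l. pm_scale a (Q p i l)) p = sW a (fromQ Q p)" if "Q \<in> fam" for Q a
      unfolding fromQ_def module.scale_sum_right[OF submodule_module[OF W[OF p]]]
      by (rule sum.cong[OF refl], rule lin_on_scale[OF tl]) (use fam_pol p that in auto)
    have zero: "fromQ (\<lambda>p i l. 0) p = 0"
      unfolding fromQ_def by (rule sum.neutral) (use lin_on_0[OF tl U] in auto)
    have "y \<in> ?S"
    proof (rule tensor_induct[OF tensor[OF p] U H y])
      show "submodule sW ?S"
        unfolding submodule_def module.subspace_def[OF submodule_module[OF W[OF p]]]
      proof (intro conjI ballI allI submodule_module[OF W[OF p]])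
        show "0 \<in> ?S" using zero fam_zero by (intro image_eqI[where x = "\<lambda>p i l. 0"]) auto
        fix y y' assume "y \<in> ?S" "y' \<in> ?S"
        then obtain Q Q' where Q: "Q \<in> fam" "Q' \<in> fam" "y = fromQ Q p" "y' = fromQ Q' p" by blast
        then have "y + y' = fromQ (\<lambda>p i l. Q p i l + Q' p i l) p" using add by simp
        then show "y + y' \<in> ?S" using fam_add[OF Q(1,2)] by (rule image_eqI)
      next
        fix a y assume "y \<in> ?S"
        then obtain Q where Q: "Q \<in> fam" "y = fromQ Q p" by blast
        then have "sW a y = fromQ (\<lambda>p i l. pm_scale a (Q p i l)) p" using scale by simp
        then show "sW a y \<in> ?S" using fam_scale[OF Q(1)] by (rule image_eqI)
      qed
      fix q V assume q: "q \<in> ?U p" and V: "V \<in> ?H p"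
      note tr = tensor_lin_right[OF tensor[OF p] U H q]
      have "\<tau> p q V = \<tau> p q (\<Sum>x\<in>?I p. ?sH (V (fst x) (b (fst x) p (snd x))) (du p (fst x) (snd x)))"
        using H_expand[OF p V] by simp
      also have "\<dots> = (\<Sum>x\<in>?I p. sW (V (fst x) (b (fst x) p (snd x))) (\<tau> p q (du p (fst x) (snd x))))"
        by (rule lin_on_comb[OF tr H]) (use du_in[OF p] in auto)
      also have "\<dots> = fromQ (emb p q V) p"
        unfolding fromQ_def
      proof (rule sum.cong[OF refl])
        fix x assume x: "x \<in> ?I p"
        then have "emb p q V p (fst x) (snd x) = pm_scale (V (fst x) (b (fst x) p (snd x))) q"
          by (auto simp: emb_def)
        then show "sW (V (fst x) (b (fst x) p (snd x))) (\<tau> p q (du p (fst x) (snd x)))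
           = \<tau> p (emb p q V p (fst x) (snd x)) (du p (fst x) (snd x))"
          using lin_on_scale[OF tl[OF x] q] by simp
      qed
      finally show "\<tau> p q V \<in> ?S" using emb_fam[OF p q] by (rule image_eqI)
    qed
    then show ?thesis by blast
  qed
  define \<Phi> where "\<Phi> x = (\<Sum>p\<in>{1..c}. \<psi> p (x p))" for x
  have \<psi>0: "\<psi> p 0 = 0" if "p \<in> {1..c}" for p by (rule lin_on_0[OF \<psi>(1)[OF that] W[OF that]])
  have \<Phi>_inj_at: "\<Phi> (inj_at p y) = \<psi> p y" if "p \<in> {1..c}" for p y
  proof -
    have "\<Phi> (inj_at p y) = (\<Sum>p'\<in>{1..c}. if p' = p then \<psi> p y else 0)"
      unfolding \<Phi>_def by (rule sum.cong) (auto simp: inj_at_def \<psi>0)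
    then show ?thesis using that by simp
  qed
  have \<Phi>_comb: "\<Phi> x = comb Q" if Q: "Q \<in> fam" and x: "\<And>p. p \<in> {1..c} \<Longrightarrow> x p = fromQ Q p" for Q x
  proof -
    have "\<Phi> x = (\<Sum>p\<in>{1..c}. comb (\<lambda>p' i l. if p' = p then Q p i l else 0))"
      unfolding \<Phi>_def by (rule sum.cong) (simp_all add: x \<psi>_fromQ[OF Q])
    also have "\<dots> = comb (\<lambda>p' i l. \<Sum>p\<in>{1..c}. if p' = p then Q p i l else 0)"
      unfolding comb_sum by (rule ext) (simp only: sum_apply)
    also have "(\<lambda>p' i l. \<Sum>p\<in>{1..c}. if p' = p then Q p i l else 0) = Q"
    proof (intro ext)
      fix p' i l
      have "p' \<notin> {1..c} \<Longrightarrow> Q p' i l = 0" by (rule famD(2)[OF Q]) blast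
      then show "(\<Sum>p\<in>{1..c}. if p' = p then Q p i l else 0) = Q p' i l" by (auto simp: sum.delta')
    qed
    finally show ?thesis .
  qed
  have families: "\<exists>Q\<in>fam. \<forall>p\<in>{1..c}. x p = fromQ Q p" if x: "x \<in> fam_sum W c" for x
  proof -
    have "x p \<in> W p" if "p \<in> {1..c}" for p
    proof -
      have "if p \<in> {1..c} then x p \<in> W p else x p = 0" using x unfolding fam_sum_def by blast
      then show ?thesis by (simp only: that if_True)
    qed
    then have "\<forall>p\<in>{1..c}. \<exists>Q. Q \<in> fam \<and> x p = fromQ Q p" using fromQ_surj by blast
    from bchoice[OF this] obtain Q where Q: "\<And>p. p \<in> {1..c} \<Longrightarrow> Q p \<in> fam"
      "\<And>p. p \<in> {1..c} \<Longrightarrow> x p = fromQ (Q p) p" by blast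
    define R where "R p i l = (if p \<in> {1..c} then Q p p i l else 0)" for p i l
    have "R \<in> fam" unfolding fam_def
    proof (intro CollectI allI)
      fix p i l
      show "if p \<in> {1..c} \<and> i < 2 \<and> l \<in> L i p then R p i l \<in> ?U p else R p i l = 0"
      proof (cases "p \<in> {1..c}")
        case True
        then show ?thesis
          using famD[OF Q(1)[OF True], of p i l] by (cases "i < 2 \<and> l \<in> L i p") (auto simp: R_def)
      next
        case False
        then have "R p i l = 0" by (simp only: R_def if_False)
        then show ?thesis using False by (simp only: if_False simp_thms)
      qed
    qed
    moreover have "x p = fromQ R p" if "p \<in> {1..c}" for p using Q(2)[OF that] that by (simp add: fromQ_def R_def)
    ultimately show ?thesis by blast
  qed
  have in_W: "p \<in> {1..c} \<Longrightarrow> x p \<in> W p" "p \<notin> {1..c} \<Longrightarrow> x p = 0" if x: "x \<in> fam_sum W c" for x p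
  proof -
    have *: "if p \<in> {1..c} then x p \<in> W p else x p = 0" using x unfolding fam_sum_def by blast
    show "p \<in> {1..c} \<Longrightarrow> x p \<in> W p" "p \<notin> {1..c} \<Longrightarrow> x p = 0"
      using * by (simp_all only: if_True if_False)
  qed
  have \<Phi>_add: "\<Phi> (x + y) = \<Phi> x + \<Phi> y" if x: "x \<in> fam_sum W c" and y: "y \<in> fam_sum W c" for x y
  proof -
    have "\<psi> p ((x + y) p) = \<psi> p (x p) + \<psi> p (y p)" if "p \<in> {1..c}" for p
      using lin_on_add[OF \<psi>(1)[OF that] in_W(1)[OF x that] in_W(1)[OF y that]] by (simp only: plus_fun_apply)
    then show ?thesis unfolding \<Phi>_def sum.distrib[symmetric] by (rule sum.cong[OF refl])
  qed
  have \<Phi>_scale: "\<Phi> (\<lambda>p. sW a (x p)) = ?sY a (\<Phi> x)" if "x \<in> fam_sum W c" for x a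
    unfolding \<Phi>_def module.scale_sum_right[OF mY]
    by (rule sum.cong[OF refl], rule lin_on_scale[OF \<psi>(1)]) (use in_W that in auto)
  have \<Phi>_in: "\<Phi> x \<in> Ext_total E" if "x \<in> fam_sum W c" for x
    using families[OF that] \<Phi>_comb comb_Ext_total by metis
  have lin: "lin_on (\<lambda>a x p. sW a (x p)) (fam_sum W c) ?sY (Ext_total E) \<Phi>"
    unfolding semilinear_on_def using \<Phi>_in \<Phi>_add \<Phi>_scale by blast
  have inj: "inj_on \<Phi> (fam_sum W c)"
  proof (rule inj_onI)
    fix x y assume x: "x \<in> fam_sum W c" and y: "y \<in> fam_sum W c" and eq: "\<Phi> x = \<Phi> y"
    have xy: "x - y \<in> fam_sum W c"
      using in_W[OF x] in_W[OF y] submodule_diff[OF W] by (simp add: fam_sum_def)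
    have "\<Phi> (x - y) + \<Phi> y = \<Phi> x" using \<Phi>_add[OF xy y] by simp
    then have 0: "\<Phi> (x - y) = 0" using eq by simp
    obtain Q where Q: "Q \<in> fam" "\<And>p. p \<in> {1..c} \<Longrightarrow> (x - y) p = fromQ Q p" using families[OF xy] by blast
    have "comb Q = 0" using \<Phi>_comb[OF Q] unfolding 0 by (rule sym)
    then have "comb Q = (\<lambda>n. 0)" by (simp add: zero_fun_def)
    then have Q0: "Q p i l = 0" for p i l by (rule comb_injective[OF Q(1)])
    have "(x - y) p = 0" for p
    proof (cases "p \<in> {1..c}")
      case True
      have "\<tau> p 0 (du p (fst z) (snd z)) = 0" if "z \<in> ?I p" for z
        by (rule lin_on_0[OF tensor_lin_left[OF tensor[OF True] U H du_in[OF True]] U]) (use that in auto)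
      then have "fromQ Q p = 0" unfolding fromQ_def by (intro sum.neutral) (simp add: Q0)
      then show ?thesis using Q(2)[OF True] by simp
    qed (rule in_W(2)[OF xy])
    then have "x - y = 0" by (simp add: fun_eq_iff)
    then show "x = y" by simp
  qed
  have surj: "\<Phi> ` fam_sum W c = Ext_total E"
  proof (intro subset_antisym subsetI)
    fix e assume "e \<in> Ext_total E"
    then obtain Q where Q: "Q \<in> fam" "comb Q = e" using comb_surjective by blast
    define x where "x p = (if p \<in> {1..c} then fromQ Q p else 0)" for p
    have "x \<in> fam_sum W c" using fromQ_W[OF Q(1)] by (simp add: fam_sum_def x_def)
    moreover have "e = \<Phi> x" using \<Phi>_comb[OF Q(1), of x] Q(2) by (simp add: x_def)
    ultimately show "e \<in> \<Phi> ` fam_sum W c" by blast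
  qed (use \<Phi>_in in auto)
  have graded: "\<Phi> (inj_at p (\<tau> p q V)) n = 0"
    if p: "p \<in> {1..c}" and i: "i \<in> {0,1}" and q: "q \<in> ?U p" and V: "V \<in> ?H p"
      and h: "pol_homogeneous j q" "\<forall>i'. i' \<noteq> i \<longrightarrow> V i' = 0" and n: "n \<noteq> 2 * j + i" for p i j q V n
  proof -
    have "comb (emb p q V) n = 0" unfolding comb_def
    proof (rule sum.neutral, rule ballI)
      fix x assume "x \<in> Idx L c c n"
      then obtain p' i' l w where x: "x = (p', i', l, w)" "i' + 2 * length w = n" by (auto simp: Idx_def)
      have "Poly_Mapping.lookup (emb p q V p' i' l) (mon w) = 0"
      proof (cases "i' = i")
        case True
        have "mon w \<notin> Poly_Mapping.keys q"
          using h(1) degree_mon[of w] x(2) n True unfolding pol_homogeneous_def by force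
        then show ?thesis by (simp add: emb_def lookups Poly_Mapping.in_keys_iff)
      next
        case False
        then show ?thesis using h(2) by (simp add: emb_def lookups)
      qed
      then show "sE (case x of (p', i, l, w) \<Rightarrow> Poly_Mapping.lookup (emb p q V p' i l) (mon w)) (monomial \<chi> v x) = 0"
        by (simp add: x(1) module.scale_zero_left[OF mE])
    qed
    then show ?thesis by (simp add: \<Phi>_inj_at[OF p] \<psi>(2)[OF p q V])
  qed
  have act: "chi_total \<chi> i (\<Phi> (inj_at p (\<tau> p q V))) = \<Phi> (inj_at p (\<tau> p (pol_var i * q) V))"
    if p: "p \<in> {1..c}" and i: "i \<in> {p..c}" and q: "q \<in> ?U p" and V: "V \<in> ?H p" for p i q V
  proof -
    have mult: "pol_var i * pm_scale a q' = pm_scale a (pol_var i * q')" for a and q' :: "'k pol"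
      by (simp add: pm_scale_def Poly_Mapping.mult_map_scale_conv_mult mult.left_commute)
    have "chi_total \<chi> i (comb (emb p q V)) = comb (\<lambda>p' i' l. pol_var i * emb p q V p' i' l)"
      by (rule chi_comb[OF p i]) (simp add: emb_def)
    also have "(\<lambda>p' i' l. pol_var i * emb p q V p' i' l) = emb p (pol_var i * q) V"
      by (auto simp: emb_def mult fun_eq_iff)
    finally show ?thesis
      using \<psi>(2)[OF p q V] \<psi>(2)[OF p pol_var_mult_pol_ring[OF q i] V] by (simp add: \<Phi>_inj_at[OF p])
  qed
  have stable: "chi_total \<chi> i (\<Phi> (inj_at p y)) \<in> (\<lambda>z. \<Phi> (inj_at p z)) ` W p"
    if p: "p \<in> {1..c}" and i: "i \<in> {p..c}" and y: "y \<in> W p" for p i y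
  proof -
    obtain Q where Q: "Q \<in> fam" "y = fromQ Q p" using fromQ_surj[OF p y] by blast
    let ?Q = "\<lambda>p' i' l. if p' = p then Q p i' l else 0" and ?R = "\<lambda>p' i' l. if p' = p then pol_var i * Q p i' l else 0"
    have R: "?R \<in> fam"
    proof -
      have "if p' \<in> {1..c} \<and> i' < 2 \<and> l \<in> L i' p' then ?R p' i' l \<in> ?U p' else ?R p' i' l = 0" for p' i' l
      proof (cases "p' = p")
        case True
        then show ?thesis
          using famD[OF Q(1), of p i' l] pol_var_mult_pol_ring[OF _ i, of "Q p i' l"] by auto
      qed (simp add: submodule_0[OF U])
      then show ?thesis unfolding fam_def by blast
    qed
    have "chi_total \<chi> i (comb ?Q) = comb (\<lambda>p' i' l. pol_var i * ?Q p' i' l)"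
      by (rule chi_comb[OF p i]) simp
    also have "(\<lambda>p' i' l. pol_var i * ?Q p' i' l) = ?R" by (auto simp: fun_eq_iff)
    also have "comb ?R = \<psi> p (fromQ ?R p)"
      unfolding \<psi>_fromQ[OF R p] by (rule arg_cong[of _ _ comb]) (auto simp: fun_eq_iff)
    finally have "chi_total \<chi> i (\<Phi> (inj_at p y)) = \<Phi> (inj_at p (fromQ ?R p))"
      by (simp only: \<Phi>_inj_at[OF p] Q(2) \<psi>_fromQ[OF Q(1) p])
    then show ?thesis using fromQ_W[OF R p] by (rule image_eqI)
  qed
  show ?thesis
  proof (intro exI[of _ \<Phi>] conjI ballI allI impI lin)
    show "bij_betw \<Phi> (fam_sum W c) (Ext_total E)" unfolding bij_betw_def using inj surj by (rule conjI)
  qed (fact stable act | (elim conjE, rule graded, assumption+))+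
qed

end
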